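(* Let $T$ be an oriented triangulation of the sphere with vertex set $V$, and let $\langle a,b,c\rangle$ be a clockwise triangular 2-cell of $T$. Let $C$ be a simple closed curve in the plane, and let $P_a,P_b,P_c$ be three arcs composing $C$, in counterclockwise order, which are determined by three distinct points of $C$. For each vertex $v\in V\setminus\{a,b,c\}$ let $P_v$ be a compact convex set in the plane containing more than one point. Then there is a (possibly degenerated) packing $Q=(Q_v:v\in V)$ in the plane conforming to $T$, such that $Q_a=P_a$, $Q_b=P_b$, $Q_c=P_c$, and each $Q_v$ ($v\in V\setminus\{a,b,c\}$) is either a point or (positively) homothetic to $P_v$. If, moreover, the sets $P_v$ ($v\in V\setminus\{a,b,c\}$) are smooth, the arcs $P_a,P_b,P_c$ are smooth, and the three angles of the bounded region determined by $C$ at the points where these arcs meet are $<\pi$, then the packing $Q=(Q_v:v\in V)$ in the plane conforming to $T$, with $Q_a=P_a$, $Q_b=P_b$, $Q_c=P_c$ and each $Q_v$ ($v\in V\setminus\{a,b,c\}$) either a point or (positively) homothetic to $P_v$, can be guaranteed to be nondegenerate and to have nerve $T$.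
   Context: Triangulations of the sphere are finite, without loops and without multiple edges, and are oriented (so "clockwise" makes sense). Two closed sets touch if they intersect but the interior of each is disjoint from the other; two closed sets intersect nontrivially if they intersect but do not touch. A packing is a finite indexed family $(Q_v:v\in V)$ of closed, connected, nonempty sets no two of which intersect nontrivially. It is degenerated if some point belongs to three of the sets or if one of the sets is a single point; otherwise it is nondegenerate. The nerve of a packing is the graph on the index set $V$ in which distinct $u,v$ are joined by a (single) edge if and only if $Q_u$ and $Q_v$ touch; "its nerve is $T$" means that this graph is the 1-skeleton of $T$. A (possibly degenerated) packing $(Q_v:v\in V)$ conforms to $T$ if each set is disjoint from the interiors of the other sets and $Q_u$ and $Q_v$ touch whenever $u,v$ are joined by an edge of $T$; additional touchings may occur, and some sets may be single points. Two planar sets are (positively) homothetic if there is a map $z\mapsto \alpha z+\beta$ with $\alpha>0$ real and $\beta\in\mathbb{C}$ taking one onto the other. A curve is smooth if it has finite length and is once differentiable with respect to an arc-length parameter; a planar set is smooth if it has nonempty interior and its boundary is smooth.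
   Formalization: "Smooth" additionally requires the derivative with respect to arc length to be a unit vector at every point; without this an arc may have zero derivative and no tangent, so that the angles where the arcs meet are undefined. *)

theory Defs
  imports "HOL-Complex_Analysis.Complex_Analysis"
begin

section \<open>Oriented triangulations of the sphere\<close>

text \<open>
  The 1-skeleton has vertex set \<open>V\<close> and edge set \<open>E\<close>, edges being two-element vertex sets (hence no
  loops and no multiple edges). It is drawn on the unit sphere: \<open>p\<close> places the vertices and \<open>A e\<close>
  is the arc drawn for the edge \<open>e\<close>.
\<close>

definition drawn_on_sphere ::
    "'v set \<Rightarrow> 'v set set \<Rightarrow> ('v \<Rightarrow> real^3) \<Rightarrow> ('v set \<Rightarrow> (real^3) set) \<Rightarrow> bool" where
  "drawn_on_sphere V E p A \<longleftrightarrow>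
     inj_on p V \<and> p ` V \<subseteq> sphere 0 1 \<and>
     (\<forall>e\<in>E. \<exists>u\<in>V. \<exists>v\<in>V. u \<noteq> v \<and> e = {u, v} \<and>
        (\<exists>g. arc g \<and> pathstart g = p u \<and> pathfinish g = p v \<and> path_image g = A e) \<and>
        A e \<subseteq> sphere 0 1 \<and> A e \<inter> p ` V = p ` e) \<and>
     (\<forall>e\<in>E. \<forall>e'\<in>E. e \<noteq> e' \<longrightarrow> A e \<inter> A e' = p ` (e \<inter> e'))"

definition two_cells ::
    "'v set \<Rightarrow> 'v set set \<Rightarrow> ('v \<Rightarrow> real^3) \<Rightarrow> ('v set \<Rightarrow> (real^3) set) \<Rightarrow> (real^3) set set" where
  "two_cells V E p A = components (sphere 0 1 - (p ` V \<union> (\<Union>e\<in>E. A e)))"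

definition triangular_cell ::
    "'v set set \<Rightarrow> ('v set \<Rightarrow> (real^3) set) \<Rightarrow> (real^3) set \<Rightarrow> 'v \<Rightarrow> 'v \<Rightarrow> 'v \<Rightarrow> bool" where
  "triangular_cell E A f u v w \<longleftrightarrow>
     distinct [u, v, w] \<and> {u, v} \<in> E \<and> {v, w} \<in> E \<and> {w, u} \<in> E \<and>
     top_of_set (sphere 0 1) frontier_of f = A {u, v} \<union> A {v, w} \<union> A {w, u}"

text \<open>
  \<open>F\<close> is the set of clockwise triangular 2-cells. A cell with clockwise vertices \<open>u, v, w\<close> is listed
  under all three cyclic rotations of \<open>(u, v, w)\<close>. The orientations of the cells are coherent: each
  edge, in each of its two directions, is traversed by exactly one clockwise cell. The triangulation
  of the sphere with two 2-cells, both bounded by the same three edges, is allowed; its cells carry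
  the two opposite cyclic orders.
\<close>

definition oriented_sphere_triangulation ::
    "'v set \<Rightarrow> 'v set set \<Rightarrow> ('v \<times> 'v \<times> 'v) set \<Rightarrow> bool" where
  "oriented_sphere_triangulation V E F \<longleftrightarrow>
     finite V \<and>
     (\<exists>p A. drawn_on_sphere V E p A \<and>
        (\<forall>f\<in>two_cells V E p A. \<exists>u v w. triangular_cell E A f u v w) \<and>
        (\<forall>u v w. (\<exists>f\<in>two_cells V E p A. triangular_cell E A f u v w) \<longleftrightarrow>
           (u, v, w) \<in> F \<or> (u, w, v) \<in> F)) \<and>
     (\<forall>u v w. (u, v, w) \<in> F \<longrightarrow> (v, w, u) \<in> F) \<and>
     (\<forall>u v. {u, v} \<in> E \<longrightarrow> (\<exists>!w. (u, v, w) \<in> F))"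


section \<open>Packings\<close>

definition touch :: "complex set \<Rightarrow> complex set \<Rightarrow> bool" where
  "touch A B \<longleftrightarrow> A \<inter> B \<noteq> {} \<and> interior A \<inter> B = {} \<and> A \<inter> interior B = {}"

definition intersect_nontrivially :: "complex set \<Rightarrow> complex set \<Rightarrow> bool" where
  "intersect_nontrivially A B \<longleftrightarrow> A \<inter> B \<noteq> {} \<and> \<not> touch A B"

definition packing :: "'v set \<Rightarrow> ('v \<Rightarrow> complex set) \<Rightarrow> bool" where
  "packing V Q \<longleftrightarrow> finite V \<and>
     (\<forall>v\<in>V. closed (Q v) \<and> connected (Q v) \<and> Q v \<noteq> {}) \<and>
     (\<forall>u\<in>V. \<forall>v\<in>V. u \<noteq> v \<longrightarrow> \<not> intersect_nontrivially (Q u) (Q v))"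

definition degenerated :: "'v set \<Rightarrow> ('v \<Rightarrow> complex set) \<Rightarrow> bool" where
  "degenerated V Q \<longleftrightarrow>
     (\<exists>u\<in>V. \<exists>v\<in>V. \<exists>w\<in>V. distinct [u, v, w] \<and> Q u \<inter> Q v \<inter> Q w \<noteq> {}) \<or>
     (\<exists>v\<in>V. \<exists>z. Q v = {z})"

definition nerve_edges :: "'v set \<Rightarrow> ('v \<Rightarrow> complex set) \<Rightarrow> 'v set set" where
  "nerve_edges V Q = {{u, v} |u v. u \<in> V \<and> v \<in> V \<and> u \<noteq> v \<and> touch (Q u) (Q v)}"

definition conforms :: "'v set \<Rightarrow> 'v set set \<Rightarrow> ('v \<Rightarrow> complex set) \<Rightarrow> bool" where
  "conforms V E Q \<longleftrightarrow>
     (\<forall>u\<in>V. \<forall>v\<in>V. u \<noteq> v \<longrightarrow> Q u \<inter> interior (Q v) = {}) \<and>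
     (\<forall>u\<in>V. \<forall>v\<in>V. {u, v} \<in> E \<longrightarrow> touch (Q u) (Q v))"

definition homothetic :: "complex set \<Rightarrow> complex set \<Rightarrow> bool" where
  "homothetic A B \<longleftrightarrow> (\<exists>\<alpha>::real. \<exists>\<beta>::complex. \<alpha> > 0 \<and> (\<lambda>z. of_real \<alpha> * z + \<beta>) ` A = B)"


section \<open>Curves\<close>

text \<open>
  The parametrization of the simple closed curve \<open>C\<close> starts at the common endpoint of \<open>Pc\<close> and \<open>Pa\<close>;
  the three points determining the arcs are \<open>g 0 = g 1\<close>, \<open>g s\<close> and \<open>g t\<close>.
\<close>

definition counterclockwise_arcs ::
    "complex set \<Rightarrow> complex set \<Rightarrow> complex set \<Rightarrow> complex set \<Rightarrow> bool" where
  "counterclockwise_arcs C Pa Pb Pc \<longleftrightarrow>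
     (\<exists>g s t. simple_path g \<and> pathfinish g = pathstart g \<and> path_image g = C \<and>
        (\<forall>z\<in>inside C. winding_number g z = 1) \<and>
        0 < s \<and> s < t \<and> t < 1 \<and>
        Pa = g ` {0..s} \<and> Pb = g ` {s..t} \<and> Pc = g ` {t..1})"

definition curve_length :: "(real \<Rightarrow> complex) \<Rightarrow> real \<Rightarrow> real \<Rightarrow> ereal" where
  "curve_length g a b =
     (SUP (n, x) \<in> {(n::nat, x::nat \<Rightarrow> real). (\<forall>i<n. x i \<le> x (Suc i)) \<and> (\<forall>i\<le>n. x i \<in> {a..b})}.
        ereal (\<Sum>i<n. dist (g (x i)) (g (x (Suc i)))))"

definition arc_length_param :: "(real \<Rightarrow> complex) \<Rightarrow> real set \<Rightarrow> bool" where
  "arc_length_param g I \<longleftrightarrow> (\<forall>s\<in>I. \<forall>t\<in>I. s \<le> t \<longrightarrow> curve_length g s t = ereal (t - s))"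

text \<open>
  The derivative with respect to arc length is required to be a unit vector. This is automatic almost
  everywhere, and everywhere if the derivative is continuous; it excludes cusps and spirals at which
  the derivative with respect to arc length exists but vanishes, so that there would be no tangent.
\<close>

definition smooth_param :: "(real \<Rightarrow> complex) \<Rightarrow> real set \<Rightarrow> bool" where
  "smooth_param g I \<longleftrightarrow> arc_length_param g I \<and>
     (\<forall>s\<in>I. \<exists>d. norm d = 1 \<and> (g has_vector_derivative d) (at s within I))"

definition smooth_arc :: "complex set \<Rightarrow> bool" where
  "smooth_arc A \<longleftrightarrow>
     (\<exists>g L. L > 0 \<and> smooth_param g {0..L} \<and> inj_on g {0..L} \<and> g ` {0..L} = A)"

text \<open>A closed curve is parametrized periodically, so that it has no exceptional point.\<close>

definition smooth_closed_curve :: "complex set \<Rightarrow> bool" where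
  "smooth_closed_curve A \<longleftrightarrow>
     (\<exists>g L. L > 0 \<and> smooth_param g UNIV \<and> (\<forall>s. g (s + L) = g s) \<and>
        inj_on g {0..<L} \<and> g ` {0..<L} = A)"

definition smooth_planar_set :: "complex set \<Rightarrow> bool" where
  "smooth_planar_set A \<longleftrightarrow> interior A \<noteq> {} \<and> smooth_closed_curve (frontier A)"

text \<open>
  The angle of a region at a boundary point \<open>p\<close>: the total measure of the directions in which one
  enters the region when leaving \<open>p\<close>. If the boundary near \<open>p\<close> consists of two arcs having tangents at
  \<open>p\<close>, this is the angle between the tangents on the side of the region; at a cusp, where the two
  tangents coincide, it is \<open>0\<close> or \<open>2 * pi\<close> as appropriate.
\<close>

definition region_angle :: "complex set \<Rightarrow> complex \<Rightarrow> real" where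
  "region_angle D p =
     measure lebesgue {\<theta> \<in> {0..<2 * pi}. \<exists>e>0. \<forall>t. 0 < t \<and> t < e \<longrightarrow> p + of_real t * cis \<theta> \<in> D}"

end

theory Submission
  imports Defs
begin

text \<open>
  The triangulation carries three Schnyder orders h 0, h 1, h 2 of its vertices: every edge other than ab, bc, ca
  joins an interior vertex v to its parent p i v, the first vertex in the i-th order among those u that lie above v
  in this order and below v in the other two (the cone of v). Give every interior vertex v a centre in the closed
  region bounded by C and a size. The Poincare-Miranda theorem yields centres and sizes for which each body touches,
  for i = 0, 1, 2, the i-th arc or a body in its i-th cone, while it overlaps none of these; any two bodies then have
  disjoint interiors. As long as no point belongs to three bodies, a winding number argument (a form of the
  nonplanarity of K(3,3)) shows that the body touched in direction i is that of p i v.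

  To exclude triple points, the convex sets and the arcs are thickened, so that each of them enters
  at each of its points every direction of some open half plane; three such sets with disjoint interiors cannot meet.
  The packing is the limit as the thickness tends to 0. In the smooth case the limit sets have this property
  themselves, so the same argument applies to the limit and shows that it has no further contacts.
\<close>

section \<open>Schnyder orders\<close>

text \<open>Each interior body has three real parameters, two for its centre and one for its size,
  and the orders supply three contact conditions, so equations and unknowns balance. Of two interior
  vertices one always lies in a cone of the other; so if no body overlaps anything in its own cones,
  no two bodies overlap. The equations ask for contact with anything in the cone and not with the
  parent, because Poincare-Miranda needs the i-th distance to vanish for every centre on the i-th
  arc. Two things must therefore be excluded afterwards: size 0 and contact with a vertex above the
  parent. A body of size 0 would lie on a body in each of its cones; climbing each cone past further
  points ends at three proper bodies with a common point. So both exclusions rest on the absence of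
  triple points. At the corners of the curve two arcs already meet. The thickening therefore cuts
  them off, and in the smooth case the angle hypothesis takes over: a body entering a half plane of
  directions at a corner would force an angle of at least pi there.\<close>

fun triples :: "'a list \<Rightarrow> ('a \<times> 'a \<times> 'a) set" where
  "triples (x # y # z # zs) = insert (x, y, z) (triples (y # z # zs))"
| "triples _ = {}"

lemma triples_append: "triples (xs @ x # y # ys) = triples (xs @ [x, y]) \<union> triples (x # y # ys)"
proof (induction xs)
  case Nil
  then show ?case by (cases ys) auto
next
  case (Cons a xs)
  show ?case
  proof (cases xs)
    case Nil
    then show ?thesis by (cases ys) auto
  next
    case (Cons b xs')
    then show ?thesis using Cons.IH by (cases xs') auto
  qed
qed

lemma triples_append_last:
  "triples (xs @ [x, y]) = triples (xs @ [x]) \<union> (if xs = [] then {} else {(last xs, x, y)})"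
proof (induction xs)
  case Nil
  then show ?case by simp
next
  case (Cons a xs)
  show ?case
  proof (cases xs)
    case Nil
    then show ?thesis by simp
  next
    case (Cons b xs')
    then show ?thesis using Cons.IH by (cases xs') auto
  qed
qed

lemma triples_Cons: "triples (x # y # ys) = triples (y # ys) \<union> (if ys = [] then {} else {(x, y, hd ys)})"
  by (cases ys) auto

lemma triples_nth: "i + 2 < length xs \<Longrightarrow> (xs ! i, xs ! (i + 1), xs ! (i + 2)) \<in> triples xs"
proof (induction xs arbitrary: i rule: triples.induct)
  case (1 x y z zs)
  then show ?case by (cases i) auto
qed auto

lemma triples_succ: "successively P xs \<Longrightarrow> (p, x, s) \<in> triples xs \<Longrightarrow> P p x \<and> P x s"
  by (induction xs rule: triples.induct) auto

lemma triples_mid: "(p, x, s) \<in> triples (u # ys @ [w]) \<Longrightarrow> x \<in> set ys"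
proof (induction ys arbitrary: u)
  case Nil
  then show ?case by simp
next
  case (Cons y ys)
  then show ?case by (cases ys) auto
qed

fun path_edges :: "'a list \<Rightarrow> 'a set set" where
  "path_edges (x # y # zs) = insert {x, y} (path_edges (y # zs))"
| "path_edges _ = {}"

definition cycle_edges :: "'a list \<Rightarrow> 'a set set" where
  "cycle_edges zs = path_edges (zs @ [hd zs])"

lemma path_edges_subset: "e \<in> path_edges zs \<Longrightarrow> e \<subseteq> set zs"
  by (induction zs rule: path_edges.induct) auto

lemma path_edges_snoc: "zs \<noteq> [] \<Longrightarrow> path_edges (zs @ [x]) = insert {last zs, x} (path_edges zs)"
  by (induction zs rule: path_edges.induct) auto

text \<open>These are the combinatorial facts about the drawing on which the orders depend.
  \<open>cycle_separates\<close> is a discrete Jordan curve theorem: \<sigma> two-colours the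
  triangles, given by their cyclic corner triples, and changes across an edge exactly when the edge
  belongs to the cycle.\<close>

locale triangulation =
  fixes V :: "'v set" and E :: "'v set set" and F :: "('v \<times> 'v \<times> 'v) set"
  assumes finV: "finite V"
    and E_pair: "{u, v} \<in> E \<Longrightarrow> u \<in> V \<and> v \<in> V \<and> u \<noteq> v"
    and F_E: "(u, v, w) \<in> F \<Longrightarrow> {u, v} \<in> E"
    and F_rot: "(u, v, w) \<in> F \<Longrightarrow> (v, w, u) \<in> F"
    and F_ex1: "{u, v} \<in> E \<Longrightarrow> \<exists>!w. (u, v, w) \<in> F"
    and link_connected: "\<lbrakk>v \<in> V; S \<noteq> {}; S \<subseteq> {u. {v, u} \<in> E};
          \<And>u w. u \<in> S \<Longrightarrow> (v, u, w) \<in> F \<Longrightarrow> w \<in> S\<rbrakk> \<Longrightarrow> S = {u. {v, u} \<in> E}"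
    and graph_connected: "\<lbrakk>S \<subseteq> V; S \<noteq> {}; \<And>u w. u \<in> S \<Longrightarrow> {u, w} \<in> E \<Longrightarrow> w \<in> S\<rbrakk> \<Longrightarrow> S = V"
    and cycle_separates: "\<lbrakk>distinct zs; length zs \<ge> 3; successively (\<lambda>u v. {u, v} \<in> E) (zs @ [hd zs])\<rbrakk> \<Longrightarrow>
          \<exists>\<sigma>::'v \<Rightarrow> 'v \<Rightarrow> 'v \<Rightarrow> bool. (\<forall>u v w. (u, v, w) \<in> F \<longrightarrow> \<sigma> u v w = \<sigma> v w u) \<and>
            (\<forall>u v w w'. (u, v, w) \<in> F \<longrightarrow> (v, u, w') \<in> F \<longrightarrow>
               (\<sigma> u v w \<noteq> \<sigma> v u w' \<longleftrightarrow> {u, v} \<in> cycle_edges zs))"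
begin

section \<open>Rotations around a vertex\<close>

definition nbrs :: "'v \<Rightarrow> 'v set" where "nbrs v = {u. {v, u} \<in> E}"

definition nx :: "'v \<Rightarrow> 'v \<Rightarrow> 'v" where "nx u v = (THE w. (u, v, w) \<in> F)"

abbreviation chain :: "'v \<Rightarrow> 'v list \<Rightarrow> bool" where
  "chain v \<equiv> successively (\<lambda>u w. (v, u, w) \<in> F)"

lemma nbrs_sym: "u \<in> nbrs v \<longleftrightarrow> v \<in> nbrs u"
  by (simp add: nbrs_def insert_commute)

lemma nbrs_V: "u \<in> nbrs v \<Longrightarrow> u \<in> V \<and> v \<in> V \<and> u \<noteq> v"
  using E_pair by (auto simp: nbrs_def)

lemma fin_nbrs: "finite (nbrs v)"
  using finite_subset[OF _ finV] nbrs_V by blast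

lemma F_nbrs: "(v, u, w) \<in> F \<Longrightarrow> u \<in> nbrs v \<and> w \<in> nbrs v \<and> w \<in> nbrs u"
proof -
  assume a: "(v, u, w) \<in> F"
  then have "{v, u} \<in> E" "{u, w} \<in> E" "{w, v} \<in> E"
    using F_E F_rot by blast+
  then show ?thesis
    by (simp add: nbrs_def insert_commute)
qed

lemma nx_F: "{u, v} \<in> E \<Longrightarrow> (u, v, nx u v) \<in> F"
  unfolding nx_def using F_ex1 by (rule theI')

lemma nx_eq: "(u, v, w) \<in> F \<Longrightarrow> nx u v = w"
  using F_ex1 F_E nx_F by blast

lemma nx_nbrs: "u \<in> nbrs v \<Longrightarrow> nx v u \<in> nbrs v"
  using F_nbrs[OF nx_F[of v u]] by (simp add: nbrs_def)

lemma F_pred_unique: "(v, u, w) \<in> F \<Longrightarrow> (v, u', w) \<in> F \<Longrightarrow> u = u'"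
  using F_rot nx_eq by metis

lemma nx_inj: "inj_on (nx v) (nbrs v)"
  unfolding inj_on_def nbrs_def using nx_F F_pred_unique by (metis mem_Collect_eq)

text \<open>Iterating \<open>nx v\<close> from u must return to u, because the map is injective on a
  finite set. The orbit is closed under successors, so \<open>link_connected\<close> makes it the
  whole neighbourhood.\<close>

lemma rotation_list:
  assumes u: "u \<in> nbrs v"
  obtains zs where "distinct (u # zs)" "set (u # zs) = nbrs v" "chain v (u # zs @ [u])"
proof -
  define f where "f i = (nx v ^^ i) u" for i
  have fN: "f i \<in> nbrs v" for i
    by (induction i) (auto simp: f_def u nx_nbrs)
  have fF: "(v, f i, f (Suc i)) \<in> F" for i
    using fN[of i] nx_F by (auto simp: nbrs_def f_def)
  have "\<not> inj_on f UNIV"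
  proof
    assume "inj f"
    moreover have "finite (range f)"
      using fN fin_nbrs by (meson finite_subset image_subset_iff)
    ultimately show False using finite_imageD infinite_UNIV_nat by blast
  qed
  then obtain i j where ij: "i < j" "f i = f j"
    by (metis injI linorder_neqE_nat)
  have bk: "f (Suc i) = f (Suc j) \<Longrightarrow> f i = f j" for i j
    using inj_onD[OF nx_inj _ fN fN] by (simp add: f_def)
  have bk2: "f (i + d) = f d' \<Longrightarrow> d' \<ge> i \<Longrightarrow> f d = f (d' - i)" for i d d'
  proof (induction i arbitrary: d')
    case (Suc i)
    then obtain d'' where d: "d' = Suc d''" by (cases d') auto
    have "f (Suc (i + d)) = f (Suc d'')" using Suc.prems(1) d by simp
    then have "f (i + d) = f d''" by (rule bk)
    then show ?case using Suc.IH[of d''] Suc.prems(2) d by simp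
  qed simp
  have per: "f (j - i) = u"
    using bk2[of i 0 j] ij by (simp add: f_def)
  define n where "n = (LEAST n. n > 0 \<and> f n = u)"
  have n: "n > 0" "f n = u"
    using LeastI[of "\<lambda>n. n > 0 \<and> f n = u" "j - i"] per ij unfolding n_def by auto
  have least: "f m \<noteq> u" if "0 < m" "m < n" for m
    using not_less_Least[of m "\<lambda>n. n > 0 \<and> f n = u"] that unfolding n_def by auto
  have inj: "inj_on f {..<n}"
  proof (rule inj_onI, rule ccontr)
    fix x y assume xy: "x \<in> {..<n}" "y \<in> {..<n}" "f x = f y" "x \<noteq> y"
    have "\<exists>x y. x < y \<and> y < n \<and> f x = f y"
      using xy by (metis lessThan_iff linorder_neqE_nat)
    then obtain x y where xy: "x < y" "y < n" "f x = f y" by blast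
    then have "f 0 = f (y - x)" using bk2[of x 0 y] by simp
    moreover have "f 0 = u" by (simp add: f_def)
    moreover have "0 < y - x" "y - x < n" using xy(1,2) by linarith+
    ultimately show False using least[of "y - x"] by metis
  qed
  define zs where "zs = map f [1..<n]"
  have uz: "u # zs = map f [0..<n]"
    using n(1) upt_conv_Cons[of 0 n] by (simp add: zs_def f_def)
  have d: "distinct (u # zs)"
    unfolding uz using inj by (simp add: distinct_map atLeast0LessThan)
  have all: "u # zs @ [u] = map f [0..<Suc n]"
    using uz n(2) by (metis append_Cons map_append list.map upt_Suc_append zero_le)
  have c: "chain v (u # zs @ [u])"
    unfolding all successively_conv_nth using fF by (simp del: upt_Suc)
  have "set (u # zs) = {w. {v, w} \<in> E}"
  proof (rule link_connected)
    show "v \<in> V" using u nbrs_V by blast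
    show "set (u # zs) \<noteq> {}" by simp
    show "set (u # zs) \<subseteq> {w. {v, w} \<in> E}" unfolding uz using fN by (auto simp: nbrs_def)
    fix x w assume x: "x \<in> set (u # zs)" and xw: "(v, x, w) \<in> F"
    from x obtain m where m: "m < n" "x = f m" unfolding uz by auto
    have "w = f (Suc m)" using xw fF[of m] m nx_eq by metis
    then show "w \<in> set (u # zs)"
    proof (cases "Suc m = n")
      case True
      then show ?thesis using \<open>w = f (Suc m)\<close> n by simp
    next
      case False
      then show ?thesis unfolding uz using \<open>w = f (Suc m)\<close> m by auto
    qed
  qed
  then show thesis using that d c by (simp add: nbrs_def)
qed

section \<open>Peeling vertices off the boundary path\<close>

lemma chain_prefix:
  assumes "chain v (u # xs)" "chain v (u # ys)" "length xs \<le> length ys"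
  shows "\<exists>zs. ys = xs @ zs"
  using assms
proof (induction xs arbitrary: u ys)
  case (Cons x xs)
  then obtain y ys' where ys: "ys = y # ys'" by (cases ys) auto
  with Cons.prems have "x = y" using nx_eq by (metis successively.simps(3))
  then show ?case using Cons.IH[of x ys'] Cons.prems ys by auto
qed simp

text \<open>For consecutive boundary vertices p, x, s this says that the removed neighbours of x
  fill one contiguous sector of the rotation at x, the one between s and p.\<close>

definition run :: "'v set \<Rightarrow> 'v \<times> 'v \<times> 'v \<Rightarrow> 'v list \<Rightarrow> bool" where
  "run B = (\<lambda>(p, x, s) R. distinct R \<and> R \<noteq> [] \<and> set R = nbrs x \<inter> B \<and> chain x (s # R @ [p]))"

text \<open>The connecting lists have no repetitions because they serve later to close a chord of
  the boundary path into a cycle.\<close>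

definition linked :: "'v set \<Rightarrow> bool" where
  "linked B \<longleftrightarrow> (\<forall>u\<in>B. \<forall>w\<in>B. \<exists>bs. bs \<noteq> [] \<and> distinct bs \<and> hd bs = u \<and> last bs = w \<and> set bs \<subseteq> B \<and>
     successively (\<lambda>x y. {x, y} \<in> E) bs)"

lemma linked_rev:
  "successively (\<lambda>x y. {x, y} \<in> E) (rev bs) \<longleftrightarrow> successively (\<lambda>x y. {x, y} \<in> E) bs"
  unfolding successively_rev by (simp add: insert_commute)

lemma linked_insert:
  assumes B: "linked B" and v: "v \<notin> B" "b \<in> B" "{v, b} \<in> E"
  shows "linked (insert v B)"
proof -
  let ?P = "\<lambda>u w bs. bs \<noteq> [] \<and> distinct bs \<and> hd bs = u \<and> last bs = w \<and> set bs \<subseteq> insert v B \<and>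
     successively (\<lambda>x y. {x, y} \<in> E) bs"
  have BB: "\<exists>bs. ?P u w bs" if "u \<in> B" "w \<in> B" for u w
    using B that unfolding linked_def by blast
  have vB: "\<exists>bs. ?P v w bs" if w: "w \<in> B" for w
  proof -
    obtain bs where bs: "bs \<noteq> []" "distinct bs" "hd bs = b" "last bs = w" "set bs \<subseteq> B"
      "successively (\<lambda>x y. {x, y} \<in> E) bs"
      using B v w unfolding linked_def by blast
    then have "?P v w (v # bs)"
      using v by (auto simp: successively_Cons)
    then show ?thesis by blast
  qed
  have Bv: "\<exists>bs. ?P w v bs" if w: "w \<in> B" for w
  proof -
    obtain bs where "?P v w bs" using vB[OF w] by blast
    then have "?P w v (rev bs)" by (auto simp: linked_rev[of bs] hd_rev last_rev simp del: successively_rev)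
    then show ?thesis by blast
  qed
  have vv: "?P v v [v]" by simp
  show ?thesis unfolding linked_def
  proof (intro ballI)
    fix u w assume "u \<in> insert v B" "w \<in> insert v B"
    then consider "u = v" "w = v" | "u = v" "w \<in> B" | "u \<in> B" "w = v" | "u \<in> B" "w \<in> B" by blast
    then show "\<exists>bs. ?P u w bs"
    proof cases
      case 1
      then show ?thesis using vv by (intro exI[of _ "[v]"]) simp
    next
      case 2
      then show ?thesis using vB by simp
    next
      case 3
      then show ?thesis using Bv by simp
    next
      case 4
      then show ?thesis using BB by simp
    qed
  qed
qed

text \<open>
  B is the set of removed vertices, growing from {a}, and L is the boundary path from c to b of what remains.
  A vertex v inside L may be removed next if it has no chord to L.
\<close>

definition peel_state :: "'v \<Rightarrow> 'v \<Rightarrow> 'v set \<Rightarrow> 'v list \<Rightarrow> bool" where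
  "peel_state b c B L \<longleftrightarrow> B \<subseteq> V \<and> B \<noteq> {} \<and> linked B \<and> distinct L \<and> set L \<subseteq> V - B \<and> b \<noteq> c \<and>
     L \<noteq> [] \<and> hd L = c \<and> last L = b \<and> {b, c} \<in> E \<and> successively (\<lambda>x y. {x, y} \<in> E) L \<and>
     (\<forall>x\<in>V - B. nbrs x \<inter> B \<noteq> {} \<longrightarrow> x \<in> set L) \<and>
     (\<forall>t\<in>triples (b # L @ [c]). \<exists>R. run B t R)"

text \<open>The neighbours of a form a cycle on which c follows b; cut open between the two, it is
  the first boundary path, and each of its vertices has a as its only removed neighbour.\<close>

lemma peel_start:
  assumes abc: "(a, b, c) \<in> F"
  obtains L where "peel_state b c {a} L" "set L = nbrs a"
proof -
  have cN: "c \<in> nbrs a" and bN: "b \<in> nbrs a" and cb: "c \<in> nbrs b"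
    using F_nbrs[OF abc] by auto
  obtain zs where zs: "distinct (c # zs)" "set (c # zs) = nbrs a" "chain a (c # zs @ [c])"
    using rotation_list[OF cN] by blast
  have bc: "b \<noteq> c" using cb nbrs_V by blast
  then have zne: "zs \<noteq> []" using bN zs(2) by auto
  have "(a, last zs, c) \<in> F"
    using zs(3) zne by (simp add: successively_Cons successively_append_iff)
  then have lb: "last zs = b" using abc F_pred_unique by blast
  have adj: "successively (\<lambda>x y. {x, y} \<in> E) (c # zs)"
  proof (rule successively_mono[where P = "\<lambda>u w. (a, u, w) \<in> F"])
    show "chain a (c # zs)" using zs(3) zne by (simp add: successively_Cons successively_append_iff)
    show "\<And>x y. x \<in> set (c # zs) \<Longrightarrow> y \<in> set (c # zs) \<Longrightarrow> (a, x, y) \<in> F \<Longrightarrow> {x, y} \<in> E"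
      using F_E F_rot by blast
  qed
  have ch: "chain a (b # (c # zs) @ [c])"
    using zs(3) abc by (simp add: successively_Cons)
  have "\<exists>R. run {a} t R" if t: "t \<in> triples (b # (c # zs) @ [c])" for t
  proof -
    obtain p x s where t_def: "t = (p, x, s)" by (cases t) auto
    have F2: "(a, p, x) \<in> F" "(a, x, s) \<in> F"
      using triples_succ[OF ch t[unfolded t_def]] by auto
    then have "(x, s, a) \<in> F" "(x, a, p) \<in> F" using F_rot by blast+
    moreover have "nbrs x \<inter> {a} = {a}" using F2(2) F_nbrs nbrs_sym by blast
    ultimately have "run {a} t [a]" by (simp add: run_def t_def)
    then show ?thesis by blast
  qed
  moreover have "linked {a}"
    unfolding linked_def by (auto intro!: exI[of _ "[a]"])
  moreover have "a \<notin> nbrs a" "a \<in> V" using nbrs_V cN by blast+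
  moreover have "nbrs a \<subseteq> V" using nbrs_V by blast
  moreover have "{b, c} \<in> E" using cb by (simp add: nbrs_def)
  moreover have "x \<in> set (c # zs)" if "nbrs x \<inter> {a} \<noteq> {}" for x
    using that zs(2) nbrs_sym by blast
  moreover have "nbrs x \<inter> {a} = {} \<or> x \<in> nbrs a" for x
    using nbrs_sym by blast
  ultimately have "peel_state b c {a} (c # zs)"
    unfolding peel_state_def using zs(1,2) adj bc lb zne by (intro conjI ballI impI) auto
  then show thesis using that zs(2) by blast
qed

text \<open>The rotation at v reads r, the removed run R, l, further vertices ys, and back to r,
  where l and r are the neighbours of v on the path. Without chords the ys are new, so they replace
  v on the path; l and r gain v at one end of their runs, and the run of each y consists of v
  alone.\<close>

lemma peel_step:
  assumes st: "peel_state b c B (L1 @ v # L2)" and L1: "L1 \<noteq> []" and L2: "L2 \<noteq> []"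
    and nochord: "\<And>x. x \<in> set (L1 @ L2) \<Longrightarrow> {v, x} \<in> E \<Longrightarrow> x = last L1 \<or> x = hd L2"
  obtains ys where "peel_state b c (insert v B) (L1 @ ys @ L2)"
    "nbrs v - B = {last L1, hd L2} \<union> set ys" "set ys \<inter> set (L1 @ v # L2) = {}"
proof -
  obtain L1' l where l: "L1 = L1' @ [l]" using L1 by (metis rev_exhaust)
  obtain r L2' where r: "L2 = r # L2'" using L2 by (cases L2) auto
  let ?M = "b # (L1 @ v # L2) @ [c]"
  note st' = st[unfolded peel_state_def]
  have M: "?M = (b # L1') @ l # v # r # L2' @ [c]" by (simp add: l r)
  have tM: "triples ?M = triples ((b # L1') @ [l, v]) \<union> insert (l, v, r) (triples (v # r # L2' @ [c]))"
    unfolding M triples_append[of "b # L1'" l v "r # L2' @ [c]"] by simp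
  have runs: "\<exists>R. run B t R" if "t \<in> triples ?M" for t using st' that by blast
  obtain R where R: "run B (l, v, r) R" using runs tM by blast
  have dist: "distinct (L1' @ l # v # r # L2')" using st' by (simp add: l r)
  have LV: "set (L1' @ l # v # r # L2') \<subseteq> V - B" using st' by (auto simp: l r)
  have near: "x \<in> set (L1 @ v # L2)" if "x \<in> V - B" "nbrs x \<inter> B \<noteq> {}" for x
    using st' that by blast
  have vB: "v \<notin> B" "v \<in> V" using LV by auto
  have "(v, r, hd R) \<in> F" "(v, last R, l) \<in> F"
    using R by (auto simp: run_def successively_Cons successively_append_iff)
  then have rN: "r \<in> nbrs v" and lN: "l \<in> nbrs v"
    using F_nbrs by blast+
  obtain zs where zs: "distinct (r # zs)" "set (r # zs) = nbrs v" "chain v (r # zs @ [r])"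
    using rotation_list[OF rN] by blast
  have chR: "chain v (r # R @ [l])" using R by (simp add: run_def)
  have rR: "r \<notin> set (R @ [l])" using R LV dist by (auto simp: run_def)
  have "\<exists>ys. zs = (R @ [l]) @ ys"
  proof (cases "length (R @ [l]) \<le> length zs")
    case True
    moreover have "chain v (r # zs)"
      using zs(3) successively_append_iff[of _ "r # zs" "[r]"] by simp
    ultimately show ?thesis using chain_prefix[OF chR, of zs] by blast
  next
    case False
    then have "length (zs @ [r]) \<le> length (R @ [l])" by simp
    then obtain ws where "R @ [l] = (zs @ [r]) @ ws"
      using chain_prefix[OF zs(3), of "R @ [l]"] chR by blast
    then have "r \<in> set (R @ [l])" by simp
    with rR show ?thesis by blast
  qed
  then obtain ys where ys: "zs = R @ l # ys" by auto
  have chy: "chain v (l # ys @ [r])"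
    using zs(3) unfolding ys by (auto simp: successively_Cons successively_append_iff)
  have Nv: "nbrs v = {r, l} \<union> set R \<union> set ys" using zs(2) ys by auto
  have ysd: "distinct ys" "set ys \<inter> (set R \<union> {l, r}) = {}" using zs(1) ys by auto
  have RB: "set R = nbrs v \<inter> B" "R \<noteq> []" using R by (auto simp: run_def)
  have ysB: "set ys \<inter> B = {}" using Nv RB ysd by blast
  have ysL: "set ys \<inter> set (L1 @ v # L2) = {}"
  proof -
    have "y \<notin> set (L1 @ L2)" if "y \<in> set ys" for y
      using nochord[of y] that Nv ysd by (auto simp: l r nbrs_def)
    moreover have "v \<notin> set ys" using Nv nbrs_V by blast
    ultimately show ?thesis by auto
  qed
  let ?B = "insert v B" and ?L = "L1 @ ys @ L2"
  \<comment> \<open>A vertex with a removed neighbour is on the path, and the ys are not.\<close>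
  have only: "nbrs x \<inter> B = {}" if "x \<in> set ys" for x
  proof -
    have "x \<in> V - B" using that Nv nbrs_V ysB by blast
    then show ?thesis using near[of x] ysL that by blast
  qed
  have run_y: "run ?B t [v]" if t: "t \<in> triples (l # ys @ [r])" for t
  proof -
    obtain p x s where t_def: "t = (p, x, s)" by (cases t) auto
    have F2: "(v, p, x) \<in> F" "(v, x, s) \<in> F" using triples_succ[OF chy t[unfolded t_def]] by auto
    have "x \<in> set ys" using triples_mid[of p x s l ys r] t t_def by simp
    then have "nbrs x \<inter> ?B = {v}" using only F2(2) F_nbrs nbrs_sym by blast
    moreover have "(x, s, v) \<in> F" "(x, v, p) \<in> F" using F2 F_rot by blast+
    ultimately show ?thesis by (simp add: run_def t_def)
  qed
  have run_other: "run ?B (p, x, s) R'" if "run B (p, x, s) R'" "x \<in> set (L1 @ L2)" "x \<noteq> l" "x \<noteq> r" for p x s R'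
  proof -
    have "v \<notin> nbrs x" using nochord[of x] that by (auto simp: l r nbrs_def insert_commute)
    then show ?thesis using that(1) by (auto simp: run_def)
  qed
  let ?y0 = "hd (ys @ [r])" and ?y1 = "last (l # ys)"
  have tL: "triples (b # ?L @ [c]) = triples ((b # L1') @ [l, ?y0]) \<union> triples (l # ys @ [r]) \<union>
       triples (?y1 # r # L2' @ [c])"
  proof -
    have e1: "b # ?L @ [c] = (b # L1') @ l # ?y0 # tl (ys @ [r]) @ L2' @ [c]"
      by (cases ys) (auto simp: l r)
    have e2: "l # ?y0 # tl (ys @ [r]) @ L2' @ [c] = butlast (l # ys) @ ?y1 # r # L2' @ [c]"
      by (cases ys) auto
    have e3: "butlast (l # ys) @ [?y1, r] = l # ys @ [r]"
      by (cases ys) auto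
    have "triples (b # ?L @ [c]) = triples ((b # L1') @ [l, ?y0]) \<union>
        triples (l # ?y0 # tl (ys @ [r]) @ L2' @ [c])"
      unfolding e1 by (rule triples_append)
    also have "triples (l # ?y0 # tl (ys @ [r]) @ L2' @ [c]) =
        triples (butlast (l # ys) @ [?y1, r]) \<union> triples (?y1 # r # L2' @ [c])"
      unfolding e2 by (rule triples_append)
    finally show ?thesis unfolding e3 by (simp only: Un_assoc)
  qed
  have run_l: "\<exists>R'. run ?B t R'" if t: "t \<in> triples ((b # L1') @ [l, ?y0])" for t
  proof -
    from t consider "t \<in> triples ((b # L1') @ [l])" | "t = (last (b # L1'), l, ?y0)"
      unfolding triples_append_last by auto
    then show ?thesis
    proof cases
      case 1
      obtain p x s where t_def: "t = (p, x, s)" by (cases t) auto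
      have x: "x \<in> set L1'" using triples_mid[of p x s b L1' l] 1 t_def by simp
      have "t \<in> triples ?M" unfolding tM triples_append_last using 1 by auto
      then obtain R' where "run B t R'" using runs by blast
      then show ?thesis using run_other[of p x s R'] x dist unfolding t_def by (auto simp: l)
    next
      case 2
      have "(last (b # L1'), l, v) \<in> triples ?M" unfolding tM triples_append_last by auto
      then obtain R' where R': "run B (last (b # L1'), l, v) R'" using runs by blast
      have "(v, l, ?y0) \<in> F" using chy by (cases ys) auto
      then have "(l, ?y0, v) \<in> F" using F_rot by blast
      moreover have "nbrs l \<inter> ?B = insert v (nbrs l \<inter> B)" using lN nbrs_sym by blast
      ultimately have "run ?B t (v # R')" using R' vB by (auto simp: run_def 2)
      then show ?thesis by blast
    qed
  qed
  have run_r: "\<exists>R'. run ?B t R'" if t: "t \<in> triples (?y1 # r # L2' @ [c])" for t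
  proof -
    from t consider "t \<in> triples (r # L2' @ [c])" | "t = (?y1, r, hd (L2' @ [c]))"
      unfolding triples_Cons[of ?y1] by auto
    then show ?thesis
    proof cases
      case 1
      obtain p x s where t_def: "t = (p, x, s)" by (cases t) auto
      have x: "x \<in> set L2'" using triples_mid[of p x s r L2' c] 1 t_def by simp
      have "t \<in> triples ?M" unfolding tM triples_Cons[of v] using 1 by auto
      then obtain R' where "run B t R'" using runs by blast
      then show ?thesis using run_other[of p x s R'] x dist unfolding t_def by (auto simp: r)
    next
      case 2
      have "(v, r, hd (L2' @ [c])) \<in> triples ?M" unfolding tM triples_Cons[of v] by auto
      then obtain R' where R': "run B (v, r, hd (L2' @ [c])) R'" using runs by blast
      have "(v, ?y1, r) \<in> F" using chy by (cases ys rule: rev_cases) (auto simp: successively_append_iff successively_Cons)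
      then have "(r, v, ?y1) \<in> F" using F_rot by blast
      moreover have "nbrs r \<inter> ?B = insert v (nbrs r \<inter> B)" using rN nbrs_sym by blast
      ultimately have "run ?B t (R' @ [v])" using R' vB
        by (auto simp: run_def 2 successively_append_iff successively_Cons)
      then show ?thesis by blast
    qed
  qed
  have adj: "successively (\<lambda>x y. {x, y} \<in> E) ?L"
  proof -
    have "successively (\<lambda>x y. {x, y} \<in> E) (l # ys @ [r])"
    proof (rule successively_mono[OF chy])
      show "\<And>x y. (v, x, y) \<in> F \<Longrightarrow> {x, y} \<in> E" using F_E F_rot by blast
    qed
    moreover have "successively (\<lambda>x y. {x, y} \<in> E) (L1' @ l # v # r # L2')" using st' by (simp add: l r)
    ultimately show ?thesis
      by (auto simp: l r successively_append_iff successively_Cons hd_append split: if_splits)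
  qed
  have "hd R \<in> nbrs v \<inter> B" using RB hd_in_set by blast
  then obtain b0 where b0: "b0 \<in> B" "{v, b0} \<in> E" by (auto simp: nbrs_def)
  have "peel_state b c ?B ?L"
    unfolding peel_state_def
  proof (intro conjI)
    show "?B \<subseteq> V" "?B \<noteq> {}" "b \<noteq> c" "{b, c} \<in> E" "?L \<noteq> []" using st' vB by (auto simp: l)
    show "linked ?B" using linked_insert[OF _ vB(1) b0] st' by blast
    show "distinct ?L" using dist ysd ysL by (auto simp: l r)
    have "set ys \<subseteq> V" using Nv nbrs_V by blast
    then show "set ?L \<subseteq> V - ?B" using LV dist ysL ysB by (auto simp: l r)
    show "hd ?L = c" "last ?L = b" using st' by (auto simp: l r hd_append)
    show "successively (\<lambda>x y. {x, y} \<in> E) ?L" by (rule adj)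
    show "\<forall>x\<in>V - ?B. nbrs x \<inter> ?B \<noteq> {} \<longrightarrow> x \<in> set ?L"
    proof (intro ballI impI)
      fix x assume x: "x \<in> V - ?B" "nbrs x \<inter> ?B \<noteq> {}"
      show "x \<in> set ?L"
      proof (cases "nbrs x \<inter> B = {}")
        case True
        with x(2) have "v \<in> nbrs x" by auto
        then have "x \<in> nbrs v" by (simp add: nbrs_sym[of x v])
        then have "x = r \<or> x = l \<or> x \<in> set R \<or> x \<in> set ys" using Nv by blast
        moreover have "x \<notin> set R" using RB(1) x(1) by blast
        ultimately show ?thesis by (auto simp: l r)
      next
        case False
        then show ?thesis using near[of x] x(1) by auto
      qed
    qed
    show "\<forall>t\<in>triples (b # ?L @ [c]). \<exists>R. run ?B t R"
      unfolding tL using run_l run_y run_r by blast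
  qed
  moreover have "nbrs v - B = {l, r} \<union> set ys"
  proof -
    have "set R \<subseteq> B" using RB(1) by blast
    moreover have "l \<notin> B" "r \<notin> B" using LV by auto
    ultimately show ?thesis unfolding Nv using ysB by blast
  qed
  then have "nbrs v - B = {last L1, hd L2} \<union> set ys" by (simp add: l r)
  ultimately show thesis using that ysL by blast
qed

section \<open>Chords of the boundary path do not cross\<close>

lemma run_parity:
  assumes rot: "\<And>u v w. (u, v, w) \<in> F \<Longrightarrow> \<sigma> u v w = \<sigma> v w u"
    and flip: "\<And>u v w w'. (u, v, w) \<in> F \<Longrightarrow> (v, u, w') \<in> F \<Longrightarrow> \<sigma> u v w \<noteq> \<sigma> v u w' \<longleftrightarrow> {u, v} \<in> Z"
    and "chain x (u # R @ [p])"
  shows "\<sigma> x (last (u # R)) p \<longleftrightarrow> (\<sigma> x u (hd (R @ [p])) \<noteq> odd (length (filter (\<lambda>b. {x, b} \<in> Z) R)))"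
  using assms(3)
proof (induction R arbitrary: u)
  case Nil
  then show ?case by simp
next
  case (Cons y R)
  let ?y' = "hd (R @ [p])"
  have c: "chain x (y # R @ [p])" and xuy: "(x, u, y) \<in> F" using Cons.prems by auto
  have "(x, y, ?y') \<in> F" using c by (cases R) auto
  moreover have yxu: "(y, x, u) \<in> F" "(u, y, x) \<in> F" using F_rot xuy by blast+
  \<comment> \<open>Passing from one triangle at x to the next crosses the spoke to y. The colour
    flips exactly when this spoke is in Z, so the parity counts the spokes in Z.\<close>
  ultimately have "\<sigma> x y ?y' \<noteq> \<sigma> y x u \<longleftrightarrow> {x, y} \<in> Z" using flip by blast
  moreover have "\<sigma> y x u = \<sigma> x u y" using rot yxu xuy by blast
  ultimately show ?case using Cons.IH[OF c] by auto
qed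

text \<open>A chord between positions p and q, closed up by a path through removed vertices, is a
  cycle. Along the removed side of the boundary its colouring changes only at p and q, so r and s
  see different colours. But a chord between r and s lies on a triangle that has both r and s as
  corners, and its colour is the one seen at each of them.\<close>

lemma no_crossing_chords:
  assumes st: "peel_state b c B L" and pq: "p < r" "r < q" "q < length L" and s: "s < length L" "s < p \<or> q < s"
    and ch: "{L ! p, L ! q} \<in> E" "{L ! r, L ! s} \<in> E"
  shows False
proof -
  define n where "n = length L"
  define prd where "prd i = (if i = 0 then n - 1 else i - 1)" for i
  define sc where "sc i = (if i = n - 1 then 0 else i + 1)" for i
  note st' = st[unfolded peel_state_def]
  have n: "n \<ge> 3" using pq by (simp add: n_def)
  have dist: "distinct L" and LB: "set L \<inter> B = {}" and Lne: "L \<noteq> []" and link: "linked B" using st' by auto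
  have cb: "c = L ! 0" "b = L ! (n - 1)" using st' by (auto simp: hd_conv_nth last_conv_nth n_def)
  have nth_eq: "L ! i = L ! j \<longleftrightarrow> i = j" if "i < n" "j < n" for i j
    using dist that by (simp add: nth_eq_iff_index_eq n_def)
  have run_ex: "\<exists>R. run B (L ! prd i, L ! i, L ! sc i) R" if i: "i < n" for i
  proof -
    let ?M = "b # L @ [c]"
    have "(?M ! i, ?M ! (i + 1), ?M ! (i + 2)) \<in> triples ?M"
      using i by (intro triples_nth) (simp add: n_def)
    moreover have "?M ! i = L ! prd i"
      using i cb by (cases i) (auto simp: prd_def nth_append n_def)
    moreover have "?M ! (i + 1) = L ! i" using i by (simp add: nth_append n_def)
    moreover have "?M ! (i + 2) = L ! sc i"
      using i cb by (auto simp: sc_def nth_append n_def)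
    ultimately have "(L ! prd i, L ! i, L ! sc i) \<in> triples ?M" by simp
    moreover have "\<forall>t\<in>triples ?M. \<exists>R. run B t R" using st' by blast
    ultimately show ?thesis by (rule bspec[rotated])
  qed
  have inB: "\<exists>y. y \<in> nbrs (L ! i) \<inter> B" if i: "i < n" for i
  proof -
    obtain R where "run B (L ! prd i, L ! i, L ! sc i) R" using run_ex[OF i] by blast
    then have "hd R \<in> nbrs (L ! i) \<inter> B" using hd_in_set[of R] by (auto simp: run_def)
    then show ?thesis by blast
  qed
  obtain y where y: "y \<in> nbrs (L ! q)" "y \<in> B" using inB[of q] pq n_def by auto
  obtain y' where y': "y' \<in> nbrs (L ! p)" "y' \<in> B" using inB[of p] pq n_def by auto
  obtain bs where bs: "bs \<noteq> []" "distinct bs" "hd bs = y" "last bs = y'" "set bs \<subseteq> B"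
    "successively (\<lambda>x y. {x, y} \<in> E) bs"
    using link y y' unfolding linked_def by blast
  define zs where "zs = L ! p # L ! q # bs"
  have Li: "L ! i \<notin> B" if "i < n" for i using LB that n_def nth_mem by blast
  have zs_not: "L ! i \<notin> set zs" if "i < n" "i \<noteq> p" "i \<noteq> q" for i
    using that Li[of i] bs(5) nth_eq[of i] pq by (auto simp: zs_def n_def)
  have dz: "distinct zs"
    using bs Li[of p] Li[of q] pq nth_eq[of p q] by (auto simp: zs_def n_def)
  have lz: "length zs \<ge> 3" using bs(1) by (cases bs) (auto simp: zs_def)
  have sz: "successively (\<lambda>u v. {u, v} \<in> E) (zs @ [hd zs])"
    using bs ch y y' by (auto simp: zs_def successively_Cons successively_append_iff nbrs_def insert_commute)
  have ce: "cycle_edges zs = {{L ! p, L ! q}, {L ! q, y}, {y', L ! p}} \<union> path_edges bs"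
  proof -
    have "path_edges (L ! q # bs @ [L ! p]) = insert {L ! q, y} (path_edges (bs @ [L ! p]))"
      using bs(1,3) by (cases bs) auto
    then show ?thesis unfolding cycle_edges_def zs_def using path_edges_snoc[OF bs(1), of "L ! p"] bs(4) by auto
  qed
  obtain \<sigma> :: "'v \<Rightarrow> 'v \<Rightarrow> 'v \<Rightarrow> bool" where
    rot: "\<And>u v w. (u, v, w) \<in> F \<Longrightarrow> \<sigma> u v w = \<sigma> v w u" and
    flip: "\<And>u v w w'. (u, v, w) \<in> F \<Longrightarrow> (v, u, w') \<in> F \<Longrightarrow> \<sigma> u v w \<noteq> \<sigma> v u w' \<longleftrightarrow> {u, v} \<in> cycle_edges zs"
    using cycle_separates[OF dz lz sz] by blast
  \<comment> \<open>The colour of the triangle on the removed side of the boundary edge from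
    position i to its cyclic successor.\<close>
  define \<tau> where "\<tau> i = \<sigma> (L ! i) (L ! sc i) (nx (L ! i) (L ! sc i))" for i
  have edge_iff: "{L ! i, z} \<in> cycle_edges zs \<longleftrightarrow> (i = q \<and> z = y) \<or> (i = p \<and> z = y')" if i: "i < n" and z: "z \<in> B" for i z
  proof -
    have "{L ! i, z} \<notin> path_edges bs" using path_edges_subset bs(5) Li[OF i] by blast
    moreover have "{L ! i, z} \<noteq> {L ! p, L ! q}" using z Li[of p] Li[of q] pq n_def by (auto simp: doubleton_eq_iff)
    moreover have "{L ! i, z} = {L ! q, y} \<longleftrightarrow> i = q \<and> z = y"
      using i z nth_eq[of i q] pq Li[of q] Li[of i] y n_def by (auto simp: doubleton_eq_iff)
    moreover have "{L ! i, z} = {y', L ! p} \<longleftrightarrow> i = p \<and> z = y'"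
      using i z nth_eq[of i p] pq Li[of p] Li[of i] y' n_def by (auto simp: doubleton_eq_iff)
    ultimately show ?thesis unfolding ce by blast
  qed
  \<comment> \<open>Turning around position i through its removed neighbours crosses a cycle edge
    only towards y at q and towards y' at p; the chord itself leads to an unremoved vertex.\<close>
  have step: "\<tau> (prd i) \<longleftrightarrow> (\<tau> i \<noteq> (i = p \<or> i = q))" if i: "i < n" for i
  proof -
    obtain R where R: "run B (L ! prd i, L ! i, L ! sc i) R" using run_ex[OF i] by blast
    let ?x = "L ! i" and ?p = "L ! prd i" and ?s = "L ! sc i"
    have c: "chain ?x (?s # R @ [?p])" and Rne: "R \<noteq> []" and dR: "distinct R" and sR: "set R = nbrs ?x \<inter> B"
      using R by (auto simp: run_def)
    have f1: "(?x, ?s, hd (R @ [?p])) \<in> F" using c by (cases R) auto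
    have f2: "(?x, last R, ?p) \<in> F" using c Rne by (auto simp: successively_Cons successively_append_iff)
    have f3: "(last R, ?p, ?x) \<in> F" "(?p, ?x, last R) \<in> F" using f2 F_rot by blast+
    have "sc (prd i) = i" using i n by (auto simp: sc_def prd_def)
    then have "\<tau> (prd i) = \<sigma> ?p ?x (last R)" using nx_eq[OF f3(2)] by (simp add: \<tau>_def)
    also have "\<dots> = \<sigma> ?x (last (?s # R)) ?p" using rot[OF f2] rot[OF f3(1)] Rne by simp
    also have "\<dots> \<longleftrightarrow> (\<sigma> ?x ?s (hd (R @ [?p])) \<noteq> odd (length (filter (\<lambda>b. {?x, b} \<in> cycle_edges zs) R)))"
      by (rule run_parity[OF rot flip c])
    also have "\<sigma> ?x ?s (hd (R @ [?p])) = \<tau> i" using nx_eq[OF f1] by (simp add: \<tau>_def)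
    also have "length (filter (\<lambda>b. {?x, b} \<in> cycle_edges zs) R) = (if i = p \<or> i = q then 1 else 0)"
    proof -
      have "{b. {?x, b} \<in> cycle_edges zs} \<inter> set R = (if i = q then {y} else if i = p then {y'} else {})"
        using edge_iff[OF i] sR y y' pq by auto
      then show ?thesis unfolding distinct_length_filter[OF dR] by auto
    qed
    finally show ?thesis by auto
  qed
  have t1: "\<tau> (p + k) = \<tau> p" if "p + k < q" for k
    using that
  proof (induction k)
    case (Suc k)
    then show ?case using step[of "p + Suc k"] pq by (auto simp: prd_def n_def)
  qed simp
  have t2: "\<tau> (q + k) = \<tau> q" if "q + k < n" for k
    using that
  proof (induction k)
    case (Suc k)
    then show ?case using step[of "q + Suc k"] pq by (auto simp: prd_def n_def)
  qed simp
  have t3: "\<tau> k = \<tau> (n - 1)" if "k < p" for k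
    using that
  proof (induction k)
    case 0
    then show ?case using step[of 0] pq n by (auto simp: prd_def)
  next
    case (Suc k)
    then show ?case using step[of "Suc k"] pq by (auto simp: prd_def n_def)
  qed
  have tq: "\<tau> (q - 1) \<noteq> \<tau> q" using step[of q] pq by (auto simp: prd_def n_def)
  have "\<tau> r = \<tau> p" using t1[of "r - p"] pq by simp
  moreover have "\<tau> (q - 1) = \<tau> p" using t1[of "q - 1 - p"] pq by simp
  moreover have "\<tau> s = \<tau> q"
  proof (cases "s < p")
    case True
    then show ?thesis using t3[of s] t2[of "n - 1 - q"] pq n_def by simp
  next
    case False
    then show ?thesis using t2[of "s - q"] s n_def by simp
  qed
  ultimately have rs: "\<tau> r \<noteq> \<tau> s" using tq by simp
  \<comment> \<open>No cycle edge ends at a vertex off the cycle, so all triangles around such a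
    vertex share one colour.\<close>
  have const: "\<sigma> (L ! i) u (nx (L ! i) u) = \<tau> i"
    if i: "i < n" "i \<noteq> p" "i \<noteq> q" and u: "u \<in> nbrs (L ! i)" for i u
  proof -
    let ?x = "L ! i"
    obtain R where "run B (L ! prd i, ?x, L ! sc i) R" using run_ex[OF i(1)] by blast
    then have "chain ?x (L ! sc i # R @ [L ! prd i])" by (simp add: run_def)
    then have "(?x, L ! sc i, hd (R @ [L ! prd i])) \<in> F" by (cases R) auto
    then have scN: "L ! sc i \<in> nbrs ?x" using F_nbrs by blast
    let ?S = "{u \<in> nbrs ?x. \<sigma> ?x u (nx ?x u) = \<tau> i}"
    have "?S = {u. {?x, u} \<in> E}"
    proof (rule link_connected)
      show "?x \<in> V" using u nbrs_V by blast
      show "?S \<noteq> {}" using scN by (auto simp: \<tau>_def)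
      show "?S \<subseteq> {u. {?x, u} \<in> E}" by (auto simp: nbrs_def)
      fix u w assume u: "u \<in> ?S" and F1: "(?x, u, w) \<in> F"
      have wN: "w \<in> nbrs ?x" using F_nbrs[OF F1] by blast
      then have F2: "(?x, w, nx ?x w) \<in> F" using nx_F by (simp add: nbrs_def)
      have F3: "(w, ?x, u) \<in> F" "(u, w, ?x) \<in> F" using F1 F_rot by blast+
      have "{?x, w} \<notin> cycle_edges zs"
      proof
        assume "{?x, w} \<in> cycle_edges zs"
        then have "?x \<in> set (zs @ [hd zs])" unfolding cycle_edges_def using path_edges_subset by blast
        then show False using zs_not[OF i] by (auto simp: zs_def)
      qed
      then have "\<sigma> ?x w (nx ?x w) = \<sigma> w ?x u" using flip[OF F2 F3(1)] by blast
      also have "\<dots> = \<sigma> ?x u w" using rot F1 F3 by blast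
      also have "\<dots> = \<tau> i" using u nx_eq[OF F1] by auto
      finally show "w \<in> ?S" using wN by simp
    qed
    then show ?thesis using u by (auto simp: nbrs_def)
  qed
  have F1: "(L ! r, L ! s, nx (L ! r) (L ! s)) \<in> F" using nx_F[OF ch(2)] .
  then have F2: "(L ! s, nx (L ! r) (L ! s), L ! r) \<in> F" using F_rot by blast
  have "\<tau> r = \<sigma> (L ! r) (L ! s) (nx (L ! r) (L ! s))"
    using const[of r "L ! s"] pq s F_nbrs[OF F1] n_def by simp
  also have "\<dots> = \<sigma> (L ! s) (nx (L ! r) (L ! s)) (L ! r)" using rot[OF F1] .
  also have "\<dots> = \<tau> s"
    using const[of s "nx (L ! r) (L ! s)"] pq s F_nbrs[OF F2] nx_eq[OF F2] n_def by auto
  finally show False using rs by simp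
qed

text \<open>Take the position just inside a shortest chord: a chord from there is either shorter or
  crosses the given one. The pair of both end positions is exempt, since the edge bc always joins
  them. If there is no other chord, position 1 will do.\<close>

lemma exists_chordless:
  assumes st: "peel_state b c B L" and n: "length L \<ge> 3"
  obtains L1 v L2 where "L = L1 @ v # L2" "L1 \<noteq> []" "L2 \<noteq> []"
    "\<And>x. x \<in> set (L1 @ L2) \<Longrightarrow> {v, x} \<in> E \<Longrightarrow> x = last L1 \<or> x = hd L2"
proof -
  let ?n = "length L"
  have "\<exists>r. 0 < r \<and> r + 1 < ?n \<and> (\<forall>x<?n. {L ! r, L ! x} \<in> E \<longrightarrow> x = r \<or> x = r - 1 \<or> x = r + 1)"
  proof (cases "\<exists>d i. d \<ge> 2 \<and> i + d < ?n \<and> (i, i + d) \<noteq> (0, ?n - 1) \<and> {L ! i, L ! (i + d)} \<in> E")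
    case True
    define d where "d = (LEAST d. \<exists>i. d \<ge> 2 \<and> i + d < ?n \<and> (i, i + d) \<noteq> (0, ?n - 1) \<and> {L ! i, L ! (i + d)} \<in> E)"
    obtain p where p: "d \<ge> 2" "p + d < ?n" "(p, p + d) \<noteq> (0, ?n - 1)" "{L ! p, L ! (p + d)} \<in> E"
      using LeastI_ex[OF True] unfolding d_def by blast
    have least: "\<not> (d' \<ge> 2 \<and> i + d' < ?n \<and> (i, i + d') \<noteq> (0, ?n - 1) \<and> {L ! i, L ! (i + d')} \<in> E)"
      if "d' < d" for d' i
      using not_less_Least[OF that[unfolded d_def]] by blast
    have "x = p + 1 \<or> x = p \<or> x = p + 2" if x: "x < ?n" "{L ! (p + 1), L ! x} \<in> E" for x
    proof (rule ccontr)
      assume ne: "\<not> ?thesis"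
      show False
      proof (cases "p \<le> x \<and> x \<le> p + d")
        case True
        with ne have "2 \<le> x - (p + 1)" "x - (p + 1) < d" "p + 1 + (x - (p + 1)) = x" by linarith+
        then show False using least[of "x - (p + 1)" "p + 1"] x by simp
      next
        case False
        then show False
          using no_crossing_chords[OF st, of p "p + 1" "p + d" x] p x by auto
      qed
    qed
    then show ?thesis using p by (intro exI[of _ "p + 1"]) auto
  next
    case False
    have "x = 1 \<or> x = 0 \<or> x = 2" if "x < ?n" "{L ! 1, L ! x} \<in> E" for x
    proof (rule ccontr)
      assume "\<not> ?thesis"
      then have "x - 1 \<ge> 2 \<and> 1 + (x - 1) < ?n \<and> (1::nat, 1 + (x - 1)) \<noteq> (0, ?n - 1) \<and> {L ! 1, L ! (1 + (x - 1))} \<in> E"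
        using that by auto
      then show False using False by blast
    qed
    note all = this
    have "0 < (1::nat) \<and> 1 + 1 < ?n \<and> (\<forall>x<?n. {L ! 1, L ! x} \<in> E \<longrightarrow> x = 1 \<or> x = 1 - 1 \<or> x = 1 + 1)"
    proof (intro conjI allI impI)
      fix x assume "x < ?n" "{L ! 1, L ! x} \<in> E"
      from all[OF this] show "x = 1 \<or> x = 1 - 1 \<or> x = 1 + 1" by linarith
    qed (use n in linarith)+
    then show ?thesis by blast
  qed
  then obtain r where r: "0 < r" "r + 1 < ?n"
    and nc: "\<And>x. x < ?n \<Longrightarrow> {L ! r, L ! x} \<in> E \<Longrightarrow> x = r \<or> x = r - 1 \<or> x = r + 1"
    by blast
  have dist: "distinct L" using st by (simp add: peel_state_def)
  show thesis
  proof (rule that[of "take r L" "L ! r" "drop (r + 1) L"])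
    show "L = take r L @ L ! r # drop (r + 1) L" using r by (simp add: id_take_nth_drop)
    show "take r L \<noteq> []" "drop (r + 1) L \<noteq> []" using r by auto
    fix x assume x: "x \<in> set (take r L @ drop (r + 1) L)" "{L ! r, x} \<in> E"
    then have "x \<in> set L" by (auto dest: in_set_takeD in_set_dropD)
    then obtain i where i: "i < ?n" "x = L ! i" by (metis in_set_conv_nth)
    have "i \<noteq> r" using x(2) E_pair i by auto
    then have "i = r - 1 \<or> i = r + 1" using nc[of i] i x by auto
    moreover have "last (take r L) = L ! (r - 1)" using r by (subst last_conv_nth) auto
    moreover have "hd (drop (r + 1) L) = L ! (r + 1)" using r by (simp add: hd_drop_conv_nth)
    ultimately show "x = last (take r L) \<or> x = hd (drop (r + 1) L)" using i by auto
  qed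
qed

section \<open>The three vertex orders\<close>

definition up :: "('v \<Rightarrow> real) \<Rightarrow> ('v \<Rightarrow> real) \<Rightarrow> ('v \<Rightarrow> real) \<Rightarrow> 'v \<Rightarrow> 'v \<Rightarrow> bool" where
  "up h h' h'' v u \<longleftrightarrow> {v, u} \<in> E \<and> h v < h u \<and> h' u < h' v \<and> h'' u < h'' v"

text \<open>
  The orders are built by reinserting the peeled vertices: v goes on top of the first order, and directly above its
  neighbour on L towards c (towards b) in the second (third) one.
\<close>

definition ordered :: "'v \<Rightarrow> 'v \<Rightarrow> 'v set \<Rightarrow> 'v list \<Rightarrow> ('v \<Rightarrow> real) \<Rightarrow> ('v \<Rightarrow> real) \<Rightarrow> ('v \<Rightarrow> real) \<Rightarrow> bool" where
  "ordered b c W L h1 h2 h3 \<longleftrightarrow>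
     inj_on h1 W \<and> inj_on h2 W \<and> inj_on h3 W \<and>
     (\<forall>u\<in>W. \<forall>v\<in>W. \<forall>w\<in>W - {u, v}. {u, v} \<in> E \<longrightarrow>
        h1 u < h1 w \<and> h1 v < h1 w \<or> h2 u < h2 w \<and> h2 v < h2 w \<or> h3 u < h3 w \<and> h3 v < h3 w) \<and>
     (\<forall>x\<in>set L. \<forall>w\<in>W - {x}. h2 x < h2 w \<or> h3 x < h3 w) \<and>
     sorted_wrt (\<lambda>x y. h2 x < h2 y \<and> h3 y < h3 x) L \<and>
     (\<forall>w\<in>W - {b, c}. h1 b < h1 w \<and> h1 c < h1 w) \<and>
     (\<forall>w\<in>W - {b}. h2 w < h2 b \<and> h3 b < h3 w) \<and>
     (\<forall>w\<in>W - {c}. h3 w < h3 c \<and> h2 c < h2 w) \<and>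
     (\<forall>v\<in>W - {b, c}. (\<exists>u\<in>W. up h2 h1 h3 v u) \<and> (\<exists>u\<in>W. up h3 h1 h2 v u) \<and>
        (v \<notin> set L \<longrightarrow> (\<exists>u\<in>W. up h1 h2 h3 v u)))"

lemma just_above:
  fixes h :: "'a \<Rightarrow> real"
  assumes "finite W"
  obtains t where "h l < t" "\<And>w. w \<in> W \<Longrightarrow> h l < h w \<Longrightarrow> t < h w"
proof -
  have "\<exists>t>h l. \<forall>w\<in>W. h l < h w \<longrightarrow> t < h w"
    using assms
  proof (induction W)
    case empty
    then show ?case by (intro exI[of _ "h l + 1"]) simp
  next
    case (insert x W)
    then obtain t where t: "t > h l" "\<forall>w\<in>W. h l < h w \<longrightarrow> t < h w" by blast
    show ?case
    proof (cases "h l < h x")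
      case True
      let ?t = "min t ((h l + h x) / 2)"
      have "?t > h l" "?t < h x" "?t \<le> t" using True t by (auto simp: min_def field_simps)
      then show ?thesis using t by (intro exI[of _ ?t]) force
    next
      case False
      then show ?thesis using t by (intro exI[of _ t]) auto
    qed
  qed
  then show thesis using that by blast
qed

text \<open>From c to b the path increases in \<open>h2\<close> and decreases in \<open>h3\<close>.
  Placing v directly above l in \<open>h2\<close>, directly above r in \<open>h3\<close> and on top
  in \<open>h1\<close> keeps this monotone, and the vertices ys, which v covers, get in v a
  neighbour that is above them in the first order and below them in the other two.\<close>

lemma ordered_insert:
  assumes o: "ordered b c W (L1 @ ys @ L2) h1 h2 h3" and finW: "finite W" and v: "v \<notin> W"
    and L: "L1 \<noteq> []" "L2 \<noteq> []" "set (L1 @ ys @ L2) \<subseteq> W" "v \<notin> {b, c}" "b \<in> W" "c \<in> W"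
    and N: "nbrs v \<inter> W = {last L1, hd L2} \<union> set ys"
    and ysL: "set ys \<inter> set (L1 @ L2) = {}"
  shows "\<exists>h1 h2 h3. ordered b c (insert v W) (L1 @ v # L2) h1 h2 h3"
proof -
  define l where "l = last L1"
  define r where "r = hd L2"
  have oI: "inj_on h1 W" "inj_on h2 W" "inj_on h3 W"
    and oE: "\<forall>u\<in>W. \<forall>v\<in>W. \<forall>w\<in>W - {u, v}. {u, v} \<in> E \<longrightarrow>
        h1 u < h1 w \<and> h1 v < h1 w \<or> h2 u < h2 w \<and> h2 v < h2 w \<or> h3 u < h3 w \<and> h3 v < h3 w"
    and oL: "\<forall>x\<in>set (L1 @ ys @ L2). \<forall>w\<in>W - {x}. h2 x < h2 w \<or> h3 x < h3 w"
    and oS: "sorted_wrt (\<lambda>x y. h2 x < h2 y \<and> h3 y < h3 x) (L1 @ ys @ L2)"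
    and o1: "\<forall>w\<in>W - {b, c}. h1 b < h1 w \<and> h1 c < h1 w"
    and o2: "\<forall>w\<in>W - {b}. h2 w < h2 b \<and> h3 b < h3 w"
    and o3: "\<forall>w\<in>W - {c}. h3 w < h3 c \<and> h2 c < h2 w"
    and oU: "\<forall>v\<in>W - {b, c}. (\<exists>u\<in>W. up h2 h1 h3 v u) \<and> (\<exists>u\<in>W. up h3 h1 h2 v u) \<and>
        (v \<notin> set (L1 @ ys @ L2) \<longrightarrow> (\<exists>u\<in>W. up h1 h2 h3 v u))"
    using o unfolding ordered_def by - (elim conjE, assumption)+
  have lr: "l \<in> set L1" "r \<in> set L2" using L by (auto simp: l_def r_def)
  have W: "l \<in> W" "r \<in> W" using lr L by auto
  obtain L1' where L1': "L1 = L1' @ [l]" using L(1) unfolding l_def by (metis append_butlast_last_id)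
  obtain L2' where L2': "L2 = r # L2'" using L(2) unfolding r_def by (metis list.collapse)
  have srt: "sorted_wrt (\<lambda>x y. h2 x < h2 y \<and> h3 y < h3 x) (L1' @ l # ys @ r # L2')"
    using oS by (simp add: L1' L2')
  have ml: "h2 x \<le> h2 l \<and> h3 l \<le> h3 x" if "x \<in> set L1" for x
    using srt that by (auto simp: L1' sorted_wrt_append less_imp_le)
  have mr: "h2 r \<le> h2 x \<and> h3 x \<le> h3 r" if "x \<in> set L2" for x
    using srt that by (auto simp: L2' sorted_wrt_append less_imp_le)
  have lr2: "h2 l < h2 r" "h3 r < h3 l" using srt by (auto simp: sorted_wrt_append)
  have my: "h2 l < h2 x \<and> h3 x < h3 l \<and> h2 x < h2 r \<and> h3 r < h3 x" if "x \<in> set ys" for x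
    using srt that by (auto simp: sorted_wrt_append)
  obtain t1 where t1: "\<And>w. w \<in> W \<Longrightarrow> h1 w < t1"
  proof
    fix w assume "w \<in> W"
    then have "h1 w \<le> Max (h1 ` W)" using finW by simp
    then show "h1 w < Max (h1 ` W) + 1" by linarith
  qed
  obtain t2 where t2: "h2 l < t2" "\<And>w. w \<in> W \<Longrightarrow> h2 l < h2 w \<Longrightarrow> t2 < h2 w"
    using just_above[OF finW] by blast
  obtain t3 where t3: "h3 r < t3" "\<And>w. w \<in> W \<Longrightarrow> h3 r < h3 w \<Longrightarrow> t3 < h3 w"
    using just_above[OF finW] by blast
  define g1 where "g1 = h1(v := t1)"
  define g2 where "g2 = h2(v := t2)"
  define g3 where "g3 = h3(v := t3)"
  have g_old: "g1 w = h1 w" "g2 w = h2 w" "g3 w = h3 w" if "w \<in> W" for w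
    using that v by (auto simp: g1_def g2_def g3_def)
  have g_new: "g1 v = t1" "g2 v = t2" "g3 v = t3" by (auto simp: g1_def g2_def g3_def)
  have t2': "h2 w < t2 \<longleftrightarrow> h2 w \<le> h2 l" "t2 < h2 w \<longleftrightarrow> h2 l < h2 w" if "w \<in> W" for w
    using t2(2)[OF that] t2(1) by linarith+
  have t3': "h3 w < t3 \<longleftrightarrow> h3 w \<le> h3 r" "t3 < h3 w \<longleftrightarrow> h3 r < h3 w" if "w \<in> W" for w
    using t3(2)[OF that] t3(1) by linarith+
  have bW: "\<And>x w. x \<in> set (L1 @ ys @ L2) \<Longrightarrow> w \<in> W - {x} \<Longrightarrow> h2 x < h2 w \<or> h3 x < h3 w"
    using oL by blast
  have Wne: "w \<noteq> v" if "w \<in> W" for w using that v by blast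
  have inj: "inj_on g1 (insert v W)" "inj_on g2 (insert v W)" "inj_on g3 (insert v W)"
  proof -
    have "inj_on g1 W" "inj_on g2 W" "inj_on g3 W"
      using g_old oI by (simp_all add: inj_on_def)
    moreover have "g1 v \<notin> g1 ` W" using g_new g_old t1 by force
    moreover have "g2 v \<notin> g2 ` W" using g_new g_old t2' by force
    moreover have "g3 v \<notin> g3 ` W" using g_new g_old t3' by force
    moreover have "W - {v} = W" using v by blast
    ultimately show "inj_on g1 (insert v W)" "inj_on g2 (insert v W)" "inj_on g3 (insert v W)" by simp_all
  qed
  \<comment> \<open>A neighbour q of v is at least as high as l in \<open>h2\<close> and as r in
    \<open>h3\<close>. As v sits directly above l and r there, whatever exceeds q in one of these
    orders exceeds v as well.\<close>
  have edge_v: "g2 v < g2 w \<and> g2 q < g2 w \<or> g3 v < g3 w \<and> g3 q < g3 w"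
    if q: "q \<in> W" "{v, q} \<in> E" and w: "w \<in> W" "w \<noteq> q" for q w
  proof -
    have qN: "q \<in> {l, r} \<union> set ys" using N q by (auto simp: nbrs_def l_def r_def)
    then have "q \<in> set (L1 @ ys @ L2)" using lr by auto
    then have "h2 q < h2 w \<or> h3 q < h3 w" using bW w by blast
    moreover have "h2 l \<le> h2 q" "h3 r \<le> h3 q" using qN my lr2 by force+
    ultimately show ?thesis using g_old q(1) w(1) g_new t2'(2)[OF w(1)] t3'(2)[OF w(1)] by auto
  qed
  have edges: "g1 u < g1 w \<and> g1 x < g1 w \<or> g2 u < g2 w \<and> g2 x < g2 w \<or> g3 u < g3 w \<and> g3 x < g3 w"
    if u: "u \<in> insert v W" and x: "x \<in> insert v W" and w: "w \<in> insert v W - {u, x}" and e: "{u, x} \<in> E" for u x w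
  proof -
    have ux: "u \<noteq> x" using e E_pair by blast
    consider "u = v" | "x = v" | "u \<noteq> v" "x \<noteq> v" "w = v" | "u \<noteq> v" "x \<noteq> v" "w \<noteq> v" by blast
    then show ?thesis
    proof cases
      case 1
      then show ?thesis using edge_v[of x w] ux x w e by auto
    next
      case 2
      then show ?thesis using edge_v[of u w] ux u w e by (auto simp: insert_commute)
    next
      case 3
      then show ?thesis using u x g_old g_new t1 by auto
    next
      case 4
      then have "u \<in> W" "x \<in> W" "w \<in> W - {u, x}" using u x w by auto
      then have "h1 u < h1 w \<and> h1 x < h1 w \<or> h2 u < h2 w \<and> h2 x < h2 w \<or> h3 u < h3 w \<and> h3 x < h3 w"
        using oE e by blast
      then show ?thesis using g_old \<open>u \<in> W\<close> \<open>x \<in> W\<close> \<open>w \<in> W - {u, x}\<close> by simp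
    qed
  qed
  have low: "g2 x < g2 w \<or> g3 x < g3 w" if x: "x \<in> set (L1 @ v # L2)" and w: "w \<in> insert v W - {x}" for x w
  proof -
    consider "x = v" | "x \<in> set L1" "x \<noteq> v" | "x \<in> set L2" "x \<noteq> v" using x by auto
    then show ?thesis
    proof cases
      case 1
      with w have wW: "w \<in> W" by auto
      have "h2 l < h2 w \<or> h3 r < h3 w"
      proof (cases "w = l")
        case True
        then show ?thesis using lr2 by simp
      next
        case False
        then have "h2 l < h2 w \<or> h3 l < h3 w" using bW[of l w] lr wW by auto
        then show ?thesis using lr2 by auto
      qed
      then show ?thesis using 1 g_new g_old[OF wW] t2'(2)[OF wW] t3'(2)[OF wW] by simp
    next
      case 2
      then have xW: "x \<in> W" using L by auto
      show ?thesis
      proof (cases "w = v")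
        case True
        then show ?thesis using g_new g_old[OF xW] ml[OF 2(1)] t2'(1)[OF xW] by simp
      next
        case False
        then show ?thesis using bW[of x w] 2 w g_old xW by auto
      qed
    next
      case 3
      then have xW: "x \<in> W" using L by auto
      show ?thesis
      proof (cases "w = v")
        case True
        then show ?thesis using g_new g_old[OF xW] mr[OF 3(1)] t3'(1)[OF xW] by simp
      next
        case False
        then show ?thesis using bW[of x w] 3 w g_old xW by auto
      qed
    qed
  qed
  have srt': "sorted_wrt (\<lambda>x y. g2 x < g2 y \<and> g3 y < g3 x) (L1 @ v # L2)"
  proof -
    have sub: "set L1 \<subseteq> W" "set L2 \<subseteq> W" using L by auto
    have s: "sorted_wrt (\<lambda>x y. h2 x < h2 y \<and> h3 y < h3 x) L1" "sorted_wrt (\<lambda>x y. h2 x < h2 y \<and> h3 y < h3 x) L2"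
      "\<And>x y. x \<in> set L1 \<Longrightarrow> y \<in> set L2 \<Longrightarrow> h2 x < h2 y \<and> h3 y < h3 x"
      using oS by (auto simp: sorted_wrt_append)
    have "sorted_wrt (\<lambda>x y. g2 x < g2 y \<and> g3 y < g3 x) L1"
      using s(1) by (rule sorted_wrt_mono_rel[rotated]) (use sub g_old in \<open>simp add: subset_iff\<close>)
    moreover have "sorted_wrt (\<lambda>x y. g2 x < g2 y \<and> g3 y < g3 x) L2"
      using s(2) by (rule sorted_wrt_mono_rel[rotated]) (use sub g_old in \<open>simp add: subset_iff\<close>)
    moreover have "g2 x < g2 v \<and> g3 v < g3 x" if x: "x \<in> set L1" for x
    proof -
      have xW: "x \<in> W" using sub x by auto
      show ?thesis using ml[OF x] lr2 g_new g_old[OF xW] t2'(1)[OF xW] t3'(2)[OF xW] by auto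
    qed
    moreover have "g2 v < g2 x \<and> g3 x < g3 v" if x: "x \<in> set L2" for x
    proof -
      have xW: "x \<in> W" using sub x by auto
      show ?thesis using mr[OF x] lr2 g_new g_old[OF xW] t2'(2)[OF xW] t3'(1)[OF xW] by auto
    qed
    moreover have "g2 x < g2 y \<and> g3 y < g3 x" if "x \<in> set L1" "y \<in> set L2" for x y
      using s(3)[OF that] sub that g_old by (simp add: subset_iff)
    ultimately show ?thesis by (auto simp: sorted_wrt_append)
  qed
  have b1: "g1 b < g1 w \<and> g1 c < g1 w" if w: "w \<in> insert v W - {b, c}" for w
    using o1 w g_old g_new t1 L by (cases "w = v") auto
  have r_b: "h2 r \<le> h2 b" "h3 b \<le> h3 r" and l_c: "h2 c \<le> h2 l" "h3 l \<le> h3 c"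
    using o2 o3 W by (metis Diff_iff less_eq_real_def singletonD)+
  have b2: "g2 w < g2 b \<and> g3 b < g3 w" if w: "w \<in> insert v W - {b}" for w
  proof (cases "w = v")
    case True
    then show ?thesis using g_new g_old[OF L(5)] t2'(2)[OF L(5)] t3'(1)[OF L(5)] r_b lr2 by simp
  next
    case False
    then show ?thesis using o2 w g_old L by auto
  qed
  have b3: "g3 w < g3 c \<and> g2 c < g2 w" if w: "w \<in> insert v W - {c}" for w
  proof (cases "w = v")
    case True
    then show ?thesis using g_new g_old[OF L(6)] t2'(1)[OF L(6)] t3'(2)[OF L(6)] l_c lr2 by simp
  next
    case False
    then show ?thesis using o3 w g_old L by auto
  qed
  have up_old: "up g2 g1 g3 x u = up h2 h1 h3 x u" "up g3 g1 g2 x u = up h3 h1 h2 x u"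
    "up g1 g2 g3 x u = up h1 h2 h3 x u" if "x \<in> W" "u \<in> W" for x u
    using that g_old by (auto simp: up_def)
  have E_v: "{v, l} \<in> E" "{v, r} \<in> E" using N by (auto simp: nbrs_def l_def r_def)
  have ups: "(\<exists>u\<in>insert v W. up g2 g1 g3 x u) \<and> (\<exists>u\<in>insert v W. up g3 g1 g2 x u) \<and>
        (x \<notin> set (L1 @ v # L2) \<longrightarrow> (\<exists>u\<in>insert v W. up g1 g2 g3 x u))"
    if x: "x \<in> insert v W - {b, c}" for x
  proof (cases "x = v")
    case True
    have "up g2 g1 g3 v r"
      using E_v g_new g_old[OF W(2)] t1[OF W(2)] t2'(2)[OF W(2)] t3'(1)[OF W(2)] lr2 by (simp add: up_def)
    moreover have "up g3 g1 g2 v l"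
      using E_v g_new g_old[OF W(1)] t1[OF W(1)] t3'(2)[OF W(1)] t2'(1)[OF W(1)] lr2 by (simp add: up_def)
    ultimately show ?thesis using True W by auto
  next
    case False
    then have xW: "x \<in> W" "x \<in> W - {b, c}" using x by auto
    then have oU': "(\<exists>u\<in>W. up h2 h1 h3 x u) \<and> (\<exists>u\<in>W. up h3 h1 h2 x u) \<and>
        (x \<notin> set (L1 @ ys @ L2) \<longrightarrow> (\<exists>u\<in>W. up h1 h2 h3 x u))"
      using oU by blast
    have "\<exists>u\<in>insert v W. up g1 g2 g3 x u" if "x \<notin> set (L1 @ v # L2)"
    proof (cases "x \<in> set ys")
      case True
      have "{x, v} \<in> E" using N True xW by (auto simp: nbrs_def insert_commute)
      then have "up g1 g2 g3 x v"
        using g_new g_old[OF xW(1)] t1[OF xW(1)] my[OF True] t2'(2)[OF xW(1)] t3'(2)[OF xW(1)] by (simp add: up_def)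
      then show ?thesis by blast
    next
      case False
      then show ?thesis using oU' that up_old xW by auto
    qed
    then show ?thesis using oU' up_old xW by auto
  qed
  have "ordered b c (insert v W) (L1 @ v # L2) g1 g2 g3"
    unfolding ordered_def using inj edges low srt' b1 b2 b3 ups by (intro conjI ballI impI) simp_all
  then show ?thesis by blast
qed

text \<open>Peeling continues until the path is the single edge from c to b; the orders are then
  built while the recursion returns, with one insertion for each peeled vertex.\<close>

lemma ordered_exists:
  "peel_state b c B L \<Longrightarrow> \<exists>h1 h2 h3. ordered b c (V - B) L h1 h2 h3"
proof (induction "card (V - B)" arbitrary: B L rule: less_induct)
  case less
  note st' = less.prems[unfolded peel_state_def]
  have bc: "b \<noteq> c" "hd L = c" "last L = b" "L \<noteq> []" "set L \<subseteq> V - B" "B \<subseteq> V" "B \<noteq> {}" using st' by auto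
  have bcW: "b \<in> V - B" "c \<in> V - B" using bc hd_in_set last_in_set by blast+
  show ?case
  proof (cases "length L \<ge> 3")
    case True
    obtain L1 v L2 where L: "L = L1 @ v # L2" "L1 \<noteq> []" "L2 \<noteq> []"
      and nc: "\<And>x. x \<in> set (L1 @ L2) \<Longrightarrow> {v, x} \<in> E \<Longrightarrow> x = last L1 \<or> x = hd L2"
      using exists_chordless[OF less.prems True] by blast
    obtain ys where ys: "peel_state b c (insert v B) (L1 @ ys @ L2)"
      "nbrs v - B = {last L1, hd L2} \<union> set ys" "set ys \<inter> set (L1 @ v # L2) = {}"
      using peel_step[OF less.prems[unfolded L(1)] L(2,3) nc] by blast
    have vV: "v \<in> V - B" using bc L by auto
    then have "card (V - insert v B) < card (V - B)"
      using finV by (intro psubset_card_mono) auto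
    then obtain h1 h2 h3 where h: "ordered b c (V - insert v B) (L1 @ ys @ L2) h1 h2 h3"
      using less.hyps[OF _ ys(1)] by blast
    have d: "distinct (L1 @ v # L2)" using st' L by simp
    have "\<exists>h1 h2 h3. ordered b c (insert v (V - insert v B)) (L1 @ v # L2) h1 h2 h3"
    proof (rule ordered_insert[OF h])
      show "finite (V - insert v B)" using finV by simp
      show "set (L1 @ ys @ L2) \<subseteq> V - insert v B" using ys(1) unfolding peel_state_def by blast
      have "hd L \<in> set L1" "last L \<in> set L2" using L by (auto simp: hd_append)
      then show vbc: "v \<notin> {b, c}" using bc d by auto
      show "b \<in> V - insert v B" "c \<in> V - insert v B" using bcW vbc by auto
      show "nbrs v \<inter> (V - insert v B) = {last L1, hd L2} \<union> set ys"
        using ys(2) nbrs_V by blast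
      show "set ys \<inter> set (L1 @ L2) = {}" using ys(3) by auto
    qed (use L in auto)
    moreover have "insert v (V - insert v B) = V - B" using vV by blast
    ultimately show ?thesis using L by simp
  next
    case False
    have "L = [c, b]"
    proof -
      have "length L \<noteq> 1" using bc by (cases L) auto
      moreover have "length L \<noteq> 0" using bc(4) by simp
      ultimately have "length L = 2" using False by linarith
      then show ?thesis using bc by (auto simp: numeral_2_eq_2 length_Suc_conv)
    qed
    have VB: "V = B \<union> {b, c}"
    proof -
      have tr: "triples (b # L @ [c]) = {(b, c, b), (c, b, c)}" using \<open>L = [c, b]\<close> by simp
      \<comment> \<open>On a path of two vertices predecessor and successor coincide. The run
        together with s is then the full rotation at x, so x has no unremoved neighbour except
        s.\<close>
      have all: "u \<in> B \<union> {b, c}" if "run B (s, x, s) R" "u \<in> nbrs x" "s \<in> {b, c}" "s \<notin> B" for s x R u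
      proof -
        have c: "chain x (s # R @ [s])" and Rne: "R \<noteq> []" and sR: "set R = nbrs x \<inter> B"
          using that by (auto simp: run_def)
        have "(x, s, hd (R @ [s])) \<in> F" using c by (cases R) auto
        then have sN: "s \<in> nbrs x" "x \<in> V" using F_nbrs nbrs_V by blast+
        have "insert s (set R) = {u. {x, u} \<in> E}"
        proof (rule link_connected)
          show "x \<in> V" "insert s (set R) \<noteq> {}" using sN by auto
          show "insert s (set R) \<subseteq> {u. {x, u} \<in> E}" using sN sR by (auto simp: nbrs_def)
          fix u w assume u: "u \<in> insert s (set R)" and uw: "(x, u, w) \<in> F"
          then obtain xs zs where xz: "s # R = xs @ u # zs" by (metis list.simps(15) split_list)
          then have "chain x (xs @ u # zs @ [s])" using c by (metis append_Cons append_assoc)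
          then have "(x, u, hd (zs @ [s])) \<in> F" by (cases zs) (auto simp: successively_append_iff)
          then have "w = hd (zs @ [s])" using uw nx_eq by metis
          then show "w \<in> insert s (set R)" using xz
            by (cases zs) (auto, metis in_set_conv_decomp list.set_intros(1) set_ConsD append_Cons append_assoc)
        qed
        then have "u \<in> insert s (set R)" using that by (simp add: nbrs_def)
        then show ?thesis using that sR by auto
      qed
      have runs: "\<exists>R. run B (b, c, b) R" "\<exists>R. run B (c, b, c) R" using st' tr by auto
      have near: "x \<in> set L" if "x \<in> V - B" "nbrs x \<inter> B \<noteq> {}" for x using st' that by blast
      have "B \<union> {b, c} = V"
      proof (rule graph_connected)
        show "B \<union> {b, c} \<subseteq> V" "B \<union> {b, c} \<noteq> {}" using bc bcW by auto
        fix u w assume u: "u \<in> B \<union> {b, c}" and uw: "{u, w} \<in> E"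
        then have wN: "w \<in> nbrs u" "w \<in> V" using nbrs_V by (auto simp: nbrs_def)
        from u consider "u \<in> B" | "u = c" | "u = b" by blast
        then show "w \<in> B \<union> {b, c}"
        proof cases
          case 1
          then show ?thesis using near[of w] wN nbrs_sym \<open>L = [c, b]\<close> by auto
        next
          case 2
          then show ?thesis using all[of b c] runs(1) wN bcW by blast
        next
          case 3
          then show ?thesis using all[of c b] runs(2) wN bcW by blast
        qed
      qed
      then show ?thesis by simp
    qed
    then have W: "V - B = {b, c}" using bcW by blast
    have "ordered b c {b, c} [c, b] (\<lambda>x. if x = b then 1 else 0) (\<lambda>x. if x = b then 1 else 0) (\<lambda>x. if x = b then 0 else 1)"
      using bc(1) E_pair[of b b] E_pair[of c c] by (auto simp: ordered_def)
    then show ?thesis using W \<open>L = [c, b]\<close> by metis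
  qed
qed

end

section \<open>Adding the vertex a; cones and parents\<close>

context triangulation
begin

text \<open>The second clause is Schnyder's criterion: each vertex off an edge exceeds both ends of
  the edge in one of three linear orders. The last clause puts a neighbour of each interior vertex
  into each of its cones. The vertex a, peeled first, is added last, on top of the first order and
  at the bottom of the others.\<close>

lemma schnyder_orders:
  assumes abc: "(a, b, c) \<in> F"
    and cor_def: "cor = (\<lambda>i::nat. if i = 0 then a else if i = 1 then b else c)"
  shows "\<exists>h :: nat \<Rightarrow> 'v \<Rightarrow> real.
    (\<forall>i<3. inj_on (h i) V) \<and>
    (\<forall>u v w. {u, v} \<in> E \<longrightarrow> w \<in> V - {u, v} \<longrightarrow> (\<exists>i<3. h i u < h i w \<and> h i v < h i w)) \<and>
    (\<forall>i<3. \<forall>v\<in>V. v \<noteq> cor i \<longrightarrow> h i v < h i (cor i)) \<and>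
    (\<forall>i<3. \<forall>j<3. i \<noteq> j \<longrightarrow> (\<forall>v\<in>V - {a, b, c}. h j (cor i) < h j v)) \<and>
    (\<forall>v\<in>V - {a, b, c}. \<forall>i<3. \<exists>u\<in>V. {v, u} \<in> E \<and> h i v < h i u \<and> (\<forall>j<3. j \<noteq> i \<longrightarrow> h j u < h j v))"
proof -
  obtain L where L: "peel_state b c {a} L" "set L = nbrs a" using peel_start[OF abc] by blast
  obtain h1 h2 h3 where o: "ordered b c (V - {a}) L h1 h2 h3" using ordered_exists[OF L(1)] by blast
  have aV: "a \<in> V" "b \<in> V" "c \<in> V" "a \<noteq> b" "a \<noteq> c" "b \<noteq> c" using F_nbrs[OF abc] nbrs_V by blast+
  have oI: "inj_on h1 (V - {a})" "inj_on h2 (V - {a})" "inj_on h3 (V - {a})"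
    and oE: "\<forall>u\<in>V - {a}. \<forall>v\<in>V - {a}. \<forall>w\<in>V - {a} - {u, v}. {u, v} \<in> E \<longrightarrow>
        h1 u < h1 w \<and> h1 v < h1 w \<or> h2 u < h2 w \<and> h2 v < h2 w \<or> h3 u < h3 w \<and> h3 v < h3 w"
    and oL: "\<forall>x\<in>set L. \<forall>w\<in>V - {a} - {x}. h2 x < h2 w \<or> h3 x < h3 w"
    and o1: "\<forall>w\<in>V - {a} - {b, c}. h1 b < h1 w \<and> h1 c < h1 w"
    and o2: "\<forall>w\<in>V - {a} - {b}. h2 w < h2 b \<and> h3 b < h3 w"
    and o3: "\<forall>w\<in>V - {a} - {c}. h3 w < h3 c \<and> h2 c < h2 w"
    and oU: "\<forall>v\<in>V - {a} - {b, c}. (\<exists>u\<in>V - {a}. up h2 h1 h3 v u) \<and> (\<exists>u\<in>V - {a}. up h3 h1 h2 v u) \<and>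
        (v \<notin> set L \<longrightarrow> (\<exists>u\<in>V - {a}. up h1 h2 h3 v u))"
    using o unfolding ordered_def by - (elim conjE, assumption)+
  define t1 where "t1 = Max (h1 ` V) + 1"
  define t2 where "t2 = Min (h2 ` V) - 1"
  define t3 where "t3 = Min (h3 ` V) - 1"
  have tt: "h1 w < t1" "t2 < h2 w" "t3 < h3 w" if "w \<in> V" for w
  proof -
    have "h1 w \<le> Max (h1 ` V)" "Min (h2 ` V) \<le> h2 w" "Min (h3 ` V) \<le> h3 w"
      using finV that by auto
    then show "h1 w < t1" "t2 < h2 w" "t3 < h3 w" by (auto simp: t1_def t2_def t3_def)
  qed
  define h where "h i = (if i = 0 then h1(a := t1) else if i = 1 then h2(a := t2) else h3(a := t3))" for i :: nat
  have h_a: "h 0 a = t1" "h 1 a = t2" "h 2 a = t3" by (auto simp: h_def)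
  have h_w: "h 0 w = h1 w" "h 1 w = h2 w" "h 2 w = h3 w" if "w \<noteq> a" for w using that by (auto simp: h_def)
  have ex3: "(\<exists>i<3. P i) \<longleftrightarrow> P 0 \<or> P 1 \<or> P 2" for P :: "nat \<Rightarrow> bool"
    by (metis less_2_cases less_Suc_eq numeral_3_eq_3 numeral_2_eq_2 One_nat_def zero_less_Suc)
  have all3: "(\<forall>i<3. P i) \<longleftrightarrow> P 0 \<and> P 1 \<and> P 2" for P :: "nat \<Rightarrow> bool"
    using ex3[of "\<lambda>i. \<not> P i"] by blast
  have inj_ins: "inj_on (g(a := t)) V" if "inj_on g (V - {a})" "\<And>w. w \<in> V \<Longrightarrow> g w \<noteq> t" for g :: "'v \<Rightarrow> real" and t
    using that by (auto simp: inj_on_def)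
  have inj: "\<forall>i<3. inj_on (h i) V"
    unfolding all3 using inj_ins[OF oI(1), of t1] inj_ins[OF oI(2), of t2] inj_ins[OF oI(3), of t3] tt
    by (force simp: h_def)
  have edge: "\<exists>i<3. h i u < h i w \<and> h i v < h i w" if e: "{u, v} \<in> E" and w: "w \<in> V - {u, v}" for u v w
  proof -
    have uv: "u \<in> V" "v \<in> V" "u \<noteq> v" using E_pair[OF e] by auto
    \<comment> \<open>The neighbours of a form the initial path, and above a vertex of the path
      every other vertex is higher in the second or in the third order.\<close>
    have edge_a: "\<exists>i<3. h i a < h i w \<and> h i x < h i w" if x: "{a, x} \<in> E" "w \<noteq> x" "w \<noteq> a" for x
    proof -
      have "x \<in> set L" "x \<noteq> a" using x L(2) E_pair[of a x] by (auto simp: nbrs_def)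
      moreover have "w \<in> V - {a} - {x}" using w x by auto
      ultimately have "h2 x < h2 w \<or> h3 x < h3 w" using oL by blast
      then show ?thesis unfolding ex3 using h_a h_w[of w] h_w[of x] x \<open>x \<noteq> a\<close> tt w by auto
    qed
    consider "u = a" | "v = a" | "u \<noteq> a" "v \<noteq> a" "w = a" | "u \<noteq> a" "v \<noteq> a" "w \<noteq> a" by blast
    then show ?thesis
    proof cases
      case 1
      then show ?thesis using edge_a[of v] e w by auto
    next
      case 2
      then show ?thesis using edge_a[of u] e w by (auto simp: insert_commute)
    next
      case 3
      then show ?thesis unfolding ex3 using h_a h_w[of u] h_w[of v] tt uv by auto
    next
      case 4
      then have "h1 u < h1 w \<and> h1 v < h1 w \<or> h2 u < h2 w \<and> h2 v < h2 w \<or> h3 u < h3 w \<and> h3 v < h3 w"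
        using oE uv w e by blast
      then show ?thesis unfolding ex3 using h_w[of u] h_w[of v] h_w[of w] 4 by simp
    qed
  qed
  have top: "\<forall>i<3. \<forall>v\<in>V. v \<noteq> cor i \<longrightarrow> h i v < h i (cor i)"
  proof -
    have "h 0 v < h 0 a" if "v \<in> V" "v \<noteq> a" for v using that h_a h_w tt by simp
    moreover have "h 1 v < h 1 b" if "v \<in> V" "v \<noteq> b" for v
      using that h_a h_w[of v] h_w[of b] tt[of b] o2 aV by (cases "v = a") auto
    moreover have "h 2 v < h 2 c" if "v \<in> V" "v \<noteq> c" for v
      using that h_a h_w[of v] h_w[of c] tt[of c] o3 aV by (cases "v = a") auto
    ultimately show ?thesis unfolding all3 by (simp add: cor_def)
  qed
  have low: "\<forall>i<3. \<forall>j<3. i \<noteq> j \<longrightarrow> (\<forall>v\<in>V - {a, b, c}. h j (cor i) < h j v)"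
  proof -
    have "h 1 a < h 1 v" "h 2 a < h 2 v" "h 0 b < h 0 v" "h 2 b < h 2 v" "h 0 c < h 0 v" "h 1 c < h 1 v"
      if "v \<in> V - {a, b, c}" for v
      using that h_a h_w[of v] h_w[of b] h_w[of c] tt[of v] o1 o2 o3 aV by auto
    then show ?thesis unfolding all3 by (simp add: cor_def)
  qed
  have ups: "\<exists>u\<in>V. {v, u} \<in> E \<and> h i v < h i u \<and> (\<forall>j<3. j \<noteq> i \<longrightarrow> h j u < h j v)"
    if v: "v \<in> V - {a, b, c}" and i: "i < 3" for v i
  proof -
    have va: "v \<noteq> a" "v \<in> V - {a} - {b, c}" "v \<in> V" using v by auto
    note u = oU[rule_format, OF va(2)]
    have "i = 0 \<or> i = 1 \<or> i = 2" using i by linarith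
    then consider "i = 0" "v \<in> set L" | "i = 0" "v \<notin> set L" | "i = 1" | "i = 2" by blast
    then show ?thesis
    proof cases
      case 1
      then have "{v, a} \<in> E" using L(2) by (simp add: nbrs_def insert_commute)
      then show ?thesis unfolding all3 using 1 h_a h_w[OF va(1)] tt[OF va(3)] aV by (intro bexI[of _ a]) auto
    next
      case 2
      then obtain u where "u \<in> V - {a}" "up h1 h2 h3 v u" using u by blast
      then show ?thesis unfolding all3 using 2 h_w[OF va(1)] h_w[of u] by (intro bexI[of _ u]) (auto simp: up_def)
    next
      case 3
      then obtain u where "u \<in> V - {a}" "up h2 h1 h3 v u" using u by blast
      then show ?thesis unfolding all3 using 3 h_w[OF va(1)] h_w[of u] by (intro bexI[of _ u]) (auto simp: up_def)
    next
      case 4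
      then obtain u where "u \<in> V - {a}" "up h3 h1 h2 v u" using u by blast
      then show ?thesis unfolding all3 using 4 h_w[OF va(1)] h_w[of u] by (intro bexI[of _ u]) (auto simp: up_def)
    qed
  qed
  show ?thesis using inj edge top low ups by blast
qed

end

text \<open>What the geometric part needs of the orders, without reference to edges. By
  \<open>pattern\<close> the three comparisons of two interior vertices always split one against
  two, so exactly one of the two vertices lies in a cone of the other. The lowest vertex of the i-th
  cone of v is \<open>p i v\<close>.\<close>

locale realizer =
  fixes V :: "'v set" and cor :: "nat \<Rightarrow> 'v" and h :: "nat \<Rightarrow> 'v \<Rightarrow> real" and p :: "nat \<Rightarrow> 'v \<Rightarrow> 'v"
  assumes finite_V: "finite V" and cor_V: "i < 3 \<Longrightarrow> cor i \<in> V"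
    and cor_top: "\<lbrakk>i < 3; v \<in> V; v \<noteq> cor i\<rbrakk> \<Longrightarrow> h i v < h i (cor i)"
    and cor_low: "\<lbrakk>i < 3; j < 3; i \<noteq> j; v \<in> V - cor ` {..<3}\<rbrakk> \<Longrightarrow> h j (cor i) < h j v"
    and pattern: "\<lbrakk>v \<in> V - cor ` {..<3}; u \<in> V - cor ` {..<3}; u \<noteq> v\<rbrakk> \<Longrightarrow>
        (\<exists>i<3. h i v < h i u \<and> (\<forall>j<3. j \<noteq> i \<longrightarrow> h j u < h j v)) \<or>
        (\<exists>i<3. h i u < h i v \<and> (\<forall>j<3. j \<noteq> i \<longrightarrow> h j v < h j u))"
    and p_cone: "\<lbrakk>v \<in> V - cor ` {..<3}; i < 3\<rbrakk> \<Longrightarrow> p i v \<in> V \<and> h i v < h i (p i v) \<and> (\<forall>j<3. j \<noteq> i \<longrightarrow> h j (p i v) < h j v)"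
    and p_least: "\<lbrakk>v \<in> V - cor ` {..<3}; i < 3; w \<in> V; h i v < h i w; \<And>j. j < 3 \<Longrightarrow> j \<noteq> i \<Longrightarrow> h j w < h j v; w \<noteq> p i v\<rbrakk> \<Longrightarrow>
        h i (p i v) < h i w"
begin

definition V0 :: "'v set" where "V0 = V - cor ` {..<3}"

definition cone :: "nat \<Rightarrow> 'v \<Rightarrow> 'v set" where
  "cone i v = {u \<in> V. h i v < h i u \<and> (\<forall>j<3. j \<noteq> i \<longrightarrow> h j u < h j v)}"

end

text \<open>The edge criterion forces a neighbour of v that lies in a cone of v to be the lowest
  vertex of this cone. So each cone contains exactly one neighbour, the parent, and every edge at an
  interior vertex leads from a vertex to one of its parents.\<close>

lemma (in triangulation) realizer_exists:
  assumes abc: "(a, b, c) \<in> F"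
    and cor_def: "cor = (\<lambda>i::nat. if i = 0 then a else if i = 1 then b else c)"
  shows "\<exists>h p. realizer V cor h p \<and>
    (\<forall>v\<in>V - {a, b, c}. \<forall>i<3. {v, p i v} \<in> E) \<and>
    (\<forall>u v. {u, v} \<in> E \<longrightarrow> v \<in> V - {a, b, c} \<longrightarrow> (\<exists>i<3. u = p i v) \<or> (u \<in> V - {a, b, c} \<and> (\<exists>i<3. v = p i u)))"
proof -
  have aV: "a \<in> V" "b \<in> V" "c \<in> V" "a \<noteq> b" "a \<noteq> c" "b \<noteq> c" using F_nbrs[OF abc] nbrs_V by blast+
  obtain h :: "nat \<Rightarrow> 'v \<Rightarrow> real" where
    H: "(\<forall>i<3. inj_on (h i) V) \<and>
    (\<forall>u v w. {u, v} \<in> E \<longrightarrow> w \<in> V - {u, v} \<longrightarrow> (\<exists>i<3. h i u < h i w \<and> h i v < h i w)) \<and>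
    (\<forall>i<3. \<forall>v\<in>V. v \<noteq> cor i \<longrightarrow> h i v < h i (cor i)) \<and>
    (\<forall>i<3. \<forall>j<3. i \<noteq> j \<longrightarrow> (\<forall>v\<in>V - {a, b, c}. h j (cor i) < h j v)) \<and>
    (\<forall>v\<in>V - {a, b, c}. \<forall>i<3. \<exists>u\<in>V. {v, u} \<in> E \<and> h i v < h i u \<and> (\<forall>j<3. j \<noteq> i \<longrightarrow> h j u < h j v))"
    using schnyder_orders[OF abc cor_def] by (elim exE)
  note inj = H[THEN conjunct1, rule_format]
    and edge = H[THEN conjunct2, THEN conjunct1, rule_format]
    and top = H[THEN conjunct2, THEN conjunct2, THEN conjunct1, rule_format]
    and low = H[THEN conjunct2, THEN conjunct2, THEN conjunct2, THEN conjunct1, rule_format]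
    and up = H[THEN conjunct2, THEN conjunct2, THEN conjunct2, THEN conjunct2, rule_format]
  have set3: "{..<3::nat} = {0, 1, 2}" by auto
  have cor: "cor ` {..<3} = {a, b, c}" unfolding set3 cor_def by auto
  have cases3: "i = 0 \<or> i = 1 \<or> i = 2" if "i < 3" for i :: nat using that by linarith
  define p where "p i v = (SOME u. u \<in> V \<and> {v, u} \<in> E \<and> h i v < h i u \<and> (\<forall>j<3. j \<noteq> i \<longrightarrow> h j u < h j v))" for i v
  have p: "p i v \<in> V \<and> {v, p i v} \<in> E \<and> h i v < h i (p i v) \<and> (\<forall>j<3. j \<noteq> i \<longrightarrow> h j (p i v) < h j v)"
    if "v \<in> V - {a, b, c}" "i < 3" for i v
    unfolding p_def by (rule someI_ex) (use up[OF that] in blast)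
  \<comment> \<open>If w is in the i-th cone of v, only the i-th order can place w above both v and
    u.\<close>
  have least: "h i u < h i w"
    if v: "v \<in> V - {a, b, c}" and i: "i < 3" and u: "{v, u} \<in> E" and w: "w \<in> V" "h i v < h i w" "\<And>j. j < 3 \<Longrightarrow> j \<noteq> i \<Longrightarrow> h j w < h j v" "w \<noteq> u" for u v w i
  proof -
    have "w \<in> V - {v, u}" using w by auto
    then obtain k where k: "k < 3" "h k v < h k w" "h k u < h k w" using edge[OF u] by blast
    then have "k = i" using w(3)[of k] by force
    then show ?thesis using k by simp
  qed
  \<comment> \<open>Two parents of v in different directions are different vertices, so one of them
    is not u; the edge from v to it must lie below u in some order.\<close>
  have dominated: "\<exists>i<3. h i v < h i u" if v: "v \<in> V - {a, b, c}" and u: "u \<in> V" "u \<noteq> v" for u v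
  proof -
    have "p 0 v \<noteq> p 1 v" using p[OF v, of 0] p[OF v, of 1] by force
    then obtain i where i: "i < 3" "p i v \<noteq> u" by (metis one_less_numeral_iff semiring_norm(77) zero_less_numeral)
    then have "u \<in> V - {v, p i v}" using u by auto
    then show ?thesis using edge[of v "p i v" u] p[OF v i(1)] by blast
  qed
  \<comment> \<open>Each vertex exceeds the other in some order, so two orders disagree and the
    third decides which vertex lies in a cone of the other.\<close>
  have pat: "(\<exists>i<3. h i v < h i u \<and> (\<forall>j<3. j \<noteq> i \<longrightarrow> h j u < h j v)) \<or>
        (\<exists>i<3. h i u < h i v \<and> (\<forall>j<3. j \<noteq> i \<longrightarrow> h j v < h j u))"
    if v: "v \<in> V - {a, b, c}" and u: "u \<in> V - {a, b, c}" and uv: "u \<noteq> v" for u v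
  proof -
    have ne: "h i u \<noteq> h i v" if "i < 3" for i using inj[OF that] u v uv by (auto simp: inj_on_def)
    obtain i where i: "i < 3" "h i v < h i u" using dominated[OF v _ uv] u by blast
    obtain j where j: "j < 3" "h j u < h j v" using dominated[OF u _ uv[symmetric]] v by blast
    have ij: "i \<noteq> j" using i j by auto
    define k where "k = 3 - i - j"
    have k: "k < 3" "k \<noteq> i" "k \<noteq> j" "\<And>l. l < 3 \<Longrightarrow> l = i \<or> l = j \<or> l = k"
      using cases3[OF i(1)] cases3[OF j(1)] ij unfolding k_def by auto
    show ?thesis
    proof (cases "h k u < h k v")
      case True
      then have "\<forall>l<3. l \<noteq> i \<longrightarrow> h l u < h l v" using k(4) j by blast
      then show ?thesis using i by blast
    next
      case False
      then have "h k v < h k u" using ne[OF k(1)] by linarith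
      then have "\<forall>l<3. l \<noteq> j \<longrightarrow> h l v < h l u" using k(4) i by blast
      then show ?thesis using j by blast
    qed
  qed
  have r: "realizer V cor h p"
  proof
    show "finite V" by (rule finV)
    show "cor i \<in> V" if "i < 3" for i using aV by (simp add: cor_def)
    show "h i v < h i (cor i)" if "i < 3" "v \<in> V" "v \<noteq> cor i" for i v using top that by blast
  qed (use low pat p least in \<open>simp_all add: cor\<close>)
  have "(\<exists>i<3. u = p i v) \<or> (u \<in> V - {a, b, c} \<and> (\<exists>i<3. v = p i u))" if e: "{u, v} \<in> E" and v: "v \<in> V - {a, b, c}" for u v
  proof -
    have uv: "u \<in> V" "u \<noteq> v" using E_pair[OF e] by auto
    have out: "u = p i v" if "i < 3" "h i v < h i u" "\<forall>j<3. j \<noteq> i \<longrightarrow> h j u < h j v" "v \<in> V - {a, b, c}" "{v, u} \<in> E" "u \<in> V" for i u v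
    proof (rule ccontr)
      assume ne: "u \<noteq> p i v"
      have "h i (p i v) < h i u" using least[OF that(4,1) _ that(6,2) _ ne] p[OF that(4,1)] that(3) by blast
      moreover have "h i u < h i (p i v)" using least[OF that(4,1,5), of "p i v"] p[OF that(4,1)] ne by blast
      ultimately show False by simp
    qed
    show ?thesis
    proof (cases "u \<in> {a, b, c}")
      case True
      then obtain i where i: "i < 3" "u = cor i" using cor by (metis imageE lessThan_iff)
      then have "h i v < h i u" "\<forall>j<3. j \<noteq> i \<longrightarrow> h j u < h j v" using top[of i v] low[of i _ v] v uv by auto
      then have "u = p i v" using out[OF i(1), of v u] v uv e by (simp add: insert_commute)
      then show ?thesis using i(1) by blast
    next
      case False
      then have u: "u \<in> V - {a, b, c}" using uv by simp
      have vu: "v \<in> V" "{v, u} \<in> E" using v e by (auto simp: insert_commute)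
      from pat[OF v u uv(2)] show ?thesis
        using out[OF _ _ _ v vu(2) uv(1)] out[OF _ _ _ u e vu(1)] u by blast
    qed
  qed
  then show ?thesis using r p by blast
qed

section \<open>Bodies touching in three directions\<close>

lemma finite_family_convergent_subsequence:
  fixes X :: "nat \<Rightarrow> 'i \<Rightarrow> 'b::metric_space"
  assumes "finite I" and "\<And>i. i \<in> I \<Longrightarrow> \<exists>K. compact K \<and> (\<forall>k. X k i \<in> K)"
  obtains r x where "strict_mono r" "\<And>i. i \<in> I \<Longrightarrow> (\<lambda>k. X (r k) i) \<longlonglongrightarrow> x i"
proof -
  have "\<exists>r x. strict_mono (r :: nat \<Rightarrow> nat) \<and> (\<forall>i\<in>I. (\<lambda>k. X (r k) i) \<longlonglongrightarrow> x i)"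
    using assms
  proof (induction I)
    case empty
    then show ?case using strict_mono_id by auto
  next
    case (insert j I)
    then obtain r x where r: "strict_mono (r :: nat \<Rightarrow> nat)" "\<forall>i\<in>I. (\<lambda>k. X (r k) i) \<longlonglongrightarrow> x i"
      by (metis insertCI)
    obtain K where K: "compact K" "\<forall>k. X k j \<in> K" using insert.prems by blast
    then obtain l s where s: "strict_mono s" "((\<lambda>k. X (r k) j) \<circ> s) \<longlonglongrightarrow> l"
      using compact_imp_seq_compact[OF K(1)] unfolding seq_compact_def by (metis (mono_tags, lifting))
    have "(\<lambda>k. X ((r \<circ> s) k) i) \<longlonglongrightarrow> (x(j := l)) i" if "i \<in> insert j I" for i
    proof (cases "i = j")
      case True
      then show ?thesis using s by (simp add: o_def)
    next
      case False
      then have "(\<lambda>k. X (r k) i) \<longlonglongrightarrow> x i" using r that by blast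
      then show ?thesis using LIMSEQ_subseq_LIMSEQ[OF _ s(1)] False by (fastforce simp: o_def)
    qed
    moreover have "strict_mono (r \<circ> s)" using r s strict_mono_o by blast
    ultimately show ?case by blast
  qed
  then show thesis using that by blast
qed

text \<open>Kuhn's combinatorial lemma is applied to ever finer grids: it gives a small cell on
  which each \<open>f i\<close> takes both weak signs, and the cells accumulate at a common zero.
  Continuity is stated through convergence at the indices in I only, so that values elsewhere do not
  matter.\<close>

lemma poincare_miranda:
  fixes f :: "'i \<Rightarrow> ('i \<Rightarrow> real) \<Rightarrow> real"
  assumes finI: "finite I"
    and cont: "\<And>i X x. \<lbrakk>i \<in> I; \<And>k j. j \<in> I \<Longrightarrow> X k j \<in> {0..1}; \<And>j. j \<in> I \<Longrightarrow> x j \<in> {0..1};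
        \<And>j. j \<in> I \<Longrightarrow> (\<lambda>k. X k j) \<longlonglongrightarrow> x j\<rbrakk> \<Longrightarrow> (\<lambda>k. f i (X k)) \<longlonglongrightarrow> f i x"
    and lo: "\<And>i x. \<lbrakk>i \<in> I; \<And>j. j \<in> I \<Longrightarrow> x j \<in> {0..1}; x i = 0\<rbrakk> \<Longrightarrow> f i x \<le> 0"
    and hi: "\<And>i x. \<lbrakk>i \<in> I; \<And>j. j \<in> I \<Longrightarrow> x j \<in> {0..1}; x i = 1\<rbrakk> \<Longrightarrow> 0 \<le> f i x"
  obtains x where "\<And>j. j \<in> I \<Longrightarrow> x j \<in> {0..1}" "\<And>i. i \<in> I \<Longrightarrow> f i x = 0"
proof -
  define N where "N = card I"
  obtain e where e: "bij_betw e {0..<N} I" using ex_bij_betw_nat_finite[OF finI] unfolding N_def by blast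
  define e' where "e' = the_inv_into {0..<N} e"
  have e': "e' i < N" "e (e' i) = i" if "i \<in> I" for i
    using bij_betw_the_inv_into[OF e] f_the_inv_into_f_bij_betw[OF e] that
    by (auto simp: e'_def bij_betw_def)
  have eI: "e n \<in> I" "e' (e n) = n" if "n < N" for n
    using e that by (auto simp: bij_betw_def e'_def the_inv_into_f_f)
  define sc where "sc k x = (\<lambda>i. real (x (e' i)) / real (Suc k))" for k and x :: "nat \<Rightarrow> nat"
  \<comment> \<open>The label is the sign of f, except on the faces, where it is prescribed as
    Kuhn's lemma requires; there \<open>lo\<close> and \<open>hi\<close> vouch for the sign.\<close>
  define lab where "lab k x n = (if x n = 0 \<or> (x n \<noteq> Suc k \<and> f (e n) (sc k x) \<le> 0) then 0 else (1::nat))" for k x n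
  have sc01: "sc k x i \<in> {0..1}" if "i \<in> I" "\<forall>n<N. x n \<le> Suc k" for k x i
  proof -
    have "real (x (e' i)) \<le> real (Suc k)" using e'(1)[OF that(1)] that(2) of_nat_le_iff by blast
    then show ?thesis by (simp add: sc_def divide_le_eq_1)
  qed
  have lab0: "f (e n) (sc k x) \<le> 0" if n: "n < N" "\<forall>n<N. x n \<le> Suc k" "lab k x n = 0" for k x n
  proof (cases "x n = 0")
    case True
    then show ?thesis using lo[of "e n" "sc k x"] eI[OF n(1)] sc01 n by (simp add: sc_def)
  next
    case False
    then show ?thesis using n(3) by (auto simp: lab_def split: if_splits)
  qed
  have lab1: "0 \<le> f (e n) (sc k x)" if n: "n < N" "\<forall>n<N. x n \<le> Suc k" "lab k x n \<noteq> 0" for k x n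
  proof (cases "x n = Suc k")
    case True
    then show ?thesis using hi[of "e n" "sc k x"] eI[OF n(1)] sc01 n by (simp add: sc_def)
  next
    case False
    then show ?thesis using n(3) by (auto simp: lab_def split: if_splits)
  qed
  define cell where "cell q x \<longleftrightarrow> (\<forall>j<N. q j \<le> x j \<and> x j \<le> q j + 1)" for q x :: "nat \<Rightarrow> nat"
  have "\<exists>q. (\<forall>n<N. q n < Suc k) \<and> (\<forall>n<N. \<exists>r s. cell q r \<and> cell q s \<and> lab k r n \<noteq> lab k s n)" for k
  proof -
    have "\<forall>x. (\<forall>i<N. x i \<le> Suc k) \<longrightarrow> (\<forall>i<N. lab k x i = 0 \<or> lab k x i = 1)"
      "\<forall>x. (\<forall>i<N. x i \<le> Suc k) \<longrightarrow> (\<forall>i<N. x i = 0 \<longrightarrow> lab k x i = 0)"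
      "\<forall>x. (\<forall>i<N. x i \<le> Suc k) \<longrightarrow> (\<forall>i<N. x i = Suc k \<longrightarrow> lab k x i = 1)"
      by (auto simp: lab_def)
    from kuhn_lemma[OF zero_less_Suc this] obtain q where "\<forall>i<N. q i < Suc k"
      "\<forall>i<N. \<exists>r s. (\<forall>j<N. q j \<le> r j \<and> r j \<le> q j + 1) \<and> (\<forall>j<N. q j \<le> s j \<and> s j \<le> q j + 1) \<and>
        lab k r i \<noteq> lab k s i" .
    then show ?thesis unfolding cell_def by (intro exI[of _ q] conjI)
  qed
  then have "\<exists>q. \<forall>k. (\<forall>n<N. q k n < Suc k) \<and> (\<forall>n<N. \<exists>r s. cell (q k) r \<and> cell (q k) s \<and> lab k r n \<noteq> lab k s n)"
    by (intro choice allI)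
  then obtain q where q: "\<And>k n. n < N \<Longrightarrow> q k n < Suc k"
    and qq: "\<And>k n. n < N \<Longrightarrow> \<exists>r s. cell (q k) r \<and> cell (q k) s \<and> lab k r n \<noteq> lab k s n"
    by blast
  have cell_le: "\<forall>j<N. r j \<le> Suc k" if "cell (q k) r" for k r
    using that q unfolding cell_def by (metis Suc_eq_plus1 Suc_leI order_trans Suc_le_mono)
  have "\<exists>r. cell (q k) r \<and> f (e n) (sc k r) \<le> 0" "\<exists>s. cell (q k) s \<and> 0 \<le> f (e n) (sc k s)" if n: "n < N" for k n
  proof -
    obtain r s where rs: "cell (q k) r" "cell (q k) s" "lab k r n \<noteq> lab k s n"
      using qq[OF n] by blast
    show "\<exists>r. cell (q k) r \<and> f (e n) (sc k r) \<le> 0"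
    proof (cases "lab k r n = 0")
      case True
      then show ?thesis using lab0[OF n cell_le[OF rs(1)]] rs by blast
    next
      case False
      then have "lab k s n = 0" using rs by (auto simp: lab_def split: if_splits)
      then show ?thesis using lab0[OF n cell_le[OF rs(2)]] rs by blast
    qed
    show "\<exists>s. cell (q k) s \<and> 0 \<le> f (e n) (sc k s)"
    proof (cases "lab k r n = 0")
      case True
      then have "lab k s n \<noteq> 0" using rs by simp
      then show ?thesis using lab1[OF n cell_le[OF rs(2)]] rs by blast
    next
      case False
      then show ?thesis using lab1[OF n cell_le[OF rs(1)]] rs by blast
    qed
  qed
  note ex = this
  define R where "R k n = (SOME r. cell (q k) r \<and> f (e n) (sc k r) \<le> 0)" for k n
  define S where "S k n = (SOME s. cell (q k) s \<and> 0 \<le> f (e n) (sc k s))" for k n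
  have RS: "cell (q k) (R k n)" "cell (q k) (S k n)" and fR: "f (e n) (sc k (R k n)) \<le> 0"
    and fS: "0 \<le> f (e n) (sc k (S k n))" if "n < N" for k n
    unfolding R_def S_def using someI_ex[OF ex(1)[OF that]] someI_ex[OF ex(2)[OF that]] by blast+
  have R: "\<And>k n j. n < N \<Longrightarrow> j < N \<Longrightarrow> q k j \<le> R k n j \<and> R k n j \<le> q k j + 1"
    and S: "\<And>k n j. n < N \<Longrightarrow> j < N \<Longrightarrow> q k j \<le> S k n j \<and> S k n j \<le> q k j + 1"
    using RS unfolding cell_def by blast+
  have q1: "\<forall>n<N. q k n \<le> Suc k" for k using q less_imp_le by blast
  have "\<exists>K. compact K \<and> (\<forall>k. sc k (q k) i \<in> K)" if "i \<in> I" for i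
    using sc01[OF that q1] by (intro exI[of _ "{0..1}"]) auto
  then obtain t x where t: "strict_mono t" and x: "\<And>i. i \<in> I \<Longrightarrow> (\<lambda>k. sc (t k) (q (t k)) i) \<longlonglongrightarrow> x i"
    using finite_family_convergent_subsequence[OF finI, of "\<lambda>k. sc k (q k)"] by blast
  have x01: "x i \<in> {0..1}" if i: "i \<in> I" for i
    using closed_sequentially[OF closed_atLeastAtMost, of "\<lambda>k. sc (t k) (q (t k)) i" 0 1 "x i"] sc01[OF i q1] x[OF i] by blast
  have inv0: "(\<lambda>k. 1 / real (Suc (t k))) \<longlonglongrightarrow> 0"
    using LIMSEQ_subseq_LIMSEQ[OF LIMSEQ_inverse_real_of_nat t] by (simp add: o_def inverse_eq_divide)
  have near: "(\<lambda>k. sc (t k) (Y (t k)) i) \<longlonglongrightarrow> x i"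
    if i: "i \<in> I" and Y: "\<And>k j. j < N \<Longrightarrow> q k j \<le> Y k j \<and> Y k j \<le> q k j + 1" for Y i
  proof (rule tendsto_sandwich[OF always_eventually always_eventually x[OF i]])
    show "\<forall>k. sc (t k) (q (t k)) i \<le> sc (t k) (Y (t k)) i"
      using Y[OF e'(1)[OF i]] by (auto simp: sc_def divide_right_mono)
    show "\<forall>k. sc (t k) (Y (t k)) i \<le> sc (t k) (q (t k)) i + 1 / real (Suc (t k))"
    proof
      fix k
      have "real (Y (t k) (e' i)) \<le> real (q (t k) (e' i)) + 1" using Y[OF e'(1)[OF i], of "t k"] by linarith
      then show "sc (t k) (Y (t k)) i \<le> sc (t k) (q (t k)) i + 1 / real (Suc (t k))"
        by (simp add: sc_def add_divide_distrib[symmetric] divide_right_mono)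
    qed
    show "(\<lambda>k. sc (t k) (q (t k)) i + 1 / real (Suc (t k))) \<longlonglongrightarrow> x i"
      using tendsto_add[OF x[OF i] inv0] by simp
  qed
  have bound: "sc k Y i \<in> {0..1}" if "i \<in> I" "\<And>j. j < N \<Longrightarrow> q k j \<le> Y j \<and> Y j \<le> q k j + 1" for k Y i
  proof (rule sc01[OF that(1)], intro allI impI)
    fix n assume "n < N"
    then show "Y n \<le> Suc k" using that(2)[of n] q[of n k] by linarith
  qed
  have "f i x = 0" if i: "i \<in> I" for i
  proof -
    let ?n = "e' i"
    have n: "?n < N" "e ?n = i" using e'[OF i] by auto
    have "(\<lambda>k. f i (sc (t k) (R (t k) ?n))) \<longlonglongrightarrow> f i x"
      by (rule cont[OF i]) (use bound R n x01 near[of _ "\<lambda>k. R k ?n"] in auto)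
    then have "f i x \<le> 0" using fR[OF n(1)] n(2) by (intro LIMSEQ_le_const2) auto
    have "(\<lambda>k. f i (sc (t k) (S (t k) ?n))) \<longlonglongrightarrow> f i x"
      by (rule cont[OF i]) (use bound S n x01 near[of _ "\<lambda>k. S k ?n"] in auto)
    then have "0 \<le> f i x" using fS[OF n(1)] n(2) by (intro LIMSEQ_le_const) auto
    with \<open>f i x \<le> 0\<close> show ?thesis by simp
  qed
  then show thesis using that x01 by blast
qed

section \<open>Homothetic copies and the gauge distance to a set\<close>

definition hom :: "complex \<Rightarrow> real \<Rightarrow> complex set \<Rightarrow> complex set" where
  "hom \<beta> r P = (\<lambda>z. of_real r * z + \<beta>) ` P"

lemma compact_hom: "compact P \<Longrightarrow> compact (hom \<beta> r P)"
  unfolding hom_def by (intro compact_continuous_image continuous_intros)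

lemma convex_hom: "convex P \<Longrightarrow> convex (hom \<beta> r P)"
proof -
  assume "convex P"
  then have "convex ((\<lambda>z. \<beta> + z) ` (\<lambda>z. r *\<^sub>R z) ` P)" by (intro convex_translation convex_scaling)
  then show ?thesis by (simp add: hom_def image_image scaleR_conv_of_real add.commute)
qed

lemma hom_0: "P \<noteq> {} \<Longrightarrow> hom \<beta> 0 P = {\<beta>}"
  by (auto simp: hom_def)

lemma center_in_hom: "0 \<in> P \<Longrightarrow> \<beta> \<in> hom \<beta> r P"
  by (force simp: hom_def)

text \<open>The distance from \<beta> to S in the gauge of P: the factor at which a growing copy of
  P first meets S. For the unit disc it is the Euclidean distance.\<close>

definition reach :: "complex set \<Rightarrow> complex \<Rightarrow> complex set \<Rightarrow> real" where
  "reach P \<beta> S = Inf {t. 0 \<le> t \<and> hom \<beta> t P \<inter> S \<noteq> {}}"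

context
  fixes P :: "complex set" and \<rho> :: real
  assumes P: "compact P" "convex P" "0 < \<rho>" "cball 0 \<rho> \<subseteq> P"
begin

lemma zero_in_P: "0 \<in> P"
  using P by auto

lemma in_hom_ball: "norm (z - \<beta>) \<le> \<rho> * t \<Longrightarrow> 0 \<le> t \<Longrightarrow> z \<in> hom \<beta> t P"
proof (cases "t = 0")
  case True
  then show "norm (z - \<beta>) \<le> \<rho> * t \<Longrightarrow> ?thesis" using hom_0 zero_in_P by auto
next
  case False
  assume a: "norm (z - \<beta>) \<le> \<rho> * t" "0 \<le> t"
  with False have t: "t > 0" by simp
  have "norm ((z - \<beta>) / of_real t) \<le> \<rho>" using a t by (simp add: norm_divide divide_le_eq)
  then have "(z - \<beta>) / of_real t \<in> P" using P(4) by auto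
  then show ?thesis unfolding hom_def using t by (intro image_eqI[of _ _ "(z - \<beta>) / of_real t"]) auto
qed

lemma reach_set_ne: "S \<noteq> {} \<Longrightarrow> {t. 0 \<le> t \<and> hom \<beta> t P \<inter> S \<noteq> {}} \<noteq> {}"
proof -
  assume "S \<noteq> {}"
  then obtain z where z: "z \<in> S" by blast
  have "z \<in> hom \<beta> (norm (z - \<beta>) / \<rho>) P" using P(3) by (intro in_hom_ball) auto
  then show ?thesis using z P(3) by (intro ex_in_conv[THEN iffD1] exI[of _ "norm (z - \<beta>) / \<rho>"]) auto
qed

lemma reach_bdd: "bdd_below {t. 0 \<le> t \<and> hom \<beta> t P \<inter> S \<noteq> {}}"
  by (auto intro!: bdd_belowI[of _ 0])

lemma reach_nonneg: "S \<noteq> {} \<Longrightarrow> 0 \<le> reach P \<beta> S"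
  unfolding reach_def using reach_set_ne by (intro cInf_greatest) auto

lemma reach_le: "0 \<le> t \<Longrightarrow> hom \<beta> t P \<inter> S \<noteq> {} \<Longrightarrow> reach P \<beta> S \<le> t"
  unfolding reach_def using reach_bdd by (intro cInf_lower) auto

lemma reach_attained:
  assumes S: "compact S" "S \<noteq> {}"
  shows "hom \<beta> (reach P \<beta> S) P \<inter> S \<noteq> {}"
proof -
  let ?T = "{t. 0 \<le> t \<and> hom \<beta> t P \<inter> S \<noteq> {}}"
  have "\<exists>t\<in>?T. t < reach P \<beta> S + inverse (real (Suc k))" for k
    using cInf_lessD[OF reach_set_ne[OF S(2)], of \<beta> "reach P \<beta> S + inverse (real (Suc k))"]
    unfolding reach_def by auto
  then obtain t where t: "\<And>k. t k \<in> ?T" "\<And>k. t k < reach P \<beta> S + inverse (real (Suc k))" by metis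
  then have "\<forall>k. \<exists>p. p \<in> P \<and> of_real (t k) * p + \<beta> \<in> S" by (force simp: hom_def)
  then obtain p where p: "\<And>k. p k \<in> P" "\<And>k. of_real (t k) * p k + \<beta> \<in> S" by metis
  obtain l s where s: "l \<in> P" "strict_mono s" "(p \<circ> s) \<longlonglongrightarrow> l"
    using compact_imp_seq_compact[OF P(1)] p(1) unfolding seq_compact_def by metis
  have tt: "t \<longlonglongrightarrow> reach P \<beta> S"
  proof (rule tendsto_sandwich[OF always_eventually always_eventually tendsto_const])
    show "\<forall>k. reach P \<beta> S \<le> t k" using t(1) reach_le by auto
    show "\<forall>k. t k \<le> reach P \<beta> S + inverse (real (Suc k))" using t(2) less_imp_le by blast
    show "(\<lambda>k. reach P \<beta> S + inverse (real (Suc k))) \<longlonglongrightarrow> reach P \<beta> S"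
      using tendsto_add[OF tendsto_const LIMSEQ_inverse_real_of_nat] by force
  qed
  have "(\<lambda>k. of_real (t (s k)) * p (s k) + \<beta>) \<longlonglongrightarrow> of_real (reach P \<beta> S) * l + \<beta>"
    using LIMSEQ_subseq_LIMSEQ[OF tt s(2)] s(3) by (intro tendsto_intros) (auto simp: o_def)
  then have "of_real (reach P \<beta> S) * l + \<beta> \<in> S"
    by (rule closed_sequentially[OF compact_imp_closed[OF S(1)] p(2)])
  then show ?thesis using s(1) by (auto simp: hom_def)
qed

text \<open>Convexity gives tP + sP \<subseteq> (t + s)P, and sP covers the disc of radius \<rho> s
  about 0. Increasing the factor by the total displacement divided by \<rho> thus makes up for
  moving both the centre and the set.\<close>

lemma reach_Lipschitz:
  assumes S: "compact S" "S \<noteq> {}" and S': "\<And>z. z \<in> S \<Longrightarrow> \<exists>z'\<in>S'. dist z z' \<le> \<delta>"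
  shows "reach P \<beta>' S' \<le> reach P \<beta> S + (\<delta> + dist \<beta> \<beta>') / \<rho>"
proof -
  let ?t = "reach P \<beta> S" and ?\<eta> = "\<delta> + dist \<beta> \<beta>'"
  have t0: "0 \<le> ?t" using reach_nonneg S by blast
  obtain p where p: "p \<in> P" "of_real ?t * p + \<beta> \<in> S" using reach_attained[OF S, of \<beta>] by (auto simp: hom_def)
  then obtain z' where z': "z' \<in> S'" "dist (of_real ?t * p + \<beta>) z' \<le> \<delta>" using S' by blast
  have \<eta>0: "0 \<le> ?\<eta>" using z'(2) zero_le_dist[of "of_real ?t * p + \<beta>" z'] zero_le_dist[of \<beta> \<beta>'] by linarith
  define e where "e = z' - \<beta>' - of_real ?t * p"
  have e: "norm e \<le> ?\<eta>"
  proof -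
    have "e = (z' - (of_real ?t * p + \<beta>)) + (\<beta> - \<beta>')" by (simp add: e_def)
    then have "norm e \<le> norm (z' - (of_real ?t * p + \<beta>)) + norm (\<beta> - \<beta>')" using norm_triangle_ineq by metis
    then show ?thesis using z'(2) by (simp add: dist_norm norm_minus_commute)
  qed
  define s where "s = ?\<eta> / \<rho>"
  have "z' \<in> hom \<beta>' (?t + s) P"
  proof (cases "?\<eta> = 0")
    case True
    then have "z' = of_real ?t * p + \<beta>'" using e by (simp add: e_def diff_eq_eq)
    then show ?thesis using p True by (auto simp: hom_def s_def)
  next
    case False
    then have \<eta>: "0 < ?\<eta>" using \<eta>0 by linarith
    then have s: "0 < s" using P by (simp add: s_def)
    define p2 where "p2 = e / of_real s"
    have "norm p2 = norm e / s" unfolding p2_def norm_divide norm_of_real abs_of_pos[OF s] ..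
    also have "\<dots> = norm e * \<rho> / ?\<eta>" by (simp add: s_def)
    also have "\<dots> \<le> \<rho>" using e \<eta> P(3) by (simp add: divide_le_eq mult.commute)
    finally have p2: "p2 \<in> P" using P(4) by auto
    let ?w = "(?t / (?t + s)) *\<^sub>R p + (s / (?t + s)) *\<^sub>R p2"
    have "?w \<in> P" using P(2) p(1) p2 t0 s by (intro convexD) (auto simp: add_divide_distrib[symmetric])
    moreover have "of_real (?t + s) * ?w + \<beta>' = z'"
    proof -
      have "of_real (?t + s) * ?w = ((?t + s) * (?t / (?t + s))) *\<^sub>R p + ((?t + s) * (s / (?t + s))) *\<^sub>R p2"
        by (simp only: scaleR_conv_of_real distrib_left of_real_mult mult.assoc)
      also have "\<dots> = of_real ?t * p + of_real s * p2" using t0 s by (simp add: scaleR_conv_of_real)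
      also have "of_real s * p2 = e" using s by (simp add: p2_def)
      finally show ?thesis by (simp add: e_def)
    qed
    ultimately show ?thesis unfolding hom_def by (intro image_eqI[of _ _ ?w]) auto
  qed
  then show ?thesis using z'(1) t0 \<eta>0 P(3) unfolding s_def by (intro reach_le) auto
qed

lemma reach_eq_0: "\<beta> \<in> S \<Longrightarrow> reach P \<beta> S = 0"
  using reach_nonneg[of S \<beta>] reach_le[of 0 \<beta> S] hom_0[of P \<beta>] zero_in_P by fastforce

text \<open>An interior point of a copy can be pushed slightly away from the centre without leaving
  the copy. It therefore lies already in a copy with a smaller factor, and such a copy misses
  S.\<close>

lemma interior_hom_disjoint:
  assumes "S \<noteq> {}" and r: "0 < r" "r \<le> reach P \<beta> S"
  shows "interior (hom \<beta> r P) \<inter> S = {}"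
proof (rule ccontr)
  assume "\<not> ?thesis"
  then obtain z where z: "z \<in> interior (hom \<beta> r P)" "z \<in> S" by blast
  then obtain e where e: "e > 0" "ball z e \<subseteq> hom \<beta> r P" by (meson mem_interior)
  have "\<exists>t. 0 \<le> t \<and> t < r \<and> z \<in> hom \<beta> t P"
  proof (cases "z = \<beta>")
    case True
    then show ?thesis using r center_in_hom[OF zero_in_P] by (intro exI[of _ 0]) auto
  next
    case False
    define d where "d = norm (z - \<beta>)"
    have d: "d > 0" using False by (simp add: d_def)
    let ?z' = "z + of_real (e / (2 * d)) * (z - \<beta>)"
    have "norm (of_real (e / (2 * d)) * (z - \<beta>)) = e / (2 * d) * d"
      unfolding norm_mult norm_of_real using d e by (simp add: d_def)
    then have "dist z ?z' = e / 2" using d by (simp add: dist_norm)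
    then have "?z' \<in> hom \<beta> r P" using e by auto
    then obtain p where p: "p \<in> P" "?z' = of_real r * p + \<beta>" by (auto simp: hom_def)
    define c where "c = 1 + e / (2 * d)"
    have c: "c > 1" using e d by (simp add: c_def)
    have "of_real c * (z - \<beta>) = of_real r * p" using p(2) by (simp add: c_def algebra_simps)
    then have "z - \<beta> = of_real (r / c) * p" using c by (simp add: field_simps)
    then have "z \<in> hom \<beta> (r / c) P"
      unfolding hom_def using p by (intro image_eqI[of _ _ p]) (simp_all add: diff_eq_eq)
    moreover have "r / c < r" using c r by (simp add: divide_less_eq)
    moreover have "0 \<le> r / c" using c r by simp
    ultimately show ?thesis by blast
  qed
  then obtain t where "0 \<le> t" "t < r" "z \<in> hom \<beta> t P" by blast
  then show False using reach_le[of t \<beta> S] z r by auto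
qed

end

text \<open>The unknowns of v are two coordinates in a square, mapped by \<tau> to a centre, and the
  size scaled to [0,1]. The sides of the square go to the sets \<open>Sd\<close> in such a way that
  on each face where a centre coordinate is extreme one distance vanishes, or two do; this yields
  the boundary signs for Poincare-Miranda.\<close>

theorem configuration_exists:
  fixes P :: "'v \<Rightarrow> complex set" and ob :: "nat \<Rightarrow> 'v \<Rightarrow> 'v set" and Sd :: "nat \<Rightarrow> complex set"
    and \<tau> :: "real \<times> real \<Rightarrow> complex"
  assumes fin: "finite V0"
    and P: "\<And>v. v \<in> V0 \<Longrightarrow> compact (P v)" "\<And>v. v \<in> V0 \<Longrightarrow> convex (P v)" "\<And>v. v \<in> V0 \<Longrightarrow> 0 < \<rho> v"
      "\<And>v. v \<in> V0 \<Longrightarrow> cball 0 (\<rho> v) \<subseteq> P v"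
    and ob: "\<And>i v. v \<in> V0 \<Longrightarrow> i < 3 \<Longrightarrow> ob i v \<subseteq> V0"
    and Sd: "\<And>i. i < 3 \<Longrightarrow> compact (Sd i)" "\<And>i. i < 3 \<Longrightarrow> Sd i \<noteq> {}"
    and \<tau>: "continuous_on ({0..1} \<times> {0..1}) \<tau>"
    and sides: "\<And>y. y \<in> {0..1} \<Longrightarrow> \<tau> (0, y) \<in> Sd 0" "\<And>y. y \<in> {0..1} \<Longrightarrow> \<tau> (1, y) \<in> Sd 1"
      "\<And>x. x \<in> {0..1} \<Longrightarrow> \<tau> (x, 1) \<in> Sd 2" "\<And>x. x \<in> {0..1} \<Longrightarrow> \<tau> (x, 0) \<in> Sd 0 \<inter> Sd 1"
  obtains \<beta> r where "\<And>v. v \<in> V0 \<Longrightarrow> \<beta> v \<in> \<tau> ` ({0..1} \<times> {0..1})" "\<And>v. v \<in> V0 \<Longrightarrow> 0 \<le> r v"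
    "\<And>v i. v \<in> V0 \<Longrightarrow> i < 3 \<Longrightarrow> reach (P v) (\<beta> v) (Sd i \<union> (\<Union>u\<in>ob i v. hom (\<beta> u) (r u) (P u))) = r v"
proof -
  let ?I = "V0 \<times> {..<3::nat}" and ?Q = "{0..1::real} \<times> {0..1::real}"
  obtain z0 where z0: "z0 \<in> Sd 0" using Sd(2)[of 0] by auto
  have "compact (\<tau> ` ?Q)" using \<tau> by (intro compact_continuous_image compact_Times) auto
  then have "bounded (\<tau> ` ?Q)" by (rule compact_imp_bounded)
  then obtain M where M: "\<And>z. z \<in> \<tau> ` ?Q \<Longrightarrow> dist z0 z \<le> M" by (meson bounded_any_center)
  have "\<tau> (0, 0) \<in> \<tau> ` ?Q" by (intro imageI) auto
  then have M0: "0 \<le> M" using M order_trans zero_le_dist by blast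
  \<comment> \<open>At the factor M / \<rho> v the copy reaches the fixed point z0 of
    \<open>Sd 0\<close> from every centre, so this is a sufficient bound for the size.\<close>
  define R where "R v = M / \<rho> v" for v
  have R0: "0 \<le> R v" if "v \<in> V0" for v using M0 P(3)[OF that] by (simp add: R_def)
  define bt where "bt x v = \<tau> (x (v, 0), x (v, 1))" for x :: "'v \<times> nat \<Rightarrow> real" and v
  define rd where "rd x v = R v * x (v, 2)" for x :: "'v \<times> nat \<Rightarrow> real" and v
  define Ob where "Ob x i v = Sd i \<union> (\<Union>u\<in>ob i v. hom (bt x u) (rd x u) (P u))" for x i v
  define d where "d i v x = reach (P v) (bt x v) (Ob x i v)" for i v x
  \<comment> \<open>A common zero says that d 0 = d 1, that their minimum is d 2, and that the size
    is the least of the three; so all three distances equal the size.\<close>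
  define f where "f = (\<lambda>(v, n::nat) x. if n = 0 then d 0 v x - d 1 v x else if n = 1 then min (d 0 v x) (d 1 v x) - d 2 v x
      else rd x v - min (min (d 0 v x) (d 1 v x)) (d 2 v x))"
  have Ob: "compact (Ob x i v)" "Ob x i v \<noteq> {}" if "v \<in> V0" "i < 3" for x i v
  proof -
    have "finite (ob i v)" using ob[OF that] fin finite_subset by blast
    then show "compact (Ob x i v)" unfolding Ob_def
      using Sd(1)[OF that(2)] compact_hom P(1) ob[OF that] by (intro compact_Un compact_UN) auto
    show "Ob x i v \<noteq> {}" using Sd(2)[OF that(2)] by (simp add: Ob_def)
  qed
  have dn: "0 \<le> d i v x" if "v \<in> V0" "i < 3" for i v x
    unfolding d_def using reach_nonneg[OF P[OF that(1)] Ob(2)[OF that]] .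
  have bt_in: "bt x v \<in> \<tau> ` ?Q" if "\<And>j. j \<in> ?I \<Longrightarrow> x j \<in> {0..1}" "v \<in> V0" for x v
    unfolding bt_def using that by (intro imageI) auto
  have dR: "d 0 v x \<le> R v" if x: "\<And>j. j \<in> ?I \<Longrightarrow> x j \<in> {0..1}" and v: "v \<in> V0" for v x
  proof -
    have "z0 \<in> hom (bt x v) (R v) (P v)"
      using M[OF bt_in[OF x v]] R0[OF v] P(3)[OF v] by (intro in_hom_ball[OF P[OF v]]) (auto simp: dist_norm R_def)
    then show ?thesis unfolding d_def using z0 R0[OF v] by (intro reach_le[OF P[OF v]]) (auto simp: Ob_def)
  qed
  have d0: "d i v x = 0" if "v \<in> V0" "bt x v \<in> Sd i" for i v x
    unfolding d_def using that by (intro reach_eq_0[OF P[OF that(1)]]) (auto simp: Ob_def)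
  have lo: "f i x \<le> 0" if i: "i \<in> ?I" and x: "\<And>j. j \<in> ?I \<Longrightarrow> x j \<in> {0..1}" and x0: "x i = 0" for i x
  proof -
    obtain v n where i_def: "i = (v, n)" by (cases i)
    have v: "v \<in> V0" using i i_def by auto
    consider "n = 0" | "n = 1" | "n = 2" using i i_def by auto linarith
    then show ?thesis
    proof cases
      case 1
      then have "bt x v \<in> Sd 0" unfolding bt_def using x0 i_def x[of "(v, 1)"] v sides(1) by simp
      then show ?thesis using 1 d0[OF v] dn[OF v, of 1 x] by (simp add: f_def i_def)
    next
      case 2
      then have "bt x v \<in> Sd 0 \<inter> Sd 1" unfolding bt_def using x0 i_def x[of "(v, 0)"] v sides(4) by simp
      then show ?thesis using 2 d0[OF v, of x 0] d0[OF v, of x 1] dn[OF v, of 2 x] by (simp add: f_def i_def)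
    next
      case 3
      then show ?thesis using x0 dn[OF v] by (simp add: f_def i_def rd_def)
    qed
  qed
  have hi: "0 \<le> f i x" if i: "i \<in> ?I" and x: "\<And>j. j \<in> ?I \<Longrightarrow> x j \<in> {0..1}" and x0: "x i = 1" for i x
  proof -
    obtain v n where i_def: "i = (v, n)" by (cases i)
    have v: "v \<in> V0" using i i_def by auto
    consider "n = 0" | "n = 1" | "n = 2" using i i_def by auto linarith
    then show ?thesis
    proof cases
      case 1
      then have "bt x v \<in> Sd 1" unfolding bt_def using x0 i_def x[of "(v, 1)"] v sides(2) by simp
      then show ?thesis using 1 d0[OF v] dn[OF v, of 0 x] by (simp add: f_def i_def)
    next
      case 2
      then have "bt x v \<in> Sd 2" unfolding bt_def using x0 i_def x[of "(v, 0)"] v sides(3) by simp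
      then show ?thesis using 2 d0[OF v, of x 2] dn[OF v, of 0 x] dn[OF v, of 1 x] by (simp add: f_def i_def)
    next
      case 3
      have "d 0 v x \<le> R v" by (rule dR) (use x v in auto)
      then have "min (min (d 0 v x) (d 1 v x)) (d 2 v x) \<le> R v" by linarith
      then show ?thesis using 3 x0 by (simp add: f_def i_def rd_def)
    qed
  qed
  have bt_lim: "(\<lambda>k. bt (X k) v) \<longlonglongrightarrow> bt x v"
    if "\<And>k j. j \<in> ?I \<Longrightarrow> X k j \<in> {0..1}" "\<And>j. j \<in> ?I \<Longrightarrow> x j \<in> {0..1}" "\<And>j. j \<in> ?I \<Longrightarrow> (\<lambda>k. X k j) \<longlonglongrightarrow> x j" "v \<in> V0" for X x v
    unfolding bt_def
  proof (rule continuous_on_tendsto_compose[OF \<tau>])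
    show "(\<lambda>k. (X k (v, 0), X k (v, 1))) \<longlonglongrightarrow> (x (v, 0), x (v, 1))"
      using that by (intro tendsto_Pair) auto
    show "(x (v, 0), x (v, 1)) \<in> ?Q" using that by auto
    show "\<forall>\<^sub>F k in sequentially. (X k (v, 0), X k (v, 1)) \<in> ?Q" using that by (intro always_eventually) auto
  qed
  have d_lim: "(\<lambda>k. d i v (X k)) \<longlonglongrightarrow> d i v x"
    if X: "\<And>k j. j \<in> ?I \<Longrightarrow> X k j \<in> {0..1}" "\<And>j. j \<in> ?I \<Longrightarrow> x j \<in> {0..1}" "\<And>j. j \<in> ?I \<Longrightarrow> (\<lambda>k. X k j) \<longlonglongrightarrow> x j"
      and v: "v \<in> V0" and i: "i < 3" for X x v i
  proof -
    have "\<exists>B. \<forall>p\<in>P u. norm p \<le> B" if "u \<in> V0" for u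
      using compact_imp_bounded[OF P(1)[OF that]] by (auto simp: bounded_iff)
    then obtain B where B: "\<And>u p. u \<in> V0 \<Longrightarrow> p \<in> P u \<Longrightarrow> norm p \<le> B u" by metis
    have B0: "0 \<le> B u" if "u \<in> V0" for u using B[OF that, of 0] P(3,4)[OF that] by force
    \<comment> \<open>A bound for how far a point of body u moves when the parameters change from x
      to X k. Summed over all u it bounds the displacement of the obstacles.\<close>
    define e where "e k u = dist (bt x u) (bt (X k) u) + \<bar>rd x u - rd (X k) u\<bar> * B u" for k u
    define \<delta> where "\<delta> k = (\<Sum>u\<in>V0. e k u)" for k
    have e0: "0 \<le> e k u" if "u \<in> V0" for k u using B0[OF that] by (simp add: e_def)
    have eB: "e k u \<le> \<delta> k" if "u \<in> V0" for k u
      unfolding \<delta>_def using member_le_sum[OF that, of "e k"] e0 fin by auto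
    have d0': "0 \<le> \<delta> k" for k unfolding \<delta>_def using e0 by (simp add: sum_nonneg)
    have pt: "dist (of_real (rd x u) * p + bt x u) (of_real (rd (X k) u) * p + bt (X k) u) \<le> \<delta> k"
      if u: "u \<in> V0" "p \<in> P u" for u p k
    proof -
      have eq: "of_real (rd x u) * p + bt x u - (of_real (rd (X k) u) * p + bt (X k) u) =
          of_real (rd x u - rd (X k) u) * p + (bt x u - bt (X k) u)"
        by (simp add: algebra_simps)
      have "norm (of_real (rd x u - rd (X k) u) * p + (bt x u - bt (X k) u)) \<le>
          norm (of_real (rd x u - rd (X k) u) * p) + norm (bt x u - bt (X k) u)" by (rule norm_triangle_ineq)
      moreover have "norm (of_real (rd x u - rd (X k) u) * p) \<le> \<bar>rd x u - rd (X k) u\<bar> * B u"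
        unfolding norm_mult norm_of_real using B[OF u] by (intro mult_left_mono) auto
      ultimately have "norm (of_real (rd x u - rd (X k) u) * p + (bt x u - bt (X k) u)) \<le> e k u"
        by (simp add: e_def dist_norm)
      then show ?thesis unfolding dist_norm eq using eB[OF u(1), of k] by linarith
    qed
    have move: "\<exists>z'\<in>Ob y' i v. dist z z' \<le> \<delta> k" if y: "y = x \<and> y' = X k \<or> y = X k \<and> y' = x" and zOb: "z \<in> Ob y i v" for z k y y'
    proof (cases "z \<in> Sd i")
      case True
      then show ?thesis using d0'[of k] by (intro bexI[of _ z]) (auto simp: Ob_def)
    next
      case False
      then obtain u p where u: "u \<in> ob i v" "p \<in> P u" "z = of_real (rd y u) * p + bt y u"
        using zOb by (auto simp: Ob_def hom_def)
      then have in_Ob: "of_real (rd y' u) * p + bt y' u \<in> Ob y' i v" by (auto simp: Ob_def hom_def)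
      have "dist z (of_real (rd y' u) * p + bt y' u) \<le> \<delta> k"
        using pt[of u p k] u(1,2) ob[OF v i] y unfolding u(3) by (metis dist_commute subsetD)
      then show ?thesis using in_Ob by blast
    qed
    note fwd = move[OF disjI1[OF conjI[OF refl refl]]] and bwd = move[OF disjI2[OF conjI[OF refl refl]]]
    define g where "g k = (\<delta> k + dist (bt x v) (bt (X k) v)) / \<rho> v" for k
    have ub: "norm (d i v (X k) - d i v x) \<le> g k" for k
    proof -
      have "d i v (X k) \<le> d i v x + g k"
        unfolding d_def g_def by (rule reach_Lipschitz[OF P[OF v] Ob[OF v i] fwd])
      moreover have "d i v x \<le> d i v (X k) + g k"
        unfolding d_def g_def using reach_Lipschitz[OF P[OF v] Ob[OF v i] bwd, where \<beta>' = "bt x v" and \<beta> = "bt (X k) v"]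
        by (simp add: dist_commute)
      ultimately show ?thesis by (simp add: abs_le_iff)
    qed
    have bl: "(\<lambda>k. bt (X k) u) \<longlonglongrightarrow> bt x u" if "u \<in> V0" for u using bt_lim[OF X that] .
    have rl: "(\<lambda>k. rd (X k) u) \<longlonglongrightarrow> rd x u" if "u \<in> V0" for u
      unfolding rd_def using X(3)[of "(u, 2)"] that by (intro tendsto_intros) auto
    have el: "(\<lambda>k. e k u) \<longlonglongrightarrow> 0" if "u \<in> V0" for u
    proof -
      have "(\<lambda>k. e k u) \<longlonglongrightarrow> dist (bt x u) (bt x u) + \<bar>rd x u - rd x u\<bar> * B u"
        unfolding e_def using bl[OF that] rl[OF that] by (intro tendsto_intros)
      then show ?thesis by simp
    qed
    have "\<delta> \<longlonglongrightarrow> 0"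
      unfolding \<delta>_def using tendsto_sum[of V0 "\<lambda>u k. e k u" "\<lambda>_. 0" sequentially] el by simp
    then have "g \<longlonglongrightarrow> (0 + dist (bt x v) (bt x v)) / \<rho> v"
      unfolding g_def using bl[OF v] P(3)[OF v] by (intro tendsto_intros) auto
    then have "g \<longlonglongrightarrow> 0" by simp
    then have "(\<lambda>k. d i v (X k) - d i v x) \<longlonglongrightarrow> 0"
      by (rule Lim_null_comparison[OF always_eventually[OF allI[OF ub]]])
    then show ?thesis by (simp add: LIM_zero_iff)
  qed
  have cont: "(\<lambda>k. f i (X k)) \<longlonglongrightarrow> f i x"
    if i: "i \<in> ?I" and X: "\<And>k j. j \<in> ?I \<Longrightarrow> X k j \<in> {0..1}" "\<And>j. j \<in> ?I \<Longrightarrow> x j \<in> {0..1}"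
      "\<And>j. j \<in> ?I \<Longrightarrow> (\<lambda>k. X k j) \<longlonglongrightarrow> x j" for i X x
  proof -
    obtain v n where i_def: "i = (v, n)" by (cases i)
    have v: "v \<in> V0" using i i_def by auto
    have l': "(\<lambda>k. d m v (X k)) \<longlonglongrightarrow> d m v x" if "m < 3" for m
      by (rule d_lim) (use X v that in auto)
    note l = l'[of 0, simplified] l'[of 1, simplified] l'[of 2, simplified]
    have r: "(\<lambda>k. rd (X k) v) \<longlonglongrightarrow> rd x v"
      unfolding rd_def using X(3)[of "(v, 2)"] v by (intro tendsto_intros) auto
    show ?thesis unfolding f_def i_def using l r
      by (cases "n = 0"; cases "n = 1") (auto intro!: tendsto_intros)
  qed
  obtain x where x: "\<And>j. j \<in> ?I \<Longrightarrow> x j \<in> {0..1}" and fx: "\<And>i. i \<in> ?I \<Longrightarrow> f i x = 0"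
  proof -
    have "finite ?I" using fin by simp
    from poincare_miranda[where I = "?I" and f = f, OF this cont lo hi] show thesis using that by blast
  qed
  have eq: "d i v x = rd x v" if v: "v \<in> V0" and i: "i < 3" for v i
  proof -
    have "d 0 v x = d 1 v x" using fx[of "(v, 0)"] v by (simp add: f_def)
    moreover have "min (d 0 v x) (d 1 v x) = d 2 v x" using fx[of "(v, 1)"] v by (simp add: f_def)
    moreover have "rd x v = min (min (d 0 v x) (d 1 v x)) (d 2 v x)" using fx[of "(v, 2)"] v by (simp add: f_def)
    moreover have "i = 0 \<or> i = 1 \<or> i = 2" using i by linarith
    ultimately show ?thesis by auto
  qed
  show thesis
  proof (rule that[of "bt x" "rd x"])
    show "bt x v \<in> \<tau> ` ?Q" if "v \<in> V0" for v using bt_in[OF x that] .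
    show "0 \<le> rd x v" if "v \<in> V0" for v using x[of "(v, 2)"] R0[OF that] that by (simp add: rd_def)
    show "reach (P v) (bt x v) (Sd i \<union> (\<Union>u\<in>ob i v. hom (bt x u) (rd x u) (P u))) = rd x v" if "v \<in> V0" "i < 3" for v i
      using eq[OF that] by (simp add: d_def Ob_def)
  qed
qed

section \<open>Winding numbers and tripods\<close>

text \<open>B stays in one component of the complement of the curve, and this component is
  unbounded.\<close>

lemma winding_number_eq_0_unbounded:
  assumes "path \<gamma>" "pathfinish \<gamma> = pathstart \<gamma>" "connected B" "\<not> bounded B" "w \<in> B" "B \<inter> path_image \<gamma> = {}"
  shows "winding_number \<gamma> w = 0"
proof -
  have "B \<subseteq> connected_component_set (- path_image \<gamma>) w"
    using assms by (intro connected_component_maximal) auto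
  then have "w \<in> outside (path_image \<gamma>)"
    unfolding outside_def using assms bounded_subset by auto
  then show ?thesis using winding_number_zero_in_outside assms by blast
qed

text \<open>
  The loop formed by two legs of the tripod at u and the part of the curve between their feet misses the set B that
  belongs to the third leg, so its winding number around w is 0. The three loops add up to the curve.
\<close>

lemma tripods_winding_number:
  assumes \<alpha>: "path \<alpha>a" "path \<alpha>b" "path \<alpha>c" "pathstart \<alpha>a = u" "pathstart \<alpha>b = u" "pathstart \<alpha>c = u"
    and \<gamma>: "path \<gamma>a" "path \<gamma>b" "path \<gamma>c" "pathstart \<gamma>a = pathfinish \<alpha>a" "pathstart \<gamma>b = pathfinish \<alpha>b"
      "pathstart \<gamma>c = pathfinish \<alpha>c" "pathfinish \<gamma>a = pathfinish \<alpha>b" "pathfinish \<gamma>b = pathfinish \<alpha>c"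
      "pathfinish \<gamma>c = pathfinish \<alpha>a"
    and B: "connected Ba" "connected Bb" "connected Bc" "\<not> bounded Ba" "\<not> bounded Bb" "\<not> bounded Bc"
      "w \<in> Ba" "w \<in> Bb" "w \<in> Bc"
    and dis: "Bc \<inter> (path_image \<alpha>a \<union> path_image \<alpha>b \<union> path_image \<gamma>a) = {}"
      "Ba \<inter> (path_image \<alpha>b \<union> path_image \<alpha>c \<union> path_image \<gamma>b) = {}"
      "Bb \<inter> (path_image \<alpha>c \<union> path_image \<alpha>a \<union> path_image \<gamma>c) = {}"
  shows "winding_number (\<gamma>a +++ \<gamma>b +++ \<gamma>c) w = 0"
proof -
  have loop: "winding_number \<alpha> w + winding_number \<gamma> w = winding_number \<alpha>' w"
    if "path \<alpha>" "path \<alpha>'" "path \<gamma>" "pathstart \<alpha> = u" "pathstart \<alpha>' = u" "pathstart \<gamma> = pathfinish \<alpha>"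
      "pathfinish \<gamma> = pathfinish \<alpha>'" "connected B" "\<not> bounded B" "w \<in> B"
      "B \<inter> (path_image \<alpha> \<union> path_image \<alpha>' \<union> path_image \<gamma>) = {}" for \<alpha> \<alpha>' \<gamma> B
  proof -
    have w: "w \<notin> path_image \<alpha>" "w \<notin> path_image \<alpha>'" "w \<notin> path_image \<gamma>" using that by auto
    have "winding_number (\<alpha> +++ \<gamma> +++ reversepath \<alpha>') w = 0"
      by (rule winding_number_eq_0_unbounded[of _ B]) (use that in \<open>auto simp: path_image_join\<close>)
    then show ?thesis using that w
      by (simp add: winding_number_join winding_number_reversepath path_image_join not_in_path_image_join algebra_simps)
  qed
  have w: "w \<notin> path_image \<gamma>a" "w \<notin> path_image \<gamma>b" "w \<notin> path_image \<gamma>c"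
    using B dis by auto
  have "winding_number \<alpha>a w + winding_number \<gamma>a w = winding_number \<alpha>b w"
    by (rule loop[where B = Bc]) (use \<alpha> \<gamma> B dis in auto)
  moreover have "winding_number \<alpha>b w + winding_number \<gamma>b w = winding_number \<alpha>c w"
    by (rule loop[where B = Ba]) (use \<alpha> \<gamma> B dis in auto)
  moreover have "winding_number \<alpha>c w + winding_number \<gamma>c w = winding_number \<alpha>a w"
    by (rule loop[where B = Bb]) (use \<alpha> \<gamma> B dis in auto)
  ultimately have "winding_number \<gamma>a w = winding_number \<alpha>b w - winding_number \<alpha>a w"
    "winding_number \<gamma>b w = winding_number \<alpha>c w - winding_number \<alpha>b w"
    "winding_number \<gamma>c w = winding_number \<alpha>a w - winding_number \<alpha>c w"
    by (simp_all add: eq_diff_eq add.commute)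
  then have "winding_number \<gamma>a w + (winding_number \<gamma>b w + winding_number \<gamma>c w) = 0"
    by simp
  then show ?thesis using \<gamma> w by (simp add: winding_number_join path_image_join not_in_path_image_join)
qed

lemma segment_in_interior:
  fixes S :: "'a::euclidean_space set"
  assumes "convex S" "a \<in> interior S" "z \<in> S"
  shows "closed_segment a z \<subseteq> insert z (interior S)"
proof -
  have "open_segment a z \<subseteq> interior S"
    using in_interior_closure_convex_segment[OF assms(1,2)] assms(3) closure_subset by blast
  then show ?thesis using assms by (auto simp: closed_segment_eq_open)
qed

section \<open>Cones and bodies of size zero\<close>

context realizer
begin

lemma cor_cone: "v \<in> V0 \<Longrightarrow> i < 3 \<Longrightarrow> cor i \<in> cone i v"
  using cor_top[of i v] cor_low[of i _ v] cor_V by (auto simp: cone_def V0_def)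

lemma cone_cor: "v \<in> V0 \<Longrightarrow> i < 3 \<Longrightarrow> u \<in> cone i v \<Longrightarrow> u \<in> V0 \<or> u = cor i"
  using cor_low[of _ i v] by (force simp: cone_def V0_def)

lemma cone_trans: "u \<in> cone i v \<Longrightarrow> w \<in> cone i u \<Longrightarrow> w \<in> cone i v"
  by (force simp: cone_def)

lemma cone_disjoint: "i < 3 \<Longrightarrow> j < 3 \<Longrightarrow> i \<noteq> j \<Longrightarrow> u \<in> cone i v \<Longrightarrow> u \<notin> cone j v"
  by (force simp: cone_def)

lemma cone_measure: "u \<in> cone i v \<Longrightarrow> card {y \<in> V. h i u < h i y} < card {y \<in> V. h i v < h i y}"
  using finite_V by (intro psubset_card_mono) (auto simp: cone_def)

text \<open>A point body lies on some body in each cone. If that one is a point too, it is the same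
  point, and since cones are transitive, climbing on reaches a proper body in the original cone. The
  bodies found in the three disjoint cones would share the point.\<close>

lemma no_points:
  assumes D: "D \<subseteq> V0" and pt: "\<And>v. v \<in> D \<Longrightarrow> K v = {z v}"
    and ct: "\<And>v i. v \<in> V0 \<Longrightarrow> i < 3 \<Longrightarrow> \<exists>u \<in> cone i v. K v \<inter> K u \<noteq> {}"
    and triple: "\<And>x y w. \<lbrakk>x \<in> V - D; y \<in> V - D; w \<in> V - D; x \<noteq> y; y \<noteq> w; x \<noteq> w\<rbrakk> \<Longrightarrow> K x \<inter> K y \<inter> K w = {}"
  shows "D = {}"
proof (rule ccontr)
  assume "D \<noteq> {}"
  then obtain v where v: "v \<in> D" by blast
  have ex: "\<exists>x\<in>V - D. z v \<in> K x \<and> x \<in> cone i v" if "v \<in> D" "i < 3" for v i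
    using that(1)
  proof (induction "card {y \<in> V. h i v < h i y}" arbitrary: v rule: less_induct)
    case less
    then obtain u where u: "u \<in> cone i v" "K v \<inter> K u \<noteq> {}" using ct \<open>i < 3\<close> D by blast
    then have zu: "z v \<in> K u" using pt less.prems by auto
    show ?case
    proof (cases "u \<in> D")
      case True
      then obtain x where "x \<in> V - D" "z u \<in> K x" "x \<in> cone i u" using less.hyps[OF cone_measure[OF u(1)]] by blast
      moreover have "z u = z v" using pt[OF True] zu by simp
      ultimately show ?thesis using cone_trans[OF u(1)] by auto
    next
      case False
      then show ?thesis using u zu by (auto simp: cone_def)
    qed
  qed
  obtain x y w where x: "x \<in> V - D" "z v \<in> K x" "x \<in> cone 0 v" and y: "y \<in> V - D" "z v \<in> K y" "y \<in> cone 1 v"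
    and w: "w \<in> V - D" "z v \<in> K w" "w \<in> cone 2 v"
    using ex[OF v, of 0] ex[OF v, of 1] ex[OF v, of 2] by auto
  have "x \<noteq> y" "y \<noteq> w" "x \<noteq> w"
    using x y w cone_disjoint[of 0 1 x v] cone_disjoint[of 1 2 y v] cone_disjoint[of 0 2 x v] by auto
  then show False using triple[OF x(1) y(1) w(1)] x y w by blast
qed

end

section \<open>Combinatorics of a triangulation drawn on the sphere\<close>

abbreviation S2 :: "(real^3) set" where "S2 \<equiv> sphere 0 1"

lemma punctured_S2:
  assumes "N \<in> S2"
  obtains \<phi> \<psi> where "homeomorphism (S2 - {N}) (UNIV :: complex set) \<phi> \<psi>"
proof -
  have "(S2 - {N}) homeomorphic (UNIV :: complex set)"
    using assms by (intro homeomorphic_punctured_sphere_affine) auto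
  then show thesis using that unfolding homeomorphic_def by blast
qed

lemma connected_S2: "connected S2"
  by (intro connected_sphere) auto

lemma infinite_S2: "infinite S2"
proof -
  obtain N where N: "N \<in> S2" using vector_choose_size[of 1] by auto
  then obtain \<phi> \<psi> where "homeomorphism (S2 - {N}) (UNIV :: complex set) \<phi> \<psi>" by (rule punctured_S2)
  then have "\<phi> ` (S2 - {N}) = (UNIV :: complex set)" by (simp add: homeomorphism_def)
  then show ?thesis using infinite_UNIV_char_0[where 'a = complex] by (metis finite_Diff finite_imageI)
qed

text \<open>A point N off the curve is sent to infinity: the two components are the inside of the
  planar image, and its outside together with N.\<close>

lemma Jordan_S2:
  assumes c: "simple_path c" "pathfinish c = pathstart c" "path_image c \<subseteq> S2" "path_image c \<noteq> S2"
  obtains I J where "I \<union> J = S2 - path_image c" "I \<inter> J = {}" "openin (top_of_set S2) I" "openin (top_of_set S2) J"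
    "connected I" "connected J" "path_image c \<subseteq> closure I" "path_image c \<subseteq> closure J"
proof -
  let ?C = "path_image c"
  obtain N where N: "N \<in> S2" "N \<notin> ?C" using c by blast
  obtain \<phi> \<psi> where hom: "homeomorphism (S2 - {N}) (UNIV :: complex set) \<phi> \<psi>" using punctured_S2[OF N(1)] by blast
  have h: "continuous_on (S2 - {N}) \<phi>" "continuous_on UNIV \<psi>" "\<psi> ` UNIV = S2 - {N}" "\<phi> ` (S2 - {N}) = UNIV"
    "\<And>x. x \<in> S2 - {N} \<Longrightarrow> \<psi> (\<phi> x) = x" "\<And>y. \<phi> (\<psi> y) = y"
    using hom by (auto simp: homeomorphism_def)
  have CN: "?C \<subseteq> S2 - {N}" using c N by blast
  define d where "d = \<phi> \<circ> c"
  have d: "simple_path d" "pathfinish d = pathstart d" "path_image d = \<phi> ` ?C"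
  proof -
    have "inj_on \<phi> ?C" using h(5) CN by (metis inj_on_inverseI subsetD)
    then show "simple_path d" unfolding d_def
      using c(1) h(1) CN by (intro simple_path_continuous_image) (auto intro: continuous_on_subset)
    show "pathfinish d = pathstart d" using c(2) by (simp add: d_def pathfinish_def pathstart_def)
    show "path_image d = \<phi> ` ?C" by (simp add: d_def path_image_def image_comp)
  qed
  have \<psi>d: "\<psi> ` path_image d = ?C" using d(3) h(5) CN by (force simp: image_iff)
  let ?in = "inside (path_image d)" and ?out = "outside (path_image d)"
  note j = Jordan_inside_outside[OF d(1,2)]
  define I where "I = \<psi> ` ?in"
  define J where "J = insert N (\<psi> ` ?out)"
  have inj: "inj \<psi>" using h(6) by (metis injI)
  have open_im: "openin (top_of_set S2) (\<psi> ` X)" if "open X" for X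
  proof -
    have "openin (top_of_set (S2 - {N})) (\<psi> ` X)"
      using homeomorphism_imp_open_map[OF homeomorphism_symD[OF hom], of X] that by simp
    moreover have "openin (top_of_set S2) (S2 - {N})" by (simp add: openin_delete)
    ultimately show ?thesis using openin_trans by blast
  qed
  have un: "I \<union> J = S2 - ?C"
  proof -
    have "\<psi> ` (?in \<union> ?out) = \<psi> ` UNIV - \<psi> ` path_image d"
      using j inj by (metis Compl_eq_Diff_UNIV image_set_diff)
    then have "I \<union> \<psi> ` ?out = S2 - {N} - ?C" using h(3) \<psi>d by (simp only: I_def image_Un[symmetric])
    then show ?thesis using N CN by (auto simp: J_def)
  qed
  have dis: "I \<inter> J = {}"
  proof -
    have "\<psi> ` ?in \<inter> \<psi> ` ?out = {}" using j inj by (metis image_Int image_empty)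
    moreover have "N \<notin> \<psi> ` ?in" using h(3) by blast
    ultimately show ?thesis by (auto simp: I_def J_def)
  qed
  have oI: "openin (top_of_set S2) I" unfolding I_def using j by (intro open_im) blast
  have cIn: "compact (?in \<union> path_image d)"
  proof -
    have "closure ?in = ?in \<union> path_image d" using j closure_Un_frontier by blast
    moreover have "compact (closure ?in)" using j by (simp add: compact_closure)
    ultimately show ?thesis by simp
  qed
  have cIC: "compact (I \<union> ?C)"
  proof -
    have "I \<union> ?C = \<psi> ` (?in \<union> path_image d)" using \<psi>d by (simp add: I_def image_Un)
    then show ?thesis using cIn h(2) by (metis compact_continuous_image continuous_on_subset top_greatest)
  qed
  have J_eq: "J = S2 - (I \<union> ?C)" using un dis by blast
  have oJ: "openin (top_of_set S2) J"
    unfolding J_eq using compact_imp_closed[OF cIC] by (metis Diff_eq openin_open open_Compl)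
  have coI: "connected I" unfolding I_def using j h(2) by (intro connected_continuous_image) (auto intro: continuous_on_subset)
  have coJ: "connected J"
  proof -
    have "connected (\<psi> ` ?out)" using j h(2) by (intro connected_continuous_image) (auto intro: continuous_on_subset)
    \<comment> \<open>Otherwise {N} would be open and closed in the connected, infinite
      sphere.\<close>
    moreover have "N \<in> closure (\<psi> ` ?out)"
    proof (rule ccontr)
      assume "N \<notin> closure (\<psi> ` ?out)"
      then have "{N} = S2 - (closure (\<psi> ` ?out) \<union> (I \<union> ?C))"
        using J_eq closure_subset[of "\<psi> ` ?out"] N by (auto simp: J_def)
      moreover have "closed (closure (\<psi> ` ?out) \<union> (I \<union> ?C))" using cIC compact_imp_closed by blast
      ultimately have "openin (top_of_set S2) {N}"
        by (metis Diff_eq openin_open open_Compl)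
      moreover have "closedin (top_of_set S2) {N}" using N by (simp add: closed_subset)
      ultimately have "{N} = S2" using connected_S2 unfolding connected_clopen by blast
      then show False using infinite_S2 by (metis finite.emptyI finite_insert)
    qed
    ultimately show ?thesis
      unfolding J_def using connected_intermediate_closure[of "\<psi> ` ?out" "insert N (\<psi> ` ?out)"] closure_subset[of "\<psi> ` ?out"] by auto
  qed
  have cl: "?C \<subseteq> closure (\<psi> ` X)" if "frontier X = path_image d" for X
  proof -
    have "\<psi> ` closure X \<subseteq> closure (\<psi> ` X)"
      using h(2) by (intro continuous_image_closure_subset[of UNIV]) auto
    moreover have "path_image d \<subseteq> closure X" using that by (auto simp: frontier_def)
    ultimately show ?thesis using \<psi>d by blast
  qed
  have "?C \<subseteq> closure I" unfolding I_def using j by (intro cl) blast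
  moreover have "?C \<subseteq> closure J" using cl[of ?out] j closure_mono[of "\<psi> ` ?out" J] unfolding J_def by blast
  ultimately show thesis using that[OF un dis oI oJ coI coJ] by blast
qed

text \<open>That a point does not separate its small neighbourhoods is what will force the cells at
  a vertex into a single cycle.\<close>

lemma punctured_nbhd_S2:
  assumes x: "x \<in> S2" and B: "open B" "x \<in> B"
  obtains W where "openin (top_of_set S2) W" "x \<in> W" "W \<subseteq> B" "connected (W - {x})"
proof -
  obtain N where N: "N \<in> S2" "N \<noteq> x" using infinite_S2 by (metis finite.emptyI finite_insert insertI1 subsetI subset_singletonD subset_insertI2 ex_in_conv insert_iff rev_finite_subset)
  obtain \<phi> \<psi> where hom: "homeomorphism (S2 - {N}) (UNIV :: complex set) \<phi> \<psi>" using punctured_S2[OF N(1)] by blast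
  have h: "continuous_on (S2 - {N}) \<phi>" "continuous_on UNIV \<psi>" "\<psi> ` UNIV = S2 - {N}" "\<phi> ` (S2 - {N}) = UNIV"
    "\<And>x. x \<in> S2 - {N} \<Longrightarrow> \<psi> (\<phi> x) = x" "\<And>y. \<phi> (\<psi> y) = y"
    using hom by (auto simp: homeomorphism_def)
  have "open (\<psi> -` B)" using h(2) B(1) open_vimage by blast
  moreover have "\<phi> x \<in> \<psi> -` B" using h(5)[of x] x N B by simp
  ultimately obtain e where e: "e > 0" "ball (\<phi> x) e \<subseteq> \<psi> -` B" using open_contains_ball by blast
  let ?W = "\<psi> ` ball (\<phi> x) e"
  have inj: "inj \<psi>" using h(6) by (metis injI)
  have "openin (top_of_set (S2 - {N})) ?W"
    using homeomorphism_imp_open_map[OF homeomorphism_symD[OF hom], of "ball (\<phi> x) e"] by simp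
  moreover have "openin (top_of_set S2) (S2 - {N})" by (simp add: openin_delete)
  ultimately have "openin (top_of_set S2) ?W" using openin_trans by blast
  moreover have "x \<in> ?W" using h(5)[of x] x N e by (metis centre_in_ball Diff_iff image_eqI singletonD)
  moreover have "?W \<subseteq> B" using e by blast
  moreover have "connected (?W - {x})"
  proof -
    have "?W - {x} = \<psi> ` (ball (\<phi> x) e - {\<phi> x})" using h(5)[of x] x N inj by (auto simp: image_set_diff inj_eq)
    moreover have "connected (ball (\<phi> x) e - {\<phi> x})" by (intro connected_punctured_ball) simp
    ultimately show ?thesis using h(2) by (metis connected_continuous_image continuous_on_subset top_greatest)
  qed
  ultimately show thesis using that by blast
qed

text \<open>\<open>big\<close> rules out the triangulation with only three vertices. There the two
  cells have the same corners, so a cell would not be determined by its corners.\<close>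

locale drawing =
  fixes V :: "'v set" and E :: "'v set set" and F :: "('v \<times> 'v \<times> 'v) set"
    and p :: "'v \<Rightarrow> real^3" and A :: "'v set \<Rightarrow> (real^3) set"
  assumes finV: "finite V" and drawn: "drawn_on_sphere V E p A"
    and triangular: "\<And>f. f \<in> two_cells V E p A \<Longrightarrow> \<exists>u v w. triangular_cell E A f u v w"
    and F_iff: "\<And>u v w. (\<exists>f\<in>two_cells V E p A. triangular_cell E A f u v w) \<longleftrightarrow> (u, v, w) \<in> F \<or> (u, w, v) \<in> F"
    and F_rot: "\<And>u v w. (u, v, w) \<in> F \<Longrightarrow> (v, w, u) \<in> F"
    and F_ex1: "\<And>u v. {u, v} \<in> E \<Longrightarrow> \<exists>!w. (u, v, w) \<in> F"
    and big: "\<And>x y z. \<not> V \<subseteq> {x, y, z}" and E_ne: "E \<noteq> {}"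
begin

abbreviation cells :: "(real^3) set set" where "cells \<equiv> two_cells V E p A"

definition D :: "(real^3) set" where "D = p ` V \<union> (\<Union>e\<in>E. A e)"

definition corners :: "(real^3) set \<Rightarrow> 'v \<Rightarrow> 'v \<Rightarrow> 'v \<Rightarrow> bool" where
  "corners = triangular_cell E A"

section \<open>Cells, edges and their closures\<close>

lemma drawn_parts:
  shows p_inj_on: "inj_on p V" and p_sphere: "p ` V \<subseteq> S2"
    and drawn_edge: "\<And>e. e \<in> E \<Longrightarrow> (\<exists>u\<in>V. \<exists>v\<in>V. u \<noteq> v \<and> e = {u, v} \<and>
        (\<exists>g. arc g \<and> pathstart g = p u \<and> pathfinish g = p v \<and> path_image g = A e)) \<and>
        A e \<subseteq> S2 \<and> A e \<inter> p ` V = p ` e"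
    and edges_meet: "\<And>e e'. e \<in> E \<Longrightarrow> e' \<in> E \<Longrightarrow> e \<noteq> e' \<Longrightarrow> A e \<inter> A e' = p ` (e \<inter> e')"
proof -
  note d = drawn[unfolded drawn_on_sphere_def]
  show "inj_on p V" "p ` V \<subseteq> S2" using d by simp_all
  show "A e \<inter> A e' = p ` (e \<inter> e')" if "e \<in> E" "e' \<in> E" "e \<noteq> e'" for e e'
    by (rule d[THEN conjunct2, THEN conjunct2, THEN conjunct2, rule_format, OF that])
  show "(\<exists>u\<in>V. \<exists>v\<in>V. u \<noteq> v \<and> e = {u, v} \<and>
        (\<exists>g. arc g \<and> pathstart g = p u \<and> pathfinish g = p v \<and> path_image g = A e)) \<and>
        A e \<subseteq> S2 \<and> A e \<inter> p ` V = p ` e" if "e \<in> E" for e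
    using d[THEN conjunct2, THEN conjunct2, THEN conjunct1, rule_format, OF that]
    by (elim bexE conjE exE) (intro conjI bexI exI; assumption)
qed

lemma p_inj: "u \<in> V \<Longrightarrow> v \<in> V \<Longrightarrow> p u = p v \<longleftrightarrow> u = v"
  using p_inj_on by (rule inj_on_eq_iff)

lemma p_S2: "v \<in> V \<Longrightarrow> p v \<in> S2"
  using p_sphere by blast

lemma edge:
  assumes "e \<in> E"
  obtains u v g where "u \<in> V" "v \<in> V" "u \<noteq> v" "e = {u, v}" "arc g" "pathstart g = p u" "pathfinish g = p v" "path_image g = A e"
  using drawn_edge[OF assms, THEN conjunct1] by blast

lemmas edge_facts = drawn_edge[THEN conjunct2, THEN conjunct1] drawn_edge[THEN conjunct2, THEN conjunct2]

lemma E_pair: "{u, v} \<in> E \<Longrightarrow> u \<in> V \<and> v \<in> V \<and> u \<noteq> v"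
  by (erule edge) (auto simp: doubleton_eq_iff)

lemma E_V: "e \<in> E \<Longrightarrow> e \<subseteq> V"
  by (erule edge) auto

lemma fin_E: "finite E"
  using E_V finV by (meson finite_Pow_iff finite_subset PowI subsetI)

lemma compact_A: "e \<in> E \<Longrightarrow> compact (A e)"
  by (erule edge) (metis compact_path_image arc_imp_path)

lemma arc_between:
  assumes "{u, v} \<in> E"
  obtains g where "arc g" "pathstart g = p u" "pathfinish g = p v" "path_image g = A {u, v}"
proof -
  obtain x y g where g: "{u, v} = {x, y}" "arc g" "pathstart g = p x" "pathfinish g = p y" "path_image g = A {u, v}"
    using edge[OF assms] by metis
  show thesis
  proof (cases "u = x")
    case True
    then have "v = y" using g(1) E_pair[OF assms] by (auto simp: doubleton_eq_iff)
    then show ?thesis using that[of g] g True by simp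
  next
    case False
    then have "u = y" "v = x" using g(1) by (auto simp: doubleton_eq_iff)
    then show ?thesis using that[of "reversepath g"] g by (simp add: arc_reversepath)
  qed
qed

lemma edge_inner_point:
  assumes e: "e \<in> E"
  shows "\<exists>x\<in>A e. x \<notin> p ` V"
proof -
  obtain u v g where g: "u \<in> V" "v \<in> V" "e = {u, v}" "arc g" "pathstart g = p u" "pathfinish g = p v" "path_image g = A e"
    using edge[OF e] by metis
  have inj: "inj_on g {0..1}" using g(4) by (simp add: arc_def)
  have "g (1/2) \<noteq> g 0" "g (1/2) \<noteq> g 1"
    using inj_onD[OF inj, of "1/2" 0] inj_onD[OF inj, of "1/2" 1] by auto
  then have "g (1/2) \<notin> p ` e" using g(3,5,6) by (auto simp: pathstart_def pathfinish_def)
  moreover have "g (1/2) \<in> A e" unfolding g(7)[symmetric] by (auto simp: path_image_def)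
  ultimately show ?thesis using edge_facts(2)[OF e] by blast
qed

lemma closed_D: "closed D" and D_S2: "D \<subseteq> S2"
proof -
  have "compact D" unfolding D_def using fin_E finV compact_A by (intro compact_Un compact_UN) (auto intro: finite_imp_compact)
  then show "closed D" by (rule compact_imp_closed)
  show "D \<subseteq> S2" unfolding D_def using p_S2 edge_facts by blast
qed

lemma cell_facts:
  assumes "f \<in> cells"
  shows "connected f" "f \<noteq> {}" "f \<subseteq> S2" "f \<inter> D = {}" "openin (top_of_set S2) f"
proof -
  have f: "f \<in> components (S2 - D)" using assms unfolding two_cells_def D_def .
  show "connected f" "f \<noteq> {}" using f in_components_connected in_components_nonempty by blast+
  have sub: "f \<subseteq> S2 - D" using f in_components_subset by blast
  then show "f \<subseteq> S2" "f \<inter> D = {}" by auto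
  have op: "openin (top_of_set S2) (S2 - D)" using closed_D by (metis Diff_eq openin_open open_Compl)
  moreover have "openin (top_of_set (S2 - D)) f"
    using f locally_open_subset[OF locally_connected_sphere op] by (intro openin_components_locally_connected) auto
  ultimately show "openin (top_of_set S2) f" using openin_trans by blast
qed

lemma cell_corners: "corners f u v w \<Longrightarrow> distinct [u, v, w] \<and> {u, v} \<in> E \<and> {v, w} \<in> E \<and> {w, u} \<in> E"
  unfolding corners_def triangular_cell_def by blast

lemma corners_rot: "corners f u v w \<Longrightarrow> corners f v w u" and corners_swap: "corners f u v w \<Longrightarrow> corners f u w v"
proof -
  assume "corners f u v w"
  then have c: "u \<noteq> v" "u \<noteq> w" "v \<noteq> w" "{u, v} \<in> E" "{v, w} \<in> E" "{w, u} \<in> E"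
    "top_of_set S2 frontier_of f = A {u, v} \<union> A {v, w} \<union> A {w, u}"
    unfolding corners_def triangular_cell_def by auto
  show "corners f v w u"
    unfolding corners_def triangular_cell_def c(7) using c(1-6) by auto
  show "corners f u w v"
    unfolding corners_def triangular_cell_def c(7) insert_commute[of u w] insert_commute[of w v] insert_commute[of v u]
    using c(1-6) by auto
qed

lemma closure_cell:
  assumes f: "f \<in> cells" "corners f u v w"
  shows "closure f = f \<union> (A {u, v} \<union> A {v, w} \<union> A {w, u})"
proof -
  have "top_of_set S2 closure_of f = closure f"
  proof -
    have "closure f \<subseteq> S2" using cell_facts(3)[OF f(1)] by (intro closure_minimal) auto
    moreover have "S2 \<inter> f = f" using cell_facts(3)[OF f(1)] by blast
    ultimately show ?thesis by (auto simp: closure_of_subtopology)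
  qed
  moreover have "top_of_set S2 interior_of f = f" using cell_facts(5)[OF f(1)] by (rule interior_of_openin)
  moreover have "top_of_set S2 frontier_of f = A {u, v} \<union> A {v, w} \<union> A {w, u}"
    using f(2) unfolding corners_def triangular_cell_def by blast
  ultimately have "closure f - f = A {u, v} \<union> A {v, w} \<union> A {w, u}" unfolding frontier_of_def by simp
  then show ?thesis using closure_subset[of f] by blast
qed

lemma cell_has_corners: "f \<in> cells \<Longrightarrow> \<exists>u v w. corners f u v w"
  using triangular unfolding corners_def by blast

lemma closure_cell_edge:
  assumes f: "f \<in> cells" "corners f u v w" and e: "e \<in> E" "x \<in> A e" "x \<notin> p ` V" "x \<in> closure f"
  shows "e \<in> {{u, v}, {v, w}, {w, u}}"
proof -
  have "x \<in> D" using e by (auto simp: D_def)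
  then have "x \<notin> f" using cell_facts(4)[OF f(1)] by blast
  then have "x \<in> A {u, v} \<union> A {v, w} \<union> A {w, u}" using e(4) closure_cell[OF f] by blast
  then obtain e' where e': "e' \<in> {{u, v}, {v, w}, {w, u}}" "x \<in> A e'" by blast
  have e'E: "e' \<in> E" using e'(1) cell_corners[OF f(2)] by auto
  have "e = e'"
  proof (rule ccontr)
    assume "e \<noteq> e'"
    then have "x \<in> p ` (e \<inter> e')" using edges_meet[OF e(1) e'E] e(2) e'(2) by blast
    then show False using e(3) E_V[OF e(1)] by blast
  qed
  then show ?thesis using e' by simp
qed

lemma closure_cell_vertex:
  assumes f: "f \<in> cells" "corners f u v w" and z: "z \<in> V" "p z \<in> closure f"
  shows "z \<in> {u, v, w}"
proof -
  have "p z \<in> D" using z by (auto simp: D_def)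
  then have "p z \<notin> f" using cell_facts(4)[OF f(1)] by blast
  then have "p z \<in> A {u, v} \<union> A {v, w} \<union> A {w, u}" using z(2) closure_cell[OF f] by blast
  then obtain e' where e': "e' \<in> {{u, v}, {v, w}, {w, u}}" "p z \<in> A e'" by blast
  have e'E: "e' \<in> E" using e'(1) cell_corners[OF f(2)] by auto
  then have "p z \<in> p ` e'" using edge_facts(2)[OF e'E] e'(2) z by blast
  then have "z \<in> e'" using p_inj E_V[OF e'E] z by blast
  then show ?thesis using e'(1) by auto
qed

lemma corner_in_closure:
  assumes f: "f \<in> cells" "corners f u v w"
  shows "p u \<in> closure f"
proof -
  have "{u, v} \<in> E" using cell_corners[OF f(2)] by simp
  then have "p u \<in> A {u, v}" using edge_facts(2)[of "{u, v}"] by blast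
  then show ?thesis using closure_cell[OF f] by blast
qed

lemma F_cell: "(u, v, w) \<in> F \<Longrightarrow> \<exists>f\<in>cells. corners f u v w"
  using F_iff unfolding corners_def by blast

lemma cell_F: "f \<in> cells \<Longrightarrow> corners f u v w \<Longrightarrow> (u, v, w) \<in> F \<or> (u, w, v) \<in> F"
  using F_iff unfolding corners_def by blast

lemma F_E: "(u, v, w) \<in> F \<Longrightarrow> {u, v} \<in> E"
  using F_cell cell_corners by blast

lemma path_arc:
  assumes "distinct zs" "length zs \<ge> 2" "successively (\<lambda>u v. {u, v} \<in> E) zs"
  shows "\<exists>g. arc g \<and> pathstart g = p (hd zs) \<and> pathfinish g = p (last zs) \<and> path_image g = (\<Union>e\<in>path_edges zs. A e)"
  using assms
proof (induction zs rule: path_edges.induct)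
  case (1 x y zs)
  have xy: "{x, y} \<in> E" using 1 by simp
  obtain g1 where g1: "arc g1" "pathstart g1 = p x" "pathfinish g1 = p y" "path_image g1 = A {x, y}"
    using arc_between[OF xy] by metis
  show ?case
  proof (cases zs)
    case Nil
    then show ?thesis using g1 by auto
  next
    case (Cons z zs')
    obtain g2 where g2: "arc g2" "pathstart g2 = p y" "pathfinish g2 = p (last (y # zs))"
      "path_image g2 = (\<Union>e\<in>path_edges (y # zs). A e)"
      using 1 Cons by auto
    have eE: "path_edges ws \<subseteq> E" if "successively (\<lambda>u v. {u, v} \<in> E) ws" for ws
      using that by (induction ws rule: path_edges.induct) auto
    have "path_image g1 \<inter> path_image g2 \<subseteq> {pathstart g2}"
    proof
      fix t assume "t \<in> path_image g1 \<inter> path_image g2"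
      then obtain e where e: "e \<in> path_edges (y # zs)" "t \<in> A e" "t \<in> A {x, y}" using g1 g2 by auto
      have "x \<notin> e" using path_edges_subset[OF e(1)] 1(2) by auto
      then have "t \<in> p ` ({x, y} \<inter> e)" using edges_meet[OF xy, of e] e eE[of "y # zs"] 1(4) by auto
      then show "t \<in> {pathstart g2}" using \<open>x \<notin> e\<close> g2 by auto
    qed
    then have "arc (g1 +++ g2)" using g1 g2 by (intro arc_join) auto
    moreover have "path_image (g1 +++ g2) = (\<Union>e\<in>path_edges (x # y # zs). A e)"
      using g1 g2 by (simp add: path_image_join)
    ultimately show ?thesis using g1 g2 by (intro exI[of _ "g1 +++ g2"]) auto
  qed
qed auto

lemma path_edges_E: "successively (\<lambda>u v. {u, v} \<in> E) ws \<Longrightarrow> path_edges ws \<subseteq> E"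
  by (induction ws rule: path_edges.induct) auto

lemma cycle_curve:
  assumes zs: "distinct zs" "length zs \<ge> 3" "successively (\<lambda>u v. {u, v} \<in> E) (zs @ [hd zs])"
  obtains c where "simple_path c" "pathfinish c = pathstart c" "path_image c = (\<Union>e\<in>cycle_edges zs. A e)"
    "cycle_edges zs \<subseteq> E"
proof -
  have zne: "zs \<noteq> []" using zs by auto
  have s: "successively (\<lambda>u v. {u, v} \<in> E) zs" "{last zs, hd zs} \<in> E"
    using zs(3) zne by (auto simp: successively_append_iff)
  obtain g where g: "arc g" "pathstart g = p (hd zs)" "pathfinish g = p (last zs)" "path_image g = (\<Union>e\<in>path_edges zs. A e)"
    using path_arc[OF zs(1) _ s(1)] zs(2) by auto
  obtain k where k: "arc k" "pathstart k = p (last zs)" "pathfinish k = p (hd zs)" "path_image k = A {last zs, hd zs}"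
    using arc_between[OF s(2)] by metis
  have ce: "cycle_edges zs = insert {last zs, hd zs} (path_edges zs)"
    unfolding cycle_edges_def by (rule path_edges_snoc[OF zne])
  have notin: "{last zs, hd zs} \<notin> path_edges zs"
  proof -
    obtain x y ws where z: "zs = x # y # ws" "ws \<noteq> []" using zs(2) by (cases zs; cases "tl zs"; cases "tl (tl zs)") auto
    have "x \<notin> e" if "e \<in> path_edges (y # ws)" for e using path_edges_subset[OF that] zs(1) z by auto
    moreover have "last zs \<noteq> y" "last zs \<noteq> x" using zs(1) z by auto
    ultimately show ?thesis using z by (auto simp: doubleton_eq_iff)
  qed
  have "path_image g \<inter> path_image k \<subseteq> {pathstart g, pathstart k}"
  proof
    fix t assume "t \<in> path_image g \<inter> path_image k"
    then obtain e where e: "e \<in> path_edges zs" "t \<in> A e" "t \<in> A {last zs, hd zs}" using g k by auto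
    have "e \<in> E" using e path_edges_E[OF s(1)] by blast
    then have "t \<in> p ` (e \<inter> {last zs, hd zs})" using edges_meet[of e "{last zs, hd zs}"] s(2) e notin by auto
    then show "t \<in> {pathstart g, pathstart k}" using g k by auto
  qed
  then have "simple_path (g +++ k)" using g k by (intro simple_path_join_loop) auto
  moreover have "path_image (g +++ k) = (\<Union>e\<in>cycle_edges zs. A e)" using g k ce by (auto simp: path_image_join)
  moreover have "cycle_edges zs \<subseteq> E" using ce s path_edges_E by auto
  ultimately show thesis using that[of "g +++ k"] g k by auto
qed

text \<open>J splits into its part in f and its part off the closure of f, and both are relatively
  open.\<close>

lemma clopen_component:
  assumes J: "connected J" "f \<inter> J \<noteq> {}" "openin (top_of_set S2) f" "J \<inter> (closure f - f) = {}" "J \<subseteq> S2"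
  shows "J \<subseteq> f"
proof (rule ccontr)
  assume "\<not> J \<subseteq> f"
  moreover obtain U where U: "open U" "f = S2 \<inter> U" using J(3) openin_open by blast
  ultimately have "J \<inter> - closure f \<noteq> {}" using J(4) by blast
  moreover have "J \<subseteq> U \<union> - closure f" using J(4,5) U by blast
  moreover have "U \<inter> - closure f \<inter> J = {}" using U J(5) closure_subset[of f] by blast
  moreover have "U \<inter> J \<noteq> {}" using J(2) U by blast
  ultimately show False using connectedD[OF J(1) U(1), of "- closure f"] by blast
qed

text \<open>Two cells bounded by the same triangle would fill the two sides of this Jordan curve and
  leave no room for a fourth vertex.\<close>

lemma cell_unique:
  assumes f: "f \<in> cells" "corners f u v w" and f': "f' \<in> cells" "corners f' u v w"
  shows "f = f'"
proof (rule ccontr)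
  assume ne: "f \<noteq> f'"
  have cc: "distinct [u, v, w]" "{u, v} \<in> E" "{v, w} \<in> E" "{w, u} \<in> E" using cell_corners[OF f(2)] by auto
  obtain c where c: "simple_path c" "pathfinish c = pathstart c" "path_image c = (\<Union>e\<in>cycle_edges [u, v, w]. A e)"
  proof -
    have "successively (\<lambda>u v. {u, v} \<in> E) ([u, v, w] @ [hd [u, v, w]])" using cc by simp
    with cc(1) obtain c where "simple_path c" "pathfinish c = pathstart c" "path_image c = (\<Union>e\<in>cycle_edges [u, v, w]. A e)"
      using cycle_curve[of "[u, v, w]"] by (metis length_Cons list.size(3) numeral_3_eq_3 order_refl)
    then show ?thesis by (rule that)
  qed
  let ?K = "A {u, v} \<union> A {v, w} \<union> A {w, u}"
  have cK: "path_image c = ?K" using c(3) by (auto simp: cycle_edges_def)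
  have KS: "?K \<subseteq> S2" using cc edge_facts by blast
  have dis: "f \<inter> f' = {}" using f f' ne components_nonoverlap unfolding two_cells_def by blast
  have fK: "f \<inter> ?K = {}" "f' \<inter> ?K = {}" using cell_facts(4) f f' cc unfolding D_def by blast+
  have "?K \<noteq> S2" using fK(1) cell_facts(2,3)[OF f(1)] by blast
  then obtain I J where IJ: "I \<union> J = S2 - ?K" "I \<inter> J = {}" "openin (top_of_set S2) I" "openin (top_of_set S2) J"
    "connected I" "connected J"
    using Jordan_S2[OF c(1,2)] cK KS by metis
  have sub: "X \<subseteq> g" if "X = I \<or> X = J" "g \<in> cells" "corners g u v w" "g \<inter> X \<noteq> {}" for X g
  proof (rule clopen_component)
    show "connected X" using that IJ by blast
    show "X \<subseteq> S2" using that IJ by blast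
    have "closure g - g \<subseteq> ?K" using closure_cell[OF that(2,3)] by blast
    then show "X \<inter> (closure g - g) = {}" using that IJ by blast
  qed (use that cell_facts(5) in auto)
  have split: "g \<inter> I \<noteq> {} \<or> g \<inter> J \<noteq> {}" if "g \<in> cells" "g \<inter> ?K = {}" for g
    using IJ(1) cell_facts(2,3)[OF that(1)] that(2) by blast
  have disJ: "\<not> (g \<inter> X \<noteq> {} \<and> g' \<inter> X \<noteq> {})" if "{g, g'} = {f, f'}" "X = I \<or> X = J" for g g' X
  proof
    assume h: "g \<inter> X \<noteq> {} \<and> g' \<inter> X \<noteq> {}"
    have g: "g \<in> cells" "corners g u v w" "g' \<in> cells" "corners g' u v w" "g \<inter> g' = {}"
      using that(1) f f' dis by (auto simp: doubleton_eq_iff)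
    then have "X \<subseteq> g" "X \<subseteq> g'" using sub that(2) h by auto
    then show False using g(5) h by blast
  qed
  have "I \<union> J \<subseteq> f \<union> f'"
  proof -
    note s = sub[OF _ f] sub[OF _ f'] and sp = split[OF f(1) fK(1)] split[OF f'(1) fK(2)]
    have d: "\<not> (f \<inter> I \<noteq> {} \<and> f' \<inter> I \<noteq> {})" "\<not> (f \<inter> J \<noteq> {} \<and> f' \<inter> J \<noteq> {})"
      using disJ[of f f'] by blast+
    have "I \<subseteq> f \<or> I \<subseteq> f'" using s(1)[of I] s(2)[of I] sp d(2) by auto
    moreover have "J \<subseteq> f \<or> J \<subseteq> f'" using s(1)[of J] s(2)[of J] sp d(1) by auto
    ultimately show ?thesis by blast
  qed
  then have all: "S2 \<subseteq> f \<union> f' \<union> ?K" using IJ(1) by blast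
  have "V \<subseteq> {u, v, w}"
  proof
    fix z assume z: "z \<in> V"
    then have "p z \<in> D" "p z \<in> S2" using p_S2 by (auto simp: D_def)
    then have "p z \<in> ?K" using all cell_facts(4) f f' by blast
    then have "p z \<in> closure f" using closure_cell[OF f] by blast
    then show "z \<in> {u, v, w}" using closure_cell_vertex[OF f z] by blast
  qed
  then show False using big by blast
qed

lemma finite_cells: "finite cells"
proof -
  define t where "t f = (SOME t. corners f (fst t) (fst (snd t)) (snd (snd t)))" for f
  have t: "corners f (fst (t f)) (fst (snd (t f))) (snd (snd (t f)))" if fc: "f \<in> cells" for f
  proof -
    obtain u v w where "corners f u v w" using cell_has_corners[OF fc] by blast
    then have "\<exists>t. corners f (fst t) (fst (snd t)) (snd (snd t))" by (intro exI[of _ "(u, v, w)"]) simp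
    then show ?thesis unfolding t_def by (rule someI_ex)
  qed
  have "inj_on t cells"
  proof (rule inj_onI)
    fix f f' assume ff: "f \<in> cells" "f' \<in> cells" "t f = t f'"
    have "corners f' (fst (t f)) (fst (snd (t f))) (snd (snd (t f)))" using t[OF ff(2)] ff(3) by simp
    then show "f = f'" using cell_unique[OF ff(1) t[OF ff(1)] ff(2)] by simp
  qed
  moreover have "t ` cells \<subseteq> V \<times> V \<times> V"
  proof
    fix x assume "x \<in> t ` cells"
    then obtain f where f: "f \<in> cells" "x = t f" by blast
    have "{fst x, fst (snd x)} \<in> E" "{fst (snd x), snd (snd x)} \<in> E"
      using cell_corners[OF t[OF f(1)]] f(2) by simp_all
    then have "fst x \<in> V" "fst (snd x) \<in> V" "snd (snd x) \<in> V" using E_pair by blast+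
    then show "x \<in> V \<times> V \<times> V" by (simp add: mem_Times_iff)
  qed
  ultimately show ?thesis by (rule inj_on_finite) (simp add: finV)
qed

text \<open>The closures cover all cells and all edges, so at most finitely many points could be
  missed. These would form a closed set complementary to a nonempty closed one, which the
  connectedness of the sphere excludes.\<close>

lemma cells_dense: "x \<in> S2 \<Longrightarrow> \<exists>f\<in>cells. x \<in> closure f"
proof -
  assume x: "x \<in> S2"
  let ?C = "\<Union>f\<in>cells. closure f"
  have CS: "?C \<subseteq> S2"
  proof -
    have "closure f \<subseteq> S2" if "f \<in> cells" for f using cell_facts(3)[OF that] by (intro closure_minimal) auto
    then show ?thesis by blast
  qed
  have clC: "closed ?C" using finite_cells by (intro closed_UN) auto
  have A: "A e \<subseteq> ?C" if eE: "e \<in> E" for e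
  proof -
    obtain u v where e: "e = {u, v}" using edge[OF eE] by metis
    then obtain w where "(u, v, w) \<in> F" using F_ex1 eE by blast
    then obtain f where f: "f \<in> cells" "corners f u v w" using F_cell by blast
    then show ?thesis using closure_cell[OF f] e by blast
  qed
  have rest: "S2 - ?C \<subseteq> p ` V"
  proof
    fix y assume y: "y \<in> S2 - ?C"
    have "y \<in> D"
    proof (rule ccontr)
      assume "y \<notin> D"
      then have "y \<in> \<Union> (components (S2 - D))" using y Union_components[of "S2 - D"] by blast
      then obtain f where "f \<in> cells" "y \<in> f" unfolding two_cells_def D_def by blast
      then show False using y closure_subset[of f] by blast
    qed
    then show "y \<in> p ` V" using A y by (auto simp: D_def)
  qed
  have "finite (S2 - ?C)" using rest finV by (meson finite_imageI finite_subset)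
  then have "closed (S2 - ?C)" by (rule finite_imp_closed)
  moreover have "?C \<noteq> {}"
  proof -
    obtain e where e: "e \<in> E" using E_ne by blast
    obtain x where "x \<in> A e" using edge_inner_point[OF e] by blast
    then have "x \<in> ?C" using A[OF e] by (rule rev_subsetD)
    then show ?thesis by (metis empty_iff)
  qed
  moreover have "?C \<inter> (S2 - ?C) \<inter> S2 = {}" "S2 \<subseteq> ?C \<union> (S2 - ?C)" by blast+
  ultimately have "S2 - ?C = {}"
    using connected_closedD[OF connected_S2, of ?C "S2 - ?C"] clC CS by (metis Diff_subset inf.absorb1)
  then show ?thesis using x by blast
qed

lemma closures_meet:
  assumes f: "f \<in> cells" "corners f u v w" and f': "f' \<in> cells" "corners f' u' v' w'" and ne: "f \<noteq> f'"
    and x: "x \<in> closure f" "x \<in> closure f'"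
  shows "\<exists>e\<in>{{u, v}, {v, w}, {w, u}}. \<exists>e'\<in>{{u', v'}, {v', w'}, {w', u'}}. x \<in> A e \<and> x \<in> A e'"
proof -
  have dis: "f \<inter> f' = {}" using f f' ne components_nonoverlap unfolding two_cells_def by blast
  have on: "A e \<subseteq> D" if "e \<in> E" for e using that by (auto simp: D_def)
  have bd: "A {u, v} \<union> A {v, w} \<union> A {w, u} \<subseteq> D" "A {u', v'} \<union> A {v', w'} \<union> A {w', u'} \<subseteq> D"
    using cell_corners[OF f(2)] cell_corners[OF f'(2)] on by auto
  have "x \<in> f \<or> x \<in> A {u, v} \<union> A {v, w} \<union> A {w, u}" "x \<in> f' \<or> x \<in> A {u', v'} \<union> A {v', w'} \<union> A {w', u'}"
    using x closure_cell[OF f] closure_cell[OF f'] by simp_all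
  moreover have "\<not> (x \<in> f \<and> x \<in> f')" "\<not> (x \<in> f \<and> x \<in> D)" "\<not> (x \<in> f' \<and> x \<in> D)"
    using dis cell_facts(4)[OF f(1)] cell_facts(4)[OF f'(1)] by auto
  ultimately have "x \<in> A {u, v} \<union> A {v, w} \<union> A {w, u}" "x \<in> A {u', v'} \<union> A {v', w'} \<union> A {w', u'}"
    using bd by (meson subsetD)+
  then show ?thesis by auto
qed

text \<open>If the rotation at v had several cycles, the closed cells with corner v would split into
  two families meeting only in p v. Near p v these cells cover the sphere, so a small punctured
  neighbourhood would be disconnected.\<close>

lemma link_connected:
  assumes v: "v \<in> V" and U: "U \<noteq> {}" "U \<subseteq> {u. {v, u} \<in> E}" and closed_U: "\<And>u w. u \<in> U \<Longrightarrow> (v, u, w) \<in> F \<Longrightarrow> w \<in> U"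
  shows "U = {u. {v, u} \<in> E}"
proof (rule ccontr)
  assume "U \<noteq> {u. {v, u} \<in> E}"
  then obtain u1 where u1: "{v, u1} \<in> E" "u1 \<notin> U" using U by blast
  obtain u0 where u0: "u0 \<in> U" "{v, u0} \<in> E" using U by blast
  define nx where "nx u = (THE w. (v, u, w) \<in> F)" for u
  have nx: "(v, u, nx u) \<in> F" if "{v, u} \<in> E" for u
    unfolding nx_def using F_ex1[OF that] by (rule theI')
  have "U \<subseteq> V"
  proof
    fix u assume "u \<in> U"
    then have "{v, u} \<in> E" using U(2) by auto
    then show "u \<in> V" using E_pair by simp
  qed
  then have finU: "finite U" using finV by (rule finite_subset)
  have "inj_on nx U"
  proof (rule inj_onI)
    fix x y assume xy: "x \<in> U" "y \<in> U" "nx x = nx y"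
    have "(v, x, nx x) \<in> F" "(v, y, nx x) \<in> F" using nx[of x] nx[of y] xy U(2) by auto
    then have "(nx x, v, x) \<in> F" "(nx x, v, y) \<in> F" using F_rot by blast+
    then show "x = y" using F_ex1[OF F_E, of "nx x" v x] by blast
  qed
  moreover have "nx ` U \<subseteq> U" using nx closed_U U(2) by blast
  \<comment> \<open>An injective self-map of a finite set is onto, so U is closed under predecessors
    too. Hence the two further corners of a cell at v are both in U or both outside.\<close>
  ultimately have onto: "nx ` U = U" using endo_inj_surj[OF finU] by blast
  have prev_U: "u \<in> U" if F: "(v, u, w) \<in> F" and w: "w \<in> U" for u w
  proof -
    obtain u' where u': "u' \<in> U" "w = nx u'" using onto w by blast
    then have "(v, u', w) \<in> F" using nx U(2) by blast
    then have "(w, v, u') \<in> F" "(w, v, u) \<in> F" using F F_rot by blast+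
    then have "u = u'" using F_ex1[OF F_E, of w v u] by blast
    then show ?thesis using u' by simp
  qed
  have cell_split: "x \<in> U \<longleftrightarrow> y \<in> U" if "f \<in> cells" "corners f v x y" for f x y
    using cell_F[OF that] closed_U prev_U by blast
  define X1 where "X1 = (\<Union>f\<in>{f \<in> cells. \<exists>x y. corners f v x y \<and> x \<in> U}. closure f)"
  define X2 where "X2 = (\<Union>f\<in>{f \<in> cells. \<exists>x y. corners f v x y \<and> x \<notin> U}. closure f)"
  define X3 where "X3 = (\<Union>f\<in>{f \<in> cells. \<not> (\<exists>x y. corners f v x y)}. closure f)"
  have cover: "S2 \<subseteq> X1 \<union> X2 \<union> X3"
  proof
    fix x assume "x \<in> S2"
    then obtain f where f: "f \<in> cells" "x \<in> closure f" using cells_dense by blast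
    show "x \<in> X1 \<union> X2 \<union> X3"
    proof (cases "\<exists>y z. corners f v y z")
      case True
      then obtain y z where "corners f v y z" by blast
      then have "x \<in> X1 \<or> x \<in> X2" unfolding X1_def X2_def using f by (cases "y \<in> U") blast+
      then show ?thesis by blast
    next
      case False
      then have "x \<in> X3" unfolding X3_def using f by blast
      then show ?thesis by blast
    qed
  qed
  have cl: "closed X1" "closed X2" "closed X3"
    unfolding X1_def X2_def X3_def using finite_cells by (auto intro!: closed_UN)
  have pv: "p v \<notin> X3"
  proof
    assume "p v \<in> X3"
    then obtain f where f: "f \<in> cells" "\<not> (\<exists>x y. corners f v x y)" "p v \<in> closure f" unfolding X3_def by blast
    obtain x y z where c: "corners f x y z" using cell_has_corners[OF f(1)] by blast
    then have "v = x \<or> v = y \<or> v = z" using closure_cell_vertex[OF f(1) c v f(3)] by blast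
    then show False using f(2) c corners_rot by blast
  qed
  have meet: "X1 \<inter> X2 \<subseteq> {p v}"
  proof
    fix t assume "t \<in> X1 \<inter> X2"
    then obtain f x y f' x' y' where f: "f \<in> cells" "corners f v x y" "x \<in> U" "t \<in> closure f"
      and f': "f' \<in> cells" "corners f' v x' y'" "x' \<notin> U" "t \<in> closure f'"
      unfolding X1_def X2_def by blast
    have yU: "y \<in> U" "y' \<notin> U" using cell_split[OF f(1,2)] cell_split[OF f'(1,2)] f f' by auto
    have "f \<noteq> f'"
    proof
      assume eq: "f = f'"
      have "p x \<in> closure f" using corner_in_closure[OF f(1)] corners_rot[OF f(2)] by blast
      moreover have "x \<in> V" using E_pair cell_corners[OF f(2)] by auto
      ultimately have "x \<in> {v, x', y'}" using closure_cell_vertex[OF f'(1,2)] eq by blast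
      moreover have "x \<noteq> v" using cell_corners[OF f(2)] by auto
      ultimately show False using f(3) f'(3) yU by auto
    qed
    then obtain e e' where e: "e \<in> {{v, x}, {x, y}, {y, v}}" "e' \<in> {{v, x'}, {x', y'}, {y', v}}" "t \<in> A e" "t \<in> A e'"
      using closures_meet[OF f(1,2) f'(1,2) _ f(4) f'(4)] by blast
    have eE: "e \<in> E" "e' \<in> E" using e(1,2) cell_corners[OF f(2)] cell_corners[OF f'(2)] by auto
    have "\<forall>a\<in>e. a = v \<or> a \<in> U" using e(1) f(3) yU by auto
    moreover have "\<forall>a\<in>e'. a = v \<or> a \<notin> U" using e(2) f'(3) yU by auto
    ultimately have inter: "e \<inter> e' \<subseteq> {v}" by blast
    have vU: "v \<notin> U" using U(2) E_pair by auto
    have "\<exists>a\<in>e. a \<in> U" using e(1) f(3) yU by auto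
    moreover have "\<forall>a\<in>e'. a \<notin> U" using e(2) f'(3) yU vU by auto
    ultimately have "e \<noteq> e'" by blast
    then show "t \<in> {p v}" using edges_meet[OF eE] e(3,4) inter by blast
  qed
  obtain W where W: "openin (top_of_set S2) W" "p v \<in> W" "W \<subseteq> - X3" "connected (W - {p v})"
    using punctured_nbhd_S2[of "p v" "- X3"] p_S2[OF v] cl(3) pv by (metis ComplI open_Compl)
  have WS: "W \<subseteq> S2" using W(1) openin_imp_subset by blast
  \<comment> \<open>The edge from v to u bounds a cell with corner v, and this cell reaches into
    every neighbourhood of p v.\<close>
  have hit: "X \<inter> (W - {p v}) \<noteq> {}" if vu: "{v, u} \<in> E" "\<And>f y. f \<in> cells \<Longrightarrow> corners f v u y \<Longrightarrow> closure f \<subseteq> X" for X u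
  proof -
    obtain w where "(v, u, w) \<in> F" using F_ex1[OF vu(1)] by blast
    then obtain f where f: "f \<in> cells" "corners f v u w" using F_cell by blast
    have "p v \<in> closure f" by (rule corner_in_closure[OF f])
    moreover obtain O' where "open O'" "W = S2 \<inter> O'" using W(1) openin_open by blast
    ultimately have "O' \<inter> f \<noteq> {}" using W(2) by (auto simp: closure_iff_nhds_not_empty)
    then obtain y where y: "y \<in> f" "y \<in> W" using cell_facts(3)[OF f(1)] \<open>W = S2 \<inter> O'\<close> by blast
    have "y \<noteq> p v" using y(1) cell_facts(4)[OF f(1)] v by (auto simp: D_def)
    moreover have "y \<in> X" using y(1) vu(2)[OF f] closure_subset[of f] by blast
    ultimately show ?thesis using y(2) by blast
  qed
  have "X1 \<inter> (W - {p v}) \<noteq> {}" using u0 by (intro hit[of u0]) (auto simp: X1_def)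
  moreover have "X2 \<inter> (W - {p v}) \<noteq> {}" using u1 by (intro hit[of u1]) (auto simp: X2_def)
  moreover have "W - {p v} \<subseteq> X1 \<union> X2" using cover WS W(3) by blast
  moreover have "X1 \<inter> X2 \<inter> (W - {p v}) = {}" using meet by blast
  ultimately show False using connected_closedD[OF W(4), of X1 X2] cl by blast
qed

text \<open>Otherwise the closed cells would fall into two families, with corners in U and with
  corners outside, that have no common point; their unions would disconnect the sphere.\<close>

lemma graph_connected:
  assumes U: "U \<subseteq> V" "U \<noteq> {}" and closed_U: "\<And>u w. u \<in> U \<Longrightarrow> {u, w} \<in> E \<Longrightarrow> w \<in> U"
  shows "U = V"
proof -
  define X1 where "X1 = (\<Union>f\<in>{f \<in> cells. \<exists>x y z. corners f x y z \<and> x \<in> U}. closure f)"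
  define X2 where "X2 = (\<Union>f\<in>{f \<in> cells. \<exists>x y z. corners f x y z \<and> x \<notin> U}. closure f)"
  have all: "(x \<in> U \<longleftrightarrow> y \<in> U) \<and> (x \<in> U \<longleftrightarrow> z \<in> U)" if "corners f x y z" for f x y z
    using cell_corners[OF that] closed_U by (metis insert_commute)
  have cover: "S2 \<subseteq> X1 \<union> X2"
  proof
    fix x assume "x \<in> S2"
    then obtain f where f: "f \<in> cells" "x \<in> closure f" using cells_dense by blast
    obtain w y z where c: "corners f w y z" using cell_has_corners[OF f(1)] by blast
    show "x \<in> X1 \<union> X2"
    proof (cases "w \<in> U")
      case True
      then have "f \<in> {f \<in> cells. \<exists>x y z. corners f x y z \<and> x \<in> U}" using f(1) c by auto
      then show ?thesis unfolding X1_def using f(2) by (meson UN_I UnI1)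
    next
      case False
      then have "f \<in> {f \<in> cells. \<exists>x y z. corners f x y z \<and> x \<notin> U}" using f(1) c by auto
      then show ?thesis unfolding X2_def using f(2) by (meson UN_I UnI2)
    qed
  qed
  have cl: "closed X1" "closed X2"
    unfolding X1_def X2_def using finite_cells by (auto intro!: closed_UN)
  have meet: "X1 \<inter> X2 = {}"
  proof (rule ccontr)
    assume "X1 \<inter> X2 \<noteq> {}"
    then obtain t f x y z f' x' y' z' where f: "f \<in> cells" "corners f x y z" "x \<in> U" "t \<in> closure f"
      and f': "f' \<in> cells" "corners f' x' y' z'" "x' \<notin> U" "t \<in> closure f'"
      unfolding X1_def X2_def by blast
    have yU: "y \<in> U" "z \<in> U" "y' \<notin> U" "z' \<notin> U" using all[OF f(2)] all[OF f'(2)] f f' by auto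
    have "f \<noteq> f'"
    proof
      assume eq: "f = f'"
      have "p x \<in> closure f" using corner_in_closure[OF f(1,2)] .
      moreover have "x \<in> V" using E_pair cell_corners[OF f(2)] by auto
      ultimately have "x \<in> {x', y', z'}" using closure_cell_vertex[OF f'(1,2)] eq by blast
      then show False using f(3) f'(3) yU by auto
    qed
    then obtain e e' where e: "e \<in> {{x, y}, {y, z}, {z, x}}" "e' \<in> {{x', y'}, {y', z'}, {z', x'}}" "t \<in> A e" "t \<in> A e'"
      using closures_meet[OF f(1,2) f'(1,2) _ f(4) f'(4)] by blast
    have eE: "e \<in> E" "e' \<in> E" using e(1,2) cell_corners[OF f(2)] cell_corners[OF f'(2)] by auto
    have "e \<subseteq> U" "e' \<inter> U = {}" "e \<noteq> {}" using e(1,2) f(3) f'(3) yU by auto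
    then have "e \<inter> e' = {}" "e \<noteq> e'" by auto
    then show False using edges_meet[OF eE] e(3,4) by blast
  qed
  have hit: "\<exists>f\<in>cells. \<exists>y z. corners f v y z \<and> p v \<in> closure f" if v: "v \<in> V" for v
  proof -
    obtain f where f: "f \<in> cells" "p v \<in> closure f" using cells_dense[OF p_S2[OF v]] by blast
    obtain x y z where c: "corners f x y z" using cell_has_corners[OF f(1)] by blast
    then have "v = x \<or> v = y \<or> v = z" using closure_cell_vertex[OF f(1) c v f(2)] by blast
    then show ?thesis using f c corners_rot by blast
  qed
  have "X1 \<inter> S2 \<noteq> {}"
  proof -
    obtain u where u: "u \<in> U" using U by blast
    then have uV: "u \<in> V" using U by blast
    then show ?thesis using hit[OF uV] u p_S2[OF uV] unfolding X1_def by blast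
  qed
  then have X2: "X2 \<inter> S2 = {}"
    using connected_closedD[OF connected_S2, of X1 X2] cl cover meet by blast
  have "v \<in> U" if v: "v \<in> V" for v
    using hit[OF v] X2 p_S2[OF v] unfolding X2_def by blast
  then show ?thesis using U by blast
qed

text \<open>The colour records on which side of the curve of the cycle a cell lies. The two cells at
  an edge are compared at an inner point x of the edge: if x is off the curve, both lie on the side
  of x; if x is on the curve, it is a limit of both sides and belongs to the closures of these two
  cells only.\<close>

lemma cycle_separates:
  assumes zs: "distinct zs" "length zs \<ge> 3" "successively (\<lambda>u v. {u, v} \<in> E) (zs @ [hd zs])"
  shows "\<exists>\<sigma>::'v \<Rightarrow> 'v \<Rightarrow> 'v \<Rightarrow> bool. (\<forall>u v w. (u, v, w) \<in> F \<longrightarrow> \<sigma> u v w = \<sigma> v w u) \<and>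
            (\<forall>u v w w'. (u, v, w) \<in> F \<longrightarrow> (v, u, w') \<in> F \<longrightarrow>
               (\<sigma> u v w \<noteq> \<sigma> v u w' \<longleftrightarrow> {u, v} \<in> cycle_edges zs))"
proof -
  obtain c where c: "simple_path c" "pathfinish c = pathstart c" "path_image c = (\<Union>e\<in>cycle_edges zs. A e)"
    and ZE: "cycle_edges zs \<subseteq> E" using cycle_curve[OF zs] by blast
  let ?K = "path_image c"
  have KD: "?K \<subseteq> D" using c(3) ZE by (auto simp: D_def)
  obtain f0 where "f0 \<in> cells"
    using cells_dense infinite_S2 by (metis ex_in_conv infinite_imp_nonempty)
  then have "?K \<noteq> S2" using KD cell_facts[of f0] by blast
  moreover have "?K \<subseteq> S2" using KD D_S2 by blast
  ultimately obtain I J where IJ: "I \<union> J = S2 - ?K" "I \<inter> J = {}" "openin (top_of_set S2) I" "openin (top_of_set S2) J"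
    "connected I" "connected J" "?K \<subseteq> closure I" "?K \<subseteq> closure J"
    using Jordan_S2[OF c(1,2)] by metis
  obtain OI OJ where OO: "open OI" "I = S2 \<inter> OI" "open OJ" "J = S2 \<inter> OJ" using IJ openin_open by metis
  have cell_IJ: "f \<subseteq> I \<or> f \<subseteq> J" if f: "f \<in> cells" for f
  proof (rule ccontr)
    assume n: "\<not> (f \<subseteq> I \<or> f \<subseteq> J)"
    have sub: "f \<subseteq> I \<union> J" using cell_facts(3,4)[OF f] KD IJ(1) by blast
    then have "OI \<inter> f \<noteq> {}" "OJ \<inter> f \<noteq> {}" "f \<subseteq> OI \<union> OJ" "OI \<inter> OJ \<inter> f = {}"
      using n OO IJ(2) cell_facts(3)[OF f] by blast+
    then show False using connectedD[OF cell_facts(1)[OF f] OO(1,3)] by blast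
  qed
  define cl where "cl u v w = (SOME f. f \<in> cells \<and> corners f u v w)" for u v w
  have cl: "cl u v w \<in> cells" "corners (cl u v w) u v w" if "(u, v, w) \<in> F" for u v w
    unfolding cl_def using someI_ex[of "\<lambda>f. f \<in> cells \<and> corners f u v w"] F_cell[OF that] by blast+
  define \<sigma> where "\<sigma> u v w \<longleftrightarrow> cl u v w \<subseteq> I" for u v w
  have "\<sigma> u v w = \<sigma> v w u" if "(u, v, w) \<in> F" for u v w
  proof -
    have F': "(v, w, u) \<in> F" using F_rot that by blast
    have "cl u v w = cl v w u"
      using cell_unique[OF cl(1)[OF that] corners_rot[OF cl(2)[OF that]] cl[OF F']] .
    then show ?thesis by (simp add: \<sigma>_def)
  qed
  moreover have "\<sigma> u v w \<noteq> \<sigma> v u w' \<longleftrightarrow> {u, v} \<in> cycle_edges zs"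
    if F1: "(u, v, w) \<in> F" and F2: "(v, u, w') \<in> F" for u v w w'
  proof -
    let ?f = "cl u v w" and ?f' = "cl v u w'"
    note f = cl[OF F1] and f' = cl[OF F2]
    have eE: "{u, v} \<in> E" using F_E[OF F1] .
    obtain x where x: "x \<in> A {u, v}" "x \<notin> p ` V" using edge_inner_point[OF eE] by blast
    have xcl: "x \<in> closure ?f" "x \<in> closure ?f'"
      using closure_cell[OF f] closure_cell[OF f'] x by (auto simp: insert_commute)
    have xS: "x \<in> S2" using x edge_facts(1)[OF eE] by blast
    have ne: "?f \<noteq> {}" "?f' \<noteq> {}" using cell_facts(2) f f' by blast+
    show ?thesis
    proof (cases "{u, v} \<in> cycle_edges zs")
      case False
      have xK: "x \<notin> ?K"
      proof
        assume "x \<in> ?K"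
        then obtain e where e: "e \<in> cycle_edges zs" "x \<in> A e" using c(3) by blast
        then have "x \<in> p ` ({u, v} \<inter> e)" using edges_meet[OF eE, of e] ZE False x(1) by blast
        then show False using x(2) E_V[OF eE] by blast
      qed
      have same: "g \<subseteq> I \<longleftrightarrow> x \<in> I" if g: "g \<in> cells" "x \<in> closure g" for g
      proof -
        have "g \<inter> OI \<noteq> {}" if "x \<in> OI" using that g(2) OO(1) by (auto simp: closure_iff_nhds_not_empty)
        moreover have "g \<inter> OJ \<noteq> {}" if "x \<in> OJ" using that g(2) OO(3) by (auto simp: closure_iff_nhds_not_empty)
        ultimately show ?thesis using cell_IJ[OF g(1)] OO IJ(1,2) xS xK cell_facts(3)[OF g(1)] by blast
      qed
      then show ?thesis using False same[OF f(1) xcl(1)] same[OF f'(1) xcl(2)] by (simp add: \<sigma>_def)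
    next
      case True
      then have xK: "x \<in> ?K" using c(3) x by blast
      define X where "X = (\<Union>g\<in>{g \<in> cells. x \<notin> closure g}. closure g)"
      have "closed X" unfolding X_def using finite_cells by (intro closed_UN) auto
      then have oX: "open (- X)" "x \<in> - X" by (rule open_Compl) (simp add: X_def)
      \<comment> \<open>In the neighbourhood \<open>- X\<close> of x, a cell whose closure contains
        a given point also has x in its closure. Applied to a point of Y near x, this finds such a
        cell within Y.\<close>
      have near: "\<exists>g\<in>cells. x \<in> closure g \<and> g \<subseteq> Y" if Y: "Y = S2 \<inter> OY" "open OY" "?K \<subseteq> closure Y" "Y = I \<or> Y = J" for Y OY
      proof -
        have "- X \<inter> Y \<noteq> {}" using oX xK Y(3) open_Int_closure_eq_empty[of "- X" Y] by blast
        then obtain y where y: "y \<in> Y" "y \<notin> X" by blast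
        then have "y \<in> S2" using Y(1) by blast
        then obtain g where g: "g \<in> cells" "y \<in> closure g" using cells_dense by blast
        then have xg: "x \<in> closure g" using y(2) unfolding X_def by blast
        have "g \<inter> OY \<noteq> {}" using g(2) y(1) Y(1,2) open_Int_closure_eq_empty[of OY g] by blast
        then have "g \<inter> Y \<noteq> {}" using Y(1) cell_facts(3)[OF g(1)] by blast
        then have "g \<subseteq> Y" using cell_IJ[OF g(1)] Y(4) IJ(2) by blast
        then show ?thesis using g(1) xg by blast
      qed
      obtain g where g: "g \<in> cells" "x \<in> closure g" "g \<subseteq> I" using near[OF OO(2,1) IJ(7)] by blast
      obtain g' where g': "g' \<in> cells" "x \<in> closure g'" "g' \<subseteq> J" using near[OF OO(4,3) IJ(8)] by blast
      \<comment> \<open>A cell with x in its closure has u and v among its corners, and for each of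
        the two orientations of the edge F admits only one third corner.\<close>
      have which: "k = ?f \<or> k = ?f'" if k: "k \<in> cells" "x \<in> closure k" for k
      proof -
        obtain x1 x2 x3 where c3: "corners k x1 x2 x3" using cell_has_corners[OF k(1)] by blast
        have "{u, v} \<in> {{x1, x2}, {x2, x3}, {x3, x1}}" using closure_cell_edge[OF k(1) c3 eE x k(2)] .
        then have "u = x1 \<and> v = x2 \<or> u = x2 \<and> v = x1 \<or> u = x2 \<and> v = x3 \<or> u = x3 \<and> v = x2 \<or> u = x3 \<and> v = x1 \<or> u = x1 \<and> v = x3"
          by (simp add: doubleton_eq_iff)
        moreover note c3 corners_rot[OF c3] corners_rot[OF corners_rot[OF c3]]
        moreover note d3 = corners_swap[OF c3]
        moreover note corners_rot[OF d3] corners_rot[OF corners_rot[OF d3]]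
        ultimately have "\<exists>z. corners k u v z" by (elim disjE conjE) (hypsubst, rule exI, assumption)+
        then obtain z where z: "corners k u v z" by (rule exE)
        from cell_F[OF k(1) z] show ?thesis
        proof
          assume "(u, v, z) \<in> F"
          then have "z = w" using F1 F_ex1[OF eE] by blast
          then show ?thesis using cell_unique[OF k(1) _ f] z by blast
        next
          assume "(u, z, v) \<in> F"
          then have "(v, u, z) \<in> F" using F_rot by blast
          then have "z = w'" using F2 F_ex1[OF F_E[OF F2]] by blast
          moreover have "corners k v u z" using z corners_rot corners_swap by blast
          ultimately show ?thesis using cell_unique[OF k(1) _ f'] by blast
        qed
      qed
      have gg: "g \<noteq> g'" using g g' IJ(2) cell_facts(2)[OF g(1)] by blast
      have "(g = ?f \<and> g' = ?f') \<or> (g = ?f' \<and> g' = ?f)" using which[OF g(1,2)] which[OF g'(1,2)] gg by blast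
      then have "(?f \<subseteq> I \<and> ?f' \<subseteq> J) \<or> (?f' \<subseteq> I \<and> ?f \<subseteq> J)" using g(3) g'(3) by blast
      then have "\<sigma> u v w \<noteq> \<sigma> v u w'" using ne IJ(2) unfolding \<sigma>_def by blast
      then show ?thesis using True by simp
    qed
  qed
  ultimately show ?thesis by blast
qed

lemma triangulation: "triangulation V E F"
proof
  show "finite V" by (rule finV)
  show "u \<in> V \<and> v \<in> V \<and> u \<noteq> v" if "{u, v} \<in> E" for u v using that by (rule E_pair)
  show "{u, v} \<in> E" if "(u, v, w) \<in> F" for u v w using that by (rule F_E)
  show "(v, w, u) \<in> F" if "(u, v, w) \<in> F" for u v w using that by (rule F_rot)
  show "\<exists>!w. (u, v, w) \<in> F" if "{u, v} \<in> E" for u v using that by (rule F_ex1)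
  show "S = {u. {v, u} \<in> E}" if "v \<in> V" "S \<noteq> {}" "S \<subseteq> {u. {v, u} \<in> E}" "\<And>u w. u \<in> S \<Longrightarrow> (v, u, w) \<in> F \<Longrightarrow> w \<in> S" for v S
    using that by (rule link_connected)
  show "S = V" if "S \<subseteq> V" "S \<noteq> {}" "\<And>u w. u \<in> S \<Longrightarrow> {u, w} \<in> E \<Longrightarrow> w \<in> S" for S
    using that by (rule graph_connected)
  show "\<exists>\<sigma>::'v \<Rightarrow> 'v \<Rightarrow> 'v \<Rightarrow> bool. (\<forall>u v w. (u, v, w) \<in> F \<longrightarrow> \<sigma> u v w = \<sigma> v w u) \<and>
            (\<forall>u v w w'. (u, v, w) \<in> F \<longrightarrow> (v, u, w') \<in> F \<longrightarrow>
               (\<sigma> u v w \<noteq> \<sigma> v u w' \<longleftrightarrow> {u, v} \<in> cycle_edges zs))"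
    if "distinct zs" "length zs \<ge> 3" "successively (\<lambda>u v. {u, v} \<in> E) (zs @ [hd zs])" for zs
    using that by (rule cycle_separates)
qed

end

lemma oriented_sphere_triangulation_combinatorial:
  assumes T: "oriented_sphere_triangulation V E F" and abc: "(a, b, c) \<in> F" and ne: "V - {a, b, c} \<noteq> {}"
  shows "triangulation V E F"
proof -
  note T' = T[unfolded oriented_sphere_triangulation_def]
  obtain p A where pA: "drawn_on_sphere V E p A" "\<forall>f\<in>two_cells V E p A. \<exists>u v w. triangular_cell E A f u v w"
    "\<forall>u v w. (\<exists>f\<in>two_cells V E p A. triangular_cell E A f u v w) \<longleftrightarrow> (u, v, w) \<in> F \<or> (u, w, v) \<in> F"
    using T' by (elim conjE exE)
  obtain f where "triangular_cell E A f a b c" using pA(3) abc by blast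
  then have abc': "distinct [a, b, c]" "{a, b} \<in> E" "{b, c} \<in> E" unfolding triangular_cell_def by blast+
  have EV: "e \<subseteq> V" if "e \<in> E" for e
    using pA(1)[unfolded drawn_on_sphere_def, THEN conjunct2, THEN conjunct2, THEN conjunct1, rule_format, OF that] by blast
  have "drawing V E F p A"
  proof
    show "finite V" using T' by (rule conjunct1)
    show "drawn_on_sphere V E p A" by (rule pA(1))
    show "\<exists>u v w. triangular_cell E A f u v w" if "f \<in> two_cells V E p A" for f using pA(2) that by (rule bspec)
    show "(\<exists>f\<in>two_cells V E p A. triangular_cell E A f u v w) = ((u, v, w) \<in> F \<or> (u, w, v) \<in> F)" for u v w
      by (rule pA(3)[rule_format])
    show "(v, w, u) \<in> F" if "(u, v, w) \<in> F" for u v w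
      by (rule T'[THEN conjunct2, THEN conjunct2, THEN conjunct1, rule_format, OF that])
    show "\<exists>!w. (u, v, w) \<in> F" if "{u, v} \<in> E" for u v
      by (rule T'[THEN conjunct2, THEN conjunct2, THEN conjunct2, rule_format, OF that])
    show "E \<noteq> {}" using abc' by blast
    show "\<not> V \<subseteq> {x, y, z}" for x y z
    proof
      assume sub: "V \<subseteq> {x, y, z}"
      obtain d where d: "d \<in> V" "d \<notin> {a, b, c}" using ne by blast
      have "{a, b, c, d} \<subseteq> V" using EV[OF abc'(2)] EV[OF abc'(3)] d by blast
      then have "card {a, b, c, d} \<le> card {x, y, z}" using sub by (intro card_mono) auto
      moreover have "card {a, b, c, d} = 4" using abc'(1) d(2) by auto
      moreover have "card {x, y, z} \<le> 3" by (metis card_length list.set(1,2) length_Cons list.size(3) numeral_3_eq_3)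
      ultimately show False by simp
    qed
  qed
  then show ?thesis by (rule drawing.triangulation)
qed

section \<open>Jordan domains\<close>

text \<open>Being defined on a compact interval, a path is a closed map and hence a quotient map
  onto its image. This allows functions on a curve to be defined through the parameter.\<close>

lemma continuous_on_quotient_path:
  fixes g :: "real \<Rightarrow> 'a::t2_space" and f :: "'a \<Rightarrow> 'b::topological_space"
  assumes "path g" and "continuous_on {0..1} (f \<circ> g)"
  shows "continuous_on (path_image g) f"
proof (rule continuous_on_closed_vimage[THEN iffD2, rule_format])
  show "closed (path_image g)" using assms(1) by (intro compact_imp_closed compact_path_image)
  fix B :: "'b set" assume "closed B"
  then have "closed ({0..1} \<inter> (f \<circ> g) -` B)"
    using assms(2) continuous_on_closed_vimage[of "{0..1::real}" "f \<circ> g"] by (simp add: Int_commute)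
  then have "compact ({0..1} \<inter> (f \<circ> g) -` B)"
    by (metis Int_absorb1 compact_Icc compact_Int_closed inf_le1 inf_commute)
  then have "compact (g ` ({0..1} \<inter> (f \<circ> g) -` B))"
    using assms(1) by (intro compact_continuous_image) (auto simp: path_def intro: continuous_on_subset)
  moreover have "g ` ({0..1} \<inter> (f \<circ> g) -` B) = f -` B \<inter> path_image g" by (auto simp: path_image_def)
  ultimately show "closed (f -` B \<inter> path_image g)" by (simp add: compact_imp_closed)
qed

lemma Jordan_curve_facts:
  fixes g :: "real \<Rightarrow> complex"
  assumes "simple_path g" "pathfinish g = pathstart g"
  shows "open (inside (path_image g))" "connected (inside (path_image g))" "bounded (inside (path_image g))" "inside (path_image g) \<noteq> {}"
    "frontier (inside (path_image g)) = path_image g" "frontier (outside (path_image g)) = path_image g"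
    "open (outside (path_image g))" "connected (outside (path_image g))" "\<not> bounded (outside (path_image g))"
    "closure (inside (path_image g)) = inside (path_image g) \<union> path_image g"
    "closure (outside (path_image g)) = outside (path_image g) \<union> path_image g"
    "interior (path_image g) = {}"
proof -
  note J = Jordan_inside_outside[OF assms]
  show "open (inside (path_image g))" "open (outside (path_image g))"
    "connected (inside (path_image g))" "bounded (inside (path_image g))" "inside (path_image g) \<noteq> {}"
    "frontier (inside (path_image g)) = path_image g" "frontier (outside (path_image g)) = path_image g"
    "connected (outside (path_image g))" "\<not> bounded (outside (path_image g))" using J by auto
  then show "closure (inside (path_image g)) = inside (path_image g) \<union> path_image g"
    "closure (outside (path_image g)) = outside (path_image g) \<union> path_image g"
    by (metis closure_Un_frontier)+
  have "closure (inside (path_image g)) \<inter> interior (path_image g) = {}"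
    using inside_no_overlap interior_subset open_Int_closure_eq_empty[of "interior (path_image g)"]
    by (metis Int_commute disjoint_iff open_interior subset_iff)
  then show "interior (path_image g) = {}"
    using \<open>closure (inside (path_image g)) = _\<close> interior_subset[of "path_image g"] by blast
qed

lemma Jordan_curve_connected_cases:
  fixes g :: "real \<Rightarrow> complex"
  assumes "simple_path g" "pathfinish g = pathstart g" "connected S" "S \<inter> path_image g = {}"
  shows "S \<subseteq> inside (path_image g) \<or> S \<subseteq> outside (path_image g)"
proof -
  note J = Jordan_curve_facts[OF assms(1,2)]
  have "S \<subseteq> inside (path_image g) \<union> outside (path_image g)" using assms(4) inside_Un_outside[of "path_image g"] by blast
  moreover have "inside (path_image g) \<inter> outside (path_image g) \<inter> S = {}" using inside_Int_outside[of "path_image g"] by blast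
  ultimately show ?thesis using connectedD[OF assms(3) J(1,7)] by blast
qed

text \<open>The radial projection from an inner point w to the circle is corrected by a phase that
  makes it a homeomorphism on the curve. Followed by the inverse of this homeomorphism it retracts
  the plane without w onto the curve; it is used outside the curve only and glued to the identity
  inside.\<close>

lemma Jordan_domain_retraction:
  fixes g :: "real \<Rightarrow> complex"
  assumes g: "simple_path g" "pathfinish g = pathstart g"
  obtains \<rho> where "continuous_on UNIV \<rho>" "range \<rho> \<subseteq> inside (path_image g) \<union> path_image g"
    "\<And>z. z \<in> inside (path_image g) \<union> path_image g \<Longrightarrow> \<rho> z = z"
proof -
  let ?C = "path_image g" and ?I = "inside (path_image g)"
  note J = Jordan_curve_facts[OF g]
  have pg: "path g" using g simple_path_imp_path by blast
  obtain w where w: "w \<in> ?I" using J(4) by blast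
  have wC: "w \<notin> ?C" using w inside_no_overlap by blast
  define N where "N = winding_number g w"
  have "N = 1 \<or> N = -1" using simple_closed_path_winding_number_inside[OF g(1)] g(2) w unfolding N_def by metis
  then obtain n :: real where n: "N = of_real n" "n = 1 \<or> n = -1" by force
  obtain q where q: "path q" "pathfinish q - pathstart q = 2 * of_real pi * \<i> * N"
    "\<And>t. t \<in> {0..1} \<Longrightarrow> g t = w + exp (q t)"
    using winding_number_as_continuous_log[OF pg wC] unfolding N_def by blast
  define \<gamma> where "\<gamma> t = Im (q t)" for t
  have \<gamma>: "continuous_on {0..1} \<gamma>" using q(1) unfolding \<gamma>_def path_def by (intro continuous_intros)
  have \<gamma>1: "\<gamma> 1 = \<gamma> 0 + 2 * pi * n"
    using q(2) n(1) by (auto simp: \<gamma>_def pathfinish_def pathstart_def complex_eq_iff algebra_simps)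
  define h where "h z = (SOME t. t \<in> {0..1} \<and> g t = z)" for z
  have h: "h z \<in> {0..1} \<and> g (h z) = z" if "z \<in> ?C" for z
    unfolding h_def by (rule someI_ex) (use that in \<open>auto simp: path_image_def\<close>)
  have hg: "h (g t) = t \<or> (t \<in> {0,1} \<and> h (g t) \<in> {0,1})" if "t \<in> {0..1}" for t
    using h[of "g t"] that g(1) unfolding simple_path_def loop_free_def path_image_def by (metis (full_types) imageI insert_iff)
  \<comment> \<open>The phase by which the argument of g t - w lags behind the uniform angle 2 * pi
    * n * t. As the winding number is n, the values at both ends of the parameter interval agree, so
    this is a function on the curve.\<close>
  define \<Theta> where "\<Theta> z = 2 * pi * n * h z - \<gamma> (h z)" for z
  have \<Theta>g: "\<Theta> (g t) = 2 * pi * n * t - \<gamma> t" if "t \<in> {0..1}" for t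
    using hg[OF that] \<gamma>1 by (auto simp: \<Theta>_def)
  have "continuous_on {0..1} (\<lambda>t. 2 * pi * n * t - \<gamma> t)" using \<gamma> by (intro continuous_intros)
  then have "continuous_on {0..1} (\<Theta> \<circ> g)" by (rule continuous_on_eq) (simp add: \<Theta>g)
  then have "continuous_on ?C \<Theta>" by (rule continuous_on_quotient_path[OF pg])
  then obtain \<Theta>' where \<Theta>': "continuous_on UNIV \<Theta>'" "\<And>z. z \<in> ?C \<Longrightarrow> \<Theta>' z = \<Theta> z"
    using Tietze_unbounded[of ?C \<Theta> UNIV] closed_path_image[OF pg] by auto
  define \<Phi> where "\<Phi> z = sgn (z - w) * cis (\<Theta>' z)" for z
  have \<Phi>c: "continuous_on (- {w}) \<Phi>" unfolding \<Phi>_def cis_conv_exp sgn_div_norm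
    by (intro continuous_intros continuous_on_subset[OF \<Theta>'(1)]) auto
  have \<Phi>s: "\<Phi> z \<in> sphere 0 1" if "z \<noteq> w" for z using that by (simp add: \<Phi>_def norm_mult norm_sgn)
  have \<Phi>g: "\<Phi> (g t) = cis (2 * pi * n * t)" if t: "t \<in> {0..1}" for t
  proof -
    have "g t \<in> ?C" using t by (auto simp: path_image_def)
    have "sgn (g t - w) = cis (\<gamma> t)" unfolding q(3)[OF t] \<gamma>_def by (simp add: sgn_eq exp_eq_polar norm_mult)
    then show ?thesis using \<Theta>'(2)[OF \<open>g t \<in> ?C\<close>] \<Theta>g[OF t] by (simp add: \<Phi>_def cis_mult)
  qed
  have \<Phi>inj: "inj_on \<Phi> ?C"
  proof (rule inj_onI)
    fix x y assume xy: "x \<in> ?C" "y \<in> ?C" "\<Phi> x = \<Phi> y"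
    have "cis (2 * pi * n * h x) = cis (2 * pi * n * h y)" using xy \<Phi>g h by metis
    then have "sin (2 * pi * n * h x) = sin (2 * pi * n * h y) \<and> cos (2 * pi * n * h x) = cos (2 * pi * n * h y)"
      by (simp add: complex_eq_iff)
    then obtain k :: int where "2 * pi * n * h x = 2 * pi * n * h y + 2 * pi * of_int k"
      unfolding sin_cos_eq_iff by blast
    then have "pi * (n * h x) = pi * (n * h y + of_int k)" by (simp add: algebra_simps)
    then have k: "n * h x = n * h y + of_int k" by simp
    have b: "h x \<in> {0..1}" "h y \<in> {0..1}" using h xy by auto
    then have "\<bar>real_of_int k\<bar> \<le> 1" using k n(2) by auto
    then have "k = 0 \<or> k = 1 \<or> k = -1" by linarith
    then have "h x = h y \<or> (h x \<in> {0,1} \<and> h y \<in> {0,1})" using k b n(2) by auto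
    moreover have "g 0 = g 1" using g(2) by (simp add: pathfinish_def pathstart_def)
    ultimately have "g (h x) = g (h y)" by auto
    then show "x = y" using h xy by metis
  qed
  have "\<Phi> ` ?C = sphere 0 1"
  proof
    show "\<Phi> ` ?C \<subseteq> sphere 0 1" using \<Phi>s wC by (metis image_subsetI)
    show "sphere 0 1 \<subseteq> \<Phi> ` ?C"
    proof
      fix y :: complex assume "y \<in> sphere 0 1"
      then have y: "norm y = 1" by simp
      \<comment> \<open>For n = -1 the circle is traversed backwards.\<close>
      define t where "t = (if n = 1 then Arg2pi y / (2 * pi) else 1 - Arg2pi y / (2 * pi))"
      have A: "0 \<le> Arg2pi y" "Arg2pi y < 2 * pi" "y = cis (Arg2pi y)" using Arg2pi[of y] Arg2pi_eq[of y] y by (auto simp: cis_conv_exp)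
      then have "t \<in> {0..1}" by (auto simp: t_def field_simps)
      moreover have "cis (2 * pi * n * t) = y"
      proof (cases "n = 1")
        case True then show ?thesis using A by (simp add: t_def)
      next
        case False
        then have "2 * pi * n * t = Arg2pi y - 2 * pi" using n(2) by (auto simp: t_def field_simps)
        then show ?thesis using A(3) by (simp add: cis_divide[symmetric])
      qed
      ultimately show "y \<in> \<Phi> ` ?C" using \<Phi>g by (auto simp: path_image_def image_iff)
    qed
  qed
  then obtain \<psi> where \<psi>: "homeomorphism ?C (sphere 0 1) \<Phi> \<psi>"
    using homeomorphism_compact[of ?C \<Phi> "sphere 0 1"] \<Phi>inj compact_path_image[OF pg]
      continuous_on_subset[OF \<Phi>c, of ?C] wC by blast
  define \<rho> where "\<rho> z = (if z \<in> ?I \<union> ?C then z else \<psi> (\<Phi> z))" for z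
  have cover: "- ?I = outside ?C \<union> ?C" using inside_Un_outside[of ?C] inside_no_overlap[of ?C] inside_Int_outside[of ?C] by blast
  have \<psi>\<Phi>: "\<psi> (\<Phi> z) = z" if "z \<in> ?C" for z using \<psi> that by (auto simp: homeomorphism_def)
  have "continuous_on ((?I \<union> ?C) \<union> (outside ?C \<union> ?C)) \<rho>" unfolding \<rho>_def
  proof (rule continuous_on_cases)
    show "closed (?I \<union> ?C)" "closed (outside ?C \<union> ?C)" using J(10,11) closed_closure by metis+
    show "continuous_on (outside ?C \<union> ?C) (\<lambda>z. \<psi> (\<Phi> z))"
    proof (rule continuous_on_compose2[of "sphere 0 1" \<psi>])
      show "continuous_on (sphere 0 1) \<psi>" using \<psi> by (simp add: homeomorphism_def)
      show "continuous_on (outside ?C \<union> ?C) \<Phi>" by (rule continuous_on_subset[OF \<Phi>c]) (use w cover in blast)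
      have "w \<notin> outside ?C \<union> ?C" using w cover by blast
      then show "\<Phi> ` (outside ?C \<union> ?C) \<subseteq> sphere 0 1" using \<Phi>s by (metis image_subsetI)
    qed
  qed (use \<psi>\<Phi> cover in auto)
  moreover have "(?I \<union> ?C) \<union> (outside ?C \<union> ?C) = UNIV" using cover by blast
  ultimately have "continuous_on UNIV \<rho>" by simp
  moreover have "range \<rho> \<subseteq> ?I \<union> ?C"
  proof
    fix y assume "y \<in> range \<rho>"
    then obtain z where z: "y = \<rho> z" by blast
    show "y \<in> ?I \<union> ?C"
    proof (cases "z \<in> ?I \<union> ?C")
      case False
      then have "\<Phi> z \<in> sphere 0 1" using w by (intro \<Phi>s) auto
      then have "\<psi> (\<Phi> z) \<in> ?C" using \<psi> by (auto simp: homeomorphism_def)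
      then show ?thesis using False z by (simp add: \<rho>_def)
    qed (simp add: z \<rho>_def)
  qed
  ultimately show thesis using that[of \<rho>] by (simp add: \<rho>_def)
qed

text \<open>A Coons patch interpolates the boundary curve over the square, with the bottom side
  collapsed to g s, and the retraction pushes it back into the closed domain.\<close>

lemma Jordan_domain_square:
  fixes g :: "real \<Rightarrow> complex"
  assumes g: "simple_path g" "pathfinish g = pathstart g" and st: "0 < s" "s < t" "t < 1"
  obtains \<tau> :: "real \<times> real \<Rightarrow> complex" where "continuous_on ({0..1} \<times> {0..1}) \<tau>" "\<tau> ` ({0..1} \<times> {0..1}) \<subseteq> inside (path_image g) \<union> path_image g"
    "\<And>y. y \<in> {0..1} \<Longrightarrow> \<tau> (0, y) \<in> g ` {0..s}" "\<And>y. y \<in> {0..1} \<Longrightarrow> \<tau> (1, y) \<in> g ` {s..t}"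
    "\<And>x. x \<in> {0..1} \<Longrightarrow> \<tau> (x, 1) \<in> g ` {t..1}" "\<And>x. x \<in> {0..1} \<Longrightarrow> \<tau> (x, 0) = g s"
proof -
  obtain \<rho> where \<rho>: "continuous_on UNIV \<rho>" "range \<rho> \<subseteq> inside (path_image g) \<union> path_image g"
    "\<And>z. z \<in> inside (path_image g) \<union> path_image g \<Longrightarrow> \<rho> z = z"
    using Jordan_domain_retraction[OF g] by blast
  \<comment> \<open>The left side leads from g s back to g 0, the right side from g s to g t, and
    the top from g 1 = g 0 back to g t.\<close>
  define l r u where "l y = s * (1 - y)" and "r y = s + (t - s) * y" and "u x = 1 + (t - 1) * x" for x y :: real
  define f where "f = (\<lambda>(x, y). of_real (1 - x) * g (l y) + of_real x * g (r y) +
     of_real y * (g (u x) - of_real (1 - x) * g 0 - of_real x * g t))"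
  have g01: "g 1 = g 0" using g(2) by (simp add: pathfinish_def pathstart_def)
  have cg: "continuous_on {0..1} g" using g(1) by (simp add: simple_path_def path_def)
  have lru: "l y \<in> {0..s}" "r y \<in> {s..t}" "u y \<in> {t..1}" if "y \<in> {0..1}" for y
  proof -
    show "l y \<in> {0..s}" using that st mult_left_mono[of "1-y" 1 s] by (auto simp: l_def)
    show "r y \<in> {s..t}" using that st mult_left_mono[of y 1 "t-s"] mult_nonneg_nonneg[of "t-s" y]
      unfolding r_def atLeastAtMost_iff mult_1_right by linarith
    show "u y \<in> {t..1}" using that st mult_left_mono[of y 1 "1-t"] mult_nonneg_nonneg[of "1-t" y] mult_minus_left[of "1-t" y]
      unfolding u_def atLeastAtMost_iff mult_1_right minus_diff_eq by linarith
  qed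
  have lru01: "l y \<in> {0..1}" "r y \<in> {0..1}" "u y \<in> {0..1}" if "y \<in> {0..1}" for y
    using lru[OF that] st by auto
  let ?Q = "{0..1::real} \<times> {0..1::real}"
  have c: "continuous_on ?Q (\<lambda>x. g (l (snd x)))" "continuous_on ?Q (\<lambda>x. g (r (snd x)))" "continuous_on ?Q (\<lambda>x. g (u (fst x)))"
  proof -
    have "continuous_on ?Q (\<lambda>x. l (snd x))" "continuous_on ?Q (\<lambda>x. r (snd x))" "continuous_on ?Q (\<lambda>x. u (fst x))"
      unfolding l_def r_def u_def by (intro continuous_intros)+
    moreover have "(\<lambda>x. l (snd x)) ` ?Q \<subseteq> {0..1}" "(\<lambda>x. r (snd x)) ` ?Q \<subseteq> {0..1}" "(\<lambda>x. u (fst x)) ` ?Q \<subseteq> {0..1}"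
      using lru01 by (simp_all add: image_subset_iff)
    ultimately show "continuous_on ?Q (\<lambda>x. g (l (snd x)))" "continuous_on ?Q (\<lambda>x. g (r (snd x)))" "continuous_on ?Q (\<lambda>x. g (u (fst x)))"
      using continuous_on_compose2[OF cg] by blast+
  qed
  have cts: "continuous_on ?Q f" unfolding f_def case_prod_beta by (intro continuous_intros c)
  have in_C: "g x \<in> path_image g" if "x \<in> {0..1}" for x using that by (auto simp: path_image_def)
  have edge: "f (0, y) = g (l y)" "f (1, y) = g (r y)" "f (y, 1) = g (u y)" "f (y, 0) = g s" if "y \<in> {0..1}" for y :: real
    using g01 by (auto simp: f_def l_def r_def u_def algebra_simps)
  let ?\<tau> = "\<rho> \<circ> f"
  have "continuous_on ({0..1} \<times> {0..1}) ?\<tau>" using cts \<rho>(1) continuous_on_compose continuous_on_subset by blast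
  moreover have "?\<tau> ` ({0..1} \<times> {0..1}) \<subseteq> inside (path_image g) \<union> path_image g" using \<rho>(2) by auto
  moreover have "?\<tau> (0, y) = g (l y)" "?\<tau> (1, y) = g (r y)" "?\<tau> (y, 1) = g (u y)" "?\<tau> (y, 0) = g s" if y: "y \<in> {0..1}" for y :: real
    using edge[OF y] lru[OF y] st \<rho>(3) in_C by auto
  ultimately show thesis using that[of ?\<tau>] lru by simp
qed

section \<open>A Jordan curve with three sides\<close>

locale jordan_sides =
  fixes g :: "real \<Rightarrow> complex" and L :: "nat \<Rightarrow> real"
  assumes simple: "simple_path g" and closed_curve: "pathfinish g = pathstart g"
    and L0: "L 0 = 0" and L3: "L 3 = 1" and L_less: "i < 3 \<Longrightarrow> L i < L (Suc i)"
begin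

abbreviation "C \<equiv> path_image g"

definition side :: "nat \<Rightarrow> complex set" where "side i = g ` {L i..L (Suc i)}"
definition oside :: "nat \<Rightarrow> complex set" where "oside i = g ` {L i<..<L (Suc i)}"
definition md :: "nat \<Rightarrow> real" where "md i = (L i + L (Suc i)) / 2"

lemmas C_facts = Jordan_curve_facts[OF simple closed_curve]

lemma three: "i < 3 \<longleftrightarrow> i = 0 \<or> i = 1 \<or> i = (2::nat)" by auto

lemma L_order: "0 < L (Suc 0)" "L (Suc 0) < L 2" "L 2 < 1" "L (Suc (Suc 0)) = L 2" "L 3 = 1"
  using L_less[of 0] L_less[of 1] L_less[of 2] L0 L3 by (simp_all add: numeral_2_eq_2 numeral_3_eq_3)

lemma L_range: "i < 3 \<Longrightarrow> 0 \<le> L i \<and> L (Suc i) \<le> 1"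
  unfolding three using L_order L0 by auto

lemma path_g: "path g" and g01: "g 1 = g 0" and cts_g: "continuous_on {0..1} g"
  using simple closed_curve by (auto simp: simple_path_def path_def pathfinish_def pathstart_def)

lemma g_inj: "x \<in> {0..1} \<Longrightarrow> y \<in> {0..1} \<Longrightarrow> g x = g y \<Longrightarrow> x = y \<or> (x = 0 \<and> y = 1) \<or> (x = 1 \<and> y = 0)"
  using simple unfolding simple_path_def loop_free_def by blast

lemma g_in_C: "x \<in> {0..1} \<Longrightarrow> g x \<in> C" by (auto simp: path_image_def)

lemma open_param: "i < 3 \<Longrightarrow> x \<in> {L i<..<L (Suc i)} \<Longrightarrow> x \<in> {0<..<1}"
  using L_range[of i] by auto

lemma g_open_eq: "x \<in> {0<..<1} \<Longrightarrow> y \<in> {0..1} \<Longrightarrow> g x = g y \<Longrightarrow> x = y"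
  using g_inj[of x y] by auto

lemma side_C: "i < 3 \<Longrightarrow> side i \<subseteq> C"
  unfolding side_def path_image_def using L_range[of i] by auto

lemma oside_side: "oside i \<subseteq> side i" unfolding oside_def side_def by auto

lemma param_disjoint: "i < 3 \<Longrightarrow> j < 3 \<Longrightarrow> i \<noteq> j \<Longrightarrow> x \<in> {L i<..<L (Suc i)} \<Longrightarrow> x \<notin> {L j..L (Suc j)}"
  unfolding three using L_order L0 by auto

lemma oside_disjoint: "i < 3 \<Longrightarrow> j < 3 \<Longrightarrow> i \<noteq> j \<Longrightarrow> oside i \<inter> side j = {}"
proof (rule ccontr)
  assume a: "i < 3" "j < 3" "i \<noteq> j" "oside i \<inter> side j \<noteq> {}"
  then obtain x y where xy: "x \<in> {L i<..<L (Suc i)}" "y \<in> {L j..L (Suc j)}" "g x = g y"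
    unfolding oside_def side_def by blast
  have "y \<in> {0..1}" using xy(2) L_range[OF a(2)] by auto
  then have "x = y" using g_open_eq[OF open_param[OF a(1) xy(1)]] xy(3) by blast
  then show False using param_disjoint[OF a(1-3) xy(1)] xy(2) by simp
qed

lemma C_sides: "C = side 0 \<union> side 1 \<union> side 2"
proof -
  have "{0..1} = {L 0..L (Suc 0)} \<union> {L 1..L (Suc 1)} \<union> {L 2..L (Suc 2)}" using L_order L0 by auto
  then show ?thesis unfolding path_image_def side_def by (metis image_Un)
qed

lemma side_cases: "i < 3 \<Longrightarrow> z \<in> side i \<Longrightarrow> z \<in> oside i \<or> z = g (L i) \<or> z = g (L (Suc i))"
  unfolding side_def oside_def by (auto simp: image_iff) (metis order_le_less greaterThanLessThan_iff)

lemma md: "i < 3 \<Longrightarrow> L i < md i \<and> md i < L (Suc i)" "i < 3 \<Longrightarrow> md i \<in> {0..1}"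
  using L_less[of i] L_range[of i] unfolding md_def by auto

lemma compact_side: "i < 3 \<Longrightarrow> compact (side i)"
  unfolding side_def using cts_g L_range[of i]
  by (intro compact_continuous_image continuous_on_subset[OF cts_g]) auto

end

section \<open>Uniqueness of contacts\<close>

text \<open>The hypotheses cover two situations: thickened bodies inside the curve, whose contacts
  with the thick sides are joined to the curve by the segments from \<open>zt\<close> to
  \<open>g th\<close>, and limit bodies touching the curve itself, for which these segments shrink
  to points.\<close>

locale jordan_bodies = jordan_sides g L + realizer V cor h p
  for g :: "real \<Rightarrow> complex" and L :: "nat \<Rightarrow> real" and V :: "'v set" and cor :: "nat \<Rightarrow> 'v"
    and h :: "nat \<Rightarrow> 'v \<Rightarrow> real" and p :: "nat \<Rightarrow> 'v \<Rightarrow> 'v" +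
  fixes K :: "'v \<Rightarrow> complex set" and cen :: "'v \<Rightarrow> complex" and zt :: "nat \<Rightarrow> 'v \<Rightarrow> complex" and th :: "nat \<Rightarrow> 'v \<Rightarrow> real"
  assumes body: "x \<in> V0 \<Longrightarrow> convex (K x) \<and> cen x \<in> interior (K x)"
    and inside: "x \<in> V0 \<Longrightarrow> interior (K x) \<subseteq> inside (path_image g)"
    and bodies_apart: "\<lbrakk>x \<in> V0; y \<in> V0; x \<noteq> y\<rbrakk> \<Longrightarrow> interior (K x) \<inter> K y = {}"
    and no_triple: "\<lbrakk>x \<in> V0; y \<in> V0; w \<in> V0; x \<noteq> y; y \<noteq> w; x \<noteq> w\<rbrakk> \<Longrightarrow> K x \<inter> K y \<inter> K w = {}"
    and curve_contact: "\<lbrakk>x \<in> V0; y \<in> V0; x \<noteq> y\<rbrakk> \<Longrightarrow> path_image g \<inter> K x \<inter> K y = {}"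
    and foot: "\<lbrakk>i < 3; x \<in> V0; K x \<inter> K (cor i) \<noteq> {}\<rbrakk> \<Longrightarrow> zt i x \<in> K x \<and> th i x \<in> {L i<..<L (Suc i)} \<and>
        closed_segment (zt i x) (g (th i x)) \<inter> path_image g = {g (th i x)} \<and>
        closed_segment (zt i x) (g (th i x)) \<inter> outside (path_image g) = {}"
    and foot_body: "\<lbrakk>i < 3; x \<in> V0; K x \<inter> K (cor i) \<noteq> {}; y \<in> V0\<rbrakk> \<Longrightarrow>
        closed_segment (zt i x) (g (th i x)) \<inter> interior (K y) = {}"
    and foot_contact: "\<lbrakk>i < 3; x \<in> V0; K x \<inter> K (cor i) \<noteq> {}; y \<in> V0; w \<in> V0; y \<noteq> w\<rbrakk> \<Longrightarrow>
        closed_segment (zt i x) (g (th i x)) \<inter> K y \<inter> K w = {}"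
    and foot_foot: "\<lbrakk>i < 3; j < 3; i \<noteq> j; x \<in> V0; y \<in> V0; x \<noteq> y; K x \<inter> K (cor i) \<noteq> {}; K y \<inter> K (cor j) \<noteq> {}\<rbrakk> \<Longrightarrow>
        closed_segment (zt i x) (g (th i x)) \<inter> closed_segment (zt j y) (g (th j y)) = {}"
    and contact: "v \<in> V0 \<Longrightarrow> i < 3 \<Longrightarrow> \<exists>u \<in> cone i v. K v \<inter> K u \<noteq> {}"
begin

text \<open>All legs in direction i are led to the same point, the parameter midpoint of side i, so
  that tripods at different bodies have common feet.\<close>

definition land :: "nat \<Rightarrow> 'v \<Rightarrow> real \<Rightarrow> complex" where
  "land i x = linepath (zt i x) (g (th i x)) +++ subpath (th i x) (md i) g"

text \<open>The curve is cut at the three midpoints; the last piece passes through the base point,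
  where the parametrization starts anew.\<close>

definition \<gamma> :: "nat \<Rightarrow> real \<Rightarrow> complex" where
  "\<gamma> i = (if i = 0 then subpath (md 0) (md 1) g else if i = 1 then subpath (md 1) (md 2) g
     else subpath (md 2) 1 g +++ subpath 0 (md 0) g)"

abbreviation "m i \<equiv> g (md i)"

text \<open>Joined with this set, a leg ending at \<open>m i\<close> becomes connected and
  unbounded, as \<open>tripods_winding_number\<close> demands of the sets around w.\<close>

definition H :: "nat \<Rightarrow> complex set" where "H i = insert (m i) (outside C)"

lemma th: "i < 3 \<Longrightarrow> x \<in> V0 \<Longrightarrow> K x \<inter> K (cor i) \<noteq> {} \<Longrightarrow> th i x \<in> {L i<..<L (Suc i)} \<and> th i x \<in> {0..1}"
  using foot[of i x] open_param[of i "th i x"] by auto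

lemma foot_side:
  assumes "i < 3" "x \<in> V0" "K x \<inter> K (cor i) \<noteq> {}"
  shows "closed_segment (zt i x) (g (th i x)) \<inter> C \<subseteq> oside i" "closed_segment (zt i x) (g (th i x)) \<inter> outside C = {}"
  using foot[OF assms] by (simp_all add: oside_def)

lemma land_image:
  assumes "i < 3" "x \<in> V0" "K x \<inter> K (cor i) \<noteq> {}"
  shows "path (land i x)" "pathstart (land i x) = zt i x" "pathfinish (land i x) = g (md i)"
    "path_image (land i x) \<subseteq> closed_segment (zt i x) (g (th i x)) \<union> oside i"
    "path_image (land i x) \<inter> outside C = {}"
proof -
  note t = th[OF assms]
  have seg: "closed_segment (th i x) (md i) \<subseteq> {L i<..<L (Suc i)}"
    using t md(1)[OF assms(1)] by (auto simp: closed_segment_eq_real_ivl split: if_splits)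
  show "path (land i x)" "pathstart (land i x) = zt i x" "pathfinish (land i x) = g (md i)"
    unfolding land_def using t md(2)[OF assms(1)] by (auto intro!: path_subpath path_g simp: pathstart_subpath pathfinish_subpath)
  show sub: "path_image (land i x) \<subseteq> closed_segment (zt i x) (g (th i x)) \<union> oside i"
    unfolding land_def oside_def using seg by (auto simp: path_image_join path_image_subpath_gen image_iff)
  have "oside i \<inter> outside C = {}" using oside_side side_C[OF assms(1)] outside_no_overlap by blast
  then show "path_image (land i x) \<inter> outside C = {}" using sub foot_side(2)[OF assms] by blast
qed

lemma gam:
  assumes "i < 3"
  shows "path (\<gamma> i)" "pathstart (\<gamma> i) = g (md i)" "pathfinish (\<gamma> i) = g (md (Suc i mod 3))"
    "path_image (\<gamma> i) \<subseteq> oside i \<union> oside (Suc i mod 3) \<union> {g (L (Suc i))}"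
proof -
  have m: "md 0 \<in> {0..1}" "md 1 \<in> {0..1}" "md 2 \<in> {0..1}" using md(2) by auto
  have cs: "closed_segment a b = {a..b}" if "a \<le> b" for a b :: real using that by (auto simp: closed_segment_eq_real_ivl)
  note o = L_order L0 md(1)[of 0] md(1)[of 1] md(1)[of 2]
  consider (0) "i = 0" "Suc i mod 3 = 1" "Suc i = 1" | (1) "i = 1" "Suc i mod 3 = 2" "Suc i = 2"
    | (2) "i = 2" "Suc i mod 3 = 0" "Suc i = 3" using assms three by force
  then have "path (\<gamma> i) \<and> pathstart (\<gamma> i) = g (md i) \<and> pathfinish (\<gamma> i) = g (md (Suc i mod 3)) \<and>
    path_image (\<gamma> i) \<subseteq> oside i \<union> oside (Suc i mod 3) \<union> {g (L (Suc i))}"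
  proof cases
    case 0
    have "{md 0..md 1} \<subseteq> {L 0<..<L (Suc 0)} \<union> {L 1<..<L (Suc 1)} \<union> {L 1}" using o by auto
    then have "g ` {md 0..md 1} \<subseteq> oside 0 \<union> oside 1 \<union> {g (L 1)}" unfolding oside_def by blast
    moreover have "path_image (\<gamma> i) = g ` {md 0..md 1}"
      using 0 o cs[of "md 0" "md 1"] unfolding \<gamma>_def by (simp add: path_image_subpath_gen)
    ultimately show ?thesis unfolding 0 using m by (simp add: \<gamma>_def path_subpath path_g)
  next
    case 1
    have "{md 1..md 2} \<subseteq> {L 1<..<L (Suc 1)} \<union> {L 2<..<L (Suc 2)} \<union> {L 2}" using o by auto
    then have "g ` {md 1..md 2} \<subseteq> oside 1 \<union> oside 2 \<union> {g (L 2)}" unfolding oside_def by blast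
    moreover have "path_image (\<gamma> i) = g ` {md 1..md 2}"
      using 1 o cs[of "md 1" "md 2"] unfolding \<gamma>_def by (simp add: path_image_subpath_gen)
    ultimately show ?thesis unfolding 1 using m by (simp add: \<gamma>_def path_subpath path_g numeral_2_eq_2)
  next
    case 2
    have "{md 2..1} \<union> {0..md 0} \<subseteq> {L 2<..<L (Suc 2)} \<union> {L 0<..<L (Suc 0)} \<union> {0, 1}" using o by auto
    then have "g ` ({md 2..1} \<union> {0..md 0}) \<subseteq> g ` {L 2<..<L (Suc 2)} \<union> g ` {L 0<..<L (Suc 0)} \<union> g ` {0, 1}" by blast
    then have "g ` ({md 2..1} \<union> {0..md 0}) \<subseteq> oside 2 \<union> oside 0 \<union> {g (L 3)}"
      using g01 unfolding oside_def L3 by simp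
    moreover have "path_image (\<gamma> i) = g ` ({md 2..1} \<union> {0..md 0})"
      using 2 o cs[of "md 2" 1] cs[of 0 "md 0"] g01 unfolding \<gamma>_def by (simp add: path_image_join path_image_subpath_gen image_Un)
    ultimately show ?thesis unfolding 2 using m g01 by (simp add: \<gamma>_def path_subpath path_g)
  qed
  then show "path (\<gamma> i)" "pathstart (\<gamma> i) = g (md i)" "pathfinish (\<gamma> i) = g (md (Suc i mod 3))"
    "path_image (\<gamma> i) \<subseteq> oside i \<union> oside (Suc i mod 3) \<union> {g (L (Suc i))}" by blast+
qed

lemma gam_C: "i < 3 \<Longrightarrow> path_image (\<gamma> i) \<subseteq> C"
proof -
  assume i: "i < 3"
  then have "Suc i mod 3 < 3" by simp
  moreover have "g (L (Suc i)) \<in> C" using L_range[OF i] L_less[OF i] by (intro g_in_C) auto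
  ultimately show ?thesis using gam(4)[OF i] oside_side side_C i by blast
qed

text \<open>The three pieces together are g with its starting point moved to
  \<open>md 0\<close>.\<close>

lemma winding_gam:
  assumes "w \<notin> C"
  shows "winding_number (\<gamma> 0 +++ \<gamma> 1 +++ \<gamma> 2) w = winding_number g w"
proof -
  have m: "md 0 \<in> {0..1}" "md 1 \<in> {0..1}" "md 2 \<in> {0..1}" using md(2) by auto
  define W where "W x y = winding_number (subpath x y g) w" for x y
  have W: "W x y + W y z = W x z" if "x \<in> {0..1}" "y \<in> {0..1}" "z \<in> {0..1}" for x y z
    unfolding W_def using winding_number_subpath_combine[OF path_g assms that] by simp
  have ps: "path (subpath x y g)" "w \<notin> path_image (subpath x y g)" if "x \<in> {0..1}" "y \<in> {0..1}" for x y
    using path_subpath[OF path_g that] path_image_subpath_subset[OF that, of g] assms by auto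
  have "winding_number (\<gamma> 2) w = W (md 2) 1 + W 0 (md 0)"
    unfolding \<gamma>_def W_def using ps m g01 by (simp add: winding_number_join pathfinish_subpath pathstart_subpath)
  moreover have "winding_number (\<gamma> 0) w = W (md 0) (md 1)" "winding_number (\<gamma> 1) w = W (md 1) (md 2)"
    unfolding \<gamma>_def W_def by simp_all
  moreover have "winding_number (\<gamma> 0 +++ \<gamma> 1 +++ \<gamma> 2) w = winding_number (\<gamma> 0) w + (winding_number (\<gamma> 1) w + winding_number (\<gamma> 2) w)"
  proof -
    have "w \<notin> path_image (\<gamma> i)" if "i < 3" for i using gam_C[OF that] assms by blast
    moreover have "Suc 0 mod 3 = 1" "Suc 1 mod 3 = 2" by auto
    ultimately show ?thesis using gam(1-3)[of 0] gam(1-3)[of 1] gam(1-3)[of 2]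
      by (simp add: winding_number_join path_image_join not_in_path_image_join numeral_2_eq_2)
  qed
  ultimately have "winding_number (\<gamma> 0 +++ \<gamma> 1 +++ \<gamma> 2) w = W (md 0) (md 1) + (W (md 1) (md 2) + (W (md 2) 1 + W 0 (md 0)))" by simp
  also have "\<dots> = (W 0 (md 0) + (W (md 0) (md 1) + W (md 1) (md 2))) + W (md 2) 1" by (simp add: ac_simps)
  also have "\<dots> = W 0 1" using W m by simp
  also have "\<dots> = winding_number g w" by (simp add: W_def)
  finally show ?thesis .
qed

lemma oside_K: "x \<in> V0 \<Longrightarrow> C \<inter> interior (K x) = {}"
  using inside[of x] inside_no_overlap[of C] by blast

lemma land_C: "i < 3 \<Longrightarrow> x \<in> V0 \<Longrightarrow> K x \<inter> K (cor i) \<noteq> {} \<Longrightarrow> path_image (land i x) \<inter> C \<subseteq> oside i"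
  using land_image(4)[of i x] foot_side(1)[of i x] by fast

lemma seg_oside:
  assumes "i < 3" "j < 3" "i \<noteq> j" "x \<in> V0" "K x \<inter> K (cor i) \<noteq> {}"
  shows "path_image (land i x) \<inter> side j = {}" "path_image (land i x) \<inter> oside j = {}"
proof -
  have "oside i \<inter> side j = {}" using oside_disjoint assms by blast
  then show "path_image (land i x) \<inter> side j = {}"
    using land_C[OF assms(1,4,5)] side_C[OF assms(2)] by blast
  then show "path_image (land i x) \<inter> oside j = {}" using oside_side by blast
qed

lemma gam_sides: "i < 3 \<Longrightarrow> path_image (\<gamma> i) \<subseteq> side i \<union> side (Suc i mod 3)"
proof -
  assume i: "i < 3"
  have "g (L (Suc i)) \<in> side i" unfolding side_def using L_less[OF i] by auto
  then show ?thesis using gam(4)[OF i] oside_side[of i] oside_side[of "Suc i mod 3"] by blast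
qed

lemma land_path: "i < 3 \<Longrightarrow> x \<in> V0 \<Longrightarrow> K x \<inter> K (cor i) \<noteq> {} \<Longrightarrow>
    path (land i x) \<and> pathstart (land i x) \<in> K x \<and> pathfinish (land i x) = m i"
  using land_image[of i x] foot[of i x] by simp

lemma land_body:
  assumes a: "i < 3" "x \<in> V0" "y \<in> V0" "K x \<inter> K (cor i) \<noteq> {}"
  shows "path_image (land i x) \<inter> interior (K y) = {}"
  using land_image(4)[OF a(1,2,4)] foot_body[OF a(1,2,4,3)] oside_K[OF a(3)] oside_side[of i] side_C[OF a(1)] by blast

lemma land_contact:
  assumes a: "i < 3" "x \<in> V0" "y \<in> V0" "y' \<in> V0" "y \<noteq> y'" "K x \<inter> K (cor i) \<noteq> {}"
  shows "path_image (land i x) \<inter> K y \<inter> K y' = {}"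
  using land_image(4)[OF a(1,2,6)] foot_contact[OF a(1,2,6,3,4,5)] curve_contact[OF a(3,4,5)] oside_side[of i] side_C[OF a(1)] by blast

lemma land_land:
  assumes a: "i < 3" "j < 3" "i \<noteq> j" "x \<in> V0" "y \<in> V0" "x \<noteq> y" "K x \<inter> K (cor i) \<noteq> {}" "K y \<inter> K (cor j) \<noteq> {}"
  shows "path_image (land i x) \<inter> path_image (land j y) = {}"
  using land_image(4)[OF a(1,4,7)] land_image(4)[OF a(2,5,8)] foot_foot[OF a]
    seg_oside(2)[OF a(1,2,3,4,7)] seg_oside(2)[OF a(2,1) a(3)[symmetric] a(5,8)] by blast

lemma \<gamma>_path: "i < 3 \<Longrightarrow> path (\<gamma> i) \<and> pathstart (\<gamma> i) = m i \<and> pathfinish (\<gamma> i) = m (Suc i mod 3)"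
  using gam[of i] by simp

lemma land_\<gamma>:
  assumes a: "i < 3" "j < 3" "j \<noteq> i" "j \<noteq> Suc i mod 3" "x \<in> V0" "K x \<inter> K (cor j) \<noteq> {}"
  shows "path_image (land j x) \<inter> path_image (\<gamma> i) = {}"
proof -
  have "path_image (land j x) \<inter> side (Suc i mod 3) = {}" using seg_oside(1)[OF a(2) _ a(4,5,6)] by simp
  then show ?thesis using seg_oside(1)[OF a(2,1,3,5,6)] gam_sides[OF a(1)] by blast
qed

lemma \<gamma>_body: "i < 3 \<Longrightarrow> y \<in> V0 \<Longrightarrow> path_image (\<gamma> i) \<inter> interior (K y) = {}"
  using gam_C[of i] oside_K[of y] by blast

lemma \<gamma>_contact: "i < 3 \<Longrightarrow> y \<in> V0 \<Longrightarrow> y' \<in> V0 \<Longrightarrow> y \<noteq> y' \<Longrightarrow> path_image (\<gamma> i) \<inter> K y \<inter> K y' = {}"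
  using gam_C[of i] curve_contact[of y y'] by blast

lemma H: "i < 3 \<Longrightarrow> connected (H i) \<and> \<not> bounded (H i) \<and> m i \<in> H i"
proof -
  assume i: "i < 3"
  have "connected (H i)" unfolding H_def
  proof (rule connected_intermediate_closure[OF C_facts(8)])
    show "insert (m i) (outside C) \<subseteq> closure (outside C)" unfolding C_facts(11) using g_in_C[OF md(2)[OF i]] by blast
  qed blast
  then show ?thesis unfolding H_def using C_facts(9) by simp
qed

lemma H_body: "i < 3 \<Longrightarrow> y \<in> V0 \<Longrightarrow> H i \<inter> interior (K y) = {}"
  unfolding H_def using inside[of y] inside_Int_outside[of C] g_in_C[OF md(2), of i] oside_K[of y] by blast

lemma H_contact: "i < 3 \<Longrightarrow> y \<in> V0 \<Longrightarrow> y' \<in> V0 \<Longrightarrow> y \<noteq> y' \<Longrightarrow> H i \<inter> K y \<inter> K y' = {}"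
proof -
  assume a: "i < 3" "y \<in> V0" "y' \<in> V0" "y \<noteq> y'"
  have "K y \<subseteq> closure (interior (K y))" using body[OF a(2)]
    by (metis closure_subset convex_closure_interior empty_iff)
  then have "K y \<subseteq> closure (inside C)" using closure_mono[OF inside[OF a(2)]] by blast
  then have "outside C \<inter> K y = {}" unfolding C_facts(10) using inside_Int_outside[of C] outside_no_overlap[of C] by blast
  then show ?thesis unfolding H_def using g_in_C[OF md(2)[OF a(1)]] curve_contact[OF a(2-4)] by blast
qed

lemma H_land:
  assumes a: "i < 3" "j < 3" "i \<noteq> j" "x \<in> V0" "K x \<inter> K (cor j) \<noteq> {}"
  shows "H i \<inter> path_image (land j x) = {}"
proof -
  have "m i \<in> side i" unfolding side_def using md(1)[OF a(1)] by auto
  then show ?thesis unfolding H_def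
    using land_image(5)[OF a(2,4,5)] seg_oside(1)[OF a(2,1) a(3)[symmetric] a(4,5)] by blast
qed

lemma H_\<gamma>:
  assumes a: "i < 3" "j < 3" "j \<noteq> i" "j \<noteq> Suc i mod 3"
  shows "H j \<inter> path_image (\<gamma> i) = {}"
proof -
  have "m j \<in> oside j" unfolding oside_def using md(1)[OF a(2)] by auto
  moreover have "oside j \<inter> side i = {}" "oside j \<inter> side (Suc i mod 3) = {}" using oside_disjoint a by auto
  moreover have "outside C \<inter> path_image (\<gamma> i) = {}" using gam_C[OF a(1)] outside_no_overlap[of C] by blast
  ultimately show ?thesis unfolding H_def using gam_sides[OF a(1)] by blast
qed

lemma winding: "x \<in> V0 \<Longrightarrow> winding_number (\<gamma> 0 +++ \<gamma> 1 +++ \<gamma> 2) (cen x) \<noteq> 0"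
proof -
  assume x: "x \<in> V0"
  have "cen x \<in> inside C" using body[OF x] inside[OF x] by blast
  moreover from this have "winding_number g (cen x) \<noteq> 0"
    using simple_closed_path_winding_number_inside[OF simple] closed_curve by (metis neg_equal_0_iff_equal zero_neq_one)
  moreover have "cen x \<notin> C" using calculation(1) inside_no_overlap[of C] by blast
  ultimately show ?thesis using winding_gam by simp
qed

text \<open>The room available to a leg in direction i that passes through the bodies in N.\<close>

definition supp :: "nat \<Rightarrow> 'v set \<Rightarrow> complex set" where
  "supp i N = (\<Union>y\<in>N. interior (K y)) \<union> (\<Union>y\<in>N. \<Union>y'\<in>N - {y}. K y \<inter> K y') \<union>
     (\<Union>y\<in>{y \<in> N. K y \<inter> K (cor i) \<noteq> {}}. path_image (land i y))"

lemma supp_mono: "N \<subseteq> N' \<Longrightarrow> supp i N \<subseteq> supp i N'"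
  unfolding supp_def by (intro Un_mono UN_mono) auto

lemma supp_cases:
  assumes "z \<in> supp i N"
  obtains y where "y \<in> N" "z \<in> interior (K y)"
    | y y' where "y \<in> N" "y' \<in> N" "y \<noteq> y'" "z \<in> K y" "z \<in> K y'"
    | y where "y \<in> N" "K y \<inter> K (cor i) \<noteq> {}" "z \<in> path_image (land i y)"
  using assms unfolding supp_def
proof (elim UnE UN_E)
  fix y assume "y \<in> N" "z \<in> interior (K y)"
  then show thesis by (rule that(1))
next
  fix y y' assume "y \<in> N" "y' \<in> N - {y}" "z \<in> K y \<inter> K y'"
  then show thesis using that(2)[of y y'] by auto
next
  fix y assume "y \<in> {y \<in> N. K y \<inter> K (cor i) \<noteq> {}}" "z \<in> path_image (land i y)"
  then show thesis using that(3)[of y] by auto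
qed

text \<open>The interior of a body misses the other bodies and all landings; a contact point of two
  bodies from one family is on no third body and on no landing; and landings of different bodies on
  different sides are kept apart by \<open>land_land\<close>.\<close>

lemma supp_disjoint:
  assumes N: "N \<subseteq> V0" "N' \<subseteq> V0" "N \<inter> N' = {}" and ij: "i < 3" "j < 3" "i \<noteq> j"
  shows "supp i N \<inter> supp j N' = {}"
proof (rule ccontr)
  assume "\<not> ?thesis"
  then obtain z where z: "z \<in> supp i N" "z \<in> supp j N'" by blast
  have one: False if N: "N \<subseteq> V0" "N' \<subseteq> V0" "N \<inter> N' = {}" and j: "j < 3" and z: "z \<in> interior (K y)" "y \<in> N" "z \<in> supp j N'" for N N' y j
    using z(3)
  proof (cases rule: supp_cases)
    case (1 y')
    then have "y' \<noteq> y" using N z by blast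
    then show False using bodies_apart[of y y'] 1 z N interior_subset[of "K y'"] by blast
  next
    case (2 y' y'')
    then have "y' \<noteq> y" using N z by blast
    then show False using bodies_apart[of y y'] 2 z N by blast
  next
    case (3 y')
    then show False using land_body[OF j, of y' y] z N by blast
  qed
  show False using z(1)
  proof (cases rule: supp_cases)
    case (1 y)
    then show False using one[OF N ij(2) 1(2,1) z(2)] by blast
  next
    case y: (2 y y')
    show False using z(2)
    proof (cases rule: supp_cases)
      case (1 w)
      have "N' \<inter> N = {}" using N by blast
      then show False using one[OF N(2,1) _ ij(1) 1(2,1) z(1)] by blast
    next
      case (2 w w')
      then have "w \<noteq> y" "w \<noteq> y'" using N y by blast+
      then show False using no_triple[of y y' w] y 2 N by blast
    next
      case (3 w)
      then show False using land_contact[OF ij(2), of w y y'] y N by blast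
    qed
  next
    case y: (3 y)
    show False using z(2)
    proof (cases rule: supp_cases)
      case (1 w)
      have "N' \<inter> N = {}" using N by blast
      then show False using one[OF N(2,1) _ ij(1) 1(2,1) z(1)] by blast
    next
      case (2 w w')
      then show False using land_contact[OF ij(1), of y w w'] y N by blast
    next
      case (3 w)
      then have "y \<noteq> w" using N y by blast
      then show False using land_land[OF ij, of y w] y 3 N by blast
    qed
  qed
qed

lemma supp_H: "N \<subseteq> V0 \<Longrightarrow> i < 3 \<Longrightarrow> j < 3 \<Longrightarrow> i \<noteq> j \<Longrightarrow> H j \<inter> supp i N = {}"
proof (rule ccontr)
  assume N: "N \<subseteq> V0" and ij: "i < 3" "j < 3" "i \<noteq> j" and "H j \<inter> supp i N \<noteq> {}"
  then obtain z where z: "z \<in> H j" "z \<in> supp i N" by blast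
  show False using z(2)
  proof (cases rule: supp_cases)
    case (1 y)
    then show False using H_body[OF ij(2), of y] z N by blast
  next
    case (2 y y')
    then show False using H_contact[OF ij(2), of y y'] z N by blast
  next
    case (3 y)
    then show False using H_land[OF ij(2,1) ij(3)[symmetric], of y] z N by blast
  qed
qed

lemma supp_\<gamma>: "N \<subseteq> V0 \<Longrightarrow> i < 3 \<Longrightarrow> j < 3 \<Longrightarrow> j \<noteq> i \<Longrightarrow> j \<noteq> Suc i mod 3 \<Longrightarrow> supp j N \<inter> path_image (\<gamma> i) = {}"
proof (rule ccontr)
  assume N: "N \<subseteq> V0" and ij: "i < 3" "j < 3" "j \<noteq> i" "j \<noteq> Suc i mod 3" and "supp j N \<inter> path_image (\<gamma> i) \<noteq> {}"
  then obtain z where z: "z \<in> path_image (\<gamma> i)" "z \<in> supp j N" by blast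
  show False using z(2)
  proof (cases rule: supp_cases)
    case (1 y)
    then show False using \<gamma>_body[OF ij(1), of y] z N by blast
  next
    case (2 y y')
    then show False using \<gamma>_contact[OF ij(1), of y y'] z N by blast
  next
    case (3 y)
    then show False using land_\<gamma>[OF ij, of y] z N by blast
  qed
qed

lemma leg_land:
  assumes "x \<in> V0" "i < 3" "K x \<inter> K (cor i) \<noteq> {}"
  shows "\<exists>\<alpha>. path \<alpha> \<and> pathstart \<alpha> = cen x \<and> pathfinish \<alpha> = m i \<and> path_image \<alpha> \<subseteq> supp i {x}"
proof -
  let ?z = "pathstart (land i x)"
  have l: "path (land i x)" "?z \<in> K x" "pathfinish (land i x) = m i" using land_path[OF assms(2,1,3)] by auto
  let ?a = "linepath (cen x) ?z +++ land i x"
  have "closed_segment (cen x) ?z \<subseteq> insert ?z (interior (K x))"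
    using segment_in_interior body[OF assms(1)] l by blast
  moreover have "?z \<in> path_image (land i x)" by (rule pathstart_in_path_image)
  ultimately have "path_image ?a \<subseteq> supp i {x}"
    using assms(3) by (subst path_image_join) (auto simp: supp_def)
  then show ?thesis using l by (intro exI[of _ ?a]) auto
qed

text \<open>The new leg goes straight from the centre of x to a point of contact with u and on to
  the centre of u. By convexity both segments are interior except at the point of contact.\<close>

lemma leg_step:
  assumes x: "x \<in> V0" "u \<in> V0" "x \<noteq> u" "K x \<inter> K u \<noteq> {}"
    and \<alpha>: "path \<alpha>" "pathstart \<alpha> = cen u" "path_image \<alpha> \<subseteq> supp i N" "u \<in> N"
  shows "\<exists>\<beta>. path \<beta> \<and> pathstart \<beta> = cen x \<and> pathfinish \<beta> = pathfinish \<alpha> \<and> path_image \<beta> \<subseteq> supp i (insert x N)"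
proof -
  obtain z where z: "z \<in> K x" "z \<in> K u" using x by blast
  let ?b = "linepath (cen x) z +++ linepath z (cen u) +++ \<alpha>"
  have "closed_segment (cen x) z \<subseteq> insert z (interior (K x))" "closed_segment (cen u) z \<subseteq> insert z (interior (K u))"
    using segment_in_interior body x z by blast+
  moreover have "z \<in> supp i (insert x N)" "interior (K x) \<subseteq> supp i (insert x N)" "interior (K u) \<subseteq> supp i (insert x N)"
    using z x \<alpha>(4) by (auto simp: supp_def)
  moreover have "path_image \<alpha> \<subseteq> supp i (insert x N)" using \<alpha>(3) supp_mono[of N "insert x N"] by blast
  ultimately have "path_image ?b \<subseteq> supp i (insert x N)"
    using \<alpha> by (simp add: path_image_join closed_segment_commute[of z]) blast
  then show ?thesis using \<alpha> by (intro exI[of _ ?b]) auto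
qed

text \<open>Each contact leads to a body higher in the i-th order, so the climb ends at the i-th
  side; by transitivity the bodies used stay in the i-th cone of x.\<close>

lemma leg_exists:
  assumes "x \<in> V0" and i: "i < 3"
  shows "\<exists>\<alpha> N. path \<alpha> \<and> pathstart \<alpha> = cen x \<and> pathfinish \<alpha> = m i \<and> path_image \<alpha> \<subseteq> supp i N \<and>
     x \<in> N \<and> N \<subseteq> V0 \<and> N \<subseteq> insert x (cone i x)"
  using assms(1)
proof (induction "card {y \<in> V. h i x < h i y}" arbitrary: x rule: less_induct)
  case less
  obtain u where u: "u \<in> cone i x" "K x \<inter> K u \<noteq> {}" using contact[OF less.prems i] by blast
  show ?case
  proof (cases "u = cor i")
    case True
    then have "K x \<inter> K (cor i) \<noteq> {}" using u by simp
    from leg_land[OF less.prems i this] obtain \<alpha> where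
      "path \<alpha>" "pathstart \<alpha> = cen x" "pathfinish \<alpha> = m i" "path_image \<alpha> \<subseteq> supp i {x}" by blast
    then show ?thesis using less.prems by (intro exI[of _ \<alpha>] exI[of _ "{x}"]) auto
  next
    case False
    then have uV: "u \<in> V0" using cone_cor[OF less.prems i u(1)] by blast
    have xu: "x \<noteq> u" using u by (auto simp: cone_def)
    obtain \<alpha> N where \<alpha>: "path \<alpha>" "pathstart \<alpha> = cen u" "pathfinish \<alpha> = m i" "path_image \<alpha> \<subseteq> supp i N"
      "u \<in> N" "N \<subseteq> V0" "N \<subseteq> insert u (cone i u)"
      using less.hyps[OF cone_measure[OF u(1)] uV] by blast
    obtain \<beta> where "path \<beta>" "pathstart \<beta> = cen x" "pathfinish \<beta> = m i" "path_image \<beta> \<subseteq> supp i (insert x N)"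
      using leg_step[OF less.prems uV xu u(2) \<alpha>(1,2,4,5)] \<alpha>(3) by auto
    moreover have "insert x N \<subseteq> insert x (cone i x)" using \<alpha>(7) u(1) cone_trans by blast
    ultimately show ?thesis using \<alpha>(6) less.prems
      by (intro exI[of _ \<beta>] exI[of _ "insert x N"]) auto
  qed
qed

text \<open>Suppose v touches u in its i-th cone and the parent w is another vertex, hence lower
  than u in the i-th order. The tripod at v runs through u in direction i and so stays above w, and
  legs of v and of w in different directions use disjoint sets of bodies. By
  \<open>tripods_winding_number\<close> the curve would have winding number 0 around the centre of
  w, which lies inside.\<close>

theorem contact_unique:
  assumes v: "v \<in> V0" and i: "i < 3" and u: "u \<in> cone i v" "K v \<inter> K u \<noteq> {}"
  shows "u = p i v"
proof (rule ccontr)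
  assume ne: "u \<noteq> p i v"
  define w where "w = p i v"
  have v': "v \<in> V - cor ` {..<3}" using v by (simp add: V0_def)
  have w: "w \<in> cone i v" using p_cone[OF v' i] by (simp add: w_def cone_def)
  have wu: "h i w < h i u"
    using p_least[OF v' i _ _ _ ne] u by (auto simp: cone_def w_def)
  have "w \<noteq> cor i"
  proof
    assume "w = cor i"
    moreover have "u \<in> V" using u by (simp add: cone_def)
    ultimately show False using wu cor_top[OF i, of u] by (cases "u = cor i") auto
  qed
  then have wV: "w \<in> V0" using cone_cor[OF v i w] by blast
  have vw: "v \<noteq> w" using w by (auto simp: cone_def)
  have vu: "v \<noteq> u" using u by (auto simp: cone_def)
  \<comment> \<open>The bound \<open>h i u \<le> h i y\<close> on the i-th leg records that after v
    it proceeds from u upwards, hence above w.\<close>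
  define leg where "leg l \<alpha> N \<longleftrightarrow>
      path \<alpha> \<and> pathstart \<alpha> = cen v \<and> pathfinish \<alpha> = m l \<and> path_image \<alpha> \<subseteq> supp l N \<and> N \<subseteq> V0 \<and>
      (\<forall>y\<in>N. y = v \<or> (l \<noteq> i \<and> h l v < h l y) \<or> (l = i \<and> h i u \<le> h i y))" for l \<alpha> N
  define leg' where "leg' l \<beta> M \<longleftrightarrow>
      path \<beta> \<and> pathstart \<beta> = cen w \<and> pathfinish \<beta> = m l \<and> path_image \<beta> \<subseteq> supp l M \<and> M \<subseteq> V0 \<and>
      M \<subseteq> insert w (cone l w)" for l \<beta> M
  have "\<exists>\<alpha> N. leg l \<alpha> N" if l: "l < 3" for l
  proof (cases "l = i")
    case False
    obtain \<alpha> N where "path \<alpha>" "pathstart \<alpha> = cen v" "pathfinish \<alpha> = m l" "path_image \<alpha> \<subseteq> supp l N"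
      "v \<in> N" "N \<subseteq> V0" "N \<subseteq> insert v (cone l v)"
      using leg_exists[OF v l] by blast
    moreover from this(7) have "\<forall>y\<in>N. y = v \<or> h l v < h l y" by (auto simp: cone_def)
    ultimately show ?thesis unfolding leg_def using False by blast
  next
    case True
    show ?thesis unfolding leg_def
    proof (cases "u = cor i")
      case True
      then have "K v \<inter> K (cor i) \<noteq> {}" using u by simp
      from leg_land[OF v i this] obtain \<alpha> where
        "path \<alpha>" "pathstart \<alpha> = cen v" "pathfinish \<alpha> = m i" "path_image \<alpha> \<subseteq> supp i {v}" by blast
      then show "\<exists>\<alpha> N. path \<alpha> \<and> pathstart \<alpha> = cen v \<and> pathfinish \<alpha> = m l \<and> path_image \<alpha> \<subseteq> supp l N \<and> N \<subseteq> V0 \<and>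
          (\<forall>y\<in>N. y = v \<or> (l \<noteq> i \<and> h l v < h l y) \<or> (l = i \<and> h i u \<le> h i y))"
        using \<open>l = i\<close> v by (intro exI[of _ \<alpha>] exI[of _ "{v}"]) auto
    next
      case False
      then have uV: "u \<in> V0" using cone_cor[OF v i u(1)] by blast
      obtain \<alpha> N where \<alpha>: "path \<alpha>" "pathstart \<alpha> = cen u" "pathfinish \<alpha> = m i" "path_image \<alpha> \<subseteq> supp i N"
        "u \<in> N" "N \<subseteq> V0" "N \<subseteq> insert u (cone i u)"
        using leg_exists[OF uV i] by blast
      obtain \<beta> where "path \<beta>" "pathstart \<beta> = cen v" "pathfinish \<beta> = m i" "path_image \<beta> \<subseteq> supp i (insert v N)"
        using leg_step[OF v uV vu u(2) \<alpha>(1,2,4,5)] \<alpha>(3) by auto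
      moreover have "\<forall>y\<in>N. h i u \<le> h i y" using \<alpha>(7) by (auto simp: cone_def)
      ultimately show "\<exists>\<alpha> N. path \<alpha> \<and> pathstart \<alpha> = cen v \<and> pathfinish \<alpha> = m l \<and> path_image \<alpha> \<subseteq> supp l N \<and> N \<subseteq> V0 \<and>
          (\<forall>y\<in>N. y = v \<or> (l \<noteq> i \<and> h l v < h l y) \<or> (l = i \<and> h i u \<le> h i y))"
        using \<open>l = i\<close> v \<alpha>(6)
        by (intro exI[of _ \<beta>] exI[of _ "insert v N"]) auto
    qed
  qed
  then obtain \<alpha> N where leg: "\<And>l. l < 3 \<Longrightarrow> leg l (\<alpha> l) (N l)" by metis
  have \<alpha>: "path (\<alpha> l)" "pathstart (\<alpha> l) = cen v" "pathfinish (\<alpha> l) = m l" "path_image (\<alpha> l) \<subseteq> supp l (N l)"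
    and N: "N l \<subseteq> V0" if "l < 3" for l
    using leg[OF that] by (simp_all add: leg_def)
  have N2: "y = v \<or> (l \<noteq> i \<and> h l v < h l y) \<or> (l = i \<and> h i u \<le> h i y)" if "l < 3" "y \<in> N l" for l y
    using leg[OF that(1)] that(2) by (simp add: leg_def)
  have "\<exists>\<beta> M. leg' l \<beta> M" if "l < 3" for l
    using leg_exists[OF wV that] unfolding leg'_def by blast
  then obtain \<beta> M where leg': "\<And>l. l < 3 \<Longrightarrow> leg' l (\<beta> l) (M l)" by metis
  have \<beta>: "path (\<beta> l)" "pathstart (\<beta> l) = cen w" "pathfinish (\<beta> l) = m l" "path_image (\<beta> l) \<subseteq> supp l (M l)"
    and M: "M l \<subseteq> V0" "M l \<subseteq> insert w (cone l w)" if "l < 3" for l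
    using leg'[OF that] by (simp_all add: leg'_def)
  \<comment> \<open>A body on the k-th leg of w is w or lies in its k-th cone, so in the two other
    orders it is at most as high as w. A body on the l-th leg of v is v, or above v in order l, or
    at least as high as u in order l = i; in each case it exceeds w in an order other than
    k.\<close>
  have NM: "N l \<inter> M k = {}" if lk: "l < 3" "k < 3" "l \<noteq> k" for l k
  proof (rule ccontr)
    assume "N l \<inter> M k \<noteq> {}"
    then obtain y where y: "y \<in> N l" "y \<in> M k" by blast
    have yw: "y = w \<or> y \<in> cone k w" using M(2)[OF lk(2)] y by blast
    from N2[OF lk(1) y(1)] consider "y = v" | "l \<noteq> i" "h l v < h l y" | "l = i" "h i u \<le> h i y" by blast
    then show False
    proof cases
      case 1
      have "\<exists>j<3. j \<noteq> k \<and> j \<noteq> i" using lk i by (intro exI[of _ "if k \<noteq> 0 \<and> i \<noteq> 0 then 0 else if k \<noteq> 1 \<and> i \<noteq> 1 then 1 else 2"]) auto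
      then obtain j where j: "j < 3" "j \<noteq> k" "j \<noteq> i" by blast
      have "h j w < h j v" using w j by (auto simp: cone_def)
      moreover have "v \<in> cone k w" using yw 1 vw by simp
      ultimately show False using j by (auto simp: cone_def)
    next
      case 2
      have "h l w < h l v" using w lk 2 by (auto simp: cone_def)
      then show False using yw lk 2 by (auto simp: cone_def)
    next
      case 3
      then show False using yw lk wu by (auto simp: cone_def)
    qed
  qed
  \<comment> \<open>The leg of w continued by the outside. It avoids the two legs of v in the other
    directions and the piece of the curve between their feet.\<close>
  define B where "B l = path_image (\<beta> l) \<union> H l" for l
  have B: "connected (B l)" "\<not> bounded (B l)" "cen w \<in> B l" if "l < 3" for l
  proof -
    have "m l \<in> path_image (\<beta> l)" using \<beta>(3)[OF that] pathfinish_in_path_image by metis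
    then show "connected (B l)" unfolding B_def
      using connected_path_image[OF \<beta>(1)[OF that]] H[OF that] by (intro connected_Un) auto
    show "\<not> bounded (B l)" unfolding B_def using H[OF that] by simp
    show "cen w \<in> B l" unfolding B_def using \<beta>(2)[OF that] pathstart_in_path_image by (metis UnI1)
  qed
  have BA: "B k \<inter> path_image (\<alpha> l) = {}" if "l < 3" "k < 3" "l \<noteq> k" for l k
  proof -
    have "supp l (N l) \<inter> supp k (M k) = {}" using supp_disjoint[OF N M(1) NM] that by blast
    moreover have "H k \<inter> supp l (N l) = {}" using supp_H[OF N] that by blast
    ultimately show ?thesis unfolding B_def using \<alpha>(4)[OF that(1)] \<beta>(4)[OF that(2)] by blast
  qed
  have BG: "B k \<inter> path_image (\<gamma> l) = {}" if "l < 3" "k < 3" "k \<noteq> l" "k \<noteq> Suc l mod 3" for l k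
    unfolding B_def using supp_\<gamma>[OF M(1), of k l k] H_\<gamma>[OF that(1,2)] \<beta>(4)[OF that(2)] that by blast
  have "winding_number (\<gamma> 0 +++ \<gamma> 1 +++ \<gamma> 2) (cen w) = 0"
  proof (rule tripods_winding_number[where \<alpha>a = "\<alpha> 0" and \<alpha>b = "\<alpha> 1" and \<alpha>c = "\<alpha> 2" and u = "cen v" and Ba = "B 0" and Bb = "B 1" and Bc = "B 2"])
    show "B 2 \<inter> (path_image (\<alpha> 0) \<union> path_image (\<alpha> 1) \<union> path_image (\<gamma> 0)) = {}"
      using BA[of 0 2] BA[of 1 2] BG[of 0 2] by auto
    show "B 0 \<inter> (path_image (\<alpha> 1) \<union> path_image (\<alpha> 2) \<union> path_image (\<gamma> 1)) = {}"
      using BA[of 1 0] BA[of 2 0] BG[of 1 0] by auto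
    show "B 1 \<inter> (path_image (\<alpha> 2) \<union> path_image (\<alpha> 0) \<union> path_image (\<gamma> 2)) = {}"
      using BA[of 2 1] BA[of 0 1] BG[of 2 1] by auto
  qed (use \<alpha>[of 0] \<alpha>[of 1] \<alpha>[of 2] \<gamma>_path[of 0] \<gamma>_path[of 1] \<gamma>_path[of 2] B[of 0] B[of 1] B[of 2] in \<open>auto simp: numeral_2_eq_2\<close>)
  then show False using winding[OF wV] by simp
qed

end

section \<open>Thickening the arcs\<close>

text \<open>Choose k so small that the two points with parameter k are closer together than any pair
  with a parameter of at least e/2. A closest pair among the parameters from k on then has both
  parameters below e/2.\<close>

lemma closest_pair_near_corner:
  fixes p q :: "real \<Rightarrow> complex"
  assumes c: "0 < c" "0 < c'" and p: "continuous_on {0..c} p" and q: "continuous_on {0..c'} q" and "p 0 = q 0"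
    and inj: "\<And>x y. x \<in> {0..c} \<Longrightarrow> y \<in> {0..c'} \<Longrightarrow> p x = q y \<Longrightarrow> x = 0 \<and> y = 0"
    and e: "0 < e" "e \<le> c" "e \<le> c'"
  obtains x y where "0 < x" "x < e" "0 < y" "y < e"
    "\<And>x' y'. x' \<in> {x..c} \<Longrightarrow> y' \<in> {y..c'} \<Longrightarrow> dist (p x) (q y) \<le> dist (p x') (q y')"
proof -
  let ?f = "\<lambda>z. dist (p (fst z)) (q (snd z))"
  have cf: "continuous_on ({0..c} \<times> {0..c'}) ?f"
    by (intro continuous_intros continuous_on_compose2[OF p] continuous_on_compose2[OF q]) auto
  let ?S = "({e/2..c} \<times> {0..c'}) \<union> ({0..c} \<times> {e/2..c'})"
  have S: "?S \<subseteq> {0..c} \<times> {0..c'}" using e by auto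
  have "compact ?S" by (intro compact_Un compact_Times) auto
  moreover have "?S \<noteq> {}" using e by auto
  ultimately obtain w where w: "w \<in> ?S" "\<And>z. z \<in> ?S \<Longrightarrow> ?f w \<le> ?f z"
    using continuous_attains_inf[OF _ _ continuous_on_subset[OF cf S]] by blast
  have "?f w > 0"
  proof (rule ccontr)
    assume "\<not> ?thesis"
    then have "p (fst w) = q (snd w)" by simp
    then show False using inj[of "fst w" "snd w"] w(1) e by auto
  qed
  have "continuous (at 0 within {0..e/2}) (\<lambda>x. ?f (x, x))"
  proof -
    have "continuous_on {0..e/2} p" "continuous_on {0..e/2} q"
      using e by (auto intro: continuous_on_subset[OF p] continuous_on_subset[OF q])
    then have "continuous_on {0..e/2} (\<lambda>x. ?f (x, x))" by (auto intro: continuous_on_dist)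
    then show ?thesis using e by (auto simp: continuous_on_eq_continuous_within)
  qed
  then obtain \<delta> where \<delta>: "\<delta> > 0" "\<And>x. x \<in> {0..e/2} \<Longrightarrow> dist x 0 < \<delta> \<Longrightarrow> dist (?f (x, x)) (?f (0, 0)) < ?f w"
    using \<open>?f w > 0\<close> unfolding continuous_within_eps_delta by blast
  define k where "k = min (e/2) (\<delta>/2)"
  have k: "0 < k" "k \<le> e/2" "dist k 0 < \<delta>" using e \<delta>(1) by (auto simp: k_def)
  have fk: "?f (k, k) < ?f w" using \<delta>(2)[of k] k \<open>p 0 = q 0\<close> by simp
  let ?K = "{k..c} \<times> {k..c'}"
  have K: "compact ?K" "?K \<noteq> {}" "?K \<subseteq> {0..c} \<times> {0..c'}" using k e by (auto intro: compact_Times)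
  obtain m where m: "m \<in> ?K" "\<And>z. z \<in> ?K \<Longrightarrow> ?f m \<le> ?f z"
    using continuous_attains_inf[OF K(1,2) continuous_on_subset[OF cf K(3)]] by blast
  have "?f m \<le> ?f (k, k)" using k e by (intro m(2)) auto
  then have "m \<notin> ?S" using w(2)[of m] fk by linarith
  then have ms: "fst m < e/2" "snd m < e/2" using m(1) k by (auto simp: mem_Times_iff not_le)
  show thesis
  proof (rule that[of "fst m" "snd m"])
    show "0 < fst m" "fst m < e" "0 < snd m" "snd m < e" using m(1) ms k e by (auto simp: mem_Times_iff)
    show "dist (p (fst m)) (q (snd m)) \<le> dist (p x') (q y')" if "x' \<in> {fst m..c}" "y' \<in> {snd m..c'}" for x' y'
      using m(2)[of "(x', y')"] that m(1) by (auto simp: mem_Times_iff)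
  qed
qed

section \<open>Trimming the corners\<close>

definition nx :: "nat \<Rightarrow> nat" where "nx i = Suc i mod 3"
definition pv :: "nat \<Rightarrow> nat" where "pv i = (i + 2) mod 3"

lemma nx_pv: "i < 3 \<Longrightarrow> nx i < 3" "i < 3 \<Longrightarrow> pv i < 3" "i < 3 \<Longrightarrow> nx (pv i) = i" "i < 3 \<Longrightarrow> pv (nx i) = i"
  "i < 3 \<Longrightarrow> nx i \<noteq> i" "i < 3 \<Longrightarrow> pv i \<noteq> i" "i < 3 \<Longrightarrow> nx i \<noteq> pv i" "i < 3 \<Longrightarrow> nx (nx i) = pv i" "i < 3 \<Longrightarrow> pv (pv i) = nx i"
  and nx_simps: "nx 0 = Suc 0" "nx (Suc 0) = 2" "nx 2 = 0" "pv 0 = 2" "pv (Suc 0) = 0" "pv 2 = Suc 0"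
proof -
  show *: "nx 0 = Suc 0" "nx (Suc 0) = 2" "nx 2 = 0" "pv 0 = 2" "pv (Suc 0) = 0" "pv 2 = Suc 0" by (auto simp: nx_def pv_def)
  have "i = 0 \<or> i = Suc 0 \<or> i = 2" if "i < 3" using that by auto
  then show "i < 3 \<Longrightarrow> nx i < 3" "i < 3 \<Longrightarrow> pv i < 3" "i < 3 \<Longrightarrow> nx (pv i) = i" "i < 3 \<Longrightarrow> pv (nx i) = i"
    "i < 3 \<Longrightarrow> nx i \<noteq> i" "i < 3 \<Longrightarrow> pv i \<noteq> i" "i < 3 \<Longrightarrow> nx i \<noteq> pv i" "i < 3 \<Longrightarrow> nx (nx i) = pv i" "i < 3 \<Longrightarrow> pv (pv i) = nx i"
    using * by fastforce+
qed

context jordan_sides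
begin

lemma L_nx: "i < 3 \<Longrightarrow> g (L (nx i)) = g (L (Suc i))"
  unfolding three using g01 L_order L0 by (auto simp: nx_simps)

lemma adjacent_sides:
  assumes i: "i < 3" and u: "u \<in> {L i..L (Suc i)}" and v: "v \<in> {L (nx i)..L (Suc (nx i))}" and e: "g u = g v"
  shows "u = L (Suc i) \<and> v = L (nx i)"
proof -
  have uv: "u \<in> {0..1}" "v \<in> {0..1}" using u v L_range[OF i] L_range[OF nx_pv(1)[OF i]] by auto
  then have c: "u = v \<or> (u = 0 \<and> v = 1) \<or> (u = 1 \<and> v = 0)" using g_inj e by blast
  from i consider "i = 0" | "i = Suc 0" | "i = 2" by (auto simp: three)
  then show ?thesis using c u v L_order L0 by cases (auto simp: nx_simps)
qed

lemma corner_opposite: "i < 3 \<Longrightarrow> g (L (Suc i)) \<notin> side (pv i)"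
proof
  assume i: "i < 3" and "g (L (Suc i)) \<in> side (pv i)"
  then obtain v where v: "v \<in> {L (pv i)..L (Suc (pv i))}" "g (L (Suc i)) = g v" unfolding side_def by auto
  have uv: "L (Suc i) \<in> {0..1}" "v \<in> {0..1}" using v(1) L_range[OF i] L_range[OF nx_pv(2)[OF i]] L_less[OF i] by auto
  then have c: "L (Suc i) = v \<or> (L (Suc i) = 0 \<and> v = 1) \<or> (L (Suc i) = 1 \<and> v = 0)" using g_inj v(2) by blast
  from i consider "i = 0" | "i = Suc 0" | "i = 2" by (auto simp: three)
  then show False using c v(1) L_order L0 by cases (auto simp: nx_simps)
qed

text \<open>Taking a closest pair as the new ends keeps the segment between them from meeting the
  remaining parts of the two adjacent sides.\<close>

lemma trim_corner:
  assumes i: "i < 3" and e: "0 < e" "e \<le> L (Suc i) - L i" "e \<le> L (Suc (nx i)) - L (nx i)"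
  shows "\<exists>x y. 0 < x \<and> x < e \<and> 0 < y \<and> y < e \<and>
    (\<forall>u\<in>{L i..L (Suc i) - x}. \<forall>v\<in>{L (nx i) + y..L (Suc (nx i))}. dist (g (L (Suc i) - x)) (g (L (nx i) + y)) \<le> dist (g u) (g v))"
proof -
  have j: "nx i < 3" using nx_pv i by blast
  let ?p = "\<lambda>x. g (L (Suc i) - x)" and ?q = "\<lambda>y. g (L (nx i) + y)"
  let ?c = "L (Suc i) - L i" and ?c' = "L (Suc (nx i)) - L (nx i)"
  obtain x y where xy: "0 < x" "x < e" "0 < y" "y < e"
    "\<And>x' y'. x' \<in> {x..?c} \<Longrightarrow> y' \<in> {y..?c'} \<Longrightarrow> dist (?p x) (?q y) \<le> dist (?p x') (?q y')"
  proof (rule closest_pair_near_corner[of ?c ?c' ?p ?q e])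
    show "0 < ?c" "0 < ?c'" using L_less i j by auto
    show "continuous_on {0..?c} ?p"
      by (rule continuous_on_compose2[OF cts_g]) (use L_range[OF i] in \<open>auto intro!: continuous_intros\<close>)
    show "continuous_on {0..?c'} ?q"
      by (rule continuous_on_compose2[OF cts_g]) (use L_range[OF j] in \<open>auto intro!: continuous_intros\<close>)
    show "?p 0 = ?q 0" using L_nx[OF i] by simp
    show "x = 0 \<and> y = 0" if "x \<in> {0..?c}" "y \<in> {0..?c'}" "?p x = ?q y" for x y
      using adjacent_sides[OF i, of "L (Suc i) - x" "L (nx i) + y"] that by auto
  qed (use e in auto)
  have "dist (?p x) (?q y) \<le> dist (g u) (g v)" if "u \<in> {L i..L (Suc i) - x}" "v \<in> {L (nx i) + y..L (Suc (nx i))}" for u v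
    using xy(5)[of "L (Suc i) - u" "v - L (nx i)"] that by auto
  then show ?thesis using xy by blast
qed

lemma trimmed_exists:
  assumes "0 < \<eta>"
  obtains a b \<rho> where "0 < \<rho>" "2 * \<rho> \<le> \<eta>" "\<And>i. i < 3 \<Longrightarrow> L i < a i \<and> a i < b i \<and> b i < L (Suc i)"
    "\<And>i x. i < 3 \<Longrightarrow> x \<in> {L i..a i} \<Longrightarrow> dist (g x) (g (a i)) \<le> \<rho>"
    "\<And>i x. i < 3 \<Longrightarrow> x \<in> {b i..L (Suc i)} \<Longrightarrow> dist (g x) (g (b i)) \<le> \<rho>"
    "\<And>i u v. \<lbrakk>i < 3; u \<in> {L i..b i}; v \<in> {a (nx i)..L (Suc (nx i))}\<rbrakk> \<Longrightarrow> dist (g (b i)) (g (a (nx i))) \<le> dist (g u) (g v)"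
    "\<And>i z. i < 3 \<Longrightarrow> z \<in> side (pv i) \<Longrightarrow> 4 * \<rho> < dist (g (L (Suc i))) z"
proof -
  define D where "D i = infdist (g (L (Suc i))) (side (pv i))" for i
  have D: "0 < D i" if "i < 3" for i
  proof -
    have "side (pv i) \<noteq> {}" unfolding side_def using L_less[of "pv i"] nx_pv(2)[OF that] by auto
    moreover have "closed (side (pv i))" using compact_side nx_pv(2)[OF that] compact_imp_closed by blast
    ultimately show ?thesis unfolding D_def
      using corner_opposite[OF that] by (metis in_closed_iff_infdist_zero infdist_nonneg less_eq_real_def)
  qed
  \<comment> \<open>\<open>D i\<close> is the distance from the end of side i to the opposite side;
    the divisor 8 makes 4 * \<rho> strictly smaller than each of them.\<close>
  define \<rho> where "\<rho> = Min {\<eta> / 2, D 0 / 8, D 1 / 8, D 2 / 8}"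
  have \<rho>: "0 < \<rho>" "\<rho> \<le> \<eta> / 2" "i < 3 \<Longrightarrow> \<rho> \<le> D i / 8" for i
    using assms D[of 0] D[of 1] D[of 2] unfolding \<rho>_def three by auto
  have "uniformly_continuous_on {0..1} g" using cts_g by (intro compact_uniformly_continuous) auto
  then obtain d where d: "d > 0" "\<And>x y. x \<in> {0..1} \<Longrightarrow> y \<in> {0..1} \<Longrightarrow> dist y x < d \<Longrightarrow> dist (g y) (g x) < \<rho>"
    unfolding uniformly_continuous_on_def using \<rho>(1) by metis
  \<comment> \<open>At each end of a side a parameter interval shorter than e is removed. On it the
    curve moves by less than \<rho>, and each side has parameter length at least 2 * e, so that a
    middle part remains.\<close>
  define e where "e = Min {d, L (Suc 0) / 2, (L 2 - L (Suc 0)) / 2, (1 - L 2) / 2}"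
  have e': "e \<le> d" "e \<le> L (Suc 0) / 2" "e \<le> (L 2 - L (Suc 0)) / 2" "e \<le> (1 - L 2) / 2" unfolding e_def by (rule Min_le; simp)+
  have e: "0 < e" "e \<le> d" "i < 3 \<Longrightarrow> 2 * e \<le> L (Suc i) - L i" for i
  proof -
    show "0 < e" using d(1) L_order unfolding e_def by simp
    show "i < 3 \<Longrightarrow> 2 * e \<le> L (Suc i) - L i" unfolding three using e'(2-4) L_order L0 by auto
  qed (rule e'(1))
  have le: "e \<le> L (Suc i) - L i" if "i < 3" for i using e(3)[OF that] e(1) by linarith
  obtain x y where xy: "\<And>i. i < 3 \<Longrightarrow> 0 < x i \<and> x i < e \<and> 0 < y i \<and> y i < e \<and>
    (\<forall>u\<in>{L i..L (Suc i) - x i}. \<forall>v\<in>{L (nx i) + y i..L (Suc (nx i))}. dist (g (L (Suc i) - x i)) (g (L (nx i) + y i)) \<le> dist (g u) (g v))"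
    using trim_corner[OF _ e(1) le le] nx_pv(1) by metis
  define a b where "a i = L i + y (pv i)" and "b i = L (Suc i) - x i" for i
  have ab: "L i < a i" "a i < L i + e" "L (Suc i) - e < b i" "b i < L (Suc i)" "L i < b i" "a i < b i" "a i < L (Suc i)" if "i < 3" for i
    using xy[OF that] xy[OF nx_pv(2)[OF that]] e(3)[OF that] L_less[OF that] unfolding a_def b_def by (linarith | force)+
  show thesis
  proof (rule that[of \<rho> a b])
    show "0 < \<rho>" "2 * \<rho> \<le> \<eta>" using \<rho> by auto
    show "L i < a i \<and> a i < b i \<and> b i < L (Suc i)" if "i < 3" for i using ab[OF that] by simp
    show "dist (g x) (g (a i)) \<le> \<rho>" if "i < 3" "x \<in> {L i..a i}" for i x
      using ab[OF that(1)] that(2) L_range[OF that(1)] e(2) by (intro less_imp_le d(2)) (auto simp: dist_real_def)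
    show "dist (g x) (g (b i)) \<le> \<rho>" if "i < 3" "x \<in> {b i..L (Suc i)}" for i x
      using ab[OF that(1)] that(2) L_range[OF that(1)] e(2) by (intro less_imp_le d(2)) (auto simp: dist_real_def)
    show "dist (g (b i)) (g (a (nx i))) \<le> dist (g u) (g v)" if "i < 3" "u \<in> {L i..b i}" "v \<in> {a (nx i)..L (Suc (nx i))}" for i u v
      using xy[OF that(1)] that(2,3) nx_pv(4)[OF that(1)] unfolding a_def b_def by auto
    show "4 * \<rho> < dist (g (L (Suc i))) z" if "i < 3" "z \<in> side (pv i)" for i z
      using \<rho>(3)[OF that(1)] D[OF that(1)] infdist_le[OF that(2), of "g (L (Suc i))"] unfolding D_def by linarith
  qed
qed

end

section \<open>Fattened sides and the curve with cut corners\<close>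

locale trimmed = jordan_sides +
  fixes a b :: "nat \<Rightarrow> real" and \<rho> :: real
  assumes \<rho>0: "0 < \<rho>"
    and ab: "i < 3 \<Longrightarrow> L i < a i \<and> a i < b i \<and> b i < L (Suc i)"
    and near_a: "i < 3 \<Longrightarrow> x \<in> {L i..a i} \<Longrightarrow> dist (g x) (g (a i)) \<le> \<rho>"
    and near_b: "i < 3 \<Longrightarrow> x \<in> {b i..L (Suc i)} \<Longrightarrow> dist (g x) (g (b i)) \<le> \<rho>"
    and closest: "\<lbrakk>i < 3; u \<in> {L i..b i}; v \<in> {a (nx i)..L (Suc (nx i))}\<rbrakk> \<Longrightarrow>
       dist (g (b i)) (g (a (nx i))) \<le> dist (g u) (g v)"
    and opposite_far: "i < 3 \<Longrightarrow> z \<in> side (pv i) \<Longrightarrow> 4 * \<rho> < dist (g (L (Suc i))) z"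
begin

definition gap :: "nat \<Rightarrow> real" where "gap i = dist (g (b i)) (g (a (nx i)))"
text \<open>The middle of the segment that replaces the corner after side i; \<open>ms i\<close> is
  the one of the corner before it.\<close>

definition me :: "nat \<Rightarrow> complex" where "me i = midpoint (g (b i)) (g (a (nx i)))"
definition ms :: "nat \<Rightarrow> complex" where "ms i = me (pv i)"
definition trim :: "nat \<Rightarrow> complex set" where "trim i = g ` {a i..b i}"
text \<open>At most half the distance to the other trimmed sides, so that discs around different
  sides do not overlap. At the two ends of a removed corner it is exactly half the gap, and the two
  discs there touch at the middle of the segment. The bound \<rho> keeps the thickening
  small.\<close>

definition rad :: "nat \<Rightarrow> real \<Rightarrow> real" where
  "rad i t = min \<rho> (infdist (g t) (trim (nx i) \<union> trim (pv i)) / 2)"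
definition fat :: "nat \<Rightarrow> complex set" where "fat i = (\<Union>t\<in>{a i..b i}. cball (g t) (rad i t))"
text \<open>The trimmed side prolonged at both ends to the middle of the segment that replaces the
  corner, where the adjacent side takes over.\<close>

definition cut :: "nat \<Rightarrow> real \<Rightarrow> complex" where
  "cut i x = (if x < a i then linepath (ms i) (g (a i)) ((x - L i) / (a i - L i))
     else if x \<le> b i then g x else linepath (g (b i)) (me i) ((x - b i) / (L (Suc i) - b i)))"
definition G :: "real \<Rightarrow> complex" where
  "G x = (if x \<le> L 1 then cut 0 x else if x \<le> L 2 then cut 1 x else cut 2 x)"

lemma ab_range: "i < 3 \<Longrightarrow> {a i..b i} \<subseteq> {L i<..<L (Suc i)}" "i < 3 \<Longrightarrow> {a i..b i} \<subseteq> {0..1}"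
  using ab[of i] L_range[of i] by auto

lemma trim_side: "i < 3 \<Longrightarrow> trim i \<subseteq> oside i" "trim i \<subseteq> side i" if "i < 3"
  using ab_range(1)[OF that] oside_side[of i] unfolding trim_def oside_def by auto

lemma compact_trim: "i < 3 \<Longrightarrow> compact (trim i)"
  unfolding trim_def by (intro compact_continuous_image continuous_on_subset[OF cts_g ab_range(2)]) auto

lemma trim_ne: "i < 3 \<Longrightarrow> trim i \<noteq> {}" using ab[of i] by (auto simp: trim_def)

lemma gap_pos: "i < 3 \<Longrightarrow> 0 < gap i"
proof -
  assume i: "i < 3"
  have j: "nx i < 3" using nx_pv i by blast
  have "g (b i) \<in> oside i" "g (a (nx i)) \<in> side (nx i)"
    unfolding oside_def side_def using ab[OF i] ab[OF j] by auto
  then have "g (b i) \<noteq> g (a (nx i))" using oside_disjoint[OF i j nx_pv(5)[OF i, symmetric]] by auto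
  then show ?thesis by (simp add: gap_def)
qed

lemma gap_le: "i < 3 \<Longrightarrow> gap i \<le> 2 * \<rho>"
proof -
  assume i: "i < 3"
  have j: "nx i < 3" using nx_pv i by blast
  have "dist (g (L (Suc i))) (g (b i)) \<le> \<rho>" using near_b[OF i] ab[OF i] by simp
  moreover have "dist (g (L (nx i))) (g (a (nx i))) \<le> \<rho>" using near_a[OF j] ab[OF j] by simp
  ultimately show ?thesis unfolding gap_def L_nx[OF i]
    by (metis add_mono dist_commute dist_triangle2 mult_2 order_trans)
qed

lemma me_dist: "dist (me i) (g (b i)) = gap i / 2" "dist (me i) (g (a (nx i))) = gap i / 2"
  unfolding me_def gap_def by (auto simp: dist_midpoint dist_commute)

lemma corner_far: "i < 3 \<Longrightarrow> z \<in> side (pv i) \<Longrightarrow> 3 * \<rho> < dist (g (b i)) z"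
  "i < 3 \<Longrightarrow> z \<in> side (pv i) \<Longrightarrow> 3 * \<rho> < dist (g (a (nx i))) z"
proof -
  assume i: "i < 3" and z: "z \<in> side (pv i)"
  have j: "nx i < 3" using nx_pv i by blast
  have "dist (g (L (Suc i))) (g (b i)) \<le> \<rho>" using near_b[OF i] ab[OF i] by simp
  then show "3 * \<rho> < dist (g (b i)) z" using opposite_far[OF i z] dist_triangle[of "g (L (Suc i))" z "g (b i)"] by linarith
  have "dist (g (L (Suc i))) (g (a (nx i))) \<le> \<rho>" using near_a[OF j, of "L (nx i)"] ab[OF j] unfolding L_nx[OF i] by simp
  then show "3 * \<rho> < dist (g (a (nx i))) z" using opposite_far[OF i z] dist_triangle[of "g (L (Suc i))" z "g (a (nx i))"] by linarith
qed

lemma trim_disjoint: "i < 3 \<Longrightarrow> j < 3 \<Longrightarrow> i \<noteq> j \<Longrightarrow> trim i \<inter> trim j = {}"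
  using trim_side[of i] trim_side[of j] oside_disjoint[of i j] by blast

lemma others: "i < 3 \<Longrightarrow> j < 3 \<Longrightarrow> j \<noteq> i \<longleftrightarrow> j = nx i \<or> j = pv i"
  unfolding three by (elim disjE) (auto simp: nx_simps)

lemma rad_pos: "i < 3 \<Longrightarrow> t \<in> {a i..b i} \<Longrightarrow> 0 < rad i t"
proof -
  assume i: "i < 3" and t: "t \<in> {a i..b i}"
  let ?T = "trim (nx i) \<union> trim (pv i)"
  have j: "nx i < 3" "pv i < 3" using nx_pv i by auto
  have "g t \<in> trim i" using t by (simp add: trim_def)
  then have "g t \<notin> ?T" using trim_disjoint[OF i] j nx_pv i by (metis IntI UnE empty_iff)
  moreover have "closed ?T" "?T \<noteq> {}" using compact_trim trim_ne j by (auto intro: compact_imp_closed)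
  ultimately have "infdist (g t) ?T > 0" by (metis in_closed_iff_infdist_zero infdist_nonneg less_eq_real_def)
  then show ?thesis using \<rho>0 by (simp add: rad_def)
qed

lemma rad_dist:
  assumes "i < 3" "j < 3" "i \<noteq> j" "t \<in> {a i..b i}" "u \<in> {a j..b j}"
  shows "2 * rad i t \<le> dist (g t) (g u)"
proof -
  have "g u \<in> trim (nx i) \<union> trim (pv i)" using others[OF assms(1,2)] assms by (auto simp: trim_def)
  from infdist_le[OF this, of "g t"] show ?thesis unfolding rad_def by linarith
qed

lemma rad_eq:
  assumes i: "i < 3" "j < 3" "k < 3" "{j, k} = {nx i, pv i}" and w: "w \<in> trim j" and d: "dist (g t) w \<le> 2 * \<rho>"
    and near: "\<And>v. v \<in> {a j..b j} \<Longrightarrow> dist (g t) w \<le> dist (g t) (g v)"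
    and far: "\<And>z. z \<in> side k \<Longrightarrow> 3 * \<rho> < dist (g t) z"
  shows "rad i t = dist (g t) w / 2"
proof -
  let ?T = "trim j \<union> trim k"
  have T: "trim (nx i) \<union> trim (pv i) = ?T" using i(4) by (auto simp: doubleton_eq_iff)
  have ne: "?T \<noteq> {}" using w by auto
  have "dist (g t) w \<le> dist (g t) z" if "z \<in> ?T" for z
  proof (cases "z \<in> trim j")
    case True then show ?thesis using near unfolding trim_def by auto
  next
    case False
    then have "z \<in> side k" using that trim_side[OF i(3)] i(3) by blast
    then show ?thesis using far[of z] d \<rho>0 by linarith
  qed
  then have "dist (g t) w \<le> infdist (g t) ?T" unfolding infdist_notempty[OF ne] by (rule cINF_greatest[OF ne])
  moreover have "infdist (g t) ?T \<le> dist (g t) w" using w by (intro infdist_le) auto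
  ultimately show ?thesis using d unfolding rad_def T by simp
qed

lemma rad_b: "i < 3 \<Longrightarrow> rad i (b i) = gap i / 2"
proof -
  assume i: "i < 3"
  have j: "nx i < 3" "pv i < 3" using nx_pv i by auto
  show ?thesis unfolding gap_def
  proof (rule rad_eq[OF i j refl])
    show "g (a (nx i)) \<in> trim (nx i)" using ab[OF j(1)] by (auto simp: trim_def)
    show "dist (g (b i)) (g (a (nx i))) \<le> dist (g (b i)) (g v)" if "v \<in> {a (nx i)..b (nx i)}" for v
      using closest[OF i, of "b i" v] ab[OF i] ab[OF j(1)] that by auto
  qed (use corner_far(1)[OF i] gap_le[OF i] in \<open>auto simp: gap_def\<close>)
qed

lemma rad_a: "i < 3 \<Longrightarrow> rad (nx i) (a (nx i)) = gap i / 2"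
proof -
  assume i: "i < 3"
  have j: "nx i < 3" "pv i < 3" using nx_pv i by auto
  show ?thesis unfolding gap_def dist_commute[of "g (b i)"]
  proof (rule rad_eq[OF j(1) i j(2)])
    show "{i, pv i} = {nx (nx i), pv (nx i)}" using nx_pv i by auto
    show "g (b i) \<in> trim i" using ab[OF i] by (auto simp: trim_def)
    show "dist (g (a (nx i))) (g (b i)) \<le> dist (g (a (nx i))) (g v)" if "v \<in> {a i..b i}" for v
      using closest[OF i, of v "a (nx i)"] ab[OF i] ab[OF j(1)] that by (auto simp: dist_commute)
  qed (use corner_far(2)[OF i] gap_le[OF i] in \<open>auto simp: gap_def dist_commute\<close>)
qed

lemma rad_le: "rad i t \<le> \<rho>" by (simp add: rad_def)

lemma fat_ball: "t \<in> {a i..b i} \<Longrightarrow> cball (g t) (rad i t) \<subseteq> fat i"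
  by (auto simp: fat_def)

lemma fat_star: "i < 3 \<Longrightarrow> z \<in> fat i \<Longrightarrow> \<exists>t\<in>{a i..b i}. 0 < rad i t \<and> z \<in> cball (g t) (rad i t) \<and> cball (g t) (rad i t) \<subseteq> fat i"
  using rad_pos fat_ball unfolding fat_def by blast

lemma fat_apart: "i < 3 \<Longrightarrow> j < 3 \<Longrightarrow> i \<noteq> j \<Longrightarrow> interior (fat i) \<inter> fat j = {}"
proof (rule ccontr)
  assume ij: "i < 3" "j < 3" "i \<noteq> j" and "interior (fat i) \<inter> fat j \<noteq> {}"
  then obtain z u where z: "z \<in> interior (fat i)" "u \<in> {a j..b j}" "0 < rad j u" "z \<in> cball (g u) (rad j u)"
    using fat_star[OF ij(2)] by blast
  have "z \<in> closure (ball (g u) (rad j u))" using z by simp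
  then obtain z' where z': "z' \<in> interior (fat i)" "z' \<in> ball (g u) (rad j u)"
    using z(1) open_interior open_Int_closure_eq_empty[of "interior (fat i)" "ball (g u) (rad j u)"] by blast
  then obtain t where t: "t \<in> {a i..b i}" "z' \<in> cball (g t) (rad i t)"
    using interior_subset unfolding fat_def by blast
  have "dist (g t) (g u) < rad i t + rad j u" using z' t dist_triangle_less_add[of "g t" z' "rad i t" "g u"]
    dist_triangle[of "g t" "g u" z'] by (simp add: dist_commute)
  moreover have "2 * rad i t \<le> dist (g t) (g u)" "2 * rad j u \<le> dist (g t) (g u)"
    using rad_dist[OF ij t(1) z(2)] rad_dist[OF ij(2,1) _ z(2) t(1)] ij by (auto simp: dist_commute)
  ultimately show False by linarith
qed

lemma compact_fat: "i < 3 \<Longrightarrow> compact (fat i)"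
proof -
  assume i: "i < 3"
  have cg: "continuous_on {a i..b i} g" using continuous_on_subset[OF cts_g ab_range(2)[OF i]] .
  have cr: "continuous_on {a i..b i} (rad i)" unfolding rad_def by (intro continuous_intros cg) auto
  have e: "fat i = (\<lambda>(t, w). g t + of_real (rad i t) * w) ` ({a i..b i} \<times> cball 0 1)"
  proof safe
    fix z assume "z \<in> fat i"
    then obtain t where t: "t \<in> {a i..b i}" "0 < rad i t" "z \<in> cball (g t) (rad i t)" using fat_star[OF i] by blast
    then have "(z - g t) / of_real (rad i t) \<in> cball 0 1" by (simp add: norm_divide dist_norm norm_minus_commute)
    moreover have "z = g t + of_real (rad i t) * ((z - g t) / of_real (rad i t))" using t by simp
    ultimately show "z \<in> (\<lambda>(t, w). g t + of_real (rad i t) * w) ` ({a i..b i} \<times> cball 0 1)"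
      using t(1) by (intro image_eqI[of _ _ "(t, (z - g t) / of_real (rad i t))"]) auto
  next
    fix t :: real and w :: complex assume t: "t \<in> {a i..b i}" "w \<in> cball 0 1"
    have "dist (g t) (g t + of_real (rad i t) * w) \<le> rad i t"
      using rad_pos[OF i t(1)] t(2) by (simp add: dist_norm norm_mult mult_left_le)
    then show "g t + of_real (rad i t) * w \<in> fat i" using fat_ball[OF t(1)] by auto
  qed
  have c: "continuous_on ({a i..b i} \<times> cball 0 1) (\<lambda>(t, w). g t + of_real (rad i t) * w)"
    unfolding case_prod_beta by (intro continuous_intros continuous_on_compose2[OF cg] continuous_on_compose2[OF cr]) auto
  show ?thesis unfolding e by (rule compact_continuous_image[OF c]) (intro compact_Times compact_Icc compact_cball)
qed

lemma cut_simps: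
  assumes "i < 3"
  shows "cut i (L i) = ms i" "cut i (L (Suc i)) = me i" "x \<in> {a i..b i} \<Longrightarrow> cut i x = g x"
  using ab[OF assms] by (auto simp: cut_def linepath_def)

lemma continuous_cut: "i < 3 \<Longrightarrow> continuous_on {L i..L (Suc i)} (cut i)"
proof -
  assume i: "i < 3"
  note ab = ab[OF i]
  have 1: "continuous_on {L i..a i} (\<lambda>x. linepath (ms i) (g (a i)) ((x - L i) / (a i - L i)))"
    unfolding linepath_def using ab by (intro continuous_intros) auto
  have 2: "continuous_on {a i..b i} g" using continuous_on_subset[OF cts_g ab_range(2)[OF i]] .
  have 3: "continuous_on {b i..L (Suc i)} (\<lambda>x. linepath (g (b i)) (me i) ((x - b i) / (L (Suc i) - b i)))"
    unfolding linepath_def using ab by (intro continuous_intros) auto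
  have "continuous_on ({L i..a i} \<union> ({a i..b i} \<union> {b i..L (Suc i)})) (cut i)"
  proof (intro continuous_on_closed_Un closed_Un closed_atLeastAtMost)
    show "continuous_on {L i..a i} (cut i)" by (rule continuous_on_eq[OF 1]) (use ab in \<open>auto simp: cut_def linepath_def\<close>)
    show "continuous_on {a i..b i} (cut i)" by (rule continuous_on_eq[OF 2]) (use ab in \<open>auto simp: cut_def\<close>)
    show "continuous_on {b i..L (Suc i)} (cut i)" by (rule continuous_on_eq[OF 3]) (use ab in \<open>auto simp: cut_def linepath_def\<close>)
  qed
  moreover have "{L i..a i} \<union> ({a i..b i} \<union> {b i..L (Suc i)}) = {L i..L (Suc i)}" using ab by auto
  ultimately show ?thesis by simp
qed

lemma cut_start:
  assumes i: "i < 3" and x: "x \<in> {L i..<a i}"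
  shows "\<exists>\<mu>. 0 \<le> \<mu> \<and> \<mu> < 1 \<and> \<mu> = (x - L i) / (a i - L i) \<and> cut i x = linepath (ms i) (g (a i)) \<mu> \<and>
    dist (cut i x) (g (a i)) = (1 - \<mu>) * (gap (pv i) / 2)" "dist (cut i x) (g (b (pv i))) < gap (pv i)" "dist (cut i x) (g (a i)) \<le> gap (pv i) / 2"
proof -
  define \<mu> where "\<mu> = (x - L i) / (a i - L i)"
  have l: "0 \<le> \<mu>" "\<mu> < 1" using x unfolding \<mu>_def by (auto simp: field_simps)
  have c: "cut i x = linepath (ms i) (g (a i)) \<mu>" using x by (simp add: cut_def \<mu>_def)
  have e: "dist (ms i) (g (a i)) = gap (pv i) / 2" unfolding ms_def using me_dist(2)[of "pv i"] nx_pv(3)[OF i] by simp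
  have "cut i x - g (a i) = (1 - \<mu>) *\<^sub>R (ms i - g (a i))" unfolding c linepath_def by (simp add: algebra_simps)
  then have d: "dist (cut i x) (g (a i)) = (1 - \<mu>) * (gap (pv i) / 2)" using e l by (simp add: dist_norm)
  have m: "ms i = midpoint (g (b (pv i))) (g (a i))" unfolding ms_def me_def using nx_pv(3)[OF i] by simp
  have "cut i x - g (b (pv i)) = ((1 + \<mu>) / 2) *\<^sub>R (g (a i) - g (b (pv i)))"
    unfolding c linepath_def m midpoint_def by (simp add: scaleR_conv_of_real field_simps)
  then have "dist (cut i x) (g (b (pv i))) = (1 + \<mu>) / 2 * gap (pv i)"
    using l unfolding gap_def nx_pv(3)[OF i] by (simp add: dist_norm norm_minus_commute)
  also have "\<dots> < gap (pv i)" using l gap_pos[OF nx_pv(2)[OF i]] by simp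
  finally show "dist (cut i x) (g (b (pv i))) < gap (pv i)" .
  show "dist (cut i x) (g (a i)) \<le> gap (pv i) / 2"
    unfolding d using l gap_pos[OF nx_pv(2)[OF i]] by (intro mult_left_le_one_le) auto
  show "\<exists>\<mu>. 0 \<le> \<mu> \<and> \<mu> < 1 \<and> \<mu> = (x - L i) / (a i - L i) \<and> cut i x = linepath (ms i) (g (a i)) \<mu> \<and>
    dist (cut i x) (g (a i)) = (1 - \<mu>) * (gap (pv i) / 2)" using l c d \<mu>_def by blast
qed

lemma cut_end:
  assumes i: "i < 3" and x: "x \<in> {b i<..L (Suc i)}"
  shows "\<exists>\<mu>. 0 < \<mu> \<and> \<mu> \<le> 1 \<and> \<mu> = (x - b i) / (L (Suc i) - b i) \<and> cut i x = linepath (g (b i)) (me i) \<mu> \<and>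
    dist (cut i x) (g (b i)) = \<mu> * (gap i / 2)" "dist (cut i x) (g (a (nx i))) < gap i" "dist (cut i x) (g (b i)) \<le> gap i / 2"
proof -
  define \<mu> where "\<mu> = (x - b i) / (L (Suc i) - b i)"
  have l: "0 < \<mu>" "\<mu> \<le> 1" using x unfolding \<mu>_def by (auto simp: field_simps)
  have c: "cut i x = linepath (g (b i)) (me i) \<mu>" using x ab[OF i] by (simp add: cut_def \<mu>_def)
  have "cut i x - g (b i) = \<mu> *\<^sub>R (me i - g (b i))" unfolding c linepath_def by (simp add: algebra_simps)
  then have d: "dist (cut i x) (g (b i)) = \<mu> * (gap i / 2)" using me_dist(1)[of i] l by (simp add: dist_norm)
  have "cut i x - g (a (nx i)) = (1 - \<mu> / 2) *\<^sub>R (g (b i) - g (a (nx i)))"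
    unfolding c linepath_def me_def midpoint_def by (simp add: scaleR_conv_of_real field_simps)
  then have "dist (cut i x) (g (a (nx i))) = (1 - \<mu> / 2) * gap i"
    using l unfolding gap_def by (simp add: dist_norm)
  also have "\<dots> < gap i" using l gap_pos[OF i] by simp
  finally show "dist (cut i x) (g (a (nx i))) < gap i" .
  show "dist (cut i x) (g (b i)) \<le> gap i / 2"
    unfolding d using l gap_pos[OF i] by (intro mult_left_le_one_le) auto
  show "\<exists>\<mu>. 0 < \<mu> \<and> \<mu> \<le> 1 \<and> \<mu> = (x - b i) / (L (Suc i) - b i) \<and> cut i x = linepath (g (b i)) (me i) \<mu> \<and>
    dist (cut i x) (g (b i)) = \<mu> * (gap i / 2)" using l c d \<mu>_def by blast
qed

text \<open>Up to the middle of a corner segment a point is closer to its own end of the segment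
  than half the gap, so it lies in the open disc there; the middle itself follows by
  closure.\<close>

lemma cut_fat: "i < 3 \<Longrightarrow> x \<in> {L i<..<L (Suc i)} \<Longrightarrow> cut i x \<in> interior (fat i)"
  "i < 3 \<Longrightarrow> x \<in> {L i..L (Suc i)} \<Longrightarrow> cut i x \<in> fat i"
proof -
  assume i: "i < 3"
  have j: "pv i < 3" "nx (pv i) = i" using nx_pv i by auto
  have ball: "ball (g t) (rad i t) \<subseteq> interior (fat i)" if "t \<in> {a i..b i}" for t
    using fat_ball[OF that] by (intro interior_maximal) (auto intro: order_trans[OF ball_subset_cball])
  have A: "rad i (a i) = gap (pv i) / 2" using rad_a[OF j(1)] j by simp
  have int: "cut i x \<in> interior (fat i)" if x: "x \<in> {L i<..<L (Suc i)}" for x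
  proof -
    consider "x < a i" | "x \<in> {a i..b i}" | "b i < x" by fastforce
    then show ?thesis
    proof cases
      case 1
      then obtain \<mu> where l: "0 \<le> \<mu>" "\<mu> < 1" "\<mu> = (x - L i) / (a i - L i)" "dist (cut i x) (g (a i)) = (1 - \<mu>) * (gap (pv i) / 2)"
        using cut_start(1)[OF i, of x] x by auto
      then have "0 < \<mu>" using x 1 by simp
      then have "dist (cut i x) (g (a i)) < gap (pv i) / 2"
        unfolding l(4) using mult_strict_right_mono[of "1 - \<mu>" 1 "gap (pv i) / 2"] gap_pos[OF j(1)] by linarith
      then have "cut i x \<in> ball (g (a i)) (rad i (a i))" using A by (simp add: dist_commute)
      then show ?thesis using ball[of "a i"] ab[OF i] by auto
    next
      case 2
      then have "cut i x \<in> ball (g x) (rad i x)" using cut_simps(3)[OF i] rad_pos[OF i] by simp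
      then show ?thesis using ball[OF 2] by auto
    next
      case 3
      then have "x \<in> {b i<..L (Suc i)}" using x by auto
      then obtain \<mu> where l: "0 < \<mu>" "\<mu> \<le> 1" "\<mu> = (x - b i) / (L (Suc i) - b i)" "dist (cut i x) (g (b i)) = \<mu> * (gap i / 2)"
        using cut_end(1)[OF i] by blast
      have "\<mu> < 1" using l(3) x 3 by simp
      then have "dist (cut i x) (g (b i)) < gap i / 2"
        unfolding l(4) using mult_strict_right_mono[of \<mu> 1 "gap i / 2"] gap_pos[OF i] by linarith
      then have "cut i x \<in> ball (g (b i)) (rad i (b i))" using rad_b[OF i] by (simp add: dist_commute)
      then show ?thesis using ball[of "b i"] ab[OF i] by auto
    qed
  qed
  then show "x \<in> {L i<..<L (Suc i)} \<Longrightarrow> cut i x \<in> interior (fat i)" .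
  have "cut i ` closure {L i<..<L (Suc i)} \<subseteq> fat i"
    using closure_greaterThanLessThan[OF L_less[OF i]] continuous_cut[OF i] compact_imp_closed[OF compact_fat[OF i]]
      subsetD[OF interior_subset int] by (intro image_closure_subset) auto
  then show "cut i x \<in> fat i" if "x \<in> {L i..L (Suc i)}"
    using that closure_greaterThanLessThan[OF L_less[OF i]] by auto
qed

text \<open>A point on a half segment is closer than the gap to the far end of the whole segment,
  whereas by \<open>closest\<close> no point of the trimmed side is. The half segments at the two
  ends of a side are kept apart by \<open>corner_far\<close>.\<close>

lemma cut_inj: "i < 3 \<Longrightarrow> inj_on (cut i) {L i..L (Suc i)}"
proof (rule linorder_inj_onI)
  assume i: "i < 3"
  fix x y assume xy: "x < y" "x \<in> {L i..L (Suc i)}" "y \<in> {L i..L (Suc i)}"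
  have j: "pv i < 3" "nx (pv i) = i" "nx i < 3" using nx_pv i by auto
  have lin: "s = t" if "linepath z w s = linepath z w t" "z \<noteq> w" for z w :: complex and s t
  proof -
    have "(s - t) *\<^sub>R (w - z) = 0" using that(1) by (simp add: linepath_def algebra_simps)
    then show ?thesis using that(2) by auto
  qed
  consider "x < a i" "y < a i" | "x < a i" "y \<in> {a i..b i}" | "x < a i" "b i < y" | "x \<in> {a i..b i}" "y \<in> {a i..b i}"
    | "x \<in> {a i..b i}" "b i < y" | "b i < x" "b i < y" using xy(1) by fastforce
  then show "cut i x \<noteq> cut i y"
  proof cases
    case 1
    have ne: "ms i \<noteq> g (a i)" using me_dist(2)[of "pv i"] gap_pos[OF j(1)] j(2) unfolding ms_def by auto
    have B: "(x - L i) / (a i - L i) < (y - L i) / (a i - L i)"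
      using xy(1) ab[OF i] by (intro divide_strict_right_mono) auto
    have "x \<in> {L i..<a i}" "y \<in> {L i..<a i}" using xy 1 by auto
    then show ?thesis using cut_start(1)[OF i, of x] cut_start(1)[OF i, of y] lin[OF _ ne] B by (metis less_irrefl)
  next
    case 2
    have "dist (cut i x) (g (b (pv i))) < gap (pv i)" using cut_start(2)[OF i, of x] xy 2 by simp
    moreover have "gap (pv i) \<le> dist (g (b (pv i))) (g y)"
      using closest[OF j(1), of "b (pv i)" y] ab[OF j(1)] 2 xy(3) j(2) unfolding gap_def by auto
    ultimately show ?thesis using cut_simps(3)[OF i 2(2)] by (auto simp: dist_commute)
  next
    case 3
    have "dist (cut i x) (g (a i)) \<le> \<rho>" using cut_start(3)[OF i, of x] xy 3 gap_le[OF j(1)] by simp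
    moreover have "dist (cut i y) (g (a (nx i))) < gap i" using cut_end(2)[OF i, of y] xy 3 by simp
    moreover have "3 * \<rho> < dist (g (a i)) (g (a (nx i)))"
      using corner_far(2)[OF j(1), of "g (a (nx i))"] j nx_pv(9)[OF i] ab[OF j(3)] by (auto simp: side_def)
    ultimately show ?thesis using gap_le[OF i] dist_triangle[of "g (a i)" "g (a (nx i))" "cut i x"] by (auto simp: dist_commute)
  next
    case 4
    then show ?thesis using cut_simps(3)[OF i] g_open_eq[of x y] open_param[OF i, of x] ab_range[OF i] xy(1) by fastforce
  next
    case 5
    have "dist (cut i y) (g (a (nx i))) < gap i" using cut_end(2)[OF i, of y] xy 5 by simp
    moreover have "gap i \<le> dist (g x) (g (a (nx i)))"
      using closest[OF i, of x "a (nx i)"] ab[OF j(3)] 5 xy(2) unfolding gap_def by auto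
    ultimately show ?thesis using cut_simps(3)[OF i 5(1)] by auto
  next
    case 6
    have ne: "g (b i) \<noteq> me i" using me_dist(1)[of i] gap_pos[OF i] by auto
    have B: "(x - b i) / (L (Suc i) - b i) < (y - b i) / (L (Suc i) - b i)"
      using xy(1) ab[OF i] by (intro divide_strict_right_mono) auto
    have "x \<in> {b i<..L (Suc i)}" "y \<in> {b i<..L (Suc i)}" using xy 6 by auto
    then show ?thesis using cut_end(1)[OF i, of x] cut_end(1)[OF i, of y] lin[OF _ ne] B by (metis less_irrefl)
  qed
qed auto

lemma G_cut: "i < 3 \<Longrightarrow> x \<in> {L i..L (Suc i)} \<Longrightarrow> G x = cut i x"
proof -
  assume i: "i < 3" and x: "x \<in> {L i..L (Suc i)}"
  have e: "cut 0 (L (Suc 0)) = cut (Suc 0) (L (Suc 0))" "cut (Suc 0) (L 2) = cut 2 (L 2)"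
    using cut_simps(1)[of "Suc 0"] cut_simps(2)[of 0] cut_simps(1)[of 2] cut_simps(2)[of "Suc 0"] L_order
    by (simp_all add: ms_def nx_simps)
  from i consider "i = 0" | "i = Suc 0" | "i = 2" by (auto simp: three)
  then show ?thesis using x L_order e unfolding G_def by cases auto
qed

lemma G_side: "i < 3 \<Longrightarrow> G ` {L i..L (Suc i)} \<subseteq> fat i" "i < 3 \<Longrightarrow> G ` {L i<..<L (Suc i)} \<subseteq> interior (fat i)"
  using cut_fat[of i] G_cut[of i] by auto

lemma param_cases: "x \<in> {0..1} \<Longrightarrow> \<exists>i<3. x \<in> {L i..L (Suc i)} \<and> (x = L i \<or> x \<in> {L i<..<L (Suc i)} \<or> x = 1)"
proof -
  assume x: "x \<in> {0..1}"
  consider "x < L (Suc 0)" | "L (Suc 0) \<le> x" "x < L 2" | "L 2 \<le> x" by linarith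
  then show ?thesis
  proof cases
    case 1 then show ?thesis using x L0 by (intro exI[of _ 0]) auto
  next
    case 2 then show ?thesis using L_order by (intro exI[of _ "Suc 0"]) auto
  next
    case 3 then show ?thesis using x L_order by (intro exI[of _ 2]) auto
  qed
qed

lemma ms_distinct: "i < 3 \<Longrightarrow> j < 3 \<Longrightarrow> i \<noteq> j \<Longrightarrow> ms i \<noteq> ms j"
proof -
  have "ms i \<noteq> me i" if i: "i < 3" for i
    using inj_onD[OF cut_inj[OF i], of "L i" "L (Suc i)"] cut_simps[OF i] L_less[OF i] by fastforce
  then have "ms 0 \<noteq> ms (Suc 0)" "ms (Suc 0) \<noteq> ms 2" "ms 2 \<noteq> ms 0" unfolding ms_def nx_simps
    by (metis nx_simps(4-6) numeral_2_eq_2 numeral_3_eq_3 lessI less_Suc_eq)+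
  then show "i < 3 \<Longrightarrow> j < 3 \<Longrightarrow> i \<noteq> j \<Longrightarrow> ms i \<noteq> ms j" unfolding three by auto
qed

text \<open>The interior of a fat side misses the other fat sides, so points of different sides
  could coincide only at the middles of the corner segments, and these are distinct.\<close>

lemma G_inj:
  assumes "x \<in> {0..<1}" "y \<in> {0..<1}" "G x = G y"
  shows "x = y"
proof -
  obtain i where i: "i < 3" "x \<in> {L i..L (Suc i)}" "x = L i \<or> x \<in> {L i<..<L (Suc i)}" using param_cases[of x] assms(1) by force
  obtain j where j: "j < 3" "y \<in> {L j..L (Suc j)}" "y = L j \<or> y \<in> {L j<..<L (Suc j)}" using param_cases[of y] assms(2) by force
  show ?thesis
  proof (cases "i = j")
    case True
    then show ?thesis using inj_onD[OF cut_inj[OF i(1)], of x y] G_cut i j assms(3) by auto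
  next
    case False
    have "G x \<in> fat i" "G y \<in> fat j" using G_side i j by blast+
    then have "x = L i" "y = L j" using G_side(2)[OF i(1)] G_side(2)[OF j(1)] i(3) j(3) assms(3)
      fat_apart[OF i(1) j(1) False] fat_apart[OF j(1) i(1) False[symmetric]] by (metis IntI empty_iff image_subset_iff)+
    then have "ms i = ms j" using assms(3) G_cut[OF i(1,2)] G_cut[OF j(1,2)] cut_simps i(1) j(1) by simp
    then show ?thesis using ms_distinct[OF i(1) j(1) False] by blast
  qed
qed

lemma G01: "G 1 = G 0"
  using G_cut[of 2 1] G_cut[of 0 0] cut_simps(2)[of 2] cut_simps(1)[of 0] L_order L0 by (simp add: ms_def nx_simps)

lemma jordan_G: "jordan_sides G L"
proof
  have "continuous_on ({L 0..L (Suc 0)} \<union> ({L (Suc 0)..L 2} \<union> {L 2..1})) G"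
  proof (intro continuous_on_closed_Un closed_Un closed_atLeastAtMost)
    have "continuous_on {L i..L (Suc i)} G" if "i < 3" for i
      by (rule continuous_on_eq[OF continuous_cut[OF that]]) (rule G_cut[OF that, symmetric])
    from this[of 0] this[of "Suc 0"] this[of 2]
    show "continuous_on {L 0..L (Suc 0)} G" "continuous_on {L (Suc 0)..L 2} G" "continuous_on {L 2..1} G" using L_order by auto
  qed
  moreover have "{L 0..L (Suc 0)} \<union> ({L (Suc 0)..L 2} \<union> {L 2..1}) = {0..1}" using L_order L0 by auto
  ultimately have "path G" by (simp add: path_def)
  moreover have "loop_free G" unfolding loop_free_def
  proof (intro ballI impI)
    fix x y :: real assume xy: "x \<in> {0..1}" "y \<in> {0..1}" "G x = G y"
    show "x = y \<or> x = 0 \<and> y = 1 \<or> x = 1 \<and> y = 0"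
    proof (cases "x = 1"; cases "y = 1")
      assume "x = 1" "y \<noteq> 1" then show ?thesis using G_inj[of 0 y] xy G01 by auto
    next
      assume "x \<noteq> 1" "y = 1" then show ?thesis using G_inj[of x 0] xy G01 by auto
    next
      assume "x \<noteq> 1" "y \<noteq> 1" then show ?thesis using G_inj[of x y] xy by auto
    qed auto
  qed
  ultimately show "simple_path G" by (simp add: simple_path_def)
  show "pathfinish G = pathstart G" using G01 by (simp add: pathfinish_def pathstart_def)
qed (use L0 L3 L_less in auto)

lemma G_near: "x \<in> {0..1} \<Longrightarrow> dist (G x) (g x) \<le> 2 * \<rho>"
proof -
  assume "x \<in> {0..1}"
  then obtain i where i: "i < 3" "x \<in> {L i..L (Suc i)}" using param_cases by blast
  have j: "pv i < 3" using nx_pv i by auto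
  consider "x < a i" | "x \<in> {a i..b i}" | "b i < x" by fastforce
  then show ?thesis
  proof cases
    case 1
    have "dist (cut i x) (g (a i)) \<le> \<rho>" using cut_start(3)[OF i(1), of x] i 1 gap_le[OF j] by simp
    moreover have "dist (g x) (g (a i)) \<le> \<rho>" using near_a[OF i(1), of x] i 1 by simp
    ultimately show ?thesis unfolding G_cut[OF i] using dist_triangle2[of "cut i x" "g x" "g (a i)"] by linarith
  next
    case 2 then show ?thesis using G_cut[OF i] cut_simps(3)[OF i(1)] \<rho>0 by simp
  next
    case 3
    have "dist (cut i x) (g (b i)) \<le> \<rho>" using cut_end(3)[OF i(1), of x] i 3 gap_le[OF i(1)] by simp
    moreover have "dist (g x) (g (b i)) \<le> \<rho>" using near_b[OF i(1), of x] i 3 by simp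
    ultimately show ?thesis unfolding G_cut[OF i] using dist_triangle2[of "cut i x" "g x" "g (b i)"] by linarith
  qed
qed

end

text \<open>The corners of the curve are cut off by segments joining closest pairs of points, so that fattening the remaining
  arcs gives sides that touch but are rounded at every point.\<close>

lemma (in jordan_sides) fat_sides_exist:
  assumes "0 < \<eta>"
  obtains G S where "jordan_sides G L" "\<And>x. x \<in> {0..1} \<Longrightarrow> dist (G x) (g x) \<le> \<eta>"
    "\<And>i. i < 3 \<Longrightarrow> compact (S i)" "\<And>i. i < 3 \<Longrightarrow> G ` {L i..L (Suc i)} \<subseteq> S i" "\<And>i. i < 3 \<Longrightarrow> G ` {L i<..<L (Suc i)} \<subseteq> interior (S i)"
    "\<And>i j. i < 3 \<Longrightarrow> j < 3 \<Longrightarrow> i \<noteq> j \<Longrightarrow> interior (S i) \<inter> S j = {}"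
    "\<And>i z. i < 3 \<Longrightarrow> z \<in> S i \<Longrightarrow> \<exists>t\<in>{L i<..<L (Suc i)}. \<exists>e>0. e \<le> \<eta> \<and> z \<in> cball (G t) e \<and> cball (G t) e \<subseteq> S i"
proof -
  obtain a b \<rho> where r: "0 < \<rho>" "2 * \<rho> \<le> \<eta>" "\<And>i. i < 3 \<Longrightarrow> L i < a i \<and> a i < b i \<and> b i < L (Suc i)"
    "\<And>i x. i < 3 \<Longrightarrow> x \<in> {L i..a i} \<Longrightarrow> dist (g x) (g (a i)) \<le> \<rho>"
    "\<And>i x. i < 3 \<Longrightarrow> x \<in> {b i..L (Suc i)} \<Longrightarrow> dist (g x) (g (b i)) \<le> \<rho>"
    "\<And>i u v. \<lbrakk>i < 3; u \<in> {L i..b i}; v \<in> {a (nx i)..L (Suc (nx i))}\<rbrakk> \<Longrightarrow> dist (g (b i)) (g (a (nx i))) \<le> dist (g u) (g v)"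
    "\<And>i z. i < 3 \<Longrightarrow> z \<in> side (pv i) \<Longrightarrow> 4 * \<rho> < dist (g (L (Suc i))) z"
    by (rule trimmed_exists[OF assms]) (rule that)
  interpret trimmed g L a b \<rho> by unfold_locales (use r in auto)
  show thesis
  proof (rule that[of G fat])
    show "jordan_sides G L" by (rule jordan_G)
    show "dist (G x) (g x) \<le> \<eta>" if "x \<in> {0..1}" for x using G_near[OF that] r(2) by linarith
    show "compact (fat i)" if "i < 3" for i using compact_fat[OF that] .
    show "G ` {L i..L (Suc i)} \<subseteq> fat i" "G ` {L i<..<L (Suc i)} \<subseteq> interior (fat i)" if "i < 3" for i using G_side[OF that] by auto
    show "interior (fat i) \<inter> fat j = {}" if "i < 3" "j < 3" "i \<noteq> j" for i j using fat_apart[OF that] .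
    show "\<exists>t\<in>{L i<..<L (Suc i)}. \<exists>e>0. e \<le> \<eta> \<and> z \<in> cball (G t) e \<and> cball (G t) e \<subseteq> fat i" if i: "i < 3" and z: "z \<in> fat i" for i z
    proof -
      obtain t where t: "t \<in> {a i..b i}" "0 < rad i t" "z \<in> cball (g t) (rad i t)" "cball (g t) (rad i t) \<subseteq> fat i"
        using fat_star[OF i z] by blast
      have t': "t \<in> {L i<..<L (Suc i)}" using t(1) ab_range[OF i] by blast
      then have "G t = g t" using G_cut[OF i, of t] cut_simps(3)[OF i t(1)] by simp
      moreover have "rad i t \<le> \<eta>" using rad_le[of i t] r(1,2) by linarith
      ultimately show ?thesis using t t' by (intro bexI[of _ t] exI[of _ "rad i t"]) auto
    qed
  qed
qed

section \<open>Blunt sets and approximating configurations\<close>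

text \<open>Here n acts as an outer unit normal: each ray from z into the open half plane opposite
  to n starts out in the interior of K. The length \<epsilon> may depend on the direction.\<close>

definition blunt :: "complex set \<Rightarrow> complex \<Rightarrow> complex \<Rightarrow> bool" where
  "blunt K z n \<longleftrightarrow> norm n = 1 \<and>
     (\<forall>d. n \<bullet> d < 0 \<longrightarrow> (\<exists>\<epsilon>>0. \<forall>t. 0 < t \<and> t < \<epsilon> \<longrightarrow> z + of_real t * d \<in> interior K))"

text \<open>Unless n' = -n, the direction -(n + n') belongs to both half planes.\<close>

lemma blunt_opposite:
  assumes "blunt K z n" "blunt K' z n'" "interior K \<inter> interior K' = {}"
  shows "n' = - n"
proof (rule ccontr)
  assume ne: "n' \<noteq> - n"
  have u: "n \<bullet> n = 1" "n' \<bullet> n' = 1" using assms by (auto simp: blunt_def norm_eq_1)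
  define d where "d = - (n + n')"
  have "0 < (n + n') \<bullet> (n + n')" using ne by (metis inner_gt_zero_iff add.commute eq_neg_iff_add_eq_0)
  then have "n \<bullet> d < 0" "n' \<bullet> d < 0" using u by (auto simp: d_def inner_add inner_diff_right inner_commute)
  then obtain e e' where e: "e > 0" "\<And>t. 0 < t \<and> t < e \<Longrightarrow> z + of_real t * d \<in> interior K"
    and e': "e' > 0" "\<And>t. 0 < t \<and> t < e' \<Longrightarrow> z + of_real t * d \<in> interior K'"
    using assms(1,2) unfolding blunt_def by meson
  define t where "t = min e e' / 2"
  have "0 < t" "t < e" "t < e'" using e(1) e'(1) by (auto simp: t_def)
  then show False using e(2)[of t] e'(2)[of t] assms(3) by blast
qed

lemma blunt_triple:
  assumes "blunt K1 z n1" "blunt K2 z n2" "blunt K3 z n3"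
    "interior K1 \<inter> interior K2 = {}" "interior K2 \<inter> interior K3 = {}" "interior K1 \<inter> interior K3 = {}"
  shows False
proof -
  have "n2 = - n1" "n3 = - n2" "n3 = - n1" using assms blunt_opposite by blast+
  then have "n1 + n1 = 0" by (metis add.inverse_inverse add.right_inverse)
  then have "n1 = 0" by simp
  then show False using assms(1) by (simp add: blunt_def)
qed

text \<open>The normal points from the centre to z; at the centre itself any unit vector
  serves.\<close>

lemma cball_blunt:
  assumes z: "z \<in> cball c r" and "cball c r \<subseteq> K" and r: "0 < r"
  shows "\<exists>n. blunt K z n"
proof -
  have int: "x \<in> interior K" if "norm (x - c) < r" for x
  proof -
    have "ball c r \<subseteq> interior K" using assms(2) by (intro interior_maximal) auto
    then show ?thesis using that by (auto simp: dist_norm norm_minus_commute)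
  qed
  define v where "v = z - c"
  have v: "norm v \<le> r" using z by (simp add: v_def dist_norm norm_minus_commute)
  define n where "n = (if v = 0 then 1 else sgn v)"
  have "\<exists>\<epsilon>>0. \<forall>t. 0 < t \<and> t < \<epsilon> \<longrightarrow> z + of_real t * d \<in> interior K" if d: "n \<bullet> d < 0" for d
  proof -
    have d0: "0 < norm d" using d by auto
    show ?thesis
    proof (cases "v = 0")
      case True
      have "z + of_real t * d \<in> interior K" if "0 < t" "t < r / norm d" for t
        by (rule int) (use True that d0 in \<open>simp add: v_def norm_mult field_simps\<close>)
      then show ?thesis using r d0 by (intro exI[of _ "r / norm d"]) auto
    next
      case False
      have vd: "v \<bullet> d < 0" using d False by (simp add: n_def sgn_div_norm mult_less_0_iff)
      \<comment> \<open>Along the ray the squared distance to c changes by 2 t (v \<bullet> d) + t^2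
        |d|^2, which is negative for 0 < t < \<epsilon>.\<close>
      define \<epsilon> where "\<epsilon> = - 2 * (v \<bullet> d) / (norm d)\<^sup>2"
      have "z + of_real t * d \<in> interior K" if t: "0 < t" "t < \<epsilon>" for t
      proof (rule int)
        have "t * (norm d)\<^sup>2 < - 2 * (v \<bullet> d)" using t(2) d0 unfolding \<epsilon>_def by (subst (asm) pos_less_divide_eq) auto
        then have "t * (t * (norm d)\<^sup>2) < t * (- 2 * (v \<bullet> d))" using t(1) by (intro mult_strict_left_mono)
        moreover have "(norm (v + t *\<^sub>R d))\<^sup>2 = (norm v)\<^sup>2 + 2 * t * (v \<bullet> d) + t * (t * (norm d)\<^sup>2)"
          by (simp only: power2_norm_eq_inner) (simp add: inner_add inner_commute algebra_simps)
        ultimately have "(norm (v + t *\<^sub>R d))\<^sup>2 < (norm v)\<^sup>2" by simp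
        then have "norm (v + t *\<^sub>R d) < norm v" by (rule power2_less_imp_less) simp
        then show "norm (z + of_real t * d - c) < r" using v by (simp add: v_def scaleR_conv_of_real algebra_simps)
      qed
      moreover have "0 < \<epsilon>" unfolding \<epsilon>_def by (rule divide_pos_pos) (use vd d0 in auto)
      ultimately show ?thesis by blast
    qed
  qed
  moreover have "norm n = 1" by (simp add: n_def norm_sgn)
  ultimately show ?thesis unfolding blunt_def by blast
qed

section \<open>Approximating configurations\<close>

definition thick :: "complex set \<Rightarrow> real \<Rightarrow> complex set" where
  "thick P \<eta> = {x + y |x y. x \<in> P \<and> y \<in> cball 0 \<eta>}"

lemma thick:
  assumes "compact P" "convex P" "0 \<in> P"
  shows "compact (thick P \<eta>)" "convex (thick P \<eta>)" "cball 0 \<eta> \<subseteq> thick P \<eta>"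
proof -
  show "compact (thick P \<eta>)" unfolding thick_def using assms by (intro compact_sums) auto
  have "thick P \<eta> = (\<Union>x\<in>P. \<Union>y\<in>cball 0 \<eta>. {x + y})" unfolding thick_def by blast
  then show "convex (thick P \<eta>)" using convex_sums[OF assms(2) convex_cball, of 0 \<eta>] by simp
  show "cball 0 \<eta> \<subseteq> thick P \<eta>" unfolding thick_def using assms(3) by force
qed

lemma subset_thick: "0 \<le> \<eta> \<Longrightarrow> P \<subseteq> thick P \<eta>" unfolding thick_def by force

lemma thick_ball:
  assumes "z \<in> hom \<beta> r (thick P \<eta>)" "0 < r"
  shows "\<exists>c. z \<in> cball c (r * \<eta>) \<and> cball c (r * \<eta>) \<subseteq> hom \<beta> r (thick P \<eta>)"
proof -
  obtain x y where xy: "x \<in> P" "norm y \<le> \<eta>" "z = of_real r * (x + y) + \<beta>" using assms unfolding hom_def thick_def by auto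
  let ?c = "of_real r * x + \<beta>"
  have "dist ?c z = r * norm y" using assms(2) by (simp add: xy(3) dist_norm algebra_simps norm_mult)
  then have "z \<in> cball ?c (r * \<eta>)" using xy(2) assms(2) by simp
  moreover have "cball ?c (r * \<eta>) \<subseteq> hom \<beta> r (thick P \<eta>)"
  proof
    fix w assume "w \<in> cball ?c (r * \<eta>)"
    then have "norm ((w - ?c) / of_real r) \<le> \<eta>" using assms(2)
      by (simp add: dist_norm norm_divide norm_minus_commute divide_le_eq mult.commute)
    then have "x + (w - ?c) / of_real r \<in> thick P \<eta>" using xy(1) unfolding thick_def by force
    moreover have "w = of_real r * (x + (w - ?c) / of_real r) + \<beta>" using assms(2) by (simp add: field_simps)
    ultimately show "w \<in> hom \<beta> r (thick P \<eta>)" unfolding hom_def by blast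
  qed
  ultimately show ?thesis by blast
qed

lemma (in jordan_sides) connected_subset_inside:
  assumes "connected S" "S \<inter> C = {}" "x \<in> S" "x \<in> inside C"
  shows "S \<subseteq> inside C"
  using Jordan_curve_connected_cases[OF simple closed_curve assms(1,2)] assms(3,4) inside_Int_outside[of C] by blast

text \<open>The shapes are normalized to contain 0, so that each copy contains its centre and grows
  with its factor. A second point in \<open>P v\<close> will bound the sizes when passing to the
  limit.\<close>

locale framework = jordan_sides g L + realizer V cor h p
  for g :: "real \<Rightarrow> complex" and L :: "nat \<Rightarrow> real" and V :: "'v set" and cor :: "nat \<Rightarrow> 'v"
    and h :: "nat \<Rightarrow> 'v \<Rightarrow> real" and p :: "nat \<Rightarrow> 'v \<Rightarrow> 'v" +
  fixes P :: "'v \<Rightarrow> complex set"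
  assumes P: "v \<in> V0 \<Longrightarrow> compact (P v)" "v \<in> V0 \<Longrightarrow> convex (P v)" "v \<in> V0 \<Longrightarrow> 0 \<in> P v"
    "v \<in> V0 \<Longrightarrow> P v \<noteq> {0}"
begin

lemma cor_inj: "i < 3 \<Longrightarrow> j < 3 \<Longrightarrow> i \<noteq> j \<Longrightarrow> V0 \<noteq> {} \<Longrightarrow> cor i \<noteq> cor j"
proof
  assume ij: "i < 3" "j < 3" "i \<noteq> j" "cor i = cor j" and "V0 \<noteq> {}"
  then obtain v where v: "v \<in> V0" by blast
  then have "v \<in> V - cor ` {..<3}" by (simp add: V0_def)
  then have "h j (cor i) < h j v" "v \<in> V" "v \<noteq> cor j" using cor_low[OF ij(1-3), of v] ij(2) by auto
  then show False using cor_top[OF ij(2), of v] ij(4) by simp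
qed

lemma V_cases: "v \<in> V \<Longrightarrow> v \<in> V0 \<or> (\<exists>i<3. v = cor i)" unfolding V0_def by auto

lemma cor_not_V0: "i < 3 \<Longrightarrow> cor i \<notin> V0" unfolding V0_def by auto

lemma p_in_cone: "v \<in> V0 \<Longrightarrow> i < 3 \<Longrightarrow> p i v \<in> cone i v"
  using p_cone[of v i] unfolding V0_def cone_def by auto

lemma cone_total: "x \<in> V0 \<Longrightarrow> y \<in> V0 \<Longrightarrow> x \<noteq> y \<Longrightarrow> \<exists>i<3. x \<in> cone i y \<or> y \<in> cone i x"
  using pattern[of x y] unfolding V0_def cone_def by blast

text \<open>The inner conditional reads the index off a corner vertex, which is unambiguous since
  the corners are distinct as soon as there is an interior vertex.\<close>

definition bodies :: "real \<Rightarrow> ('v \<Rightarrow> complex) \<Rightarrow> ('v \<Rightarrow> real) \<Rightarrow> (nat \<Rightarrow> complex set) \<Rightarrow> 'v \<Rightarrow> complex set" where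
  "bodies \<eta> \<beta> r S v = (if v \<in> V0 then hom (\<beta> v) (r v) (thick (P v) \<eta>) else S (if v = cor 0 then 0 else if v = cor 1 then 1 else 2))"

lemma bodies_cor: "V0 \<noteq> {} \<Longrightarrow> i < 3 \<Longrightarrow> bodies \<eta> \<beta> r S (cor i) = S i"
  using cor_inj[of i 0] cor_inj[of i 1] cor_not_V0[of i] unfolding bodies_def three by auto

text \<open>This lists what is used in the passage to the limit. The absence of triple points,
  through which the contacts with the parents are obtained, need not survive the limit and is left
  out.\<close>

definition approximant :: "real \<Rightarrow> (real \<Rightarrow> complex) \<Rightarrow> (nat \<Rightarrow> complex set) \<Rightarrow> ('v \<Rightarrow> complex) \<Rightarrow> ('v \<Rightarrow> real) \<Rightarrow> bool" where
  "approximant \<eta> G S \<beta> r \<longleftrightarrow> jordan_sides G L \<and> (\<forall>x\<in>{0..1}. dist (G x) (g x) \<le> \<eta>) \<and>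
    (\<forall>i<3. G ` {L i..L (Suc i)} \<subseteq> S i \<and> (\<forall>z\<in>S i. \<exists>t\<in>{L i<..<L (Suc i)}. dist z (G t) \<le> \<eta>)) \<and>
    (\<forall>v\<in>V0. 0 < r v \<and> \<beta> v \<in> inside (path_image G) \<and> hom (\<beta> v) (r v) (thick (P v) \<eta>) \<subseteq> inside (path_image G)) \<and>
    (\<forall>u\<in>V. \<forall>v\<in>V. u \<noteq> v \<longrightarrow> interior (bodies \<eta> \<beta> r S u) \<inter> bodies \<eta> \<beta> r S v = {}) \<and>
    (\<forall>v\<in>V0. \<forall>i<3. bodies \<eta> \<beta> r S v \<inter> bodies \<eta> \<beta> r S (p i v) \<noteq> {})"

text \<open>Proper thick bodies and fat sides are unions of discs, hence blunt at each point, so no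
  point belongs to three of them. This rules out size 0, keeps the bodies off the curve, and
  supplies the hypotheses under which each contact in a cone is one with the parent.\<close>

lemma configuration_approximants:
  assumes \<eta>: "0 < \<eta>" and ne: "V0 \<noteq> {}"
  shows "\<exists>G S \<beta> r. approximant \<eta> G S \<beta> r"
proof -
  obtain G S where G: "jordan_sides G L" "\<And>x. x \<in> {0..1} \<Longrightarrow> dist (G x) (g x) \<le> \<eta>"
    and S: "\<And>i. i < 3 \<Longrightarrow> compact (S i)" "\<And>i. i < 3 \<Longrightarrow> G ` {L i..L (Suc i)} \<subseteq> S i" "\<And>i. i < 3 \<Longrightarrow> G ` {L i<..<L (Suc i)} \<subseteq> interior (S i)"
    "\<And>i j. i < 3 \<Longrightarrow> j < 3 \<Longrightarrow> i \<noteq> j \<Longrightarrow> interior (S i) \<inter> S j = {}"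
    "\<And>i z. i < 3 \<Longrightarrow> z \<in> S i \<Longrightarrow> \<exists>t\<in>{L i<..<L (Suc i)}. \<exists>e>0. e \<le> \<eta> \<and> z \<in> cball (G t) e \<and> cball (G t) e \<subseteq> S i"
    by (rule fat_sides_exist[OF \<eta>]) (rule that)
  interpret G: jordan_sides G L by (rule G(1))
  let ?C = "path_image G" and ?P = "\<lambda>v. thick (P v) \<eta>"
  have th: "compact (?P v)" "convex (?P v)" "cball 0 \<eta> \<subseteq> ?P v" if "v \<in> V0" for v using thick P that by auto
  obtain \<tau> :: "real \<times> real \<Rightarrow> complex" where \<tau>: "continuous_on ({0..1} \<times> {0..1}) \<tau>" "\<tau> ` ({0..1} \<times> {0..1}) \<subseteq> inside ?C \<union> ?C"
    "\<And>y. y \<in> {0..1} \<Longrightarrow> \<tau> (0, y) \<in> G ` {0..L (Suc 0)}" "\<And>y. y \<in> {0..1} \<Longrightarrow> \<tau> (1, y) \<in> G ` {L (Suc 0)..L 2}"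
    "\<And>x. x \<in> {0..1} \<Longrightarrow> \<tau> (x, 1) \<in> G ` {L 2..1}" "\<And>x. x \<in> {0..1} \<Longrightarrow> \<tau> (x, 0) = G (L (Suc 0))"
    by (rule Jordan_domain_square[OF G.simple G.closed_curve L_order(1-3)]) (rule that)
  have S012: "G ` {0..L (Suc 0)} \<subseteq> S 0" "G ` {L (Suc 0)..L 2} \<subseteq> S 1" "G ` {L 2..1} \<subseteq> S 2"
    using S(2)[of 0] S(2)[of "Suc 0"] S(2)[of 2] L_order L0 by simp_all
  let ?ob = "\<lambda>i v. cone i v \<inter> V0"
  obtain \<beta> r where \<beta>: "\<And>v. v \<in> V0 \<Longrightarrow> \<beta> v \<in> \<tau> ` ({0..1} \<times> {0..1})" "\<And>v. v \<in> V0 \<Longrightarrow> 0 \<le> r v"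
    and reach: "\<And>v i. v \<in> V0 \<Longrightarrow> i < 3 \<Longrightarrow> reach (?P v) (\<beta> v) (S i \<union> (\<Union>u\<in>?ob i v. hom (\<beta> u) (r u) (?P u))) = r v"
  proof (rule configuration_exists[of V0 ?P "\<lambda>_. \<eta>" ?ob S \<tau>])
    show "finite V0" using finite_V by (simp add: V0_def)
    show "compact (?P v)" "convex (?P v)" "cball 0 \<eta> \<subseteq> ?P v" if "v \<in> V0" for v using th that by auto
    show "compact (S i)" "S i \<noteq> {}" if "i < 3" for i using S(1,2)[OF that] L_less[OF that] by auto
    show "\<tau> (0, y) \<in> S 0" "\<tau> (1, y) \<in> S 1" "\<tau> (y, 1) \<in> S 2" if "y \<in> {0..1}" for y using \<tau>(3-5)[OF that] S012 by blast+
    show "\<tau> (x, 0) \<in> S 0 \<inter> S 1" if "x \<in> {0..1}" for x unfolding \<tau>(6)[OF that] using S012 L_order by auto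
  qed (use \<eta> \<tau>(1) that in auto)
  define K where "K = bodies \<eta> \<beta> r S"
  define D where "D = {v \<in> V0. r v = 0}"
  have KV0: "K v = hom (\<beta> v) (r v) (?P v)" if "v \<in> V0" for v using that by (simp add: K_def bodies_def)
  have Kcor: "K (cor i) = S i" if "i < 3" for i unfolding K_def using bodies_cor[OF ne that] .
  \<comment> \<open>\<open>cor i\<close> lies in the i-th cone of every interior vertex, so the fat
    side S i is just one more body of that cone.\<close>
  have obst: "S i \<union> (\<Union>u\<in>?ob i v. hom (\<beta> u) (r u) (?P u)) = (\<Union>u\<in>cone i v. K u)" if "v \<in> V0" "i < 3" for i v
  proof -
    have "cone i v = insert (cor i) (?ob i v)" using cone_cor[OF that] cor_cone[OF that] by blast
    then have "(\<Union>u\<in>cone i v. K u) = K (cor i) \<union> (\<Union>u\<in>?ob i v. K u)" by (metis UN_insert)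
    then show ?thesis using KV0 Kcor[OF that(2)] by simp
  qed
  let ?T = "\<lambda>i v. S i \<union> (\<Union>u\<in>?ob i v. hom (\<beta> u) (r u) (?P u))"
  have Tne: "?T i v \<noteq> {}" if "i < 3" for i v using S(2)[OF that] L_less[OF that] by auto
  have ct: "\<exists>u \<in> cone i v. K v \<inter> K u \<noteq> {}" if "v \<in> V0" "i < 3" for v i
  proof -
    have "finite (?ob i v)" using finite_V by (simp add: V0_def)
    then have "compact (?T i v)" using S(1)[OF that(2)] th(1) by (intro compact_Un compact_UN compact_hom) auto
    then have "hom (\<beta> v) (reach (?P v) (\<beta> v) (?T i v)) (?P v) \<inter> ?T i v \<noteq> {}"
      by (rule reach_attained[OF th(1,2)[OF that(1)] \<eta> th(3)[OF that(1)] _ Tne[OF that(2)]])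
    then have "K v \<inter> (\<Union>u\<in>cone i v. K u) \<noteq> {}" unfolding reach[OF that] unfolding obst[OF that] KV0[OF that(1)] .
    then show ?thesis by blast
  qed
  have free: "interior (K v) \<inter> K u = {}" if "v \<in> V0" "v \<notin> D" "i < 3" "u \<in> cone i v" for u v i
  proof -
    have "interior (hom (\<beta> v) (r v) (?P v)) \<inter> ?T i v = {}"
    proof (rule interior_hom_disjoint[OF th(1,2)[OF that(1)] \<eta> th(3)[OF that(1)] Tne[OF that(3)]])
      show "0 < r v" using \<beta>(2)[OF that(1)] that(1,2) unfolding D_def by auto
      show "r v \<le> reach (?P v) (\<beta> v) (?T i v)" using reach[OF that(1,3)] by simp
    qed
    then have "interior (K v) \<inter> (\<Union>u\<in>cone i v. K u) = {}" unfolding obst[OF that(1,3)] KV0[OF that(1)] .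
    then show ?thesis using that(4) by blast
  qed
  \<comment> \<open>One of two interior vertices lies in a cone of the other, and a corner lies in a
    cone of every interior vertex; so \<open>free\<close> applies to the owner of the cone. Two fat
    sides are apart by construction.\<close>
  have apart: "interior (K x) \<inter> interior (K y) = {}" if xy: "x \<in> V - D" "y \<in> V - D" "x \<noteq> y" for x y
  proof -
    have *: "interior (K x) \<inter> interior (K y) = {}" if xy: "x \<in> V0 - D" "y \<in> V - D" "x \<noteq> y" for x y
    proof (cases "y \<in> V0")
      case True
      then obtain i where "i < 3" "x \<in> cone i y \<or> y \<in> cone i x" using cone_total xy by blast
      then show ?thesis using free[of x i y] free[of y i x] xy True interior_subset[of "K x"] interior_subset[of "K y"] by blast
    next
      case False
      then obtain i where "i < 3" "y = cor i" using V_cases xy by blast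
      then show ?thesis using free[of x i y] cor_cone[of x i] xy interior_subset[of "K y"] by blast
    qed
    show ?thesis
    proof (cases "x \<in> V0 \<or> y \<in> V0")
      case True then show ?thesis using *[of x y] *[of y x] xy by blast
    next
      case False
      then obtain i j where "i < 3" "x = cor i" "j < 3" "y = cor j" using V_cases xy by (metis DiffD1)
      then show ?thesis using S(4)[of i j] Kcor xy(3) interior_subset[of "S j"] by auto
    qed
  qed
  have bl: "\<exists>n. blunt (K x) z n" if xy: "x \<in> V - D" "z \<in> K x" for x z
  proof (cases "x \<in> V0")
    case True
    then have r: "0 < r x" using \<beta>(2)[OF True] xy(1) D_def by force
    obtain c where "z \<in> cball c (r x * \<eta>)" "cball c (r x * \<eta>) \<subseteq> K x"
      using thick_ball[OF _ r] xy(2) unfolding KV0[OF True] by blast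
    then show ?thesis using cball_blunt r \<eta> by (metis mult_pos_pos)
  next
    case False
    then obtain i where i: "i < 3" "x = cor i" using V_cases xy by blast
    then show ?thesis using S(5)[OF i(1)] xy(2) cball_blunt unfolding i(2) Kcor[OF i(1)] by meson
  qed
  have triple: "K x \<inter> K y \<inter> K w = {}" if xy: "x \<in> V - D" "y \<in> V - D" "w \<in> V - D" "x \<noteq> y" "y \<noteq> w" "x \<noteq> w" for x y w
  proof (rule ccontr)
    assume "K x \<inter> K y \<inter> K w \<noteq> {}"
    then obtain z where z: "z \<in> K x" "z \<in> K y" "z \<in> K w" by blast
    obtain n1 n2 n3 where "blunt (K x) z n1" "blunt (K y) z n2" "blunt (K w) z n3" using bl xy z by meson
    then show False using blunt_triple apart xy by blast
  qed
  have "D = {}"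
  proof (rule no_points[where K = K and z = \<beta>])
    show "K v = {\<beta> v}" if "v \<in> D" for v
      using that KV0[of v] hom_0[of "?P v" "\<beta> v"] subset_thick[of \<eta> "P v"] P(3)[of v] \<eta> unfolding D_def by force
  qed (use D_def ct triple in auto)
  then have rpos: "0 < r v" if "v \<in> V0" for v using \<beta>(2)[OF that] that unfolding D_def by force
  note apart = apart[unfolded \<open>D = {}\<close> Diff_empty] and triple = triple[unfolded \<open>D = {}\<close> Diff_empty]
  have V0V: "v \<in> V" if "v \<in> V0" for v using that by (simp add: V0_def)
  have corV: "cor i \<in> V" if "i < 3" for i using cor_V that .
  have Kconv: "convex (K v)" "\<beta> v \<in> interior (K v)" "compact (K v)" if v: "v \<in> V0" for v
  proof -
    show "convex (K v)" "compact (K v)" unfolding KV0[OF v] using th v by (auto intro: convex_hom compact_hom)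
    have "cball (\<beta> v) (\<eta> * r v) \<subseteq> K v" unfolding KV0[OF v]
      using in_hom_ball[OF th(1,2)[OF v] \<eta> th(3)[OF v]] rpos[OF v] by (auto simp: dist_norm norm_minus_commute less_imp_le)
    then show "\<beta> v \<in> interior (K v)" using rpos[OF v] \<eta> by (meson centre_in_ball interior_maximal open_ball ball_subset_cball subset_trans subsetD mult_pos_pos)
  qed
  have solid: "K v \<subseteq> closure (interior (K v))" if v: "v \<in> V" for v
  proof (cases "v \<in> V0")
    case True then show ?thesis using Kconv[OF True] by (metis closure_subset convex_closure_interior empty_iff)
  next
    case False
    then obtain i where i: "i < 3" "v = cor i" using V_cases v by blast
    show ?thesis
    proof
      fix z assume "z \<in> K v"
      then obtain t e where e: "e > 0" "z \<in> cball (G t) e" "cball (G t) e \<subseteq> K v" using S(5)[OF i(1)] unfolding i(2) Kcor[OF i(1)] by blast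
      have "ball (G t) e \<subseteq> interior (K v)" using e(3) by (intro interior_maximal) auto
      then have "cball (G t) e \<subseteq> closure (interior (K v))" using closure_mono closure_ball[OF e(1)] by metis
      then show "z \<in> closure (interior (K v))" using e(2) by blast
    qed
  qed
  \<comment> \<open>Each body lies in the closure of its interior, so an open set meeting the body
    would meet its interior.\<close>
  have sep: "interior (K x) \<inter> K y = {}" if "x \<in> V" "y \<in> V" "x \<noteq> y" for x y
    using open_Int_closure_eq_empty[OF open_interior, of "K x" "interior (K y)"] apart[OF that] solid[OF that(2)] by blast
  have S_K: "S i \<inter> interior (K x) = {}" "interior (S i) \<inter> K x = {}" if "i < 3" "x \<in> V0" for i x
    using sep[OF corV[OF that(1)] V0V[OF that(2)]] sep[OF V0V[OF that(2)] corV[OF that(1)]] cor_not_V0[OF that(1)] that(2) unfolding Kcor[OF that(1)] by blast+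
  have S_KK: "S i \<inter> K x \<inter> K y = {}" if "i < 3" "x \<in> V0" "y \<in> V0" "x \<noteq> y" for i x y
    using triple[OF corV[OF that(1)] V0V[OF that(2)] V0V[OF that(3)]] cor_not_V0[OF that(1)] that unfolding Kcor[OF that(1)] by blast
  have SS_K: "S i \<inter> S j \<inter> K x = {}" if "i < 3" "j < 3" "i \<noteq> j" "x \<in> V0" for i j x
    using triple[OF corV[OF that(1)] corV[OF that(2)] V0V[OF that(4)] cor_inj[OF that(1-3) ne]] cor_not_V0[OF that(1)] cor_not_V0[OF that(2)] that(4)
    unfolding Kcor[OF that(1)] Kcor[OF that(2)] by blast
  have sideS: "G.side i \<subseteq> S i" "G.oside i \<subseteq> interior (S i)" if "i < 3" for i
    using S(2,3)[OF that] unfolding G.side_def G.oside_def by auto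
  have corner2: "G (L i) \<in> S (pv i)" "G (L (Suc i)) \<in> S (nx i)" "G (L i) \<in> S i" "G (L (Suc i)) \<in> S i" if "i < 3" for i
  proof -
    show "G (L i) \<in> S i" "G (L (Suc i)) \<in> S i" using S(2)[OF that] L_less[OF that] by auto
    show "G (L (Suc i)) \<in> S (nx i)" using G.L_nx[OF that] S(2)[OF nx_pv(1)[OF that]] L_less[OF nx_pv(1)[OF that]] by force
    show "G (L i) \<in> S (pv i)" using G.L_nx[OF nx_pv(2)[OF that]] nx_pv(3)[OF that] S(2)[OF nx_pv(2)[OF that]] L_less[OF nx_pv(2)[OF that]] by force
  qed
  \<comment> \<open>A side of the curve lies in the interior of its fat side except for its ends,
    and these belong to two fat sides, where a further body would create a triple point.\<close>
  have K_C: "?C \<inter> K x = {}" if x: "x \<in> V0" for x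
  proof -
    have "z \<notin> K x" if i: "i < 3" and z: "z \<in> G.side i" for i z
    proof -
      consider "z \<in> G.oside i" | "z = G (L i)" | "z = G (L (Suc i))" using G.side_cases[OF i z] by blast
      then show ?thesis
      proof cases
        case 1 then show ?thesis using sideS(2)[OF i] S_K(2)[OF i x] by blast
      next
        case 2 then show ?thesis using corner2(1,3)[OF i] SS_K[OF i nx_pv(2)[OF i] nx_pv(6)[OF i, symmetric] x] by blast
      next
        case 3 then show ?thesis using corner2(2,4)[OF i] SS_K[OF i nx_pv(1)[OF i] nx_pv(5)[OF i, symmetric] x] by blast
      qed
    qed
    from this[of 0] this[of 1] this[of 2] show ?thesis unfolding G.C_sides by auto
  qed
  have K_in: "K x \<subseteq> inside ?C" if x: "x \<in> V0" for x
  proof (rule G.connected_subset_inside)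
    show "connected (K x)" using Kconv(1)[OF x] by (rule convex_connected)
    show "\<beta> x \<in> K x" using Kconv(2)[OF x] interior_subset by blast
    then show "\<beta> x \<in> inside ?C" using \<beta>(1)[OF x] \<tau>(2) K_C[OF x] by blast
    show "K x \<inter> ?C = {}" using K_C[OF x] by blast
  qed
  \<comment> \<open>From the contact point walk towards the centre G t of a disc within the fat
    side, and stop at the first point w of the curve. After its start the walk is in the interior of
    the fat side, and before w it cannot have left the inside.\<close>
  have foot: "\<exists>z \<theta>. z \<in> K x \<and> z \<in> S i \<and> \<theta> \<in> {L i<..<L (Suc i)} \<and> closed_segment z (G \<theta>) \<subseteq> insert z (interior (S i)) \<and>
     closed_segment z (G \<theta>) \<inter> ?C = {G \<theta>} \<and> closed_segment z (G \<theta>) \<inter> outside ?C = {}"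
    if i: "i < 3" and x: "x \<in> V0" and xi: "K x \<inter> S i \<noteq> {}" for i x
  proof -
    obtain z where z: "z \<in> K x" "z \<in> S i" using xi by blast
    obtain t e where t: "t \<in> {L i<..<L (Suc i)}" "e > 0" "z \<in> cball (G t) e" "cball (G t) e \<subseteq> S i" using S(5)[OF i z(2)] by blast
    have zC: "z \<notin> ?C" using K_C[OF x] z by blast
    have ball: "ball (G t) e \<subseteq> interior (S i)" using t(4) by (intro interior_maximal) auto
    have seg: "closed_segment z (G t) \<subseteq> insert z (interior (S i))"
    proof -
      have "closed_segment (G t) z \<subseteq> insert z (interior (cball (G t) e))"
        by (rule segment_in_interior) (use t in auto)
      then show ?thesis using ball by (auto simp: closed_segment_commute)
    qed
    have tC: "G t \<in> ?C" using open_param[OF i t(1)] by (intro G.g_in_C) auto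
    have c1: "compact (closed_segment z (G t) \<inter> ?C)" using G.path_g by (intro compact_Int compact_path_image compact_segment)
    have c2: "closed_segment z (G t) \<inter> ?C \<noteq> {}" using tC by auto
    have c3: "continuous_on (closed_segment z (G t) \<inter> ?C) (dist z)" by (intro continuous_intros)
    obtain w where w: "w \<in> closed_segment z (G t) \<inter> ?C" "\<And>y. y \<in> closed_segment z (G t) \<inter> ?C \<Longrightarrow> dist z w \<le> dist z y"
      using continuous_attains_inf[OF c1 c2 c3] by blast
    have sub: "closed_segment z w \<subseteq> closed_segment z (G t)" using w(1) by (auto simp: subset_closed_segment)
    have wS: "w \<in> interior (S i)" using seg w(1) zC by blast
    \<comment> \<open>Distances add up along a segment, so a curve point between z and w would be
      nearer to z than w.\<close>
    have only: "q = w" if "q \<in> closed_segment z w" "q \<in> ?C" for q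
    proof -
      have "dist z w \<le> dist z q" using that sub by (intro w(2)) blast
      moreover have "dist z w = dist z q + dist q w" using that(1) between_mem_segment[of z w q] between[of z w q] by (metis (no_types))
      ultimately show ?thesis by simp
    qed
    have "\<exists>\<theta>\<in>{L i<..<L (Suc i)}. w = G \<theta>"
    proof -
      have "w \<in> G.side i"
      proof -
        have "w \<in> G.side 0 \<or> w \<in> G.side 1 \<or> w \<in> G.side 2" using w(1) G.C_sides by blast
        moreover have "0 < (3::nat)" "1 < (3::nat)" "2 < (3::nat)" by auto
        ultimately obtain j where j: "j < 3" "w \<in> G.side j" by metis
        then show ?thesis using sideS(1)[OF j(1)] S(4)[OF i j(1)] wS by blast
      qed
      then have "w \<in> G.oside i" using G.side_cases[OF i] corner2(1,2)[OF i] S(4)[OF i nx_pv(1)[OF i] nx_pv(5)[OF i, symmetric]]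
         S(4)[OF i nx_pv(2)[OF i] nx_pv(6)[OF i, symmetric]] wS by blast
      then show ?thesis unfolding G.oside_def by blast
    qed
    then obtain \<theta> where \<theta>: "\<theta> \<in> {L i<..<L (Suc i)}" "w = G \<theta>" by blast
    have "closed_segment z w \<inter> outside ?C = {}"
    proof (rule ccontr)
      assume "closed_segment z w \<inter> outside ?C \<noteq> {}"
      then obtain q where q: "q \<in> closed_segment z w" "q \<in> outside ?C" by blast
      have "q \<noteq> w" using q(2) w(1) outside_no_overlap by blast
      moreover have qs: "closed_segment z q \<subseteq> closed_segment z w" using q(1) by (auto simp: subset_closed_segment)
      ultimately have "w \<notin> closed_segment z q" using q(1) by (metis between_antisym between_mem_segment between_commute)
      then have "closed_segment z q \<inter> ?C = {}" using only qs by blast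
      then have "closed_segment z q \<subseteq> inside ?C" using K_in[OF x] z by (intro G.connected_subset_inside[of _ z]) auto
      then have "q \<in> inside ?C" by auto
      then show False using q(2) inside_Int_outside[of ?C] by blast
    qed
    then show ?thesis using z \<theta> sub seg only w(1) by (intro exI[of _ z] exI[of _ \<theta>]) auto
  qed
  then obtain zt th where ft: "\<And>i x. i < 3 \<Longrightarrow> x \<in> V0 \<Longrightarrow> K x \<inter> S i \<noteq> {} \<Longrightarrow>
     zt i x \<in> K x \<and> zt i x \<in> S i \<and> th i x \<in> {L i<..<L (Suc i)} \<and> closed_segment (zt i x) (G (th i x)) \<subseteq> insert (zt i x) (interior (S i)) \<and>
     closed_segment (zt i x) (G (th i x)) \<inter> ?C = {G (th i x)} \<and> closed_segment (zt i x) (G (th i x)) \<inter> outside ?C = {}" by metis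
  interpret B: jordan_bodies G L V cor h p K \<beta> zt th
  proof
    fix x assume x: "x \<in> V0"
    show "convex (K x) \<and> \<beta> x \<in> interior (K x)" using Kconv[OF x] by blast
    show "interior (K x) \<subseteq> inside ?C" using K_in[OF x] interior_subset by blast
  next
    fix x y w assume "x \<in> V0" "y \<in> V0" "w \<in> V0" "x \<noteq> y" "y \<noteq> w" "x \<noteq> w"
    then show "K x \<inter> K y \<inter> K w = {}" using triple V0V by blast
  next
    fix x y assume "x \<in> V0" "y \<in> V0" "x \<noteq> y"
    then show "interior (K x) \<inter> K y = {}" "?C \<inter> K x \<inter> K y = {}" using sep V0V K_C by blast+
  next
    fix i x assume a: "i < 3" "x \<in> V0" "K x \<inter> K (cor i) \<noteq> {}"
    note f = ft[OF a(1,2) a(3)[unfolded Kcor[OF a(1)]]]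
    show "zt i x \<in> K x \<and> th i x \<in> {L i<..<L (Suc i)} \<and> closed_segment (zt i x) (G (th i x)) \<inter> ?C = {G (th i x)} \<and>
      closed_segment (zt i x) (G (th i x)) \<inter> outside ?C = {}" using f by blast
    show "closed_segment (zt i x) (G (th i x)) \<inter> interior (K y) = {}" if "y \<in> V0" for y
      using f S_K[OF a(1) that] interior_subset[of "K y"] by blast
    show "closed_segment (zt i x) (G (th i x)) \<inter> K y \<inter> K w = {}" if "y \<in> V0" "w \<in> V0" "y \<noteq> w" for y w
      using f S_K(2)[OF a(1) that(1)] S_KK[OF a(1) that] by blast
  next
    fix i x j y assume a: "i < 3" "j < 3" "i \<noteq> j" "x \<in> V0" "y \<in> V0" "x \<noteq> y" "K x \<inter> K (cor i) \<noteq> {}" "K y \<inter> K (cor j) \<noteq> {}"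
    note f = ft[OF a(1,4) a(7)[unfolded Kcor[OF a(1)]]] ft[OF a(2,5) a(8)[unfolded Kcor[OF a(2)]]]
    show "closed_segment (zt i x) (G (th i x)) \<inter> closed_segment (zt j y) (G (th j y)) = {}"
    proof (rule ccontr)
      assume "\<not> ?thesis"
      then obtain q where q: "q \<in> closed_segment (zt i x) (G (th i x))" "q \<in> closed_segment (zt j y) (G (th j y))" by blast
      have "q \<in> S i" "q \<in> S j" using q f interior_subset[of "S i"] interior_subset[of "S j"] by blast+
      then have "q \<notin> interior (S i)" "q \<notin> interior (S j)" using S(4)[OF a(1-3)] S(4)[OF a(2,1) a(3)[symmetric]] by blast+
      then have "q = zt i x" using q f by blast
      then have "q \<in> K x" using f by blast
      then show False using \<open>q \<in> S i\<close> \<open>q \<in> S j\<close> SS_K[OF a(1-4)] by blast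
    qed
  next
    show "\<exists>u \<in> cone i v. K v \<inter> K u \<noteq> {}" if "v \<in> V0" "i < 3" for v i using ct[OF that] .
  qed
  have final: "K v \<inter> K (p i v) \<noteq> {}" if "v \<in> V0" "i < 3" for v i
    using ct[OF that] B.contact_unique[OF that] by blast
  have near: "\<exists>t\<in>{L i<..<L (Suc i)}. dist z (G t) \<le> \<eta>" if iz: "i < 3" "z \<in> S i" for i z
  proof -
    obtain t e where "t \<in> {L i<..<L (Suc i)}" "e \<le> \<eta>" "z \<in> cball (G t) e" using S(5)[OF iz] by blast
    then show ?thesis by (intro bexI[of _ t]) (auto simp: dist_commute)
  qed
  have in\<beta>: "\<beta> v \<in> inside ?C" if "v \<in> V0" for v using Kconv(2)[OF that] K_in[OF that] interior_subset by blast
  have "approximant \<eta> G S \<beta> r" unfolding approximant_def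
  proof (intro conjI ballI allI impI)
    show "jordan_sides G L" by (rule G(1))
    show "dist (G x) (g x) \<le> \<eta>" if "x \<in> {0..1}" for x by (rule G(2)[OF that])
    show "G ` {L i..L (Suc i)} \<subseteq> S i" if "i < 3" for i by (rule S(2)[OF that])
    show "\<exists>t\<in>{L i<..<L (Suc i)}. dist z (G t) \<le> \<eta>" if "i < 3" "z \<in> S i" for i z by (rule near[OF that])
    show "0 < r v" "\<beta> v \<in> inside ?C" "hom (\<beta> v) (r v) (?P v) \<subseteq> inside ?C" if "v \<in> V0" for v
      using rpos[OF that] in\<beta>[OF that] K_in[OF that] KV0[OF that] by auto
    show "interior (bodies \<eta> \<beta> r S u) \<inter> bodies \<eta> \<beta> r S v = {}" if "u \<in> V" "v \<in> V" "u \<noteq> v" for u v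
      using sep[OF that] unfolding K_def .
    show "bodies \<eta> \<beta> r S v \<inter> bodies \<eta> \<beta> r S (p i v) \<noteq> {}" if "v \<in> V0" "i < 3" for v i
      using final[OF that] unfolding K_def .
  qed
  then show ?thesis by blast
qed

end

section \<open>The limit configuration\<close>

lemma interior_hom: "0 < r \<Longrightarrow> interior (hom \<beta> r P) = hom \<beta> r (interior P)"
proof -
  assume r: "0 < r"
  have e: "hom \<beta> r A = (+) \<beta> ` (\<lambda>z. r *\<^sub>R z) ` A" for A
    by (auto simp: hom_def image_image scaleR_conv_of_real add.commute)
  have "interior ((\<lambda>z. r *\<^sub>R z) ` P) = (\<lambda>z. r *\<^sub>R z) ` interior P" for P :: "complex set"
    using r by (intro interior_injective_linear_image linear_scaleR injI) auto
  then show ?thesis unfolding e by (simp add: interior_translation)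
qed

lemma hom_mono: "P \<subseteq> P' \<Longrightarrow> hom \<beta> r P \<subseteq> hom \<beta> r P'" unfolding hom_def by blast

lemma thick_0: "thick P 0 = P" unfolding thick_def by force

lemma in_hom_iff: "0 < r \<Longrightarrow> z \<in> hom \<beta> r P \<longleftrightarrow> (z - \<beta>) / of_real r \<in> P"
  unfolding hom_def by (force simp: image_iff field_simps)

text \<open>The straight-line homotopy between the two translated loops avoids 0.\<close>

lemma winding_number_nearby:
  assumes "path g" "path h" "pathfinish g = pathstart g" "pathfinish h = pathstart h"
    and "\<And>t. t \<in> {0..1} \<Longrightarrow> norm (h t - w - (g t - z)) < norm (g t - z)"
  shows "winding_number h w = winding_number g z"
proof -
  let ?g = "\<lambda>t. g t - z" and ?h = "\<lambda>t. h t - w"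
  have "homotopic_loops (- {0}) ?g ?h"
  proof (rule homotopic_loops_nearby_explicit)
    show "path ?g" "path ?h" using assms(1,2) unfolding path_def by (auto intro: continuous_intros)
    show "norm (?h t - ?g t) < norm (?g t - x)" if "t \<in> {0..1}" "x \<notin> - {0}" for t x using assms(5)[OF that(1)] that(2) by simp
  qed (use assms(3,4) in \<open>auto simp: pathfinish_def pathstart_def\<close>)
  then have "winding_number ?g 0 = winding_number ?h 0" by (rule winding_number_homotopic_loops)
  then show ?thesis using winding_number_offset[of g z] winding_number_offset[of h w] by simp
qed

context framework
begin

abbreviation "limit_bodies \<beta> r \<equiv> bodies 0 \<beta> r side"

text \<open>Centres and sizes stay bounded, so a subsequence converges. Contacts persist by
  compactness. A sequence converging to an interior point of a proper limit body is eventually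
  interior to the approximating bodies, which keeps this interior off the other limit bodies. That
  it lies inside the curve is read off the winding number, which is stable under small changes of
  curve and point.\<close>

lemma limit_configuration:
  assumes ne: "V0 \<noteq> {}"
  shows "\<exists>\<beta> r. (\<forall>v\<in>V0. 0 \<le> r v) \<and>
    (\<forall>u\<in>V. \<forall>v\<in>V. u \<noteq> v \<longrightarrow> interior (limit_bodies \<beta> r u) \<inter> limit_bodies \<beta> r v = {}) \<and>
    (\<forall>v\<in>V0. \<forall>i<3. limit_bodies \<beta> r v \<inter> limit_bodies \<beta> r (p i v) \<noteq> {}) \<and>
    (\<forall>v\<in>V0. interior (limit_bodies \<beta> r v) \<subseteq> inside C)"
proof -
  define \<eta> where "\<eta> n = inverse (real (Suc n))" for n
  have \<eta>: "0 < \<eta> n" "\<eta> n \<le> 1" for n by (auto simp: \<eta>_def inverse_le_1_iff)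
  obtain G S \<beta> r where ap: "\<And>n. approximant (\<eta> n) (G n) (S n) (\<beta> n) (r n)"
    using configuration_approximants[OF \<eta>(1) ne] by metis
  note ap = ap[unfolded approximant_def]
  note ap2 = ap[THEN conjunct2] note ap3 = ap2[THEN conjunct2] note ap4 = ap3[THEN conjunct2] note ap5 = ap4[THEN conjunct2]
  note G = ap[THEN conjunct1] ap2[THEN conjunct1, rule_format] and S' = ap3[THEN conjunct1, rule_format]
    and V0' = ap4[THEN conjunct1, rule_format] and sep = ap5[THEN conjunct1, rule_format] and ct = ap5[THEN conjunct2, rule_format]
  have S: "G n x \<in> S n i" if "i < 3" "x \<in> {L i..L (Suc i)}" for n i x using S'[OF that(1), of n] that(2) by blast
  note S = S S'[THEN conjunct2, rule_format] and r = V0'[THEN conjunct1] and ins = V0'[THEN conjunct2, THEN conjunct1] V0'[THEN conjunct2, THEN conjunct2]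
  obtain B where B: "\<And>z. z \<in> C \<Longrightarrow> norm z \<le> B" using compact_path_image[OF path_g] compact_imp_bounded bounded_iff by metis
  have inB: "norm z \<le> B + 1" if "z \<in> inside (path_image (G n))" for z n
  proof -
    have "path_image (G n) \<subseteq> cball 0 (B + 1)"
    proof
      fix y assume "y \<in> path_image (G n)"
      then obtain x where x: "x \<in> {0..1}" "y = G n x" by (auto simp: path_image_def)
      then show "y \<in> cball 0 (B + 1)" using G(2)[OF x(1), of n] \<eta>(2)[of n] B[OF g_in_C[OF x(1)]] norm_triangle_sub[of y "g x"] by (simp add: dist_norm)
    qed
    then have "- cball 0 (B + 1) \<subseteq> outside (path_image (G n))" by (rule outside_subset_convex[OF convex_cball])
    then have "z \<in> cball 0 (B + 1)" using that inside_Int_outside[of "path_image (G n)"] by blast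
    then show ?thesis by simp
  qed
  have bdd: "\<exists>A. compact A \<and> (\<forall>n. (\<beta> n v, r n v) \<in> A)" if v: "v \<in> V0" for v
  proof -
    \<comment> \<open>The images of 0 and of x both lie in a bounded domain, which bounds the size
      by twice its radius divided by norm x.\<close>
    obtain x where x: "x \<in> P v" "x \<noteq> 0" using P(3,4)[OF v] by blast
    have "r n v \<le> 2 * (B + 1) / norm x" for n
    proof -
      have "of_real (r n v) * x + \<beta> n v \<in> hom (\<beta> n v) (r n v) (thick (P v) (\<eta> n))"
        using subset_thick[of "\<eta> n" "P v"] \<eta>(1)[of n] x(1) unfolding hom_def by (auto intro: less_imp_le)
      then have "norm (of_real (r n v) * x + \<beta> n v) \<le> B + 1" "norm (\<beta> n v) \<le> B + 1" using inB ins[OF v] by blast+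
      then have "norm (of_real (r n v) * x) \<le> 2 * (B + 1)" using norm_triangle_ineq4[of "of_real (r n v) * x + \<beta> n v" "\<beta> n v"] by simp
      then show ?thesis using x(2) r[OF v, of n] by (simp add: norm_mult pos_le_divide_eq)
    qed
    then have "(\<beta> n v, r n v) \<in> cball 0 (B + 1) \<times> {0..2 * (B + 1) / norm x}" for n
      using inB[OF ins(1)[OF v]] r[OF v, of n] by (simp add: less_imp_le)
    moreover have "compact (cball (0::complex) (B + 1) \<times> {0..2 * (B + 1) / norm x})" by (intro compact_Times compact_cball compact_Icc)
    ultimately show ?thesis by blast
  qed
  have "finite V0" using finite_V by (simp add: V0_def)
  then obtain \<phi> X where \<phi>: "strict_mono \<phi>" "\<And>v. v \<in> V0 \<Longrightarrow> (\<lambda>n. (\<beta> (\<phi> n) v, r (\<phi> n) v)) \<longlonglongrightarrow> X v"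
    by (rule finite_family_convergent_subsequence[of V0 "\<lambda>n v. (\<beta> n v, r n v)"]) (erule bdd, rule that)
  define \<beta>' r' where "\<beta>' v = fst (X v)" and "r' v = snd (X v)" for v
  have lim: "(\<lambda>n. \<beta> (\<phi> n) v) \<longlonglongrightarrow> \<beta>' v" "(\<lambda>n. r (\<phi> n) v) \<longlonglongrightarrow> r' v" if "v \<in> V0" for v
    using tendsto_fst[OF \<phi>(2)[OF that]] tendsto_snd[OF \<phi>(2)[OF that]] by (simp_all add: \<beta>'_def r'_def)
  have r'0: "0 \<le> r' v" if "v \<in> V0" for v
    by (rule LIMSEQ_le_const[OF lim(2)[OF that]]) (use r[OF that] in \<open>auto intro: less_imp_le\<close>)
  have "\<eta> \<longlonglongrightarrow> 0" unfolding \<eta>_def using LIMSEQ_inverse_real_of_nat .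
  then have \<eta>0: "(\<lambda>n. \<eta> (\<phi> n)) \<longlonglongrightarrow> 0" using LIMSEQ_subseq_LIMSEQ[OF _ \<phi>(1)] by (simp add: o_def)
  define K where "K n = bodies (\<eta> (\<phi> n)) (\<beta> (\<phi> n)) (r (\<phi> n)) (S (\<phi> n))" for n
  define Q where "Q = limit_bodies \<beta>' r'"
  have KV: "K n v = hom (\<beta> (\<phi> n) v) (r (\<phi> n) v) (thick (P v) (\<eta> (\<phi> n)))" "Q v = hom (\<beta>' v) (r' v) (P v)" if "v \<in> V0" for v n
    using that unfolding K_def Q_def bodies_def by (auto simp: thick_0)
  have Kcor: "K n (cor i) = S (\<phi> n) i" "Q (cor i) = side i" if "i < 3" for n i
    unfolding K_def Q_def using bodies_cor[OF ne that] by auto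
  have Q_compact: "compact (Q v)" if "v \<in> V" for v
    using V_cases[OF that] KV(2)[of v] P(1)[of v] Kcor(2) compact_side compact_hom by metis
  \<comment> \<open>Together with \<open>close\<close> below this is Hausdorff convergence of the
    bodies to their limits.\<close>
  have approx: "\<exists>f. (\<forall>n. f n \<in> K n v) \<and> f \<longlonglongrightarrow> z" if v: "v \<in> V" and z: "z \<in> Q v" for v z
    using V_cases[OF v]
  proof
    assume v: "v \<in> V0"
    then obtain q where q: "q \<in> P v" "z = of_real (r' v) * q + \<beta>' v" using z KV(2) unfolding hom_def by auto
    have "(\<lambda>n. of_real (r (\<phi> n) v) * q + \<beta> (\<phi> n) v) \<longlonglongrightarrow> z" unfolding q(2) by (intro tendsto_intros lim v)
    moreover have "of_real (r (\<phi> n) v) * q + \<beta> (\<phi> n) v \<in> K n v" for n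
      unfolding KV(1)[OF v] hom_def using subset_thick[of "\<eta> (\<phi> n)" "P v"] \<eta>(1)[of "\<phi> n"] q(1) by (auto intro: less_imp_le)
    ultimately show ?thesis by (intro exI[of _ "\<lambda>n. of_real (r (\<phi> n) v) * q + \<beta> (\<phi> n) v"]) simp
  next
    assume "\<exists>i<3. v = cor i"
    then obtain i where i: "i < 3" "v = cor i" by blast
    then obtain t where t: "t \<in> {L i..L (Suc i)}" "z = g t" using z Kcor(2) unfolding side_def by auto
    have "t \<in> {0..1}" using t(1) L_range[OF i(1)] by auto
    then have "dist (G (\<phi> n) t) z \<le> \<eta> (\<phi> n)" for n using G(2) t(2) by simp
    then have "(\<lambda>n. G (\<phi> n) t) \<longlonglongrightarrow> z" by (intro metric_tendsto_imp_tendsto[OF \<eta>0]) (use \<eta>(1) in \<open>auto intro!: always_eventually simp: less_imp_le\<close>)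
    moreover have "G (\<phi> n) t \<in> K n v" for n using S(1)[OF i(1) t(1)] Kcor(1)[OF i(1)] i(2) by simp
    ultimately show ?thesis by (intro exI[of _ "\<lambda>n. G (\<phi> n) t"]) simp
  qed
  have close: "\<exists>\<epsilon>. \<epsilon> \<longlonglongrightarrow> 0 \<and> (\<forall>n. \<forall>z\<in>K n v. \<exists>z'\<in>Q v. dist z z' \<le> \<epsilon> n)" if v: "v \<in> V" for v
    using V_cases[OF v]
  proof
    assume v: "v \<in> V0"
    obtain b where b: "\<And>q. q \<in> P v \<Longrightarrow> norm q \<le> b" using P(1)[OF v] compact_imp_bounded bounded_iff by metis
    let ?\<epsilon> = "\<lambda>n. norm (\<beta> (\<phi> n) v - \<beta>' v) + \<bar>r (\<phi> n) v - r' v\<bar> * b + r (\<phi> n) v * \<eta> (\<phi> n)"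
    have "?\<epsilon> \<longlonglongrightarrow> norm (\<beta>' v - \<beta>' v) + \<bar>r' v - r' v\<bar> * b + r' v * 0" by (intro tendsto_intros lim v \<eta>0)
    moreover have "\<exists>z'\<in>Q v. dist z z' \<le> ?\<epsilon> n" if zK: "z \<in> K n v" for n z
    proof -
      obtain q w where q: "q \<in> P v" "norm w \<le> \<eta> (\<phi> n)" "z = of_real (r (\<phi> n) v) * (q + w) + \<beta> (\<phi> n) v"
        using zK unfolding KV(1)[OF v] hom_def thick_def by auto
      let ?z = "of_real (r' v) * q + \<beta>' v"
      have "z - ?z = (\<beta> (\<phi> n) v - \<beta>' v) + of_real (r (\<phi> n) v - r' v) * q + of_real (r (\<phi> n) v) * w"
        unfolding q(3) by (simp add: algebra_simps)
      also have "norm \<dots> \<le> norm (\<beta> (\<phi> n) v - \<beta>' v) + norm (of_real (r (\<phi> n) v - r' v) * q) + norm (of_real (r (\<phi> n) v) * w)"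
        by (intro order_trans[OF norm_triangle_ineq] add_right_mono norm_triangle_ineq)
      also have "\<dots> \<le> ?\<epsilon> n" unfolding norm_mult norm_of_real using b[OF q(1)] q(2) r[OF v, of "\<phi> n"] by (intro add_mono mult_mono) auto
      finally show ?thesis using q(1) unfolding KV(2)[OF v] hom_def by (auto simp: dist_norm intro!: bexI[of _ q])
    qed
    ultimately show ?thesis by (intro exI[of _ ?\<epsilon>]) simp
  next
    assume "\<exists>i<3. v = cor i"
    then obtain i where i: "i < 3" "v = cor i" by blast
    have "\<exists>z'\<in>Q v. dist z z' \<le> 2 * \<eta> (\<phi> n)" if "z \<in> K n v" for n z
    proof -
      have "z \<in> S (\<phi> n) i" using that Kcor(1)[OF i(1)] i(2) by simp
      then obtain t where t: "t \<in> {L i<..<L (Suc i)}" "dist z (G (\<phi> n) t) \<le> \<eta> (\<phi> n)" using S(2)[OF i(1)] by blast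
      have "dist (G (\<phi> n) t) (g t) \<le> \<eta> (\<phi> n)" using G(2)[of t] open_param[OF i(1) t(1)] by simp
      then have "dist z (g t) \<le> 2 * \<eta> (\<phi> n)" using t(2) dist_triangle[of z "g t" "G (\<phi> n) t"] by linarith
      moreover have "g t \<in> Q v" using t(1) Kcor(2)[OF i(1)] i(2) unfolding side_def by auto
      ultimately show ?thesis by blast
    qed
    moreover have "(\<lambda>n. 2 * \<eta> (\<phi> n)) \<longlonglongrightarrow> 0" using tendsto_mult[OF tendsto_const \<eta>0, of 2] by simp
    ultimately show ?thesis by (intro exI[of _ "\<lambda>n. 2 * \<eta> (\<phi> n)"]) simp
  qed
  have Q_sep: "interior (Q u) \<inter> Q v = {}" if uv: "u \<in> V" "v \<in> V" "u \<noteq> v" for u v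
  proof (rule ccontr)
    assume "interior (Q u) \<inter> Q v \<noteq> {}"
    then obtain z where z: "z \<in> interior (Q u)" "z \<in> Q v" by blast
    have u: "u \<in> V0"
    proof (rule ccontr)
      assume "u \<notin> V0"
      then obtain i where "i < 3" "u = cor i" using V_cases[OF uv(1)] by blast
      then have "Q u \<subseteq> C" using Kcor(2) side_C by simp
      then show False using z(1) C_facts(12) interior_mono by blast
    qed
    have r'u: "0 < r' u"
    proof (rule ccontr)
      assume "\<not> ?thesis"
      then have "Q u = {\<beta>' u}" using r'0[OF u] KV(2)[OF u] hom_0 P(3)[OF u] by (metis antisym_conv2 empty_iff)
      then show False using z(1) by simp
    qed
    obtain f where f: "\<And>n. f n \<in> K n v" "f \<longlonglongrightarrow> z" using approx[OF uv(2) z(2)] by blast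
    have "z \<in> hom (\<beta>' u) (r' u) (interior (P u))" using z(1) interior_hom[OF r'u] KV(2)[OF u] by simp
    then have y: "(z - \<beta>' u) / of_real (r' u) \<in> interior (P u)" using in_hom_iff[OF r'u] by simp
    have "(\<lambda>n. (f n - \<beta> (\<phi> n) u) / of_real (r (\<phi> n) u)) \<longlonglongrightarrow> (z - \<beta>' u) / of_real (r' u)"
      using r'u by (intro tendsto_intros f lim u) auto
    then have "\<forall>\<^sub>F n in sequentially. (f n - \<beta> (\<phi> n) u) / of_real (r (\<phi> n) u) \<in> interior (P u)"
      using topological_tendstoD y by blast
    then obtain n where "(f n - \<beta> (\<phi> n) u) / of_real (r (\<phi> n) u) \<in> interior (P u)" by (auto simp: eventually_sequentially)
    then have "f n \<in> interior (hom (\<beta> (\<phi> n) u) (r (\<phi> n) u) (P u))" using interior_hom[OF r[OF u]] in_hom_iff[OF r[OF u]] by blast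
    moreover have "hom (\<beta> (\<phi> n) u) (r (\<phi> n) u) (P u) \<subseteq> K n u"
      unfolding KV(1)[OF u] using \<eta>(1)[of "\<phi> n"] by (intro hom_mono subset_thick) auto
    ultimately have "f n \<in> interior (K n u)" using interior_mono by blast
    then show False using f(1)[of n] sep[OF uv, of "\<phi> n"] unfolding K_def by blast
  qed
  have Q_ct: "Q v \<inter> Q (p i v) \<noteq> {}" if v: "v \<in> V0" and i: "i < 3" for v i
  proof -
    have V: "v \<in> V" "p i v \<in> V" using v p_in_cone[OF v i] by (auto simp: V0_def cone_def)
    obtain f where f: "\<And>n. f n \<in> K n v" "\<And>n. f n \<in> K n (p i v)"
    proof -
      have "\<forall>n. \<exists>z. z \<in> K n v \<and> z \<in> K n (p i v)" using ct[OF v i] unfolding K_def by blast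
      then show thesis using that by metis
    qed
    obtain \<epsilon> \<epsilon>' where e: "\<epsilon> \<longlonglongrightarrow> 0" "\<And>n z. z \<in> K n v \<Longrightarrow> \<exists>z'\<in>Q v. dist z z' \<le> \<epsilon> n"
      and e': "\<epsilon>' \<longlonglongrightarrow> 0" "\<And>n z. z \<in> K n (p i v) \<Longrightarrow> \<exists>z'\<in>Q (p i v). dist z z' \<le> \<epsilon>' n"
      using close[OF V(1)] close[OF V(2)] by metis
    obtain x where x: "\<And>n. x n \<in> Q v" "\<And>n. dist (f n) (x n) \<le> \<epsilon> n" using e(2)[OF f(1)] by metis
    obtain y where y: "\<And>n. y n \<in> Q (p i v)" "\<And>n. dist (f n) (y n) \<le> \<epsilon>' n" using e'(2)[OF f(2)] by metis
    obtain l s where s: "l \<in> Q v" "strict_mono s" "(x \<circ> s) \<longlonglongrightarrow> l"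
      using Q_compact[OF V(1)] x(1) unfolding compact_def by metis
    have e0: "(\<lambda>n. \<epsilon> (s n) + \<epsilon>' (s n)) \<longlonglongrightarrow> 0"
      using tendsto_add[OF LIMSEQ_subseq_LIMSEQ[OF e(1) s(2)] LIMSEQ_subseq_LIMSEQ[OF e'(1) s(2)]] by (simp add: o_def)
    have "dist (y (s n) - x (s n)) 0 \<le> dist (\<epsilon> (s n) + \<epsilon>' (s n)) 0" for n
      using x(2)[of "s n"] y(2)[of "s n"] dist_triangle3[of "y (s n)" "x (s n)" "f (s n)"] by (simp add: dist_norm)
    then have "(\<lambda>n. y (s n) - x (s n)) \<longlonglongrightarrow> 0"
      by (rule metric_tendsto_imp_tendsto[OF e0 always_eventually[OF allI]])
    then have "(\<lambda>n. (y (s n) - x (s n)) + x (s n)) \<longlonglongrightarrow> 0 + l" using s(3) by (intro tendsto_add) (auto simp: o_def)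
    then have yl: "(\<lambda>n. y (s n)) \<longlonglongrightarrow> l" by simp
    have "l \<in> Q (p i v)" by (rule closed_sequentially[OF compact_imp_closed[OF Q_compact[OF V(2)]] _ yl]) (rule y(1))
    then show ?thesis using s(1) by blast
  qed
  have Q_in: "interior (Q v) \<subseteq> inside C" if v: "v \<in> V0" for v
  proof
    fix q assume q: "q \<in> interior (Q v)"
    have r'v: "0 < r' v"
    proof (rule ccontr)
      assume "\<not> ?thesis"
      then have "Q v = {\<beta>' v}" using r'0[OF v] KV(2)[OF v] hom_0 P(3)[OF v] by (metis antisym_conv2 empty_iff)
      then show False using q by simp
    qed
    have qC: "q \<notin> C"
    proof
      assume "q \<in> C"
      then obtain i where "i \<in> {0, 1, 2}" "q \<in> side i" using C_sides by blast
      then have i: "i < 3" "q \<in> side i" by auto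
      then show False using Q_sep[of v "cor i"] q v cor_V[OF i(1)] cor_not_V0[OF i(1)] Kcor(2)[OF i(1)] by (auto simp: V0_def)
    qed
    define d where "d = setdist {q} C"
    have d: "0 < d" "\<And>x. x \<in> {0..1} \<Longrightarrow> d \<le> norm (g x - q)"
    proof -
      show "0 < d" unfolding d_def using qC compact_path_image[OF path_g] by (simp add: setdist_gt_0_compact_closed compact_imp_closed)
      show "d \<le> norm (g x - q)" if "x \<in> {0..1}" for x
        unfolding d_def using setdist_le_dist[of q "{q}" "g x" C] g_in_C[OF that] by (simp add: dist_norm norm_minus_commute)
    qed
    have "q \<in> Q v" "v \<in> V" using q v interior_subset by (auto simp: V0_def)
    then obtain f where f: "\<And>n. f n \<in> K n v" "f \<longlonglongrightarrow> q" using approx by blast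
    have "(\<lambda>n. \<eta> (\<phi> n) + dist (f n) q) \<longlonglongrightarrow> 0 + dist q q" by (intro tendsto_intros f \<eta>0)
    then have "\<forall>\<^sub>F n in sequentially. \<eta> (\<phi> n) + dist (f n) q < d" using d(1) by (intro order_tendstoD(2)) auto
    then obtain n where n: "\<eta> (\<phi> n) + dist (f n) q < d" by (auto simp: eventually_sequentially)
    interpret G: jordan_sides "G (\<phi> n)" L by (rule G(1))
    have "winding_number (G (\<phi> n)) (f n) = winding_number g q"
    proof (rule winding_number_nearby[OF path_g G.path_g closed_curve G.closed_curve])
      fix t :: real assume t: "t \<in> {0..1}"
      have "norm (G (\<phi> n) t - f n - (g t - q)) = norm ((G (\<phi> n) t - g t) - (f n - q))" by (simp add: algebra_simps)
      also have "\<dots> \<le> norm (G (\<phi> n) t - g t) + norm (f n - q)" by (rule norm_triangle_ineq4)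
      also have "\<dots> \<le> \<eta> (\<phi> n) + dist (f n) q" using G(2)[OF t, of "\<phi> n"] by (simp add: dist_norm)
      also have "\<dots> < norm (g t - q)" using n d(2)[OF t] by linarith
      finally show "norm (G (\<phi> n) t - f n - (g t - q)) < norm (g t - q)" .
    qed
    moreover have "f n \<in> inside (path_image (G (\<phi> n)))" using ins(2)[OF v] f(1)[of n] KV(1)[OF v] by blast
    then have "winding_number (G (\<phi> n)) (f n) \<noteq> 0"
      using simple_closed_path_winding_number_inside[OF G.simple] G.closed_curve by (metis neg_equal_0_iff_equal zero_neq_one)
    ultimately have "q \<notin> outside C" using winding_number_zero_in_outside[OF path_g closed_curve] by auto
    then show "q \<in> inside C" using qC inside_Un_outside[of C] by blast
  qed
  show ?thesis
  proof (intro exI[of _ \<beta>'] exI[of _ r'] conjI ballI allI impI)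
    show "0 \<le> r' v" if "v \<in> V0" for v using r'0[OF that] .
    show "interior (limit_bodies \<beta>' r' u) \<inter> limit_bodies \<beta>' r' v = {}" if "u \<in> V" "v \<in> V" "u \<noteq> v" for u v
      using Q_sep[OF that] unfolding Q_def .
    show "limit_bodies \<beta>' r' v \<inter> limit_bodies \<beta>' r' (p i v) \<noteq> {}" if "v \<in> V0" "i < 3" for v i using Q_ct[OF that] unfolding Q_def .
    show "interior (limit_bodies \<beta>' r' v) \<subseteq> inside C" if "v \<in> V0" for v using Q_in[OF that] unfolding Q_def .
  qed
qed

end

section \<open>Smoothness\<close>

lemma interior_blunt: "z \<in> interior K \<Longrightarrow> blunt K z 1"
proof -
  assume "z \<in> interior K"
  then obtain e where e: "e > 0" "ball z e \<subseteq> interior K" by (meson open_contains_ball open_interior)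
  have "z + of_real t * d \<in> interior K" if "0 < t" "t < e / (norm d + 1)" for t d
  proof -
    have "t * (norm d + 1) < e" using that(2) by (simp add: pos_less_divide_eq add_nonneg_pos)
    then have "norm (of_real t * d) < e" using that(1) by (simp add: norm_mult algebra_simps)
    then show ?thesis using e(2) by (auto simp: dist_norm)
  qed
  moreover have "0 < e / (norm d + 1)" for d :: complex using e(1) by (simp add: add_nonneg_pos)
  ultimately show ?thesis unfolding blunt_def by (metis norm_one)
qed

lemma blunt_hom:
  assumes "blunt P z n" "0 < r"
  shows "blunt (hom \<beta> r P) (of_real r * z + \<beta>) n"
  unfolding blunt_def
proof (intro conjI allI impI)
  show "norm n = 1" using assms(1) by (simp add: blunt_def)
  fix d assume "n \<bullet> d < 0"
  then obtain e where e: "e > 0" "\<And>t. 0 < t \<and> t < e \<Longrightarrow> z + of_real t * d \<in> interior P" using assms(1) unfolding blunt_def by meson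
  have "of_real r * z + \<beta> + of_real t * d \<in> interior (hom \<beta> r P)" if "0 < t" "t < r * e" for t
  proof -
    have "z + of_real (t / r) * d \<in> interior P" using that assms(2) by (intro e(2)) (simp add: divide_less_eq mult.commute)
    moreover have "of_real r * z + \<beta> + of_real t * d = of_real r * (z + of_real (t / r) * d) + \<beta>" using assms(2) by (simp add: field_simps)
    ultimately have "of_real r * z + \<beta> + of_real t * d \<in> hom \<beta> r (interior P)" unfolding hom_def by blast
    then show ?thesis unfolding interior_hom[OF assms(2)] .
  qed
  then show "\<exists>\<epsilon>>0. \<forall>t. 0 < t \<and> t < \<epsilon> \<longrightarrow> of_real r * z + \<beta> + of_real t * d \<in> interior (hom \<beta> r P)"
    using assms(2) e(1) by (intro exI[of _ "r * e"]) auto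
qed

text \<open>A separating hyperplane must pass through z, which is a limit point of both
  sets.\<close>

lemma support_at:
  fixes P :: "complex set"
  assumes "convex P" "interior P \<noteq> {}" "convex R" "R \<noteq> {}" "R \<inter> interior P = {}" "z \<in> P" "z \<in> closure R"
  obtains a where "a \<noteq> 0" "\<And>x. x \<in> P \<Longrightarrow> a \<bullet> x \<le> a \<bullet> z" "\<And>x. x \<in> R \<Longrightarrow> a \<bullet> z \<le> a \<bullet> x"
proof -
  obtain a b where ab: "a \<noteq> 0" "\<And>x. x \<in> interior P \<Longrightarrow> a \<bullet> x \<le> b" "\<And>x. x \<in> R \<Longrightarrow> b \<le> a \<bullet> x"
    using separating_hyperplane_sets[of "interior P" R] assms by (metis Int_commute convex_interior)
  have "closure (interior P) \<subseteq> {x. a \<bullet> x \<le> b}" using ab(2) by (intro closure_minimal closed_halfspace_le) auto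
  then have P: "a \<bullet> x \<le> b" if "x \<in> P" for x using that convex_closure_interior[OF assms(1,2)] closure_subset by blast
  have "closure R \<subseteq> {x. a \<bullet> x \<ge> b}" using ab(3) by (intro closure_minimal closed_halfspace_ge) auto
  then have "a \<bullet> z = b" using P[OF assms(6)] assms(7) by force
  then show thesis using that[of a] ab P by auto
qed

text \<open>A supporting functional at a boundary point z has a maximum along the boundary curve at
  z and so vanishes on the tangent; all of them are thus multiples of one vector n0. If a ray into
  the open half plane missed the interior, separation would give a negative multiple of n0 as a
  supporting functional, and P would be flat.\<close>

lemma smooth_convex_blunt:
  assumes sm: "smooth_planar_set P" and P: "compact P" "convex P" and z: "z \<in> P"
  shows "\<exists>n. blunt P z n"
proof (cases "z \<in> interior P")
  case True
  then show ?thesis using interior_blunt by blast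
next
  case False
  have int: "interior P \<noteq> {}" using sm by (simp add: smooth_planar_set_def)
  obtain \<gamma> L where L: "L > 0" "smooth_param \<gamma> UNIV" "\<And>s. \<gamma> (s + L) = \<gamma> s" "\<gamma> ` {0..<L} = frontier P"
    using sm unfolding smooth_planar_set_def smooth_closed_curve_def by blast
  have "z \<in> frontier P" using z False closure_subset by (auto simp: frontier_def)
  then obtain s where s: "s \<in> {0..<L}" "\<gamma> s = z" using L(4) by (metis imageE)
  obtain d where d: "norm d = 1" "(\<gamma> has_vector_derivative d) (at s)" using L(2) unfolding smooth_param_def by auto
  have fr: "\<gamma> t \<in> P" if "\<bar>t - s\<bar> < L" for t
  proof -
    have "\<exists>t'\<in>{0..<L}. \<gamma> t = \<gamma> t'"
    proof -
      consider "t < 0" | "t \<in> {0..<L}" | "L \<le> t" by fastforce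
      then show ?thesis
      proof cases
        case 1 then show ?thesis using L(3)[of t] s(1) that by (intro bexI[of _ "t + L"]) auto
      next
        case 3 then show ?thesis using L(3)[of "t - L"] s(1) that by (intro bexI[of _ "t - L"]) auto
      qed auto
    qed
    then have "\<gamma> t \<in> frontier P" using L(4) by auto
    then show ?thesis using P(1) compact_imp_closed frontier_subset_closed by blast
  qed
  have tangent: "a \<bullet> d = 0" if a: "\<And>x. x \<in> P \<Longrightarrow> a \<bullet> x \<le> a \<bullet> z" for a
  proof (rule DERIV_local_max[of "\<lambda>t. a \<bullet> \<gamma> t" "a \<bullet> d" s L])
    have "((\<lambda>t. a \<bullet> \<gamma> t) has_vector_derivative a \<bullet> d) (at s)"
      by (rule bounded_linear.has_vector_derivative[OF bounded_linear_inner_right d(2)])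
    then show "((\<lambda>t. a \<bullet> \<gamma> t) has_real_derivative a \<bullet> d) (at s)" by (simp add: has_real_derivative_iff_has_vector_derivative)
    show "\<forall>y. \<bar>s - y\<bar> < L \<longrightarrow> a \<bullet> \<gamma> y \<le> a \<bullet> \<gamma> s" using a fr s(2) by (simp add: abs_minus_commute)
  qed (rule L(1))
  obtain n0 where n0: "n0 \<noteq> 0" "\<And>x. x \<in> P \<Longrightarrow> n0 \<bullet> x \<le> n0 \<bullet> z"
    using support_at[OF P(2) int, of "{z}" z] False z by auto
  \<comment> \<open>In the plane the vectors orthogonal to d form the line spanned by \<i> *
    d.\<close>
  have par: "\<exists>k. a = k *\<^sub>R n0" if "a \<bullet> d = 0" for a
  proof -
    have n0d: "n0 \<bullet> d = 0" using tangent n0(2) by blast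
    have *: "x = ((\<i> * d) \<bullet> x) *\<^sub>R (\<i> * d)" if "x \<bullet> d = 0" for x
    proof -
      have "(Re d)\<^sup>2 + (Im d)\<^sup>2 = 1" using d(1) by (simp add: cmod_def)
      moreover have "Re x * Re d + Im x * Im d = 0" using that by (simp add: inner_complex_def)
      ultimately have "Re x = (Re x * Im d - Im x * Re d) * Im d" "Im x = (Im x * Re d - Re x * Im d) * Re d" by algebra+
      then show ?thesis by (simp add: complex_eq_iff inner_complex_def algebra_simps)
    qed
    have "(\<i> * d) \<bullet> n0 \<noteq> 0" using *[OF n0d] n0(1) by (metis scaleR_zero_left)
    then have "a = (((\<i> * d) \<bullet> a) / ((\<i> * d) \<bullet> n0)) *\<^sub>R n0"
      using *[OF that] *[OF n0d] by (metis nonzero_divide_eq_eq scaleR_scaleR)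
    then show ?thesis by blast
  qed
  have "\<exists>\<epsilon>>0. \<forall>t. 0 < t \<and> t < \<epsilon> \<longrightarrow> z + of_real t * e \<in> interior P" if e: "sgn n0 \<bullet> e < 0" for e
  proof -
    have ne: "n0 \<bullet> e < 0" using e n0(1) by (simp add: sgn_div_norm mult_less_0_iff)
    let ?R = "(\<lambda>t. z + of_real t * e) ` {0<..}"
    have "?R \<inter> interior P \<noteq> {}"
    proof
      assume R: "?R \<inter> interior P = {}"
      have "?R = (+) z ` (\<lambda>t. t *\<^sub>R e) ` {0<..}" by (auto simp: image_image scaleR_conv_of_real)
      moreover have "convex ((\<lambda>t. t *\<^sub>R e) ` {0<..})" by (rule convex_linear_image) (auto intro: linearI simp: algebra_simps)
      ultimately have cR: "convex ?R" by (metis convex_translation)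
      have zR: "z \<in> closure ?R" unfolding closure_approachable
      proof (intro allI impI)
        fix \<epsilon> :: real assume \<epsilon>: "0 < \<epsilon>"
        define t where "t = \<epsilon> / (norm e + 1)"
        have pos: "0 < norm e + 1" by (simp add: add_nonneg_pos)
        then have t: "0 < t" using \<epsilon> by (simp add: t_def)
        have "t * (norm e + 1) = \<epsilon>" using pos by (simp add: t_def)
        then have t: "0 < t" "t * norm e < \<epsilon>" using t by (simp_all add: distrib_left)
        have "dist (z + of_real t * e) z < \<epsilon>" using t by (simp add: dist_norm norm_mult)
        then show "\<exists>y\<in>?R. dist y z < \<epsilon>" using t(1) by (intro bexI[of _ "z + of_real t * e"]) auto
      qed
      obtain a where a: "a \<noteq> 0" "\<And>x. x \<in> P \<Longrightarrow> a \<bullet> x \<le> a \<bullet> z" "\<And>x. x \<in> ?R \<Longrightarrow> a \<bullet> z \<le> a \<bullet> x"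
        by (rule support_at[OF P(2) int cR _ R z zR]) auto
      obtain k where k: "a = k *\<^sub>R n0" using par tangent a(2) by blast
      have "a \<bullet> z \<le> a \<bullet> (z + of_real 1 * e)" by (rule a(3)) (auto intro!: image_eqI[of _ _ 1])
      then have "0 \<le> k * (n0 \<bullet> e)" by (simp add: k inner_add_right)
      then have "k < 0" using ne a(1) k by (auto simp: zero_le_mult_iff)
      obtain x \<epsilon> where x: "\<epsilon> > 0" "cball x \<epsilon> \<subseteq> P" using int by (metis ex_in_conv mem_interior_cball)
      have flat: "n0 \<bullet> y = n0 \<bullet> z" if "y \<in> P" for y
        using n0(2)[OF that] a(2)[OF that] \<open>k < 0\<close> by (simp add: k)
      have "x + (\<epsilon> / norm n0) *\<^sub>R n0 \<in> P" using x n0(1) by (intro subsetD[OF x(2)]) (simp add: dist_norm)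
      moreover have "x \<in> P" using x by auto
      ultimately have "n0 \<bullet> (x + (\<epsilon> / norm n0) *\<^sub>R n0) = n0 \<bullet> x" using flat by metis
      then have "n0 \<bullet> ((\<epsilon> / norm n0) *\<^sub>R n0) = 0" by (simp only: inner_add_right add_cancel_left_right)
      then show False using x(1) n0(1) by simp
    qed
    then obtain t1 where t1: "0 < t1" "z + of_real t1 * e \<in> interior P" by auto
    have seg: "closed_segment (z + of_real t1 * e) z \<subseteq> insert z (interior P)" by (rule segment_in_interior[OF P(2) t1(2) z])
    have "z + of_real t * e \<in> interior P" if t: "0 < t" "t < t1" for t
    proof -
      have "z + of_real t * e = (1 - (1 - t / t1)) *\<^sub>R (z + of_real t1 * e) + (1 - t / t1) *\<^sub>R z"
        using t1(1) by (simp add: scaleR_conv_of_real field_simps)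
      then have "z + of_real t * e \<in> closed_segment (z + of_real t1 * e) z" unfolding in_segment using t t1(1) by (intro exI[of _ "1 - t / t1"]) auto
      moreover have "z + of_real t * e \<noteq> z" using t(1) ne by auto
      ultimately show ?thesis using seg by blast
    qed
    then show ?thesis using t1(1) by blast
  qed
  then have "blunt P z (sgn n0)" unfolding blunt_def using n0(1) by (simp add: norm_sgn)
  then show ?thesis by blast
qed

text \<open>The directions given by bluntness already fill an open half circle. Comparing measures
  requires the whole set of directions to be measurable: up to the interval of angles it is a
  countable union of countable intersections of complements of compact sets.\<close>

lemma region_angle_blunt:
  assumes K: "blunt K z n" and D: "open D" "interior K \<subseteq> D"
  shows "pi \<le> region_angle D z"
proof -
  define M where "M = {\<theta> \<in> {0..<2 * pi}. \<exists>e>0. \<forall>t. 0 < t \<and> t < e \<longrightarrow> z + of_real t * cis \<theta> \<in> D}"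
  define A where "A k m = {\<theta> \<in> {0..2 * pi}. \<exists>t\<in>{1 / real (Suc k + m)..1 / real (Suc k)}. z + of_real t * cis \<theta> \<notin> D}" for k m
  have "compact (A k m)" for k m
  proof -
    let ?R = "{0..2 * pi} \<times> {1 / real (Suc k + m)..1 / real (Suc k)}" and ?f = "\<lambda>x. z + of_real (snd x) * cis (fst x)"
    have "continuous_on ?R ?f" unfolding cis_conv_exp by (intro continuous_intros)
    moreover have cR: "compact ?R" by (intro compact_Times compact_Icc)
    ultimately have "closed (?R \<inter> ?f -` (- D))" using D(1) by (intro continuous_closed_preimage compact_imp_closed[OF cR]) (auto simp: closed_Compl)
    then have "compact (?R \<inter> ?f -` (- D))" using compact_Int_closed[OF cR] by (metis Int_left_absorb)
    then have "compact (fst ` (?R \<inter> ?f -` (- D)))" by (intro compact_continuous_image continuous_intros)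
    moreover have "fst ` (?R \<inter> ?f -` (- D)) = A k m" unfolding A_def by (force simp: image_iff)
    ultimately show ?thesis by simp
  qed
  then have Am: "A k m \<in> sets lebesgue" for k m by (simp add: borel_compact lmeasurable_compact fmeasurableD)
  have "M = {0..<2 * pi} \<inter> (\<Union>k. \<Inter>m. - A k m)"
  proof (intro equalityI subsetI)
    fix \<theta> assume "\<theta> \<in> M"
    then obtain e where \<theta>: "\<theta> \<in> {0..<2 * pi}" and e: "e > 0" "\<And>t. 0 < t \<and> t < e \<Longrightarrow> z + of_real t * cis \<theta> \<in> D" unfolding M_def by blast
    obtain k where k: "1 / real (Suc k) < e" using nat_approx_posE[OF e(1)] by metis
    have "\<theta> \<notin> A k m" for m
    proof
      assume "\<theta> \<in> A k m"
      then obtain t where t: "t \<in> {1 / real (Suc k + m)..1 / real (Suc k)}" "z + of_real t * cis \<theta> \<notin> D" unfolding A_def by blast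
      have "0 < 1 / real (Suc k + m)" by simp
      then have "0 < t" using t(1) by (metis atLeastAtMost_iff less_le_trans)
      moreover have "t < e" using t(1) k by simp
      ultimately show False using e(2) t(2) by blast
    qed
    then show "\<theta> \<in> {0..<2 * pi} \<inter> (\<Union>k. \<Inter>m. - A k m)" using \<theta> by blast
  next
    fix \<theta> assume "\<theta> \<in> {0..<2 * pi} \<inter> (\<Union>k. \<Inter>m. - A k m)"
    then obtain k where k: "\<theta> \<in> {0..<2 * pi}" "\<And>m. \<theta> \<notin> A k m" by blast
    have "z + of_real t * cis \<theta> \<in> D" if t: "0 < t" "t < 1 / real (Suc k)" for t
    proof -
      obtain m where m: "1 / real (Suc m) < t" using nat_approx_posE[OF t(1)] by metis
      have "1 / real (Suc k + m) \<le> 1 / real (Suc m)" by (simp add: frac_le)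
      then have "t \<in> {1 / real (Suc k + m)..1 / real (Suc k)}" using m t(2) by simp
      then show ?thesis using k(1) k(2)[of m] unfolding A_def by auto
    qed
    then show "\<theta> \<in> M" unfolding M_def using k(1) by (intro CollectI conjI exI[of _ "1 / real (Suc k)"]) auto
  qed
  moreover have "(\<Union>k. \<Inter>m. - A k m) \<in> sets lebesgue"
    using Am by (intro sets.countable_UN sets.countable_INT) (auto simp: Compl_eq_Diff_UNIV)
  moreover have "{0..<2 * pi} \<in> sets lebesgue" by simp
  ultimately have "M \<in> sets lebesgue" by (simp only: sets.Int)
  then have M: "M \<in> lmeasurable" by (rule bounded_set_imp_lmeasurable[rotated]) (auto simp: M_def intro: bounded_subset[of "{0..2*pi}"])
  have "norm n = 1" using K by (simp add: blunt_def)
  \<comment> \<open>With this angle \<open>n \<bullet> cis \<theta> = - sin (\<theta> - b)\<close>,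
    so the directions of the half plane are those from b to b + pi, modulo 2 * pi.\<close>
  define b where "b = Arg2pi (\<i> * n)"
  have b: "0 \<le> b" "b < 2 * pi" "\<i> * n = cis b"
    using Arg2pi[of "\<i> * n"] Arg2pi_eq[of "\<i> * n"] \<open>norm n = 1\<close> by (auto simp: b_def cis_conv_exp norm_mult)
  have inM: "\<theta> \<in> M" if "\<theta> \<in> {0..<2 * pi}" "0 < sin (\<theta> - b)" for \<theta>
  proof -
    have "n \<bullet> cis \<theta> = (\<i> * n) \<bullet> (\<i> * cis \<theta>)" by (simp add: inner_complex_def)
    also have "\<dots> = - sin (\<theta> - b)" unfolding b(3) by (simp add: inner_complex_def sin_diff)
    finally have "n \<bullet> cis \<theta> < 0" using that(2) by simp
    then show ?thesis using K D(2) that(1) unfolding blunt_def M_def by blast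
  qed
  \<comment> \<open>If b exceeds pi, the half circle wraps past 2 * pi and is measured in two
    pieces.\<close>
  have "\<exists>S. S \<in> lmeasurable \<and> S \<subseteq> M \<and> measure lebesgue S = pi"
  proof (cases "b \<le> pi")
    case True
    have "{b<..<b + pi} \<subseteq> M" using True b by (auto intro!: inM sin_gt_zero)
    then show ?thesis by (intro exI[of _ "{b<..<b + pi}"]) auto
  next
    case False
    have "{b<..<2 * pi} \<subseteq> M" using False b by (auto intro!: inM sin_gt_zero)
    moreover have "{0<..<b - pi} \<subseteq> M"
    proof
      fix x assume x: "x \<in> {0<..<b - pi}"
      have "0 < sin (x - b + 2 * pi)" using x b False by (intro sin_gt_zero) auto
      then show "x \<in> M" using x b by (intro inM) auto
    qed
    moreover have "measure lebesgue ({b<..<2 * pi} \<union> {0<..<b - pi}) = measure lebesgue {b<..<2 * pi} + measure lebesgue {0<..<b - pi}"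
      by (rule measure_Union) (use b False in auto)
    ultimately show ?thesis using b False by (intro exI[of _ "{b<..<2 * pi} \<union> {0<..<b - pi}"]) auto
  qed
  then obtain S where "S \<in> lmeasurable" "S \<subseteq> M" "measure lebesgue S = pi" by blast
  then have "pi \<le> measure lebesgue M" using measure_mono_fmeasurable[of S M lebesgue] M by (auto simp: fmeasurableD)
  then show ?thesis unfolding region_angle_def M_def .
qed

text \<open>The two parametrizations are only known to have the same image. An inner point of one
  cannot be an end of the other, because an interval stays connected when an end is removed but not
  when an inner point is. So the derivative of the smooth parametrization is two-sided
  there.\<close>

lemma smooth_arc_interior_tangent:
  fixes g :: "real \<Rightarrow> complex"
  assumes sm: "smooth_arc (g ` {a..b})" and g: "continuous_on {a..b} g" "inj_on g {a..b}" and u: "u \<in> {a<..<b}"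
  shows "\<exists>h s d \<epsilon>. norm d = 1 \<and> 0 < \<epsilon> \<and> h s = g u \<and> (h has_vector_derivative d) (at s) \<and> h ` {s - \<epsilon><..<s + \<epsilon>} \<subseteq> g ` {a..b}"
proof -
  obtain h L where h: "L > 0" "smooth_param h {0..L}" "inj_on h {0..L}" "h ` {0..L} = g ` {a..b}"
    using sm unfolding smooth_arc_def by blast
  have "g u \<in> h ` {0..L}" unfolding h(4) using u by (intro imageI) auto
  then obtain s where s: "s \<in> {0..L}" "h s = g u" by (metis imageE)
  obtain d where d: "norm d = 1" "(h has_vector_derivative d) (at s within {0..L})" using h(2) s(1) unfolding smooth_param_def by blast
  have ch: "continuous_on {0..L} h" using h(2) unfolding smooth_param_def continuous_on_eq_continuous_within
    by (metis has_vector_derivative_continuous)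
  obtain k where k: "homeomorphism {a..b} (g ` {a..b}) g k" using homeomorphism_compact[OF compact_Icc g(1) refl g(2)] by blast
  have "s \<noteq> s0" if s0: "s0 \<in> {0, L}" for s0
  proof
    assume e: "s = s0"
    have "{0..L} - {s} = (if s = 0 then {0<..L} else {0..<L})" using s0 e h(1) by auto
    then have "connected ({0..L} - {s})" by auto
    moreover have "continuous_on ({0..L} - {s}) (k \<circ> h)"
      by (rule continuous_on_compose[OF continuous_on_subset[OF ch]])
        (use k h(4) in \<open>auto simp: homeomorphism_def intro: continuous_on_subset\<close>)
    ultimately have con: "connected ((k \<circ> h) ` ({0..L} - {s}))" by (rule connected_continuous_image[rotated])
    have "(k \<circ> h) ` ({0..L} - {s}) = {a..b} - {u}"
    proof -
      have "h ` ({0..L} - {s}) = g ` ({a..b} - {u})"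
        using inj_on_image_set_diff[OF h(3), of "{0..L}" "{s}"] inj_on_image_set_diff[OF g(2), of "{a..b}" "{u}"] s u h(4) by simp
      then have "(k \<circ> h) ` ({0..L} - {s}) = k ` g ` ({a..b} - {u})" by (metis image_comp)
      also have "\<dots> = {a..b} - {u}" using k by (force simp: homeomorphism_def image_image)
      finally show ?thesis .
    qed
    then have "connected ({a..b} - {u})" using con by simp
    then have "{a..b} \<subseteq> {a..b} - {u}" by (rule connected_contains_Icc) (use u in auto)
    moreover have "u \<in> {a..b}" using u by auto
    ultimately show False by blast
  qed
  then have s': "0 < s" "s < L" using s(1) by (auto simp: order_less_le)
  have "(h has_vector_derivative d) (at s)" using d(2) s' by (simp add: at_within_Icc_at)
  moreover have "h ` {s - min s (L - s)<..<s + min s (L - s)} \<subseteq> g ` {a..b}" unfolding h(4)[symmetric] by (intro image_mono) auto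
  ultimately show ?thesis using d(1) s(2) s' by (intro exI[of _ h] exI[of _ s] exI[of _ d] exI[of _ "min s (L - s)"]) auto
qed

section \<open>Two blunt bodies cannot share a point of a smooth side\<close>

definition side_of :: "complex \<Rightarrow> complex \<Rightarrow> complex \<Rightarrow> real" where
  "side_of z m w = (\<i> * m) \<bullet> (w - z)"

lemma side_of_zero: "m \<noteq> 0 \<Longrightarrow> side_of z m w = 0 \<longleftrightarrow> (\<exists>t. w = z + of_real t * m)"
proof
  assume m: "m \<noteq> 0" and "side_of z m w = 0"
  then have "Im (cnj m * (w - z)) = 0" by (simp add: side_of_def inner_complex_def)
  then obtain r where r: "cnj m * (w - z) = of_real r" by (metis complex_is_Real_iff Reals_cases)
  have "of_real ((norm m)\<^sup>2) * (w - z) = m * (cnj m * (w - z))" by (simp only: complex_norm_square mult.assoc)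
  then have "w - z = of_real (r / (norm m)\<^sup>2) * m" using m r by (simp add: field_simps)
  then show "\<exists>t. w = z + of_real t * m" by (metis add.commute diff_add_cancel)
qed (auto simp: side_of_def inner_complex_def)

text \<open>A closed curve leaving z in both directions along a tangent transversal to m cannot have both m-sides of z inside:
  joining them inside the curve would give a simple loop that the curve crosses only once, at z.\<close>

lemma (in jordan_sides) one_sided:
  assumes u: "u \<in> {0<..<1}" and z: "z = g u"
    and h: "h s = z" "(h has_vector_derivative d) (at s)" "0 < \<epsilon>" "h ` {s - \<epsilon><..<s + \<epsilon>} \<subseteq> C"
    and m: "(\<i> * m) \<bullet> d \<noteq> 0"
    and i: "0 < \<tau>" "\<And>t. 0 < t \<Longrightarrow> t \<le> \<tau> \<Longrightarrow> z + of_real t * m \<in> inside C" "\<And>t. 0 < t \<Longrightarrow> t \<le> \<tau> \<Longrightarrow> z - of_real t * m \<in> inside C"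
  shows False
proof -
  have m0: "m \<noteq> 0" using m by auto
  let ?p = "\<lambda>t. z + of_real t * m"
  have pinj: "?p t = ?p t' \<longleftrightarrow> t = t'" for t t' using m0 by simp
  have cp: "continuous_on S ?p" for S by (intro continuous_intros)
  have ins: "?p t \<in> inside C" if "t \<noteq> 0" "\<bar>t\<bar> \<le> \<tau>" for t
    using i(2)[of t] i(3)[of "-t"] that by (cases "t > 0") auto
  have "path_connected (inside C)" using C_facts(1,2) by (simp add: connected_open_path_connected)
  then obtain q0 where q0: "path q0" "path_image q0 \<subseteq> inside C" "pathstart q0 = ?p \<tau>" "pathfinish q0 = ?p (-\<tau>)"
    using ins[of \<tau>] ins[of "-\<tau>"] i(1) unfolding path_connected_def by fastforce
  obtain q where q: "arc q" "path_image q \<subseteq> inside C" "pathstart q = ?p \<tau>" "pathfinish q = ?p (-\<tau>)"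
    using path_contains_arc[OF q0(1,3,4)] q0(2) pinj[of \<tau> "-\<tau>"] i(1) by (metis equal_neg_zero less_irrefl order_trans)
  have cq: "continuous_on {0..1} q" using q(1) by (simp add: arc_def path_def)
  let ?A = "?p ` {0..\<tau>}" and ?B = "?p ` {-\<tau>..0}"
  have AB: "compact ?A" "compact ?B" by (intro compact_continuous_image cp compact_Icc)+
  have "z \<in> C" unfolding z using u by (intro g_in_C) auto
  then have zin: "z \<notin> inside C" using inside_no_overlap[of C] by blast
  have cpre: "compact ({x..y} \<inter> q -` S)" if "compact S" "0 \<le> x" "y \<le> 1" for x y S
  proof -
    have "closed ({x..y} \<inter> q -` S)" using that
      by (intro continuous_closed_preimage continuous_on_subset[OF cq] compact_imp_closed[OF that(1)]) auto
    then have "compact ({x..y} \<inter> ({x..y} \<inter> q -` S))" using compact_Int_closed[OF compact_Icc] by blast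
    then show ?thesis by (simp only: Int_left_absorb)
  qed
  have ne: "0 \<in> {0..1} \<inter> q -` ?A" using q(3) i(1) by (auto simp: pathstart_def)
  \<comment> \<open>The last time of q on the forward segment and, after it, the first time on the
    backward segment: in between q meets the two segments only at these ends, so the loop J is
    simple.\<close>
  obtain t1 where "t1 \<in> {0..1} \<inter> q -` ?A" "\<forall>t\<in>{0..1} \<inter> q -` ?A. t \<le> t1"
    using compact_attains_sup[OF cpre[OF AB(1), of 0 1]] ne by blast
  then have t1: "t1 \<in> {0..1}" "q t1 \<in> ?A" "\<And>t. t \<in> {0..1} \<Longrightarrow> q t \<in> ?A \<Longrightarrow> t \<le> t1" by blast+
  have ne: "1 \<in> {t1..1} \<inter> q -` ?B" using q(4) i(1) t1(1) by (auto simp: pathfinish_def image_iff intro!: bexI[of _ "- \<tau>"])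
  obtain t2 where "t2 \<in> {t1..1} \<inter> q -` ?B" "\<forall>t\<in>{t1..1} \<inter> q -` ?B. t2 \<le> t"
    using compact_attains_inf[OF cpre[OF AB(2), of t1 1]] ne t1(1) by (metis atLeastAtMost_iff empty_iff order_refl)
  then have t2: "t2 \<in> {t1..1}" "q t2 \<in> ?B" "\<And>t. t \<in> {t1..1} \<Longrightarrow> q t \<in> ?B \<Longrightarrow> t2 \<le> t" by blast+
  have qin: "q t \<in> inside C" if "t \<in> {0..1}" for t using q(2) that by (auto simp: path_image_def)
  obtain x y where x: "x \<in> {0..\<tau>}" "q t1 = ?p x" and y: "y \<in> {-\<tau>..0}" "q t2 = ?p y" using t1(2) t2(2) by blast
  have x0: "x \<noteq> 0" using x zin qin[OF t1(1)] by auto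
  have y0: "y \<noteq> 0" using y zin qin[of t2] t1(1) t2(1) by auto
  have xy: "0 < x" "y < 0" using x(1) y(1) x0 y0 by auto
  have t12: "t1 < t2" using t2(1) x(2) y(2) xy pinj[of x y] by (cases "t1 = t2") auto
  let ?Q = "subpath t1 t2 q" and ?l = "linepath (?p y) (?p x)"
  define J where "J = ?Q +++ ?l"
  have Q: "arc ?Q" "pathstart ?Q = ?p x" "pathfinish ?Q = ?p y" "path_image ?Q = q ` {t1..t2}"
    using arc_subpath_arc[OF q(1), of t1 t2] t1(1) t2(1) t12 x y by (auto simp: path_image_subpath)
  have seg: "closed_segment (?p y) (?p x) = ?p ` {y..x}"
  proof -
    have "closed_segment (?p y) (?p x) = ?p ` ((\<lambda>t. (1 - t) *\<^sub>R y + t *\<^sub>R x) ` {0..1})"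
      unfolding closed_segment_image_interval image_image by (intro image_cong refl) (simp add: scaleR_conv_of_real algebra_simps)
    also have "\<dots> = ?p ` closed_segment y x" unfolding closed_segment_image_interval ..
    finally show ?thesis using xy by (simp add: closed_segment_eq_real_ivl)
  qed
  have PJ: "path_image J = q ` {t1..t2} \<union> ?p ` {y..x}" unfolding J_def using Q seg by (simp add: path_image_join)
  have J: "simple_path J" "pathfinish J = pathstart J"
  proof -
    have "path_image ?Q \<inter> path_image ?l \<subseteq> {pathstart ?Q, pathstart ?l}"
    proof
      fix w assume "w \<in> path_image ?Q \<inter> path_image ?l"
      then have "w \<in> q ` {t1..t2}" "w \<in> ?p ` {y..x}" using Q(4) seg by simp_all
      then obtain t r where w: "t \<in> {t1..t2}" "w = q t" "r \<in> {y..x}" "w = ?p r" by blast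
      have t: "t \<in> {0..1}" "t \<in> {t1..1}" using w(1) t1(1) t2(1) by auto
      show "w \<in> {pathstart ?Q, pathstart ?l}"
      proof (cases "r \<ge> 0")
        case True
        then have "r \<in> {0..\<tau>}" using w(3) x(1) by auto
        then have "q t \<in> ?A" using w(2,4) by blast
        then have "t = t1" using t1(3)[OF t(1)] w(1) by simp
        then show ?thesis using w x Q by simp
      next
        case False
        then have "r \<in> {-\<tau>..0}" using w(3) y(1) by auto
        then have "q t \<in> ?B" using w(2,4) by blast
        then have "t = t2" using t2(3)[OF t(2)] w(1) by simp
        then show ?thesis using w y Q by simp
      qed
    qed
    moreover have "arc ?l" using pinj[of y x] xy by (intro arc_linepath) auto
    ultimately show "simple_path J" unfolding J_def using Q by (intro simple_path_join_loop) auto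
    show "pathfinish J = pathstart J" unfolding J_def using Q by simp
  qed
  note JF = Jordan_curve_facts[OF J] and Jcases = Jordan_curve_connected_cases[OF J]
  have zJ: "z \<in> path_image J" unfolding PJ using xy by (auto intro!: image_eqI[of _ _ 0])
  have zQ: "z \<notin> q ` {t1..t2}" using zin qin t1(1) t2(1) by force
  have "closed (q ` {t1..t2})" using Q(1,4) by (metis arc_imp_path closed_path_image)
  then obtain \<delta>1 where \<delta>1: "\<delta>1 > 0" "ball z \<delta>1 \<inter> q ` {t1..t2} = {}"
    using zQ by (metis open_contains_ball open_Compl ComplI disjoint_eq_subset_Compl)
  \<comment> \<open>Within this distance of z the loop consists only of a piece of the line through
    z in direction m.\<close>
  define \<delta> where "\<delta> = min \<delta>1 (min x (- y) * norm m)"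
  have \<delta>0: "\<delta> > 0" using \<delta>1(1) xy m0 by (simp add: \<delta>_def)
  have ballJ: "w \<in> path_image J \<longleftrightarrow> side_of z m w = 0" if w: "w \<in> ball z \<delta>" for w
  proof
    assume "w \<in> path_image J"
    moreover have "w \<in> ball z \<delta>1" using w by (simp add: \<delta>_def)
    ultimately have "w \<in> ?p ` {y..x}" using \<delta>1(2) unfolding PJ by blast
    then show "side_of z m w = 0" unfolding side_of_zero[OF m0] by blast
  next
    assume "side_of z m w = 0"
    then obtain t where t: "w = ?p t" unfolding side_of_zero[OF m0] by blast
    have "\<bar>t\<bar> * norm m < min x (- y) * norm m" using w by (simp add: t dist_norm norm_mult \<delta>_def)
    then have "\<bar>t\<bar> < min x (- y)" using m0 by simp
    then have "t \<in> {y..x}" by auto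
    then show "w \<in> path_image J" unfolding PJ t by blast
  qed
  have half: "connected (ball z \<delta> \<inter> {w. side_of z m w > 0})" "connected (ball z \<delta> \<inter> {w. side_of z m w < 0})"
  proof -
    have "{w. side_of z m w > 0} = {w. (\<i> * m) \<bullet> w > (\<i> * m) \<bullet> z}" "{w. side_of z m w < 0} = {w. (\<i> * m) \<bullet> w < (\<i> * m) \<bullet> z}"
      by (auto simp: side_of_def inner_diff_right)
    then show "connected (ball z \<delta> \<inter> {w. side_of z m w > 0})" "connected (ball z \<delta> \<inter> {w. side_of z m w < 0})"
      by (metis convex_Int convex_ball convex_connected convex_halfspace_gt, metis convex_Int convex_ball convex_connected convex_halfspace_lt)
  qed
  have conn: "connected (C - {z})"
  proof -
    have "connected (g ` {0..<u} \<union> g ` {u<..1})"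
    proof (rule connected_Un)
      show "connected (g ` {0..<u})" "connected (g ` {u<..1})"
        using u by (auto intro!: connected_continuous_image continuous_on_subset[OF cts_g])
      show "g ` {0..<u} \<inter> g ` {u<..1} \<noteq> {}" using g01 u by (metis IntI atLeastLessThan_iff empty_iff greaterThanAtMost_iff greaterThanLessThan_iff imageI order_refl)
    qed
    moreover have "C - {z} = g ` {0..<u} \<union> g ` {u<..1}"
    proof -
      have "{0..1} - {u} = {0..<u} \<union> {u<..1}" using u by auto
      moreover have "C - {z} = g ` ({0..1} - {u})" unfolding path_image_def z using g_open_eq[OF u] by blast
      ultimately show ?thesis by (metis image_Un)
    qed
    ultimately show ?thesis by simp
  qed
  have CJ: "(C - {z}) \<inter> path_image J = {}"
  proof -
    have "q t \<notin> C" if "t \<in> {t1..t2}" for t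
    proof -
      have "q t \<in> inside C" using that t1(1) t2(1) by (intro qin) auto
      then show ?thesis using inside_no_overlap[of C] by blast
    qed
    moreover have "?p r \<notin> C - {z}" if "r \<in> {y..x}" for r
    proof (cases "r = 0")
      case False
      then have "?p r \<in> inside C" using that x(1) y(1) by (intro ins) auto
      then show ?thesis using inside_no_overlap[of C] by blast
    qed simp
    ultimately show ?thesis unfolding PJ by blast
  qed
  define F where "F t = side_of z m (h t)" for t
  have "((\<lambda>t. (\<i> * m) \<bullet> (h t - z)) has_vector_derivative (\<i> * m) \<bullet> d) (at s)"
    by (rule bounded_linear.has_vector_derivative[OF bounded_linear_inner_right]) (auto intro!: derivative_eq_intros h(2))
  then have F: "(F has_real_derivative (\<i> * m) \<bullet> d) (at s)" "F s = 0"
    by (simp_all add: F_def[abs_def] side_of_def has_real_derivative_iff_has_vector_derivative h(1))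
  have "isCont h s" using h(2) by (rule has_vector_derivative_continuous)
  then obtain \<delta>2 where \<delta>2: "\<delta>2 > 0" "\<And>t. \<bar>t - s\<bar> < \<delta>2 \<Longrightarrow> dist (h t) z < \<delta>"
    using \<delta>0 unfolding continuous_at_eps_delta h(1) by (metis dist_real_def)
  \<comment> \<open>The derivative of \<open>F\<close> at s is not 0, so h passes from one side of
    the line to the other.\<close>
  have "\<exists>e>0. \<forall>t. 0 < t \<and> t < e \<longrightarrow> F (s + t) * F (s - t) < 0"
  proof (cases "(\<i> * m) \<bullet> d > 0")
    case True
    obtain e where "e > 0" "\<And>t. 0 < t \<Longrightarrow> t < e \<Longrightarrow> F s < F (s + t)" using DERIV_pos_inc_right[OF F(1) True] by blast
    moreover obtain e' where "e' > 0" "\<And>t. 0 < t \<Longrightarrow> t < e' \<Longrightarrow> F (s - t) < F s" using DERIV_pos_inc_left[OF F(1) True] by blast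
    ultimately show ?thesis unfolding F(2) by (intro exI[of _ "min e e'"]) (auto simp: mult_less_0_iff)
  next
    case False
    then have neg: "(\<i> * m) \<bullet> d < 0" using m by simp
    obtain e where "e > 0" "\<And>t. 0 < t \<Longrightarrow> t < e \<Longrightarrow> F (s + t) < F s" using DERIV_neg_dec_right[OF F(1) neg] by blast
    moreover obtain e' where "e' > 0" "\<And>t. 0 < t \<Longrightarrow> t < e' \<Longrightarrow> F s < F (s - t)" using DERIV_neg_dec_left[OF F(1) neg] by blast
    ultimately show ?thesis unfolding F(2) by (intro exI[of _ "min e e'"]) (auto simp: mult_less_0_iff)
  qed
  then obtain e where e: "e > 0" "\<And>t. 0 < t \<and> t < e \<Longrightarrow> F (s + t) * F (s - t) < 0" by blast
  define t where "t = min e (min \<delta>2 \<epsilon>) / 2"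
  have t: "0 < t" "t < e" "t < \<delta>2" "t < \<epsilon>" using e(1) \<delta>2(1) h(3) by (auto simp: t_def)
  have pts: "h t' \<in> C - {z} \<and> h t' \<in> ball z \<delta>" if "t' = s + t \<or> t' = s - t" for t'
  proof -
    have "\<bar>t' - s\<bar> < \<delta>2" "t' \<in> {s - \<epsilon><..<s + \<epsilon>}" using that t by auto
    then have "h t' \<in> C" "h t' \<in> ball z \<delta>" using h(4) \<delta>2(2) by (auto simp: dist_commute)
    moreover have "F t' \<noteq> 0" using e(2)[of t] t that by auto
    then have "h t' \<noteq> z" by (auto simp: F_def side_of_def)
    ultimately show ?thesis by blast
  qed
  have "F (s + t) > 0 \<and> F (s - t) < 0 \<or> F (s + t) < 0 \<and> F (s - t) > 0" using e(2)[of t] t by (auto simp: mult_less_0_iff)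
  then obtain a b where a: "a \<in> C - {z}" "a \<in> ball z \<delta> \<inter> {w. side_of z m w > 0}"
    and b: "b \<in> C - {z}" "b \<in> ball z \<delta> \<inter> {w. side_of z m w < 0}"
    using pts[of "s + t"] pts[of "s - t"] unfolding F_def by blast
  have HJ: "(ball z \<delta> \<inter> {w. side_of z m w > 0}) \<inter> path_image J = {}" "(ball z \<delta> \<inter> {w. side_of z m w < 0}) \<inter> path_image J = {}"
    using ballJ by auto
  \<comment> \<open>C - {z} is connected and misses J but has points in both half discs, so both
    half discs lie on the same side of J. Yet z is in the closure of the inside and of the outside
    of J.\<close>
  have one: "ball z \<delta> - path_image J \<subseteq> X" if X: "X = inside (path_image J) \<or> X = outside (path_image J)" "C - {z} \<subseteq> X" for X
  proof -
    have "ball z \<delta> \<inter> {w. side_of z m w > 0} \<subseteq> X" "ball z \<delta> \<inter> {w. side_of z m w < 0} \<subseteq> X"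
      using Jcases[OF half(1) HJ(1)] Jcases[OF half(2) HJ(2)] X a b inside_Int_outside[of "path_image J"] by blast+
    moreover have "w \<in> ball z \<delta> \<inter> {w. side_of z m w > 0} \<or> w \<in> ball z \<delta> \<inter> {w. side_of z m w < 0}" if "w \<in> ball z \<delta> - path_image J" for w
      using ballJ[of w] that by auto
    ultimately show ?thesis by blast
  qed
  have meets: "ball z \<delta> \<inter> inside (path_image J) \<noteq> {}" "ball z \<delta> \<inter> outside (path_image J) \<noteq> {}"
  proof -
    have "z \<in> closure (inside (path_image J))" "z \<in> closure (outside (path_image J))" unfolding JF(10,11) using zJ by auto
    then show "ball z \<delta> \<inter> inside (path_image J) \<noteq> {}" "ball z \<delta> \<inter> outside (path_image J) \<noteq> {}"
      using \<delta>0 open_Int_closure_eq_empty[OF open_ball, of z \<delta>] by (metis IntI centre_in_ball empty_iff)+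
  qed
  show False using Jcases[OF conn CJ]
  proof
    assume "C - {z} \<subseteq> inside (path_image J)"
    then have "ball z \<delta> - path_image J \<subseteq> inside (path_image J)" by (intro one) auto
    then show False using meets(2) inside_Int_outside[of "path_image J"] outside_no_overlap[of "path_image J"] by blast
  next
    assume "C - {z} \<subseteq> outside (path_image J)"
    then have "ball z \<delta> - path_image J \<subseteq> outside (path_image J)" by (intro one) auto
    then show False using meets(1) inside_Int_outside[of "path_image J"] inside_no_overlap[of "path_image J"] by blast
  qed
qed

text \<open>The two normals are opposite. So for a direction m transversal to the tangent one set
  contains a short segment from z in direction m and the other one in direction -m, which
  \<open>one_sided\<close> excludes.\<close>

lemma (in jordan_sides) blunt_pair_off_smooth_side:
  assumes i: "i < 3" and sm: "smooth_arc (side i)" and z: "z \<in> oside i"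
    and K: "blunt K z n" "blunt K' z n'" "interior K \<inter> interior K' = {}" "interior K \<subseteq> inside C" "interior K' \<subseteq> inside C"
  shows False
proof -
  obtain u where u: "u \<in> {L i<..<L (Suc i)}" "z = g u" using z unfolding oside_def by blast
  have u01: "u \<in> {0<..<1}" using open_param[OF i u(1)] .
  have sub: "{L i..L (Suc i)} \<subseteq> {0..1}" using L_range[OF i] by auto
  have "inj_on g {L i..L (Suc i)}"
  proof (rule inj_onI)
    fix x y assume xy: "x \<in> {L i..L (Suc i)}" "y \<in> {L i..L (Suc i)}" "g x = g y"
    have "\<not> (L i = 0 \<and> L (Suc i) = 1)" using i L_order L0 unfolding three by auto
    then show "x = y" using g_inj[of x y] xy sub L_range[OF i] by fastforce
  qed
  then obtain h s d \<epsilon> where h: "norm d = 1" "0 < \<epsilon>" "h s = g u" "(h has_vector_derivative d) (at s)" "h ` {s - \<epsilon><..<s + \<epsilon>} \<subseteq> g ` {L i..L (Suc i)}"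
    using smooth_arc_interior_tangent[OF sm[unfolded side_def] continuous_on_subset[OF cts_g sub] _ u(1)] by blast
  have hC: "h ` {s - \<epsilon><..<s + \<epsilon>} \<subseteq> C" using h(5) side_C[OF i] unfolding side_def by blast
  have n': "n' = - n" by (rule blunt_opposite[OF K(1-3)])
  have n1: "norm n = 1" using K(1) by (simp add: blunt_def)
  \<comment> \<open>If -n is parallel to the tangent it is tilted by a perpendicular component,
    which keeps it in the half plane.\<close>
  have "\<exists>m. n \<bullet> m < 0 \<and> (\<i> * m) \<bullet> d \<noteq> 0"
  proof (cases "(\<i> * n) \<bullet> d = 0")
    case False
    then show ?thesis using n1 by (intro exI[of _ "- n"]) (auto simp: norm_eq_1)
  next
    case True
    have "(n \<bullet> d)\<^sup>2 + ((\<i> * n) \<bullet> d)\<^sup>2 = (norm n * norm d)\<^sup>2"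
      unfolding power_mult_distrib cmod_power2 by (simp add: inner_complex_def power2_eq_square algebra_simps)
    then have "n \<bullet> d \<noteq> 0" using True n1 h(1) by auto
    moreover have "(\<i> * (- n + \<i> * n)) \<bullet> d = - ((\<i> * n) \<bullet> d) - n \<bullet> d" by (simp add: inner_complex_def algebra_simps)
    moreover have "n \<bullet> (- n + \<i> * n) = - (n \<bullet> n)" by (simp add: inner_complex_def algebra_simps)
    ultimately show ?thesis using True n1 by (intro exI[of _ "- n + \<i> * n"]) (auto simp: norm_eq_1)
  qed
  then obtain m where m: "n \<bullet> m < 0" "(\<i> * m) \<bullet> d \<noteq> 0" by blast
  then have "n' \<bullet> (- m) < 0" using n' by simp
  then obtain e e' where e: "e > 0" "\<And>t. 0 < t \<and> t < e \<Longrightarrow> z + of_real t * m \<in> interior K"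
    and e': "e' > 0" "\<And>t. 0 < t \<and> t < e' \<Longrightarrow> z + of_real t * (- m) \<in> interior K'"
    using K(1,2) m(1) unfolding blunt_def by meson
  show False
  proof (rule one_sided[OF u01 u(2) _ h(4,2) hC m(2), of "min e e' / 2"])
    show "z + of_real t * m \<in> inside C" if "0 < t" "t \<le> min e e' / 2" for t using e(2)[of t] that K(4) e(1) e'(1) by auto
    show "z - of_real t * m \<in> inside C" if "0 < t" "t \<le> min e e' / 2" for t using e'(2)[of t] that K(5) e(1) e'(1) by auto
  qed (use h(3) u(2) e(1) e'(1) in auto)
qed

section \<open>Nondegeneracy\<close>

context jordan_sides
begin

lemma three_sides: "side 0 \<inter> side 1 \<inter> side 2 = {}"
proof (rule ccontr)
  assume "\<not> ?thesis"
  then obtain z where z: "z \<in> side 0" "z \<in> side 1" "z \<in> side 2" by blast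
  have "z \<notin> oside 0" using oside_disjoint[of 0 1] z(2) by auto
  then have "z = g (L 0) \<or> z = g (L (Suc 0))" using side_cases[of 0 z] z(1) by auto
  moreover have "g (L (Suc 0)) \<notin> side 2" using corner_opposite[of 0] by (simp add: nx_simps)
  moreover have "g (L 0) \<notin> side 1" using corner_opposite[of 2] L_nx[of 2] by (simp add: nx_simps)
  ultimately show False using z by blast
qed

lemma sides_meet: "i < 3 \<Longrightarrow> j < 3 \<Longrightarrow> side i \<inter> side j \<noteq> {}"
proof -
  have c: "g (L i) \<in> side i" "g (L (Suc i)) \<in> side i" if "i < 3" for i using L_less[OF that] by (auto simp: side_def)
  have "side i \<inter> side (nx i) \<noteq> {}" if "i < 3" for i
    using c(2)[OF that] c(1)[OF nx_pv(1)[OF that]] L_nx[OF that] by auto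
  from this[of 0] this[of 1] this[of 2] c[of 0] c[of 1] c[of 2] show "i < 3 \<Longrightarrow> j < 3 \<Longrightarrow> side i \<inter> side j \<noteq> {}"
    unfolding three by (auto simp: nx_simps Int_commute)
qed

lemma interior_side: "i < 3 \<Longrightarrow> interior (side i) = {}"
  using interior_mono[OF side_C] C_facts(12) by blast

lemma side_not_point: "i < 3 \<Longrightarrow> side i \<noteq> {z}"
proof
  assume i: "i < 3" and "side i = {z}"
  moreover have "g (L i) \<in> side i" "g (md i) \<in> side i" using md(1)[OF i] L_less[OF i] by (auto simp: side_def)
  ultimately have "g (md i) = g (L i)" by auto
  then show False using g_open_eq[OF open_param[OF i, of "md i"], of "L i"] md(1)[OF i] L_range[OF i] L_less[OF i] by auto
qed

lemma connected_side: "i < 3 \<Longrightarrow> connected (side i)"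
  unfolding side_def using L_range[of i] by (intro connected_continuous_image continuous_on_subset[OF cts_g]) auto

lemma corner_sides: "k < 4 \<Longrightarrow> \<exists>i<3. \<exists>j<3. i \<noteq> j \<and> g (L k) \<in> side i \<inter> side j"
proof -
  assume "k < 4"
  moreover have "\<exists>i<3. \<exists>j<3. i \<noteq> j \<and> g (L (Suc i0)) \<in> side i \<inter> side j" if i: "i0 < 3" for i0
    using i nx_pv(1,5)[OF i] L_nx[OF i] L_less[OF i] L_less[OF nx_pv(1)[OF i]]
    by (intro exI[of _ i0] conjI exI[of _ "nx i0"]) (auto simp: side_def image_iff intro: bexI[of _ "L (nx i0)"])
  moreover have "g (L 0) = g (L (Suc 2))" using g01 L0 L3 by simp
  ultimately show ?thesis by (cases k) (metis less_2_cases_iff numeral_3_eq_3 numeral_2_eq_2 lessI, auto)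
qed

end

lemma blunt_interior: "blunt K z n \<Longrightarrow> interior K \<noteq> {}"
proof -
  assume b: "blunt K z n"
  then have "n \<bullet> (- n) < 0" by (auto simp: blunt_def norm_eq_1)
  then obtain e where "e > 0" "\<And>t. 0 < t \<and> t < e \<Longrightarrow> z + of_real t * (- n) \<in> interior K" using b unfolding blunt_def by meson
  then show ?thesis using dense[of 0 e] by blast
qed

context framework
begin

text \<open>The sides have empty interior and are not blunt, so triple points on them need separate
  arguments: a body at a corner would force an angle of at least pi there, and two bodies at another
  point of a smooth side contradict \<open>blunt_pair_off_smooth_side\<close>. With triple points
  gone the sizes are positive, and \<open>contact_unique\<close> applies to the limit
  itself.\<close>

lemma limit_nondegenerate:
  assumes ne: "V0 \<noteq> {}" and r: "\<And>v. v \<in> V0 \<Longrightarrow> 0 \<le> r v"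
    and sep: "\<And>u v. u \<in> V \<Longrightarrow> v \<in> V \<Longrightarrow> u \<noteq> v \<Longrightarrow> interior (limit_bodies \<beta> r u) \<inter> limit_bodies \<beta> r v = {}"
    and ct: "\<And>v i. v \<in> V0 \<Longrightarrow> i < 3 \<Longrightarrow> limit_bodies \<beta> r v \<inter> limit_bodies \<beta> r (p i v) \<noteq> {}"
    and ins: "\<And>v. v \<in> V0 \<Longrightarrow> interior (limit_bodies \<beta> r v) \<subseteq> inside C"
    and blP: "\<And>v z. v \<in> V0 \<Longrightarrow> z \<in> P v \<Longrightarrow> \<exists>n. blunt (P v) z n"
    and sm: "\<And>i. i < 3 \<Longrightarrow> smooth_arc (side i)"
    and angle: "\<And>k. k < 4 \<Longrightarrow> region_angle (inside C) (g (L k)) < pi"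
  shows "(\<forall>v\<in>V0. 0 < r v \<and> interior (limit_bodies \<beta> r v) \<noteq> {}) \<and>
    (\<forall>x\<in>V. \<forall>y\<in>V. \<forall>w\<in>V. x \<noteq> y \<longrightarrow> y \<noteq> w \<longrightarrow> x \<noteq> w \<longrightarrow> limit_bodies \<beta> r x \<inter> limit_bodies \<beta> r y \<inter> limit_bodies \<beta> r w = {}) \<and>
    (\<forall>v\<in>V0. \<forall>i<3. \<forall>u\<in>cone i v. limit_bodies \<beta> r v \<inter> limit_bodies \<beta> r u \<noteq> {} \<longrightarrow> u = p i v)"
proof -
  define Q where "Q = limit_bodies \<beta> r"
  note sep = sep[folded Q_def] and ct = ct[folded Q_def] and ins = ins[folded Q_def]
  define D where "D = {v \<in> V0. r v = 0}"
  have QV: "Q v = hom (\<beta> v) (r v) (P v)" if "v \<in> V0" for v using that by (simp add: Q_def bodies_def thick_0)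
  have Qcor: "Q (cor i) = side i" if "i < 3" for i unfolding Q_def using bodies_cor[OF ne that] .
  have V0V: "v \<in> V" if "v \<in> V0" for v using that by (simp add: V0_def)
  have bl: "\<exists>n. blunt (Q v) z n" if v: "v \<in> V0 - D" and z: "z \<in> Q v" for v z
  proof -
    have r0: "0 < r v" using r[of v] v unfolding D_def by force
    obtain q where q: "q \<in> P v" "z = of_real (r v) * q + \<beta> v" using z v QV[of v] unfolding hom_def by auto
    then obtain n where "blunt (P v) q n" using blP[of v q] v by blast
    then show ?thesis using blunt_hom[OF _ r0, of "P v" q n "\<beta> v"] v QV[of v] q(2) by auto
  qed
  have corner_free: "g (L k) \<notin> Q v" if vk: "v \<in> V0 - D" "k < 4" for v k
  proof
    assume "g (L k) \<in> Q v"
    then obtain n where "blunt (Q v) (g (L k)) n" using bl vk(1) by blast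
    then have "pi \<le> region_angle (inside C) (g (L k))" using region_angle_blunt[OF _ C_facts(1) ins] vk(1) by blast
    then show False using angle[OF vk(2)] by simp
  qed
  have apart: "interior (Q x) \<inter> interior (Q y) = {}" if "x \<in> V" "y \<in> V" "x \<noteq> y" for x y
    using sep[OF that] interior_subset[of "Q y"] by blast
  have on_side: "z \<in> oside i" if "v \<in> V0 - D" "i < 3" "z \<in> Q v" "z \<in> side i" for v i z
  proof -
    have "i < 4" "Suc i < 4" using that(2) by auto
    then show ?thesis using side_cases[OF that(2,4)] corner_free[OF that(1)] that(3) by metis
  qed
  have two: "Q x \<inter> Q y \<inter> side i = {}" if xy: "x \<in> V0 - D" "y \<in> V0 - D" "x \<noteq> y" "i < 3" for x y i
  proof (rule ccontr)
    assume "\<not> ?thesis"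
    then obtain z where z: "z \<in> Q x" "z \<in> Q y" "z \<in> side i" by blast
    obtain n n' where n: "blunt (Q x) z n" "blunt (Q y) z n'" using bl xy z by meson
    have "x \<in> V0" "y \<in> V0" using xy by auto
    then show False using blunt_pair_off_smooth_side[OF xy(4) sm[OF xy(4)] on_side[OF xy(1,4) z(1,3)] n apart ins ins] V0V xy(3) by blast
  qed
  have one: "Q x \<inter> side i \<inter> side j = {}" if "x \<in> V0 - D" "i < 3" "j < 3" "i \<noteq> j" for x i j
    using on_side[OF that(1,2)] oside_disjoint[OF that(2-4)] by blast
  have triple: "Q x \<inter> Q y \<inter> Q w = {}" if xyw: "x \<in> V - D" "y \<in> V - D" "w \<in> V - D" "x \<noteq> y" "y \<noteq> w" "x \<noteq> w" for x y w
  proof -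
    have c: "v \<in> V0 - D \<or> (\<exists>i<3. v = cor i)" if "v \<in> V - D" for v using V_cases that by blast
    show ?thesis
    proof (cases "x \<in> V0 - D \<and> y \<in> V0 - D \<and> w \<in> V0 - D")
      case True
      show ?thesis
      proof (rule ccontr)
        assume "\<not> ?thesis"
        then obtain z where z: "z \<in> Q x" "z \<in> Q y" "z \<in> Q w" by blast
        obtain n1 n2 n3 where "blunt (Q x) z n1" "blunt (Q y) z n2" "blunt (Q w) z n3" using bl True z by meson
        then show False using blunt_triple[OF _ _ _ apart apart apart] True V0V xyw by blast
      qed
    next
      case False
      have cc: "Q x \<inter> Q y \<inter> Q w = {}" if a: "x \<in> V - D" "y \<in> V - D" "w = cor i" "i < 3" "x \<noteq> y" "y \<noteq> w" "x \<noteq> w" for x y w i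
      proof -
        have w: "Q w = side i" using Qcor a by simp
        consider "x \<in> V0 - D" "y \<in> V0 - D" | j where "x \<in> V0 - D" "j < 3" "y = cor j" | j where "y \<in> V0 - D" "j < 3" "x = cor j"
          | j k where "j < 3" "x = cor j" "k < 3" "y = cor k" using c[OF a(1)] c[OF a(2)] by blast
        then show ?thesis
        proof cases
          case 1 then show ?thesis using two[of x y i] a w by blast
        next
          case 2 then show ?thesis using one[of x i j] a w Qcor by blast
        next
          case 3 then show ?thesis using one[of y i j] a w Qcor by blast
        next
          case 4
          then have "i \<noteq> j" "j \<noteq> k" "i \<noteq> k" using a by auto
          then have "{i, j, k} = {0, 1, 2}" using a(4) 4 unfolding three by auto
          then have "side i \<inter> side j \<inter> side k = side 0 \<inter> side 1 \<inter> side 2"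
            by (metis INT_insert INT_empty Int_UNIV_right Int_assoc)
          then show ?thesis using three_sides w Qcor 4 by blast
        qed
      qed
      consider i where "w = cor i" "i < 3" | i where "x = cor i" "i < 3" | i where "y = cor i" "i < 3" using False c xyw(1-3) by metis
      then show ?thesis
      proof cases
        case 1 then show ?thesis using cc xyw by blast
      next
        case 2 then show ?thesis using cc[of y w x i] xyw by blast
      next
        case 3 then show ?thesis using cc[of x w y i] xyw by blast
      qed
    qed
  qed
  have "D = {}"
  proof (rule no_points[where K = Q and z = \<beta>])
    show "Q v = {\<beta> v}" if "v \<in> D" for v using that QV[of v] hom_0[of "P v" "\<beta> v"] P(3)[of v] unfolding D_def by force
    show "\<exists>u \<in> cone i v. Q v \<inter> Q u \<noteq> {}" if "v \<in> V0" "i < 3" for v i using ct[OF that] p_in_cone[OF that] by blast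
  qed (use D_def triple in auto)
  note D = this
  have rpos: "0 < r v" if "v \<in> V0" for v using r[OF that] that D unfolding D_def by force
  have int_ne: "interior (Q v) \<noteq> {}" if "v \<in> V0" for v
    using bl[of v "\<beta> v"] blunt_interior that D QV[OF that] center_in_hom[OF P(3)[OF that]] by auto
  define cen where "cen v = (SOME q. q \<in> interior (Q v))" for v
  have cen: "cen v \<in> interior (Q v)" if "v \<in> V0" for v unfolding cen_def using int_ne[OF that] some_in_eq by blast
  have conv: "convex (Q v)" if "v \<in> V0" for v using QV[OF that] P(2)[OF that] convex_hom by simp
  have sideC: "\<exists>i<3. z \<in> side i" if "z \<in> C" for z
  proof -
    have "z \<in> side 0 \<or> z \<in> side 1 \<or> z \<in> side 2" using that C_sides by blast
    moreover have "0 < (3::nat)" "1 < (3::nat)" "2 < (3::nat)" by auto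
    ultimately show ?thesis by blast
  qed
  have CQ: "C \<inter> Q x \<inter> Q y = {}" if "x \<in> V0" "y \<in> V0" "x \<noteq> y" for x y using two[of x y] that D sideC by blast
  have "\<exists>\<theta>. \<theta> \<in> {L i<..<L (Suc i)} \<and> g \<theta> \<in> Q x" if "i < 3" "x \<in> V0" "Q x \<inter> Q (cor i) \<noteq> {}" for i x
    using that on_side[of x i] D unfolding Qcor[OF that(1)] oside_def by blast
  then obtain th where th: "\<And>i x. i < 3 \<Longrightarrow> x \<in> V0 \<Longrightarrow> Q x \<inter> Q (cor i) \<noteq> {} \<Longrightarrow> th i x \<in> {L i<..<L (Suc i)} \<and> g (th i x) \<in> Q x" by metis
  have thC: "g (th i x) \<in> C" "g (th i x) \<in> oside i" if "i < 3" "x \<in> V0" "Q x \<inter> Q (cor i) \<noteq> {}" for i x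
    using th[OF that] oside_side[of i] side_C[OF that(1)] unfolding oside_def by blast+
  \<comment> \<open>The limit bodies touch the curve itself, so the feet are the contact points and
    the segments are trivial.\<close>
  interpret B: jordan_bodies g L V cor h p Q cen "\<lambda>i x. g (th i x)" th
  proof
    fix x assume x: "x \<in> V0"
    show "convex (Q x) \<and> cen x \<in> interior (Q x)" using cen[OF x] conv[OF x] by blast
    show "interior (Q x) \<subseteq> inside C" by (rule ins[OF x])
  next
    fix x y w assume "x \<in> V0" "y \<in> V0" "w \<in> V0" "x \<noteq> y" "y \<noteq> w" "x \<noteq> w"
    then show "Q x \<inter> Q y \<inter> Q w = {}" using triple V0V D by blast
  next
    fix x y assume "x \<in> V0" "y \<in> V0" "x \<noteq> y"
    then show "interior (Q x) \<inter> Q y = {}" "C \<inter> Q x \<inter> Q y = {}" using sep V0V CQ by blast+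
  next
    fix i x assume a: "i < 3" "x \<in> V0" "Q x \<inter> Q (cor i) \<noteq> {}"
    have nC: "g (th i x) \<notin> outside C" "g (th i x) \<notin> inside C"
      using thC(1)[OF a] inside_no_overlap[of C] outside_no_overlap[of C] by blast+
    show "g (th i x) \<in> Q x \<and> th i x \<in> {L i<..<L (Suc i)} \<and> closed_segment (g (th i x)) (g (th i x)) \<inter> C = {g (th i x)} \<and>
      closed_segment (g (th i x)) (g (th i x)) \<inter> outside C = {}"
      using th[OF a] thC(1)[OF a] nC by simp
    show "closed_segment (g (th i x)) (g (th i x)) \<inter> interior (Q y) = {}" if "y \<in> V0" for y
      using nC(2) ins[OF that] by auto
    show "closed_segment (g (th i x)) (g (th i x)) \<inter> Q y \<inter> Q w = {}" if "y \<in> V0" "w \<in> V0" "y \<noteq> w" for y w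
      using thC(1)[OF a] CQ[OF that] by auto
    show "closed_segment (g (th i x)) (g (th i x)) \<inter> closed_segment (g (th j y)) (g (th j y)) = {}"
      if "j < 3" "i \<noteq> j" "y \<in> V0" "x \<noteq> y" "Q y \<inter> Q (cor j) \<noteq> {}" for j y
      using thC(2)[OF a] thC(2)[OF that(1,3,5)] oside_disjoint[OF a(1) that(1,2)] oside_side[of j] by auto
  next
    show "\<exists>u \<in> cone i v. Q v \<inter> Q u \<noteq> {}" if "v \<in> V0" "i < 3" for v i using ct[OF that] p_in_cone[OF that] by blast
  qed
  show ?thesis unfolding Q_def[symmetric]
    using rpos int_ne triple B.contact_unique unfolding D by auto
qed

end

section \<open>Assembling the packing\<close>

lemma packing_conforms_nerve:
  assumes "finite V" and E: "\<And>e. e \<in> E \<Longrightarrow> \<exists>u\<in>V. \<exists>v\<in>V. u \<noteq> v \<and> e = {u, v}"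
    and Q: "\<And>v. v \<in> V \<Longrightarrow> compact (Q v) \<and> connected (Q v) \<and> Q v \<noteq> {}"
    and sep: "\<And>u v. u \<in> V \<Longrightarrow> v \<in> V \<Longrightarrow> u \<noteq> v \<Longrightarrow> interior (Q u) \<inter> Q v = {}"
    and meet: "\<And>u v. {u, v} \<in> E \<Longrightarrow> Q u \<inter> Q v \<noteq> {}"
  shows "packing V Q" "conforms V E Q"
    "(\<And>u v. u \<in> V \<Longrightarrow> v \<in> V \<Longrightarrow> u \<noteq> v \<Longrightarrow> Q u \<inter> Q v \<noteq> {} \<Longrightarrow> {u, v} \<in> E) \<Longrightarrow> nerve_edges V Q = E"
proof -
  have t: "touch (Q u) (Q v) \<longleftrightarrow> Q u \<inter> Q v \<noteq> {}" if "u \<in> V" "v \<in> V" "u \<noteq> v" for u v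
    using sep[OF that] sep[OF that(2,1) that(3)[symmetric]] unfolding touch_def by (auto simp: Int_commute)
  have Euv: "u \<in> V \<and> v \<in> V \<and> u \<noteq> v" if "{u, v} \<in> E" for u v using E[OF that] by (auto simp: doubleton_eq_iff)
  show "packing V Q" unfolding packing_def intersect_nontrivially_def using assms(1) Q t by (auto intro: compact_imp_closed)
  show "conforms V E Q" unfolding conforms_def using sep t Euv meet by (simp add: Int_commute)
  show "nerve_edges V Q = E" if n: "\<And>u v. u \<in> V \<Longrightarrow> v \<in> V \<Longrightarrow> u \<noteq> v \<Longrightarrow> Q u \<inter> Q v \<noteq> {} \<Longrightarrow> {u, v} \<in> E"
  proof
    show "nerve_edges V Q \<subseteq> E" unfolding nerve_edges_def using n t by auto
    show "E \<subseteq> nerve_edges V Q"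
    proof
      fix e assume e: "e \<in> E"
      then obtain u v where uv: "u \<in> V" "v \<in> V" "u \<noteq> v" "e = {u, v}" using E by blast
      then show "e \<in> nerve_edges V Q" unfolding nerve_edges_def using meet[of u v] t[of u v] e by auto
    qed
  qed
qed

lemma hom_translate: "hom \<beta> r (hom x 1 P) = hom (\<beta> + of_real r * x) r P"
  by (auto simp: hom_def image_image algebra_simps)

theorem mainTheorem3:
  fixes V :: "'v set" and E :: "'v set set" and F :: "('v \<times> 'v \<times> 'v) set"
    and a b c :: 'v and C :: "complex set" and P :: "'v \<Rightarrow> complex set"
  assumes T: "oriented_sphere_triangulation V E F"
    and abc: "(a, b, c) \<in> F"
    and C: "counterclockwise_arcs C (P a) (P b) (P c)"
    and P: "\<And>v. v \<in> V - {a, b, c} \<Longrightarrow> compact (P v) \<and> convex (P v) \<and> (\<exists>x\<in>P v. \<exists>y\<in>P v. x \<noteq> y)"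
  shows "(\<exists>Q. packing V Q \<and> conforms V E Q \<and> Q a = P a \<and> Q b = P b \<and> Q c = P c \<and>
             (\<forall>v\<in>V - {a, b, c}. (\<exists>z. Q v = {z}) \<or> homothetic (P v) (Q v))) \<and>
         ((\<forall>v\<in>V - {a, b, c}. smooth_planar_set (P v)) \<and>
          smooth_arc (P a) \<and> smooth_arc (P b) \<and> smooth_arc (P c) \<and>
          (\<forall>p \<in> (P a \<inter> P b) \<union> (P b \<inter> P c) \<union> (P c \<inter> P a). region_angle (inside C) p < pi)
          \<longrightarrow>
          (\<exists>Q. packing V Q \<and> conforms V E Q \<and> Q a = P a \<and> Q b = P b \<and> Q c = P c \<and>
             (\<forall>v\<in>V - {a, b, c}. (\<exists>z. Q v = {z}) \<or> homothetic (P v) (Q v)) \<and>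
             \<not> degenerated V Q \<and> nerve_edges V Q = E))"
proof -
  note T' = T[unfolded oriented_sphere_triangulation_def]
  obtain p A where pA: "drawn_on_sphere V E p A"
    "\<forall>u v w. (\<exists>f\<in>two_cells V E p A. triangular_cell E A f u v w) \<longleftrightarrow> (u, v, w) \<in> F \<or> (u, w, v) \<in> F"
    using T' by (elim conjE exE)
  have fin: "finite V" using T' by (rule conjunct1)
  obtain f where "triangular_cell E A f a b c" using pA(2) abc by blast
  then have abcE: "distinct [a, b, c]" "{a, b} \<in> E" "{b, c} \<in> E" "{c, a} \<in> E" unfolding triangular_cell_def by blast+
  have E: "\<exists>u\<in>V. \<exists>v\<in>V. u \<noteq> v \<and> e = {u, v}" if "e \<in> E" for e
    using pA(1)[unfolded drawn_on_sphere_def, THEN conjunct2, THEN conjunct2, THEN conjunct1, rule_format, OF that] by blast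
  have abcV: "a \<in> V" "b \<in> V" "c \<in> V" using E[OF abcE(2)] E[OF abcE(3)] by (auto simp: doubleton_eq_iff)
  obtain g s t where "simple_path g \<and> pathfinish g = pathstart g \<and> path_image g = C \<and> (\<forall>z\<in>inside C. winding_number g z = 1) \<and>
    0 < s \<and> s < t \<and> t < 1 \<and> P a = g ` {0..s} \<and> P b = g ` {s..t} \<and> P c = g ` {t..1}"
    using C[unfolded counterclockwise_arcs_def] by (elim exE)
  then have g: "simple_path g" "pathfinish g = pathstart g" "path_image g = C" "0 < s" "s < t" "t < 1"
    "P a = g ` {0..s}" "P b = g ` {s..t}" "P c = g ` {t..1}" by - (elim conjE, assumption)+
  define L where "L i = (if i = 0 then 0 else if i = 1 then s else if i = 2 then t else 1)" for i :: nat
  interpret J: jordan_sides g L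
  proof
    show "L i < L (Suc i)" if "i < 3" for i
    proof -
      have "i = 0 \<or> i = 1 \<or> i = 2" using that by auto
      then show ?thesis using g(4-6) by (auto simp: L_def)
    qed
  qed (use g in \<open>auto simp: L_def\<close>)
  have side: "J.side 0 = P a" "J.side 1 = P b" "J.side 2 = P c" unfolding J.side_def using g(7-9) by (simp_all add: L_def)
  define cor where "cor = (\<lambda>i::nat. if i = 0 then a else if i = 1 then b else c)"
  have cor: "cor ` {..<3} = {a, b, c}" "P (cor i) = J.side i" if "i < 3" for i
    using side that unfolding J.three by (auto simp: cor_def lessThan_nat_numeral lessThan_Suc)
  have corE: "{cor i, cor j} \<in> E" if "i < 3" "j < 3" "i \<noteq> j" for i j
    using abcE that unfolding J.three by (auto simp: cor_def insert_commute)
  have cor_cases: "\<exists>i<3. v = cor i" if "v \<in> {a, b, c}" for v using that cor(1)[of 0] by auto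
  have sides: "compact (P (cor i)) \<and> connected (P (cor i)) \<and> P (cor i) \<noteq> {}" if "i < 3" for i
    unfolding cor(2)[OF that] using J.compact_side J.connected_side J.sides_meet that by blast
  let ?sm = "(\<forall>v\<in>V - {a, b, c}. smooth_planar_set (P v)) \<and> smooth_arc (P a) \<and> smooth_arc (P b) \<and> smooth_arc (P c) \<and>
          (\<forall>p \<in> (P a \<inter> P b) \<union> (P b \<inter> P c) \<union> (P c \<inter> P a). region_angle (inside C) p < pi)"
  have "\<exists>Q. packing V Q \<and> conforms V E Q \<and> Q a = P a \<and> Q b = P b \<and> Q c = P c \<and>
      (\<forall>v\<in>V - {a, b, c}. (\<exists>z. Q v = {z}) \<or> homothetic (P v) (Q v)) \<and> (?sm \<longrightarrow> \<not> degenerated V Q \<and> nerve_edges V Q = E)"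
  proof (cases "V - {a, b, c} = {}")
    \<comment> \<open>Without interior vertices the three arcs alone are the packing. This case is
      separate because the combinatorial analysis of the drawing relies on a fourth vertex.\<close>
    case True
    have V: "\<exists>i<3. v = cor i" if "v \<in> V" for v using that True cor_cases by blast
    have int: "interior (P u) = {}" if "u \<in> V" for u using V[OF that] cor(2) J.interior_side by metis
    have meet: "P u \<inter> P v \<noteq> {}" if "u \<in> V" "v \<in> V" for u v using V[OF that(1)] V[OF that(2)] cor(2) J.sides_meet by metis
    have edge: "{u, v} \<in> E" if "u \<in> V" "v \<in> V" "u \<noteq> v" for u v using V[OF that(1)] V[OF that(2)] corE that(3) by metis
    have meetE: "P u \<inter> P v \<noteq> {}" if "{u, v} \<in> E" for u v using E[OF that] meet by (auto simp: doubleton_eq_iff)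
    have comp: "compact (P v) \<and> connected (P v) \<and> P v \<noteq> {}" if "v \<in> V" for v using V[OF that] sides by metis
    have sep: "interior (P u) \<inter> P v = {}" if "u \<in> V" "v \<in> V" "u \<noteq> v" for u v using int[OF that(1)] by simp
    note pk = packing_conforms_nerve[of V E P, OF fin]
    have pk12: "packing V P" "conforms V E P"
      by (rule pk(1), erule E, erule comp, erule sep, assumption+, erule meetE,
          rule pk(2), erule E, erule comp, erule sep, assumption+, erule meetE)
    have "\<not> degenerated V P"
    proof -
      have "P u \<inter> P v \<inter> P w = {}" if "u \<in> V" "v \<in> V" "w \<in> V" "distinct [u, v, w]" for u v w
      proof -
        have "u \<in> {a, b, c}" "v \<in> {a, b, c}" "w \<in> {a, b, c}" using that True by auto
        then show ?thesis using J.three_sides that(4) unfolding side by auto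
      qed
      moreover have "P v \<noteq> {z}" if "v \<in> V" for v z using V[OF that] J.side_not_point cor(2) by metis
      ultimately show ?thesis unfolding degenerated_def by blast
    qed
    moreover have "nerve_edges V P = E"
      by (rule pk(3), erule E, erule comp, erule sep, assumption+, erule meetE) (rule edge)
    ultimately show ?thesis using pk12 True by (intro exI[of _ P]) auto
  next
    case False
    interpret Tr: triangulation V E F using oriented_sphere_triangulation_combinatorial[OF T abc False] .
    obtain h q where hq: "realizer V cor h q" "\<forall>v\<in>V - {a, b, c}. \<forall>i<3. {v, q i v} \<in> E"
      "\<forall>u v. {u, v} \<in> E \<longrightarrow> v \<in> V - {a, b, c} \<longrightarrow> (\<exists>i<3. u = q i v) \<or> (u \<in> V - {a, b, c} \<and> (\<exists>i<3. v = q i u))"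
      using Tr.realizer_exists[OF abc cor_def] by blast
    interpret R: realizer V cor h q by (rule hq(1))
    have V0: "R.V0 = V - {a, b, c}" unfolding R.V0_def cor(1)[of 0, simplified] ..
    \<comment> \<open>Each shape is translated by one of its own points so as to contain 0; the
      translation is later absorbed into the offset of the homothety.\<close>
    have "\<exists>x. x \<in> P v" if "v \<in> R.V0" for v using P that unfolding V0 by blast
    then obtain x where x: "\<And>v. v \<in> R.V0 \<Longrightarrow> x v \<in> P v" by metis
    define P' where "P' v = hom (- x v) 1 (P v)" for v
    interpret F: framework g L V cor h q P'
    proof
      fix v assume v: "v \<in> R.V0"
      note Pv = P[OF v[unfolded V0]]
      show "compact (P' v)" "convex (P' v)" unfolding P'_def using Pv by (auto intro: compact_hom convex_hom)
      show "0 \<in> P' v" using x[OF v] by (force simp: P'_def hom_def)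
      show "P' v \<noteq> {0}"
      proof
        assume e: "P' v = {0}"
        have "y = x v" if "y \<in> P v" for y
        proof -
          have "y - x v \<in> P' v" using that by (force simp: P'_def hom_def)
          then show ?thesis using e by simp
        qed
        then show False using Pv by blast
      qed
    qed
    have ne: "R.V0 \<noteq> {}" using False V0 by simp
    obtain \<beta> r where lim: "(\<forall>v\<in>R.V0. 0 \<le> r v) \<and>
        (\<forall>u\<in>V. \<forall>v\<in>V. u \<noteq> v \<longrightarrow> interior (F.limit_bodies \<beta> r u) \<inter> F.limit_bodies \<beta> r v = {}) \<and>
        (\<forall>v\<in>R.V0. \<forall>i<3. F.limit_bodies \<beta> r v \<inter> F.limit_bodies \<beta> r (q i v) \<noteq> {}) \<and>
        (\<forall>v\<in>R.V0. interior (F.limit_bodies \<beta> r v) \<subseteq> inside C)"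
      using F.limit_configuration[OF ne, unfolded g(3)] by (elim exE)
    define Q where "Q = F.limit_bodies \<beta> r"
    note lim2 = lim[THEN conjunct2] note lim3 = lim2[THEN conjunct2]
    note r = lim[THEN conjunct1, rule_format] and sep = lim2[THEN conjunct1, rule_format, folded Q_def]
      and ct = lim3[THEN conjunct1, rule_format, folded Q_def] and ins = lim3[THEN conjunct2, rule_format, folded Q_def]
    have QV: "Q v = hom (\<beta> v - of_real (r v) * x v) (r v) (P v)" if "v \<in> R.V0" for v
      using that unfolding Q_def F.bodies_def thick_0 P'_def hom_translate by simp
    have Qcor: "Q (cor i) = P (cor i)" if "i < 3" for i unfolding Q_def F.bodies_cor[OF ne that] cor(2)[OF that] ..
    have Qabc: "Q a = P a" "Q b = P b" "Q c = P c" using Qcor[of 0] Qcor[of 1] Qcor[of 2] by (simp_all add: cor_def)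
    have hmt: "(\<exists>z. Q v = {z}) \<or> homothetic (P v) (Q v)" if v: "v \<in> V - {a, b, c}" for v
    proof (cases "r v = 0")
      case True
      then have "Q v = {\<beta> v - of_real (r v) * x v}" using QV[of v] hom_0[of "P v"] x[of v] v unfolding V0 by force
      then show ?thesis by blast
    next
      case False
      then have "0 < r v" using r[of v] v unfolding V0 by force
      then show ?thesis using QV[of v] v unfolding V0 homothetic_def hom_def by blast
    qed
    have meetE: "Q u \<inter> Q v \<noteq> {}" if uv: "{u, v} \<in> E" for u v
    proof -
      have V: "u \<in> V" "v \<in> V" "u \<noteq> v" using E[OF uv] by (auto simp: doubleton_eq_iff)
      have *: "Q u \<inter> Q v \<noteq> {}" if "{u, v} \<in> E" "v \<in> R.V0" for u v
        using hq(3)[rule_format, OF that(1)] that(2) ct unfolding V0 by (metis Int_commute)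
      show ?thesis
      proof (cases "u \<in> R.V0 \<or> v \<in> R.V0")
        case True then show ?thesis using *[OF uv] *[of v u] uv by (metis Int_commute insert_commute)
      next
        case False
        then have "u \<in> {a, b, c}" "v \<in> {a, b, c}" using V unfolding V0 by auto
        then obtain i j where "i < 3" "u = cor i" "j < 3" "v = cor j" using cor_cases by metis
        then show ?thesis using Qcor cor(2) J.sides_meet by metis
      qed
    qed
    have comp: "compact (Q v) \<and> connected (Q v) \<and> Q v \<noteq> {}" if v: "v \<in> V" for v
    proof (cases "v \<in> R.V0")
      case True
      then have "compact (P v)" "convex (P v)" "P v \<noteq> {}" using P[of v] unfolding V0 by blast+
      then show ?thesis unfolding QV[OF True] by (intro conjI compact_hom convex_connected convex_hom) (auto simp: hom_def)
    next
      case False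
      then have "v \<in> {a, b, c}" using v unfolding V0 by auto
      then show ?thesis using cor_cases Qcor sides by metis
    qed
    note pk = packing_conforms_nerve[of V E Q, OF fin]
    have pk12: "packing V Q" "conforms V E Q"
      by (rule pk(1), erule E, erule comp, erule sep, assumption+, erule meetE,
          rule pk(2), erule E, erule comp, erule sep, assumption+, erule meetE)
    have "\<not> degenerated V Q \<and> nerve_edges V Q = E" if sm: ?sm
    proof -
      have nd: "(\<forall>v\<in>R.V0. 0 < r v \<and> interior (Q v) \<noteq> {}) \<and>
        (\<forall>x\<in>V. \<forall>y\<in>V. \<forall>w\<in>V. x \<noteq> y \<longrightarrow> y \<noteq> w \<longrightarrow> x \<noteq> w \<longrightarrow> Q x \<inter> Q y \<inter> Q w = {}) \<and>
        (\<forall>v\<in>R.V0. \<forall>i<3. \<forall>u\<in>R.cone i v. Q v \<inter> Q u \<noteq> {} \<longrightarrow> u = q i v)"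
        unfolding Q_def
      proof (rule F.limit_nondegenerate[OF ne r])
        show "interior (F.limit_bodies \<beta> r v) \<subseteq> inside (path_image g)" if "v \<in> R.V0" for v using ins[OF that] unfolding g(3) Q_def .
        show "\<exists>n. blunt (P' v) z n" if vz: "v \<in> R.V0" "z \<in> P' v" for v z
        proof -
          obtain y where y: "y \<in> P v" "z = of_real 1 * y + - x v" using vz(2) unfolding P'_def hom_def by auto
          obtain n where "blunt (P v) y n" using smooth_convex_blunt[of "P v" y] sm P[of v] vz(1) y(1) unfolding V0 by blast
          then show ?thesis using blunt_hom[of "P v" y n 1 "- x v"] unfolding P'_def y(2) by auto
        qed
        show "smooth_arc (J.side i)" if "i < 3" for i
          using that sm unfolding J.three side[symmetric] by auto
        show "region_angle (inside (path_image g)) (g (L k)) < pi" if k: "k < 4" for k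
        proof -
          obtain i j where ij: "i < 3" "j < 3" "i \<noteq> j" "g (L k) \<in> J.side i \<inter> J.side j" using J.corner_sides[OF k] by blast
          then have "g (L k) \<in> (P a \<inter> P b) \<union> (P b \<inter> P c) \<union> (P c \<inter> P a)"
            unfolding side[symmetric] J.three by auto
          then show ?thesis using sm unfolding g(3) by blast
        qed
      qed (use sep ct in \<open>auto simp: Q_def\<close>)
      note nd2 = nd[THEN conjunct2]
      have "Q v \<noteq> {z}" if v: "v \<in> V" for v z
      proof (cases "v \<in> R.V0")
        case True then show ?thesis using nd[THEN conjunct1] by auto
      next
        case False
        then have "v \<in> {a, b, c}" using v unfolding V0 by auto
        then show ?thesis using cor_cases Qcor cor(2) J.side_not_point by metis
      qed
      moreover have "Q u \<inter> Q v \<inter> Q w = {}" if "u \<in> V" "v \<in> V" "w \<in> V" "distinct [u, v, w]" for u v w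
        using nd2[THEN conjunct1] that by simp
      ultimately have dg: "\<not> degenerated V Q" unfolding degenerated_def by blast
      have edge: "{u, v} \<in> E" if uv: "u \<in> V" "v \<in> V" "u \<noteq> v" "Q u \<inter> Q v \<noteq> {}" for u v
      proof -
        have cn: "{u, v} \<in> E" if "v \<in> R.V0" "i < 3" "u \<in> R.cone i v" "Q u \<inter> Q v \<noteq> {}" for u v i
        proof -
          have "u = q i v" using nd2[THEN conjunct2] that by (metis Int_commute)
          then show ?thesis using hq(2) that(1,2) unfolding V0 by (metis insert_commute)
        qed
        have cc: "{u, v} \<in> E" if a: "u \<in> V" "v \<in> R.V0" "u \<noteq> v" "Q u \<inter> Q v \<noteq> {}" for u v
        proof (cases "u \<in> R.V0")
          case True
          then obtain i where "i < 3" "u \<in> R.cone i v \<or> v \<in> R.cone i u" using F.cone_total a by blast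
          then show ?thesis using cn[of v i u] cn[of u i v] a True by (metis Int_commute insert_commute)
        next
          case False
          then have "u \<in> {a, b, c}" using a(1) unfolding V0 by auto
          then obtain i where "i < 3" "u = cor i" using cor_cases by blast
          then show ?thesis using cn[of v i u] R.cor_cone[of v i] a by blast
        qed
        show ?thesis
        proof (cases "u \<in> R.V0 \<or> v \<in> R.V0")
          case True then show ?thesis using cc[of u v] cc[of v u] uv by (metis Int_commute insert_commute)
        next
          case False
          then have "u \<in> {a, b, c}" "v \<in> {a, b, c}" using uv unfolding V0 by auto
          then obtain i j where "i < 3" "u = cor i" "j < 3" "v = cor j" using cor_cases by metis
          then show ?thesis using corE uv(3) by metis
        qed
      qed
      have "nerve_edges V Q = E"
        by (rule pk(3), erule E, erule comp, erule sep, assumption+, erule meetE) (rule edge)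
      then show ?thesis using dg by blast
    qed
    then show ?thesis using pk12 Qabc hmt by (intro exI[of _ Q]) blast
  qed
  then show ?thesis by blast
qed

end
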